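(* Let $(R,\mathfrak m,\Bbbk)$ be an algebra with coefficient field $K$, let $d=\dim R$, and suppose that the associated graded ring $G_{R|K}$ is a finitely generated $R$-algebra. Then the sequence $\dfrac{\lambda_R(R/\mathfrak m^{\langle n\rangle_K})}{n^d/d!}$ converges to $\mathrm{s}^{\mathrm{diff}}_K(R)=\mathrm{s}^{\mathrm{diff}}_K(\widehat R)$, and the limit is rational.
   Context: Algebra with coefficient field $K$: $K$ is a field and $R\ne0$ is a commutative $K$-algebra that is either $\mathbb N$-graded and finitely generated over $R_0=K$ (with $\mathfrak m$ the homogeneous maximal ideal), or local and essentially of finite type over $K$ (with $\mathfrak m$ the maximal ideal), and the map $K\to\Bbbk=R/\mathfrak m$ is an isomorphism. $\widehat R$ is the $\mathfrak m$-adic completion. Differential operators: $D^0_{R|K}=\operatorname{Hom}_R(R,R)$ and $D^n_{R|K}=\{\delta\in\operatorname{Hom}_K(R,R) : [\delta,r]\in D^{n-1}_{R|K}\ \forall r\in R\}$, with $D^{-1}_{R|K}=0$; $D_{R|K}=\bigcup_nD^n_{R|K}$ is filtered by order, and $G_{R|K}=\bigoplus_{n\ge0}D^n_{R|K}/D^{n-1}_{R|K}$ is the associated graded ring. Differential powers: $\mathfrak m^{\langle n\rangle_K}=\{f\in R : \delta(f)\in\mathfrak m \text{ for all }\delta\in D^{n-1}_{R|K}\}$. Differential signature: $\mathrm{s}^{\mathrm{diff}}_K(R)=\limsup_{n\to\infty}\dfrac{\lambda_R(R/\mathfrak m^{\langle n\rangle_K})}{n^d/d!}$, where $\lambda_R$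 is length; the same definitions apply to the local ring $\widehat R\supseteq K$. *)

theory Defs
  imports Complex_Main "HOL-Library.Extended_Real" "HOL-Algebra.Algebra"
begin

section \<open>Generation, localization, Krull dimension and length\<close>

definition finitely_generated_over ::
    "('a, 'p) ring_scheme \<Rightarrow> ('b, 'q) ring_scheme \<Rightarrow> ('a \<Rightarrow> 'b) \<Rightarrow> bool" where
  "finitely_generated_over A B \<phi> \<longleftrightarrow>
     \<phi> \<in> ring_hom A B \<and>
     (\<exists>S \<subseteq> carrier B. finite S \<and> generate_ring B (\<phi> ` carrier A \<union> S) = carrier B)"

definition structure_map :: "('k, 'a, 'q) module_scheme \<Rightarrow> 'k \<Rightarrow> 'a" where
  "structure_map R k = k \<odot>\<^bsub>R\<^esub> \<one>\<^bsub>R\<^esub>"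

definition is_localization ::
    "('a, 'p) ring_scheme \<Rightarrow> 'a set \<Rightarrow> ('b, 'q) ring_scheme \<Rightarrow> ('a \<Rightarrow> 'b) \<Rightarrow> bool" where
  "is_localization A W B \<phi> \<longleftrightarrow>
     W \<subseteq> carrier A \<and> \<one>\<^bsub>A\<^esub> \<in> W \<and> (\<forall>v\<in>W. \<forall>w\<in>W. v \<otimes>\<^bsub>A\<^esub> w \<in> W) \<and>
     \<phi> \<in> ring_hom A B \<and> \<phi> ` W \<subseteq> Units B \<and>
     (\<forall>b \<in> carrier B. \<exists>a \<in> carrier A. \<exists>w \<in> W. b = \<phi> a \<otimes>\<^bsub>B\<^esub> inv\<^bsub>B\<^esub> (\<phi> w)) \<and>
     (\<forall>a \<in> carrier A. \<forall>a' \<in> carrier A.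
        \<phi> a = \<phi> a' \<longleftrightarrow> (\<exists>w \<in> W. w \<otimes>\<^bsub>A\<^esub> a = w \<otimes>\<^bsub>A\<^esub> a'))"

text \<open>The finitely generated algebra \<open>A\<close> is sought on the element type of \<open>R\<close>. This loses no
  generality: if \<open>R\<close> is a localization of a finitely generated algebra on any other type, then it
  is also a localization of the image of that algebra in \<open>R\<close>.\<close>

definition essentially_of_finite_type ::
    "('k, 'p) ring_scheme \<Rightarrow> ('k, 'a, 'q) module_scheme \<Rightarrow> bool" where
  "essentially_of_finite_type K R \<longleftrightarrow>
     (\<exists>(A :: ('k, 'a) module) W \<phi>.
        algebra K A \<and> finitely_generated_over K A (structure_map A) \<and>
        is_localization A W R \<phi> \<and>
        (\<forall>k \<in> carrier K. \<phi> (structure_map A k) = structure_map R k))"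

definition krull_dim :: "('a, 'p) ring_scheme \<Rightarrow> enat" where
  "krull_dim R = Sup {enat n | n. \<exists>P :: nat \<Rightarrow> 'a set.
     (\<forall>i\<le>n. primeideal (P i) R) \<and> (\<forall>i<n. P i \<subset> P (Suc i))}"

definition module_length :: "('a, 'p) ring_scheme \<Rightarrow> ('a, 'b, 'q) module_scheme \<Rightarrow> enat" where
  "module_length R M = Sup {enat n | n. \<exists>N :: nat \<Rightarrow> 'b set.
     (\<forall>i\<le>n. submodule (N i) R M) \<and> (\<forall>i<n. N i \<subset> N (Suc i))}"

definition quotient_module :: "('a, 'p) ring_scheme \<Rightarrow> 'a set \<Rightarrow> ('a, 'a set) module" where
  "quotient_module R I =
     \<lparr>carrier = carrier (R Quot I), monoid.mult = monoid.mult (R Quot I), one = \<one>\<^bsub>R Quot I\<^esub>,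
      ring.zero = \<zero>\<^bsub>R Quot I\<^esub>, add = add (R Quot I),
      smult = (\<lambda>r C. (I +>\<^bsub>R\<^esub> r) \<otimes>\<^bsub>R Quot I\<^esub> C)\<rparr>"

section \<open>Algebras with coefficient field\<close>

definition is_grading :: "('a, 'p) ring_scheme \<Rightarrow> (nat \<Rightarrow> 'a set) \<Rightarrow> bool" where
  "is_grading R G \<longleftrightarrow>
     (\<forall>i. additive_subgroup (G i) R) \<and>
     (\<forall>i j. \<forall>x \<in> G i. \<forall>y \<in> G j. x \<otimes>\<^bsub>R\<^esub> y \<in> G (i + j)) \<and>
     (\<forall>x \<in> carrier R. \<exists>!c. (\<forall>i. c i \<in> G i) \<and> finite {i. c i \<noteq> \<zero>\<^bsub>R\<^esub>} \<and>
        x = finsum R c {i. c i \<noteq> \<zero>\<^bsub>R\<^esub>})"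

definition homogeneous_ideal :: "('a, 'p) ring_scheme \<Rightarrow> (nat \<Rightarrow> 'a set) \<Rightarrow> 'a set \<Rightarrow> bool" where
  "homogeneous_ideal R G I \<longleftrightarrow> ideal I R \<and> I = Idl\<^bsub>R\<^esub> (I \<inter> (\<Union>i. G i))"

definition graded_algebra_with_ideal ::
    "('k, 'p) ring_scheme \<Rightarrow> ('k, 'a, 'q) module_scheme \<Rightarrow> 'a set \<Rightarrow> bool" where
  "graded_algebra_with_ideal K R \<mm> \<longleftrightarrow>
     finitely_generated_over K R (structure_map R) \<and>
     (\<exists>G. is_grading R G \<and> G 0 = structure_map R ` carrier K \<and>
          maximalideal \<mm> R \<and> homogeneous_ideal R G \<mm>)"

definition local_ring :: "('a, 'p) ring_scheme \<Rightarrow> bool" where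
  "local_ring R \<longleftrightarrow> cring R \<and> (\<exists>!M. maximalideal M R)"

definition max_ideal :: "('a, 'p) ring_scheme \<Rightarrow> 'a set" where
  "max_ideal R = (THE M. maximalideal M R)"

definition algebra_with_coefficient_field ::
    "('k, 'p) ring_scheme \<Rightarrow> ('k, 'a, 'q) module_scheme \<Rightarrow> 'a set \<Rightarrow> bool" where
  "algebra_with_coefficient_field K R \<mm> \<longleftrightarrow>
     field K \<and> algebra K R \<and> \<one>\<^bsub>R\<^esub> \<noteq> \<zero>\<^bsub>R\<^esub> \<and>
     (graded_algebra_with_ideal K R \<mm> \<or>
      local_ring R \<and> \<mm> = max_ideal R \<and> essentially_of_finite_type K R) \<and>
     (\<lambda>k. \<mm> +>\<^bsub>R\<^esub> structure_map R k) \<in> ring_iso K (R Quot \<mm>)"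

section \<open>Completion\<close>

text \<open>The inverse limit of the quotients of \<open>R\<close> by the powers of \<open>\<mm>\<close>. For cosets \<open>f n\<close>, the
  condition \<open>f (Suc n) \<subseteq> f n\<close> says that \<open>f (Suc n)\<close> is mapped to \<open>f n\<close> by the projection.\<close>

definition completion ::
    "('k, 'a, 'q) module_scheme \<Rightarrow> 'a set \<Rightarrow> ('k, nat \<Rightarrow> 'a set) module" where
  "completion R \<mm> =
     (let Q = (\<lambda>n::nat. R Quot (\<mm> [^]\<^bsub>ideals_set R\<^esub> n)) in
      \<lparr>carrier = {f. (\<forall>n. f n \<in> carrier (Q n)) \<and> (\<forall>n. f (Suc n) \<subseteq> f n)},
       monoid.mult = (\<lambda>f g n. f n \<otimes>\<^bsub>Q n\<^esub> g n),
       one = (\<lambda>n. \<one>\<^bsub>Q n\<^esub>),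
       ring.zero = (\<lambda>n. \<zero>\<^bsub>Q n\<^esub>),
       add = (\<lambda>f g n. f n \<oplus>\<^bsub>Q n\<^esub> g n),
       smult = (\<lambda>k f n. ((\<mm> [^]\<^bsub>ideals_set R\<^esub> n) +>\<^bsub>R\<^esub> structure_map R k) \<otimes>\<^bsub>Q n\<^esub> f n)\<rparr>)"

section \<open>Differential operators\<close>

text \<open>Maps are taken extensional on the carrier, so that equality of operators is equality of
  functions.\<close>

definition ring_linear_endos :: "('a, 'p) ring_scheme \<Rightarrow> ('a \<Rightarrow> 'a) set" where
  "ring_linear_endos R = {f \<in> carrier R \<rightarrow>\<^sub>E carrier R.
     (\<forall>x \<in> carrier R. \<forall>y \<in> carrier R. f (x \<oplus>\<^bsub>R\<^esub> y) = f x \<oplus>\<^bsub>R\<^esub> f y) \<and>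
     (\<forall>r \<in> carrier R. \<forall>x \<in> carrier R. f (r \<otimes>\<^bsub>R\<^esub> x) = r \<otimes>\<^bsub>R\<^esub> f x)}"

definition linear_endos ::
    "('k, 'p) ring_scheme \<Rightarrow> ('k, 'a, 'q) module_scheme \<Rightarrow> ('a \<Rightarrow> 'a) set" where
  "linear_endos K R = {f \<in> carrier R \<rightarrow>\<^sub>E carrier R.
     (\<forall>x \<in> carrier R. \<forall>y \<in> carrier R. f (x \<oplus>\<^bsub>R\<^esub> y) = f x \<oplus>\<^bsub>R\<^esub> f y) \<and>
     (\<forall>k \<in> carrier K. \<forall>x \<in> carrier R. f (k \<odot>\<^bsub>R\<^esub> x) = k \<odot>\<^bsub>R\<^esub> f x)}"

definition commutator :: "('a, 'p) ring_scheme \<Rightarrow> ('a \<Rightarrow> 'a) \<Rightarrow> 'a \<Rightarrow> ('a \<Rightarrow> 'a)" where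
  "commutator R \<delta> r = (\<lambda>x \<in> carrier R. \<delta> (r \<otimes>\<^bsub>R\<^esub> x) \<ominus>\<^bsub>R\<^esub> r \<otimes>\<^bsub>R\<^esub> \<delta> x)"

fun diffop ::
    "('k, 'p) ring_scheme \<Rightarrow> ('k, 'a, 'q) module_scheme \<Rightarrow> nat \<Rightarrow> ('a \<Rightarrow> 'a) set" where
  "diffop K R 0 = ring_linear_endos R"
| "diffop K R (Suc n) =
     {\<delta> \<in> linear_endos K R. \<forall>r \<in> carrier R. commutator R \<delta> r \<in> diffop K R n}"

definition diffop_ring ::
    "('k, 'p) ring_scheme \<Rightarrow> ('k, 'a, 'q) module_scheme \<Rightarrow> ('a \<Rightarrow> 'a) ring" where
  "diffop_ring K R =
     \<lparr>carrier = (\<Union>n. diffop K R n),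
      monoid.mult = compose (carrier R),
      one = (\<lambda>x \<in> carrier R. x),
      ring.zero = (\<lambda>x \<in> carrier R. \<zero>\<^bsub>R\<^esub>),
      add = (\<lambda>\<delta> \<epsilon>. \<lambda>x \<in> carrier R. \<delta> x \<oplus>\<^bsub>R\<^esub> \<epsilon> x)\<rparr>"

section \<open>Associated graded ring\<close>

text \<open>For an increasing filtration \<open>F\<close> of a ring \<open>A\<close> indexed by the natural numbers,
  \<open>filt_pred A F n\<close> is the step of index \<open>n - 1\<close>, the step of index \<open>- 1\<close> being zero.\<close>

definition filt_pred :: "('a, 'p) ring_scheme \<Rightarrow> (nat \<Rightarrow> 'a set) \<Rightarrow> nat \<Rightarrow> 'a set" where
  "filt_pred A F n = (case n of 0 \<Rightarrow> {\<zero>\<^bsub>A\<^esub>} | Suc k \<Rightarrow> F k)"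

text \<open>The quotient group in degree \<open>n\<close>; it is a \<^typ>\<open>'a set monoid\<close> in multiplicative notation,
  whose operation is the addition of cosets.\<close>

definition gr_component ::
    "('a, 'p) ring_scheme \<Rightarrow> (nat \<Rightarrow> 'a set) \<Rightarrow> nat \<Rightarrow> 'a set monoid" where
  "gr_component A F n = (A\<lparr>carrier := F n\<rparr>) A_Mod (filt_pred A F n)"

text \<open>Elements of the direct sum are finitely supported families of cosets. The product of a
  coset in degree \<open>i\<close> and one in degree \<open>n - i\<close> is the coset in degree \<open>n\<close> of the product of
  representatives, which is what \<^const>\<open>rcoset_mult\<close> modulo the step \<open>n - 1\<close> yields.\<close>

definition assoc_graded :: "('a, 'p) ring_scheme \<Rightarrow> (nat \<Rightarrow> 'a set) \<Rightarrow> (nat \<Rightarrow> 'a set) ring" where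
  "assoc_graded A F =
     \<lparr>carrier = {f. (\<forall>n. f n \<in> carrier (gr_component A F n)) \<and>
                    finite {n. f n \<noteq> \<one>\<^bsub>gr_component A F n\<^esub>}},
      monoid.mult = (\<lambda>f g n. finprod (gr_component A F n)
                (\<lambda>i. rcoset_mult A (filt_pred A F n) (f i) (g (n - i))) {..n}),
      one = (\<lambda>n. if n = 0 then filt_pred A F 0 +>\<^bsub>A\<^esub> \<one>\<^bsub>A\<^esub> else \<one>\<^bsub>gr_component A F n\<^esub>),
      ring.zero = (\<lambda>n. \<one>\<^bsub>gr_component A F n\<^esub>),
      add = (\<lambda>f g n. f n \<otimes>\<^bsub>gr_component A F n\<^esub> g n)\<rparr>"

definition gr_diffop ::
    "('k, 'p) ring_scheme \<Rightarrow> ('k, 'a, 'q) module_scheme \<Rightarrow> (nat \<Rightarrow> ('a \<Rightarrow> 'a) set) ring" where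
  "gr_diffop K R = assoc_graded (diffop_ring K R) (diffop K R)"

text \<open>The \<open>R\<close>-algebra structure: \<open>r\<close> is sent to the class of multiplication by \<open>r\<close> in degree 0.\<close>

definition gr_diffop_map ::
    "('k, 'p) ring_scheme \<Rightarrow> ('k, 'a, 'q) module_scheme \<Rightarrow> 'a \<Rightarrow> (nat \<Rightarrow> ('a \<Rightarrow> 'a) set)" where
  "gr_diffop_map K R r =
     (\<lambda>n. filt_pred (diffop_ring K R) (diffop K R) n +>\<^bsub>diffop_ring K R\<^esub>
        (if n = 0 then (\<lambda>x \<in> carrier R. r \<otimes>\<^bsub>R\<^esub> x) else \<zero>\<^bsub>diffop_ring K R\<^esub>))"

section \<open>Differential powers and differential signature\<close>

definition diff_power ::
    "('k, 'p) ring_scheme \<Rightarrow> ('k, 'a, 'q) module_scheme \<Rightarrow> 'a set \<Rightarrow> nat \<Rightarrow> 'a set" where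
  "diff_power K R \<mm> n =
     {f \<in> carrier R. \<forall>\<delta> \<in> filt_pred (diffop_ring K R) (diffop K R) n. \<delta> f \<in> \<mm>}"

definition diff_length ::
    "('k, 'p) ring_scheme \<Rightarrow> ('k, 'a, 'q) module_scheme \<Rightarrow> 'a set \<Rightarrow> nat \<Rightarrow> enat" where
  "diff_length K R \<mm> n = module_length R (quotient_module R (diff_power K R \<mm> n))"

definition diff_signature ::
    "('k, 'p) ring_scheme \<Rightarrow> ('k, 'a, 'q) module_scheme \<Rightarrow> 'a set \<Rightarrow> ereal" where
  "diff_signature K R \<mm> =
     (let d = the_enat (krull_dim R) in
      limsup (\<lambda>n. ereal_of_enat (diff_length K R \<mm> n) / ereal (real n ^ d / fact d)))"

end

theory Submission
  imports Defs "HOL-Library.List_Lexorder"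
begin

text \<open>If the associated graded ring is generated over \<open>R\<close> by the symbols of operators
  \<open>\<delta>\<^sub>1, \<dots>, \<delta>\<^sub>s\<close>, then the operators of order at most \<open>n\<close> are spanned over \<open>R\<close> by the ordered monomials
  in the \<open>\<delta>\<^sub>i\<close> of weight at most \<open>n\<close>. Order the monomials by weight and then lexicographically, and
  call a monomial standard if it takes a value outside \<open>\<mm>\<close> at some point where all smaller
  monomials take values in \<open>\<mm>\<close>. The standard exponents form a down-closed set \<open>S\<close>, and the length of
  \<open>R / \<mm>\<^bsup>\<langle>n+1\<rangle>\<^esup>\<close> is the number of elements of \<open>S\<close> of weight at most \<open>n\<close>. By Dickson's lemma and
  induction on the number of variables this number is asymptotic to \<open>q n\<^sup>e\<close> with \<open>q\<close> rational. As
  \<open>\<mm>\<^sup>n\<close> is contained in the \<open>n\<close>-th differential power, \<open>e\<close> is at most the growth exponent of the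
  length of \<open>R / \<mm>\<^sup>n\<close>, which is the height of \<open>\<mm>\<close> and equals the dimension; in the graded case the
  last equality follows by comparing the filtration by powers of \<open>\<mm>\<close> with the one by degree.

  Operators on \<open>R\<close> extend continuously to the completion. Conversely, the values on \<open>R\<close> of an
  operator of bounded order on the completion are universal \<open>R\<close>-linear combinations of its values at
  a finite set of points. By the Artin-Rees lemma the \<open>R\<close>-linear relations between these values have
  a solution in \<open>R\<close> that is congruent to them modulo the maximal ideal, and this solution defines an
  operator on \<open>R\<close>. Hence the differential powers of \<open>R\<close> and of its completion correspond.\<close>

no_notation Sum_Type.Plus (infixr \<open><+>\<close> 65)

section \<open>Lengths of intervals of submodules\<close>

text \<open>Values modulo \<mm> are K-linear but not R-linear, so standard monomials count
  dimensions of K-subspaces; this returns the length over R because K is the residue field and the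
  differential powers contain powers of \<mm>. Down-closedness of the standard exponents has two
  sources: commutators drop the order, so ordered monomials multiply like commuting ones up to
  smaller order, and operators of smaller order are combinations of monomials of smaller weight.
  Only the leading term of the counting function is followed. It is positive unless the function
  vanishes, so a bound on the growth bounds the exponent, and an exponent below the dimension gives
  the limit 0. The hypothesis on the associated graded ring concerns R alone, so nothing is counted
  in the completion: its lengths are shown equal to those of R. An operator of the completion need
  not come from R, but membership in a differential power sees values only modulo the maximal ideal,
  so an operator of R congruent to it there is enough. Krull dimension enters through growth as
  well: the completion has the dimension of R because the lengths of the quotients by powers of the
  maximal ideals agree.\<close>

definition lchain :: "'a set set \<Rightarrow> 'a set \<Rightarrow> 'a set \<Rightarrow> nat \<Rightarrow> (nat \<Rightarrow> 'a set) \<Rightarrow> bool" where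
  "lchain L U V n N \<longleftrightarrow> (\<forall>i\<le>n. N i \<in> L \<and> U \<subseteq> N i \<and> N i \<subseteq> V) \<and> (\<forall>i<n. N i \<subset> N (Suc i))"

text \<open>The family \<open>L\<close> is a parameter because ideals of R, K-subspaces of R and
  submodules of a quotient are all counted by it, and lengths in different families are
  compared.\<close>

definition len :: "'a set set \<Rightarrow> 'a set \<Rightarrow> 'a set \<Rightarrow> enat" where
  "len L U V = Sup {enat n | n. \<exists>N. lchain L U V n N}"

lemma len_geI: "lchain L U V n N \<Longrightarrow> enat n \<le> len L U V"
  unfolding len_def by (rule Sup_upper) auto

lemma len_leI: "(\<And>n N. lchain L U V n N \<Longrightarrow> enat n \<le> x) \<Longrightarrow> len L U V \<le> x"
  unfolding len_def by (rule Sup_least) auto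

text \<open>A strictly increasing map of intervals carries chains to chains. Equalities of lengths
  come from two such maps in opposite directions, which need not be inverse to each other.\<close>

lemma len_transfer:
  assumes "\<And>N. N \<in> L \<Longrightarrow> U \<subseteq> N \<Longrightarrow> N \<subseteq> V \<Longrightarrow> \<Phi> N \<in> L' \<and> U' \<subseteq> \<Phi> N \<and> \<Phi> N \<subseteq> V'"
    and "\<And>N M. N \<in> L \<Longrightarrow> M \<in> L \<Longrightarrow> U \<subseteq> N \<Longrightarrow> M \<subseteq> V \<Longrightarrow> N \<subset> M \<Longrightarrow> \<Phi> N \<subset> \<Phi> M"
  shows "len L U V \<le> len L' U' V'"
proof (rule len_leI)
  fix n N assume N: "lchain L U V n N"
  have "lchain L' U' V' n (\<lambda>i. \<Phi> (N i))"
    unfolding lchain_def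
  proof (intro conjI allI impI)
    fix i assume "i \<le> n"
    hence "N i \<in> L" "U \<subseteq> N i" "N i \<subseteq> V" using N unfolding lchain_def by auto
    thus "\<Phi> (N i) \<in> L'" "U' \<subseteq> \<Phi> (N i)" "\<Phi> (N i) \<subseteq> V'" using assms(1) by auto
  next
    fix i assume i: "i < n"
    have "N i \<in> L" "U \<subseteq> N i" "N (Suc i) \<in> L" "N (Suc i) \<subseteq> V" "N i \<subset> N (Suc i)"
      using N i unfolding lchain_def by auto
    thus "\<Phi> (N i) \<subset> \<Phi> (N (Suc i))" using assms(2) by auto
  qed
  thus "enat n \<le> len L' U' V'" by (rule len_geI)
qed

lemma len_mono:
  assumes "L \<subseteq> L'" "U' \<subseteq> U" "V \<subseteq> V'"
  shows "len L U V \<le> len L' U' V'"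
  by (rule len_transfer[where \<Phi> = "\<lambda>N. N"]) (use assms in auto)

text \<open>Dropping the repetitions from a chain that may stall leaves a strict chain. Chains
  obtained by intersecting with, or adding, a fixed subgroup are of this kind.\<close>

lemma len_weak_chain:
  assumes "\<forall>i\<le>n. N i \<in> L \<and> U \<subseteq> N i \<and> N i \<subseteq> V" "\<forall>i<n. N i \<subseteq> N (Suc i)"
  shows "enat (card {i. i < n \<and> N i \<noteq> N (Suc i)}) \<le> len L U V"
proof -
  \<comment> \<open>The end point is kept in the induction statement so that the next member can be
    appended.\<close>
  have "\<exists>M. lchain L U V (card {i. i < n \<and> N i \<noteq> N (Suc i)}) M \<and>
            M (card {i. i < n \<and> N i \<noteq> N (Suc i)}) = N n"
    using assms
  proof (induction n)
    case 0
    thus ?case by (auto simp: lchain_def intro!: exI[of _ N])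
  next
    case (Suc n)
    let ?c = "card {i. i < n \<and> N i \<noteq> N (Suc i)}"
    from Suc obtain M where M: "lchain L U V ?c M" "M ?c = N n" by auto
    show ?case
    proof (cases "N n = N (Suc n)")
      case True
      hence "{i. i < Suc n \<and> N i \<noteq> N (Suc i)} = {i. i < n \<and> N i \<noteq> N (Suc i)}"
        using less_Suc_eq by auto
      thus ?thesis using M True by auto
    next
      case False
      hence "{i. i < Suc n \<and> N i \<noteq> N (Suc i)} = insert n {i. i < n \<and> N i \<noteq> N (Suc i)}"
        using less_Suc_eq by auto
      hence c: "card {i. i < Suc n \<and> N i \<noteq> N (Suc i)} = Suc ?c" by simp
      have sub: "N n \<subset> N (Suc n)" using False Suc.prems(2) by auto
      have "N (Suc n) \<in> L \<and> U \<subseteq> N (Suc n) \<and> N (Suc n) \<subseteq> V" using Suc.prems(1) by auto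
      hence "lchain L U V (Suc ?c) (M(Suc ?c := N (Suc n)))"
        using M sub unfolding lchain_def by (auto simp: le_Suc_eq less_Suc_eq)
      thus ?thesis unfolding c
        by (intro exI[of _ "M(Suc ?c := N (Suc n))"] conjI) (assumption, rule fun_upd_same)
    qed
  qed
  thus ?thesis using len_geI by blast
qed

lemma lchain_truncate: "lchain L U V n N \<Longrightarrow> k \<le> n \<Longrightarrow> lchain L U V k N"
  unfolding lchain_def by auto

text \<open>Truncating a longer chain gives one of length exactly n. The case n = 0 is excluded
  because an interval without members of \<open>L\<close> has length 0 but carries no chain.\<close>

lemma len_chain:
  assumes "enat n \<le> len L U V" "0 < n"
  shows "\<exists>N. lchain L U V n N"
proof (rule ccontr)
  assume no: "\<nexists>N. lchain L U V n N"
  have "len L U V \<le> enat (n - 1)"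
  proof (rule len_leI)
    fix k N assume "lchain L U V k N"
    hence "\<not> n \<le> k" using no lchain_truncate by blast
    thus "enat k \<le> enat (n - 1)" by simp
  qed
  hence "enat n \<le> enat (n - 1)" using assms(1) order_trans by blast
  thus False using assms(2) by simp
qed

text \<open>Infinite summands are handled by letting their finite lower bounds vary; a bound above
  every natural number is infinite.\<close>

lemma enat_add_leI:
  assumes "\<And>n k. enat n \<le> a \<Longrightarrow> enat k \<le> b \<Longrightarrow> enat (n + k) \<le> x"
  shows "a + b \<le> x"
proof -
  have inf: "x = \<infinity>" if "\<And>n. enat n \<le> x" for x
    using that by (metis enat_ord_code(4) not_infinity_eq Suc_n_not_le_n enat_ord_simps(1))
  have "enat n \<le> x" if "a = \<infinity> \<or> b = \<infinity>" for n
    using that assms[of n 0] assms[of 0 n] by (auto simp: zero_enat_def[symmetric])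
  thus ?thesis using assms inf by (cases a; cases b) auto
qed

lemma len_superadd:
  assumes "U \<subseteq> V" "V \<subseteq> W"
  shows "len L U V + len L V W \<le> len L U W"
proof (rule enat_add_leI)
  fix n k assume n: "enat n \<le> len L U V" and k: "enat k \<le> len L V W"
  show "enat (n + k) \<le> len L U W"
  proof (cases "n = 0 \<or> k = 0")
    case True
    thus ?thesis
      using n k len_mono[of L L U U V W] len_mono[of L L U V W W] assms
      by (auto intro: order_trans)
  next
    case False
    then obtain N M where N: "lchain L U V n N" and M: "lchain L V W k M"
      using len_chain n k by blast
    \<comment> \<open>\<open>M 0\<close> is left out of the concatenation: it may equal
      \<open>N n\<close>, whereas \<open>M 1\<close> is strictly larger.\<close>
    let ?Q = "\<lambda>i. if i \<le> n then N i else M (i - n)"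
    have NV: "N n \<subseteq> V" "V \<subseteq> M 0" using N M unfolding lchain_def by auto
    have "lchain L U W (n + k) ?Q"
      unfolding lchain_def
    proof (intro conjI allI impI)
      fix i assume i: "i \<le> n + k"
      have "?Q i \<in> L \<and> U \<subseteq> ?Q i \<and> ?Q i \<subseteq> W"
      proof (cases "i \<le> n")
        case True
        hence "N i \<in> L" "U \<subseteq> N i" "N i \<subseteq> V" using N unfolding lchain_def by auto
        thus ?thesis using True assms by auto
      next
        case False
        hence "i - n \<le> k" using i by auto
        hence "M (i - n) \<in> L" "V \<subseteq> M (i - n)" "M (i - n) \<subseteq> W" using M unfolding lchain_def by auto
        thus ?thesis using False assms by auto
      qed
      thus "?Q i \<in> L" "U \<subseteq> ?Q i" "?Q i \<subseteq> W" by auto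
    next
      fix i assume i: "i < n + k"
      show "?Q i \<subset> ?Q (Suc i)"
      proof (cases "i < n")
        case True thus ?thesis using N unfolding lchain_def by auto
      next
        case False
        hence "M (i - n) \<subset> M (Suc i - n)" using M i unfolding lchain_def
          by (auto simp: Suc_diff_le)
        thus ?thesis using False NV by (cases "i = n") auto
      qed
    qed
    thus ?thesis by (rule len_geI)
  qed
qed

text \<open>For \<open>A\<close> the whole ring these are the ideals, for \<open>A\<close> the
  coefficient field the K-subspaces. \<open>A\<close> is just a set of scalars, so that one theory
  of length serves both.\<close>

definition asub :: "('a, 'p) ring_scheme \<Rightarrow> 'a set \<Rightarrow> 'a set \<Rightarrow> bool" where
  "asub R A U \<longleftrightarrow> U \<subseteq> carrier R \<and> \<zero>\<^bsub>R\<^esub> \<in> U \<and> (\<forall>u\<in>U. \<forall>v\<in>U. u \<oplus>\<^bsub>R\<^esub> v \<in> U) \<and>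
     (\<forall>u\<in>U. \<ominus>\<^bsub>R\<^esub> u \<in> U) \<and> (\<forall>a\<in>A. \<forall>u\<in>U. a \<otimes>\<^bsub>R\<^esub> u \<in> U)"

abbreviation (input) sublat :: "('a, 'p) ring_scheme \<Rightarrow> 'a set \<Rightarrow> 'a set set" where
  "sublat R A \<equiv> {U. asub R A U}"

lemma asubD:
  assumes "asub R A U"
  shows "U \<subseteq> carrier R" "u \<in> U \<Longrightarrow> u \<in> carrier R" "\<zero>\<^bsub>R\<^esub> \<in> U" "u \<in> U \<Longrightarrow> v \<in> U \<Longrightarrow> u \<oplus>\<^bsub>R\<^esub> v \<in> U"
    "u \<in> U \<Longrightarrow> \<ominus>\<^bsub>R\<^esub> u \<in> U" "a \<in> A \<Longrightarrow> u \<in> U \<Longrightarrow> a \<otimes>\<^bsub>R\<^esub> u \<in> U"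
    "u \<in> U \<Longrightarrow> v \<in> U \<Longrightarrow> u \<ominus>\<^bsub>R\<^esub> v \<in> U"
  using assms unfolding asub_def a_minus_def by auto

lemma mem_set_add: "x \<in> A <+>\<^bsub>R\<^esub> B \<longleftrightarrow> (\<exists>a\<in>A. \<exists>b\<in>B. x = a \<oplus>\<^bsub>R\<^esub> b)"
  unfolding set_add_def' by auto

section \<open>Ideals, sums of subgroups and the additivity of length\<close>

context cring begin

lemma asub_ideal_iff: "asub R (carrier R) U \<longleftrightarrow> ideal U R"
proof
  assume "ideal U R"
  then interpret ideal U R .
  show "asub R (carrier R) U" unfolding asub_def using a_subset I_l_closed by auto
next
  assume a: "asub R (carrier R) U"
  show "ideal U R"
  proof (rule idealI)
    show "ring R" by (rule ring_axioms)
    show "subgroup U (add_monoid R)"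
      using a unfolding asub_def
      by (auto intro!: subgroup.intro simp: a_inv_def)
    show "x \<otimes> u \<in> U" "u \<otimes> x \<in> U" if "u \<in> U" "x \<in> carrier R" for u x
      using asubD(2,6)[OF a] that by (auto simp: m_comm[of u x])
  qed
qed

lemma idealD:
  assumes "ideal U R"
  shows "asub R (carrier R) U" "U \<subseteq> carrier R" "u \<in> U \<Longrightarrow> u \<in> carrier R" "\<zero> \<in> U"
    "u \<in> U \<Longrightarrow> v \<in> U \<Longrightarrow> u \<oplus> v \<in> U"
    "u \<in> U \<Longrightarrow> \<ominus> u \<in> U" "a \<in> carrier R \<Longrightarrow> u \<in> U \<Longrightarrow> a \<otimes> u \<in> U"
    "a \<in> carrier R \<Longrightarrow> u \<in> U \<Longrightarrow> u \<otimes> a \<in> U"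
    "u \<in> U \<Longrightarrow> v \<in> U \<Longrightarrow> u \<ominus> v \<in> U"
proof -
  have a: "asub R (carrier R) U" using assms asub_ideal_iff by auto
  show "asub R (carrier R) U" "U \<subseteq> carrier R" "u \<in> U \<Longrightarrow> u \<in> carrier R" "\<zero> \<in> U"
    "u \<in> U \<Longrightarrow> v \<in> U \<Longrightarrow> u \<oplus> v \<in> U"
    "u \<in> U \<Longrightarrow> \<ominus> u \<in> U" "a \<in> carrier R \<Longrightarrow> u \<in> U \<Longrightarrow> a \<otimes> u \<in> U"
    "u \<in> U \<Longrightarrow> v \<in> U \<Longrightarrow> u \<ominus> v \<in> U"
    using asubD[OF a] a by auto
  show "a \<in> carrier R \<Longrightarrow> u \<in> U \<Longrightarrow> u \<otimes> a \<in> U"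
    using asubD(6)[OF a, of a u] asubD(2)[OF a, of u] by (simp add: m_comm)
qed

lemma asubI:
  assumes "subring A R" "U \<subseteq> carrier R" "\<zero> \<in> U" "\<And>u v. u \<in> U \<Longrightarrow> v \<in> U \<Longrightarrow> u \<oplus> v \<in> U"
    "\<And>a u. a \<in> A \<Longrightarrow> u \<in> U \<Longrightarrow> a \<otimes> u \<in> U"
  shows "asub R A U"
proof -
  have "\<ominus> u \<in> U" if u: "u \<in> U" for u
  proof -
    have "(\<ominus> \<one>) \<otimes> u \<in> U" using assms(5) u subringE(3,5)[OF assms(1)] by blast
    thus ?thesis using u assms(2) by (auto simp: l_minus)
  qed
  thus ?thesis unfolding asub_def using assms(2-5) by blast
qed

lemmas ideal_intro = asubI[OF carrier_is_subring, unfolded asub_ideal_iff]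

lemma asub_carrier: "A \<subseteq> carrier R \<Longrightarrow> asub R A (carrier R)"
  unfolding asub_def by auto

lemma asub_zero: "A \<subseteq> carrier R \<Longrightarrow> asub R A {\<zero>}"
  unfolding asub_def by auto

lemma asub_mono: "asub R A U \<Longrightarrow> B \<subseteq> A \<Longrightarrow> asub R B U"
  unfolding asub_def by blast

lemma asub_inter: "asub R A U \<Longrightarrow> asub R A V \<Longrightarrow> asub R A (U \<inter> V)"
  unfolding asub_def by auto

lemma asub_add:
  assumes "asub R A U" "asub R A V" "A \<subseteq> carrier R"
  shows "asub R A (U <+> V)"
  unfolding asub_def
proof (intro conjI ballI)
  have c: "u \<in> U \<Longrightarrow> u \<in> carrier R" "v \<in> V \<Longrightarrow> v \<in> carrier R" for u v
    using asubD(2)[OF assms(1)] asubD(2)[OF assms(2)] by auto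
  show "U <+> V \<subseteq> carrier R" using c by (auto simp: mem_set_add)
  show "\<zero> \<in> U <+> V"
    using assms asubD(3) unfolding mem_set_add by (metis l_zero zero_closed)
  show "x \<oplus> y \<in> U <+> V" if "x \<in> U <+> V" "y \<in> U <+> V" for x y
  proof -
    from that obtain u v u' v' where h: "x = u \<oplus> v" "y = u' \<oplus> v'" "u \<in> U" "u' \<in> U" "v \<in> V" "v' \<in> V"
      unfolding mem_set_add by blast
    hence "x \<oplus> y = (u \<oplus> u') \<oplus> (v \<oplus> v')" using c by (simp add: a_ac)
    moreover have "u \<oplus> u' \<in> U" "v \<oplus> v' \<in> V" using h asubD(4)[OF assms(1)] asubD(4)[OF assms(2)] by auto
    ultimately show ?thesis unfolding mem_set_add by blast
  qed
  show "\<ominus> x \<in> U <+> V" if "x \<in> U <+> V" for x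
  proof -
    from that obtain u v where h: "x = u \<oplus> v" "u \<in> U" "v \<in> V"
      unfolding mem_set_add by blast
    hence "\<ominus> x = \<ominus> u \<oplus> \<ominus> v" using c by (simp add: minus_add)
    moreover have "\<ominus> u \<in> U" "\<ominus> v \<in> V" using h asubD(5)[OF assms(1)] asubD(5)[OF assms(2)] by auto
    ultimately show ?thesis unfolding mem_set_add by blast
  qed
  show "a \<otimes> x \<in> U <+> V" if "a \<in> A" "x \<in> U <+> V" for x a
  proof -
    from that obtain u v where h: "x = u \<oplus> v" "u \<in> U" "v \<in> V"
      unfolding mem_set_add by blast
    hence "a \<otimes> x = a \<otimes> u \<oplus> a \<otimes> v" using c assms(3) that by (simp add: r_distr subset_iff)
    moreover have "a \<otimes> u \<in> U" "a \<otimes> v \<in> V" using h asubD(6)[OF assms(1)] asubD(6)[OF assms(2)] that by auto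
    ultimately show ?thesis unfolding mem_set_add by blast
  qed
qed

lemma add_subset:
  assumes "asub R A U" "asub R A V" shows "U \<subseteq> U <+> V" "V \<subseteq> U <+> V"
proof
  fix x assume "x \<in> U"
  hence "x = x \<oplus> \<zero>" using asubD(2)[OF assms(1)] by simp
  thus "x \<in> U <+> V" unfolding mem_set_add using \<open>x \<in> U\<close> asubD(3)[OF assms(2)] by blast
next
  show "V \<subseteq> U <+> V"
  proof
    fix x assume "x \<in> V"
    hence "x = \<zero> \<oplus> x" using asubD(2)[OF assms(2)] by simp
    thus "x \<in> U <+> V" unfolding mem_set_add using \<open>x \<in> V\<close> asubD(3)[OF assms(1)] by blast
  qed
qed

lemma add_least:
  assumes "asub R A W" "U \<subseteq> W" "V \<subseteq> W" shows "U <+> V \<subseteq> W"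
proof
  fix x assume "x \<in> U <+> V"
  then obtain a b where "a \<in> U" "b \<in> V" "x = a \<oplus> b" unfolding mem_set_add by blast
  thus "x \<in> W" using asubD(4)[OF assms(1), of a b] assms(2,3) by blast
qed

lemma set_add_mono: "U \<subseteq> U' \<Longrightarrow> V \<subseteq> V' \<Longrightarrow> U <+> V \<subseteq> U' <+> V'"
  unfolding subset_iff mem_set_add by blast

lemma set_add_commute:
  assumes "U \<subseteq> carrier R" "V \<subseteq> carrier R" shows "U <+> V = V <+> U"
proof -
  have "x \<in> V <+> U" if "x \<in> U <+> V" "U \<subseteq> carrier R" "V \<subseteq> carrier R" for x U V
  proof -
    from that(1) obtain a b where "a \<in> U" "b \<in> V" "x = a \<oplus> b" unfolding mem_set_add by blast
    moreover from this have "x = b \<oplus> a" using a_comm that(2,3) by blast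
    ultimately show ?thesis unfolding mem_set_add by blast
  qed
  thus ?thesis using assms by blast
qed

lemma add_absorb:
  assumes "asub R A U" "asub R A V" "V \<subseteq> U" shows "U <+> V = U"
  using add_least[OF assms(1) subset_refl assms(3)] add_subset(1)[OF assms(1,2)] by blast

text \<open>The modular law: x in \<open>M\<close> is y + v with y in \<open>N\<close> and v in
  \<open>V\<close>, so v = x - y lies in \<open>M \<inter> V\<close>, hence in
  \<open>N\<close>.\<close>

lemma modular_eq:
  assumes "asub R A N" "asub R A M" "asub R A V" "N \<subseteq> M" "N \<inter> V = M \<inter> V" "N <+> V = M <+> V"
  shows "N = M"
proof
  show "M \<subseteq> N"
  proof
    fix x assume x: "x \<in> M"
    hence "x \<in> N <+> V" using assms(6) add_subset(1)[OF assms(2,3)] by blast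
    then obtain y v where yv: "x = y \<oplus> v" "y \<in> N" "v \<in> V" unfolding mem_set_add by blast
    hence c: "y \<in> carrier R" "v \<in> carrier R" using asubD(2)[OF assms(1)] asubD(2)[OF assms(3)] by auto
    hence "v = x \<ominus> y" using yv by algebra
    hence "v \<in> M" using x yv assms(4) asubD(7)[OF assms(2)] by blast
    hence "v \<in> N" using assms(5) yv by blast
    thus "x \<in> N" using yv asubD(4)[OF assms(1)] by blast
  qed
qed (rule assms(4))

text \<open>By the modular law a strict step of a chain stays strict after intersecting with
  \<open>V\<close> or after adding \<open>V\<close>. So the n steps are covered by the strict steps
  of the two derived chains.\<close>

lemma len_subadd:
  assumes "asub R A V" "asub R A W" "A \<subseteq> carrier R" "U \<subseteq> V" "V \<subseteq> W"
  shows "len (sublat R A) U W \<le> len (sublat R A) U V + len (sublat R A) V W"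
proof (rule len_leI)
  let ?L = "sublat R A"
  fix n N assume N: "lchain ?L U W n N"
  have a: "asub R A (N i)" "U \<subseteq> N i" "N i \<subseteq> W" if "i \<le> n" for i using N that unfolding lchain_def by auto
  have s: "N i \<subset> N (Suc i)" if "i < n" for i using N that unfolding lchain_def by auto
  define S1 where "S1 = {i. i < n \<and> N i \<inter> V \<noteq> N (Suc i) \<inter> V}"
  define S2 where "S2 = {i. i < n \<and> N i <+> V \<noteq> N (Suc i) <+> V}"
  have 1: "enat (card S1) \<le> len ?L U V"
    unfolding S1_def
  proof (rule len_weak_chain)
    show "\<forall>i\<le>n. N i \<inter> V \<in> ?L \<and> U \<subseteq> N i \<inter> V \<and> N i \<inter> V \<subseteq> V"
      using a assms asub_inter by auto
    show "\<forall>i<n. N i \<inter> V \<subseteq> N (Suc i) \<inter> V"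
      by (intro allI impI Int_mono subset_refl psubset_imp_subset s)
  qed
  have 2: "enat (card S2) \<le> len ?L V W"
    unfolding S2_def
  proof (rule len_weak_chain)
    show "\<forall>i\<le>n. N i <+> V \<in> ?L \<and> V \<subseteq> N i <+> V \<and> N i <+> V \<subseteq> W"
    proof (intro allI impI conjI)
      fix i assume i: "i \<le> n"
      show "N i <+> V \<in> ?L" using asub_add[OF a(1)[OF i] assms(1,3)] by simp
      show "V \<subseteq> N i <+> V" using add_subset(2)[OF a(1)[OF i] assms(1)] .
      show "N i <+> V \<subseteq> W" using add_least[OF assms(2) a(3)[OF i] assms(5)] .
    qed
    show "\<forall>i<n. N i <+> V \<subseteq> N (Suc i) <+> V" by (intro allI impI set_add_mono subset_refl psubset_imp_subset s)
  qed
  have "{..<n} \<subseteq> S1 \<union> S2"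
  proof
    fix i assume i: "i \<in> {..<n}"
    have "N i \<noteq> N (Suc i)" using s i by blast
    moreover have "asub R A (N i)" "asub R A (N (Suc i))" "N i \<subseteq> N (Suc i)" using a s[of i] i by auto
    ultimately show "i \<in> S1 \<union> S2" unfolding S1_def S2_def using i modular_eq assms(1) by blast
  qed
  moreover have "finite S1" "finite S2" unfolding S1_def S2_def by auto
  ultimately have "n \<le> card S1 + card S2"
    by (metis card_Un_le card_lessThan card_mono finite_Un le_trans)
  hence "enat n \<le> enat (card S1) + enat (card S2)" by simp
  also have "\<dots> \<le> len ?L U V + len ?L V W" using 1 2 add_mono_thms_linordered_semiring(1) by blast
  finally show "enat n \<le> len ?L U V + len ?L V W" .
qed

lemma len_add:
  assumes "asub R A V" "asub R A W" "A \<subseteq> carrier R" "U \<subseteq> V" "V \<subseteq> W"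
  shows "len (sublat R A) U W = len (sublat R A) U V + len (sublat R A) V W"
  using len_subadd[OF assms] len_superadd[OF assms(4,5)] by (rule antisym)

lemma len_self: "len L U U = 0"
proof -
  have "len L U U \<le> enat 0"
  proof (rule len_leI)
    fix n N assume N: "lchain L U U n N"
    hence "n = 0" unfolding lchain_def by (metis bot_nat_0.not_eq_extremum less_eq_Suc_le order_antisym psubsetE less_imp_le_nat zero_le)
    thus "enat n \<le> enat 0" by simp
  qed
  thus ?thesis by (simp add: zero_enat_def[symmetric])
qed

lemma len_pos:
  assumes "U \<in> L" "V \<in> L" "U \<subset> V" shows "1 \<le> len L U V"
proof -
  have "lchain L U V 1 (\<lambda>i. if i = 0 then U else V)" using assms unfolding lchain_def by auto
  thus ?thesis using len_geI by (metis one_enat_def)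
qed

lemma len_le_one:
  assumes "\<And>N. N \<in> L \<Longrightarrow> U \<subset> N \<Longrightarrow> N \<subseteq> V \<Longrightarrow> N = V" shows "len L U V \<le> 1"
proof (rule len_leI)
  fix n N assume N: "lchain L U V n N"
  have "n < 2"
  proof (rule ccontr)
    assume "\<not> n < 2"
    hence "N 0 \<subset> N 1" "N 1 \<subset> N 2" "U \<subseteq> N 0" "N 1 \<in> L" "N 1 \<subseteq> V" "N 2 \<subseteq> V"
      using N unfolding lchain_def by (auto simp: numeral_2_eq_2)
    thus False using assms[of "N 1"] by blast
  qed
  thus "enat n \<le> 1" by (simp add: one_enat_def)
qed

section \<open>Multiplication by an element: images and colons\<close>

definition ximg :: "'a \<Rightarrow> 'a set \<Rightarrow> 'a set" where "ximg x V = (\<lambda>v. x \<otimes> v) ` V"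
text \<open>This is the colon (B : x).\<close>

definition xpre :: "'a \<Rightarrow> 'a set \<Rightarrow> 'a set" where "xpre x B = {r \<in> carrier R. x \<otimes> r \<in> B}"

lemma mem_ximg: "y \<in> ximg x V \<longleftrightarrow> (\<exists>v\<in>V. y = x \<otimes> v)" unfolding ximg_def by blast

lemma asub_ximg:
  assumes "asub R A V" "x \<in> carrier R" "A \<subseteq> carrier R" shows "asub R A (ximg x V)"
proof -
  note c = asubD[OF assms(1)]
  have 1: "a \<otimes> (x \<otimes> v) = x \<otimes> (a \<otimes> v)" if "a \<in> A" "v \<in> V" for a v
    using that c(2)[of v] assms by (simp add: m_lcomm subset_iff)
  have 2: "x \<otimes> u \<oplus> x \<otimes> v = x \<otimes> (u \<oplus> v)" if "u \<in> V" "v \<in> V" for u v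
    using that c(2) assms by (simp add: r_distr)
  have 3: "\<ominus> (x \<otimes> u) = x \<otimes> (\<ominus> u)" if "u \<in> V" for u
    using that c(2) assms by (simp add: r_minus)
  have 4: "\<zero> = x \<otimes> \<zero>" using assms by simp
  show ?thesis unfolding asub_def
  proof (intro conjI ballI)
    show "ximg x V \<subseteq> carrier R" using c(2) assms(2) unfolding ximg_def by auto
    show "\<zero> \<in> ximg x V" unfolding mem_ximg using 4 c(3) by blast
    fix u assume "u \<in> ximg x V"
    then obtain u' where u: "u' \<in> V" "u = x \<otimes> u'" unfolding mem_ximg by blast
    show "\<ominus> u \<in> ximg x V" unfolding mem_ximg u(2) 3[OF u(1)] using c(5)[OF u(1)] by blast
    show "a \<otimes> u \<in> ximg x V" if "a \<in> A" for a
      unfolding mem_ximg u(2) 1[OF that u(1)] using c(6)[OF that u(1)] by blast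
    fix v assume "v \<in> ximg x V"
    then obtain v' where v: "v' \<in> V" "v = x \<otimes> v'" unfolding mem_ximg by blast
    show "u \<oplus> v \<in> ximg x V" unfolding mem_ximg u(2) v(2) 2[OF u(1) v(1)] using c(4)[OF u(1) v(1)] by blast
  qed
qed

lemma asub_xpre:
  assumes "asub R A B" "x \<in> carrier R" "A \<subseteq> carrier R" shows "asub R A (xpre x B)"
proof -
  note c = asubD[OF assms(1)]
  have "x \<otimes> (a \<otimes> v) = a \<otimes> (x \<otimes> v)" if "a \<in> A" "v \<in> carrier R" for a v
    using that c assms by (simp add: m_lcomm subset_iff)
  thus ?thesis unfolding asub_def xpre_def using c assms(2,3)
    by (auto simp: r_distr r_minus subset_iff)
qed

text \<open>Multiplication by x induces an isomorphism from V / (V \<inter> (B : x)) onto (B + xV) /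
  B; its preimages and images of subgroups give the two inequalities.\<close>

lemma len_ximg:
  assumes "asub R A B" "asub R A V" "x \<in> carrier R" "A \<subseteq> carrier R"
  shows "len (sublat R A) B (B <+> ximg x V) = len (sublat R A) (V \<inter> xpre x B) V"
proof (rule antisym)
  note b = asubD[OF assms(1)] and v = asubD[OF assms(2)]
  show "len (sublat R A) B (B <+> ximg x V) \<le> len (sublat R A) (V \<inter> xpre x B) V"
  proof (rule len_transfer[where \<Phi> = "\<lambda>N. V \<inter> xpre x N"])
    fix N M assume h: "N \<in> sublat R A" "M \<in> sublat R A" "B \<subseteq> N" "M \<subseteq> B <+> ximg x V" "N \<subset> M"
    then obtain y where y: "y \<in> M" "y \<notin> N" by blast
    have "y \<in> B <+> ximg x V" using y(1) h(4) by (rule subsetD[rotated])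
    then obtain b w where b': "b \<in> B" "w \<in> ximg x V" "y = b \<oplus> w" unfolding mem_set_add by blast
    then obtain v where "v \<in> V" "w = x \<otimes> v" unfolding mem_ximg by blast
    with b' have bv: "y = b \<oplus> x \<otimes> v" "b \<in> B" "v \<in> V" by auto
    have c: "b \<in> carrier R" "v \<in> carrier R" using bv b v by auto
    have "x \<otimes> v = y \<ominus> b" unfolding bv(1) using c assms(3) by algebra
    moreover have "asub R A M" "asub R A N" "b \<in> M" "b \<in> N" using h bv by auto
    ultimately have "x \<otimes> v \<in> M" using y(1) asubD(7)[of R A M y b] by simp
    moreover have "x \<otimes> v \<notin> N"
    proof
      assume "x \<otimes> v \<in> N"
      hence "b \<oplus> x \<otimes> v \<in> N" using \<open>asub R A N\<close> \<open>b \<in> N\<close> asubD(4) by metis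
      thus False using y(2) bv(1) by simp
    qed
    ultimately have "v \<in> V \<inter> xpre x M" "v \<notin> V \<inter> xpre x N" unfolding xpre_def using bv c by auto
    thus "V \<inter> xpre x N \<subset> V \<inter> xpre x M" using h(5) unfolding xpre_def by blast
  next
    fix N assume "N \<in> sublat R A" "B \<subseteq> N"
    thus "V \<inter> xpre x N \<in> sublat R A \<and> V \<inter> xpre x B \<subseteq> V \<inter> xpre x N \<and> V \<inter> xpre x N \<subseteq> V"
      using asub_inter asub_xpre assms unfolding xpre_def by auto
  qed
  show "len (sublat R A) (V \<inter> xpre x B) V \<le> len (sublat R A) B (B <+> ximg x V)"
  proof (rule len_transfer[where \<Phi> = "\<lambda>N. B <+> ximg x N"])
    fix N assume "N \<in> sublat R A" "N \<subseteq> V"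
    thus "B <+> ximg x N \<in> sublat R A \<and> B \<subseteq> B <+> ximg x N \<and> B <+> ximg x N \<subseteq> B <+> ximg x V"
      using asub_add[OF assms(1) asub_ximg[of A N x] assms(4)] add_subset(1)[OF assms(1) asub_ximg[of A N x]]
        set_add_mono[of B B "ximg x N" "ximg x V"] assms(3,4) unfolding ximg_def by auto
  next
    fix N M assume h: "N \<in> sublat R A" "M \<in> sublat R A" "V \<inter> xpre x B \<subseteq> N" "M \<subseteq> V" "N \<subset> M"
    then obtain y where y: "y \<in> M" "y \<notin> N" by blast
    have "x \<otimes> y \<notin> B <+> ximg x N"
    proof
      assume "x \<otimes> y \<in> B <+> ximg x N"
      then obtain b w where b': "b \<in> B" "w \<in> ximg x N" "x \<otimes> y = b \<oplus> w" unfolding mem_set_add by blast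
      then obtain n where "n \<in> N" "w = x \<otimes> n" unfolding mem_ximg by blast
      with b' have bn: "x \<otimes> y = b \<oplus> x \<otimes> n" "b \<in> B" "n \<in> N" by auto
      have c: "b \<in> carrier R" "n \<in> carrier R" "y \<in> carrier R" using bn b v y h asubD(2)[of R A N] by auto
      have "x \<otimes> (y \<ominus> n) = x \<otimes> y \<ominus> x \<otimes> n" using c assms(3) by algebra
      also have "\<dots> = b" unfolding bn(1) using c assms(3) by algebra
      finally have "x \<otimes> (y \<ominus> n) \<in> B" using bn by simp
      moreover have "y \<in> V" "n \<in> V" using y bn h by auto
      hence "y \<ominus> n \<in> V" by (rule v(7))
      ultimately have "y \<ominus> n \<in> N" using h(3) c unfolding xpre_def by auto
      hence "(y \<ominus> n) \<oplus> n \<in> N" using h(1) bn asubD(4)[of R A N] by simp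
      moreover have "(y \<ominus> n) \<oplus> n = y" using c by algebra
      ultimately show False using y by simp
    qed
    moreover have "x \<otimes> y \<in> B <+> ximg x M"
    proof -
      have "ximg x M \<subseteq> B <+> ximg x M" using add_subset(2)[OF assms(1) asub_ximg[of A M x]] h(2) assms by simp
      moreover have "x \<otimes> y \<in> ximg x M" using y unfolding mem_ximg by blast
      ultimately show ?thesis by (rule subsetD)
    qed
    moreover have "ximg x N \<subseteq> ximg x M" using h(5) unfolding ximg_def by auto
    hence "B <+> ximg x N \<subseteq> B <+> ximg x M" by (rule set_add_mono[OF subset_refl])
    ultimately show "B <+> ximg x N \<subset> B <+> ximg x M" by blast
  qed
qed

text \<open>Multiplication by x = 1 in \<open>len_ximg\<close>.\<close>

lemma len_second_iso:
  assumes "asub R A B" "asub R A V" "A \<subseteq> carrier R"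
  shows "len (sublat R A) B (B <+> V) = len (sublat R A) (V \<inter> B) V"
proof -
  have "ximg \<one> V = V" using asubD(2)[OF assms(2)] unfolding ximg_def by force
  moreover have "V \<inter> xpre \<one> B = V \<inter> B" using asubD(2)[OF assms(2)] unfolding xpre_def by force
  ultimately show ?thesis using len_ximg[OF assms(1,2) one_closed assms(3)] by simp
qed

end

section \<open>The length of R / I as the length of an interval of ideals\<close>

lemma module_length_alt: "module_length R M = len {N. submodule N R M} {} UNIV"
  unfolding module_length_def len_def lchain_def by simp

context cring begin

lemma inv_quotient_module:
  "inv\<^bsub>add_monoid (quotient_module R I)\<^esub> C = \<ominus>\<^bsub>R Quot I\<^esub> C"
  by (simp add: m_inv_def a_inv_def quotient_module_def)

lemma quot_mem: "C \<in> carrier (R Quot I) \<longleftrightarrow> (\<exists>r\<in>carrier R. C = I +> r)"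
  unfolding FactRing_def A_RCOSETS_def' a_r_coset_def' by auto

lemma coset_self: "ideal I R \<Longrightarrow> r \<in> carrier R \<Longrightarrow> r \<in> I +> r"
  using idealD(4)[of I] unfolding a_r_coset_def' by force

lemma coset_eq_iff:
  assumes "ideal I R" "r \<in> carrier R" "s \<in> carrier R"
  shows "I +> r = I +> s \<longleftrightarrow> r \<ominus> s \<in> I"
  using assms by (metis quotient_eq_iff_same_a_r_cos)

lemma coset_mem_iff:
  assumes "ideal I R" "r \<in> carrier R" "s \<in> carrier R"
  shows "s \<in> I +> r \<longleftrightarrow> s \<ominus> r \<in> I"
proof
  assume "s \<in> I +> r"
  then obtain h where h: "h \<in> I" "s = h \<oplus> r" unfolding a_r_coset_def' by auto
  hence "s \<ominus> r = h" using idealD(3)[OF assms(1)] assms by algebra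
  thus "s \<ominus> r \<in> I" using h by simp
next
  assume h: "s \<ominus> r \<in> I"
  have "s = (s \<ominus> r) \<oplus> r" using assms by algebra
  thus "s \<in> I +> r" using h unfolding a_r_coset_def' by blast
qed

lemma quot_ops:
  assumes "ideal I R" "r \<in> carrier R" "s \<in> carrier R"
  shows "(I +> r) \<otimes>\<^bsub>R Quot I\<^esub> (I +> s) = I +> (r \<otimes> s)"
    "(I +> r) \<oplus>\<^bsub>R Quot I\<^esub> (I +> s) = I +> (r \<oplus> s)"
    "\<ominus>\<^bsub>R Quot I\<^esub> (I +> r) = I +> (\<ominus> r)"
    "\<one>\<^bsub>R Quot I\<^esub> = I +> \<one>" "\<zero>\<^bsub>R Quot I\<^esub> = I +> \<zero>"
proof -
  interpret h: ring_hom_ring R "R Quot I" "(+>) I"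
    using ideal.rcos_ring_hom_ring[OF assms(1)] .
  show "(I +> r) \<otimes>\<^bsub>R Quot I\<^esub> (I +> s) = I +> (r \<otimes> s)"
    "(I +> r) \<oplus>\<^bsub>R Quot I\<^esub> (I +> s) = I +> (r \<oplus> s)"
    "\<ominus>\<^bsub>R Quot I\<^esub> (I +> r) = I +> (\<ominus> r)"
    "\<one>\<^bsub>R Quot I\<^esub> = I +> \<one>" "\<zero>\<^bsub>R Quot I\<^esub> = I +> \<zero>"
    using assms by simp_all
qed

lemma submodule_quotient_iff:
  assumes I: "ideal I R"
  shows "submodule N R (quotient_module R I) \<longleftrightarrow>
    N \<subseteq> carrier (R Quot I) \<and> I +> \<zero> \<in> N \<and> (\<forall>C\<in>N. \<forall>D\<in>N. C \<oplus>\<^bsub>R Quot I\<^esub> D \<in> N) \<and>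
    (\<forall>C\<in>N. \<ominus>\<^bsub>R Quot I\<^esub> C \<in> N) \<and> (\<forall>r\<in>carrier R. \<forall>C\<in>N. (I +> r) \<otimes>\<^bsub>R Quot I\<^esub> C \<in> N)"
proof -
  have "\<zero>\<^bsub>R Quot I\<^esub> = I +> \<zero>" using quot_ops(5)[OF I, of \<zero> \<zero>] by simp
  thus ?thesis
  unfolding submodule_def submodule_axioms_def subgroup_def inv_quotient_module
  by (auto simp: quotient_module_def)
qed

text \<open>The correspondence theorem: taking preimages and images of cosets is strictly increasing
  between the submodules of R / I and the ideals containing I.\<close>

lemma module_length_quotient:
  assumes I: "ideal I R"
  shows "module_length R (quotient_module R I) = len (sublat R (carrier R)) I (carrier R)"
  unfolding module_length_alt
proof (rule antisym)
  let ?S = "{N. submodule N R (quotient_module R I)}" and ?L = "sublat R (carrier R)"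
  define pre where "pre N = {r \<in> carrier R. I +> r \<in> N}" for N
  show "len ?S {} UNIV \<le> len ?L I (carrier R)"
  proof (rule len_transfer[where \<Phi> = pre])
    fix N assume "N \<in> ?S"
    hence N: "I +> \<zero> \<in> N" "\<forall>C\<in>N. \<forall>D\<in>N. C \<oplus>\<^bsub>R Quot I\<^esub> D \<in> N"
      "\<forall>C\<in>N. \<ominus>\<^bsub>R Quot I\<^esub> C \<in> N" "\<forall>r\<in>carrier R. \<forall>C\<in>N. (I +> r) \<otimes>\<^bsub>R Quot I\<^esub> C \<in> N"
      using submodule_quotient_iff[OF I] by auto
    have "asub R (carrier R) (pre N)"
      unfolding asub_def pre_def
    proof (intro conjI ballI)
      fix u assume u: "u \<in> {r \<in> carrier R. I +> r \<in> N}"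
      show "\<ominus> u \<in> {r \<in> carrier R. I +> r \<in> N}" using u N(3) quot_ops(3)[OF I, of u u] by auto
      show "r \<otimes> u \<in> {r \<in> carrier R. I +> r \<in> N}" if "r \<in> carrier R" for r
        using u that bspec[OF bspec[OF N(4) that], of "I +> u"] quot_ops(1)[OF I, of r u] by auto
      show "u \<oplus> v \<in> {r \<in> carrier R. I +> r \<in> N}" if "v \<in> {r \<in> carrier R. I +> r \<in> N}" for v
        using u that bspec[OF bspec[OF N(2), of "I +> u"], of "I +> v"] quot_ops(2)[OF I, of u v] by auto
    qed (use N(1) in auto)
    moreover have "I \<subseteq> pre N"
    proof
      fix r assume r: "r \<in> I"
      hence c: "r \<in> carrier R" using idealD(3)[OF I] by blast
      hence "I +> r = I +> \<zero>" using coset_eq_iff[OF I] r by (simp add: a_minus_def)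
      thus "r \<in> pre N" using N c unfolding pre_def by simp
    qed
    ultimately show "pre N \<in> ?L \<and> I \<subseteq> pre N \<and> pre N \<subseteq> carrier R" unfolding pre_def by auto
  next
    fix N M assume h: "N \<in> ?S" "M \<in> ?S" "N \<subset> M"
    then obtain C where C: "C \<in> M" "C \<notin> N" by blast
    then obtain r where "r \<in> carrier R" "C = I +> r" using h(2) submodule_quotient_iff[OF I, of M] quot_mem[of C I] by blast
    thus "pre N \<subset> pre M" using h(3) C unfolding pre_def by blast
  qed
  define im where "im J = {I +> r | r. r \<in> J}" for J
  show "len ?L I (carrier R) \<le> len ?S {} UNIV"
  proof (rule len_transfer[where \<Phi> = im])
    fix J assume "J \<in> ?L"
    hence J: "asub R (carrier R) J" by simp
    note J = asubD[OF J]
    have "submodule (im J) R (quotient_module R I)"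
      unfolding submodule_quotient_iff[OF I]
    proof (intro conjI ballI)
      show "im J \<subseteq> carrier (R Quot I)" using J unfolding im_def quot_mem subset_iff by blast
      show "I +> \<zero> \<in> im J" using J unfolding im_def by blast
      show "C \<oplus>\<^bsub>R Quot I\<^esub> D \<in> im J" if "C \<in> im J" "D \<in> im J" for C D
      proof -
        from that obtain c d where "c \<in> J" "d \<in> J" "C = I +> c" "D = I +> d" unfolding im_def by blast
        thus ?thesis using quot_ops(2)[OF I, of c d] J unfolding im_def by auto
      qed
      show "\<ominus>\<^bsub>R Quot I\<^esub> C \<in> im J" if "C \<in> im J" for C
      proof -
        from that obtain c where "c \<in> J" "C = I +> c" unfolding im_def by blast
        thus ?thesis using quot_ops(3)[OF I, of c c] J unfolding im_def by auto
      qed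
      show "(I +> r) \<otimes>\<^bsub>R Quot I\<^esub> C \<in> im J" if "r \<in> carrier R" "C \<in> im J" for r C
      proof -
        from that obtain c where "c \<in> J" "C = I +> c" unfolding im_def by blast
        thus ?thesis using quot_ops(1)[OF I, of r c] J that unfolding im_def by auto
      qed
    qed
    thus "im J \<in> ?S \<and> {} \<subseteq> im J \<and> im J \<subseteq> UNIV" by simp
  next
    fix N M assume h: "N \<in> ?L" "M \<in> ?L" "I \<subseteq> N" "N \<subset> M"
    then obtain r where r: "r \<in> M" "r \<notin> N" by blast
    have N: "asub R (carrier R) N" and M: "asub R (carrier R) M" using h by auto
    have "I +> r \<notin> im N"
    proof
      assume "I +> r \<in> im N"
      then obtain s where s: "s \<in> N" "I +> r = I +> s" unfolding im_def by blast
      have c: "r \<in> carrier R" "s \<in> carrier R" using s r asubD(2)[OF N] asubD(2)[OF M] by auto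
      hence "r \<ominus> s \<in> N" using s coset_eq_iff[OF I] h(3) by blast
      hence "(r \<ominus> s) \<oplus> s \<in> N" using s asubD(4)[OF N] by blast
      moreover have "(r \<ominus> s) \<oplus> s = r" using c by algebra
      ultimately show False using r by simp
    qed
    thus "im N \<subset> im M" using h(4) r unfolding im_def by blast
  qed
qed

end

section \<open>Graded Noetherian families\<close>

context cring begin

text \<open>Homogeneous elements of degree n of the graded submodule of R[t] generated over A[Tt] by
  the pairs (d, g) of \<open>F\<close>, read as g t^d. The degree is kept as an index, so an element
  of R may occur in many degrees.\<close>

inductive Gen :: "'a set \<Rightarrow> 'a set \<Rightarrow> (nat \<times> 'a) set \<Rightarrow> nat \<Rightarrow> 'a \<Rightarrow> bool"
  for A T F where
  Gzero: "Gen A T F n \<zero>"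
| Gbase: "(n, g) \<in> F \<Longrightarrow> Gen A T F n g"
| Gadd: "Gen A T F n u \<Longrightarrow> Gen A T F n v \<Longrightarrow> Gen A T F n (u \<oplus> v)"
| Gneg: "Gen A T F n u \<Longrightarrow> Gen A T F n (\<ominus> u)"
| Gsmult: "a \<in> A \<Longrightarrow> Gen A T F n u \<Longrightarrow> Gen A T F n (a \<otimes> u)"
| Gmult: "x \<in> T \<Longrightarrow> Gen A T F n u \<Longrightarrow> Gen A T F (Suc n) (x \<otimes> u)"

text \<open>A graded A[Tt]-submodule of R[t], given by its components.\<close>

definition gfam :: "'a set \<Rightarrow> 'a set \<Rightarrow> (nat \<Rightarrow> 'a set) \<Rightarrow> bool" where
  "gfam A T N \<longleftrightarrow> (\<forall>n. asub R A (N n)) \<and> (\<forall>n. \<forall>x\<in>T. \<forall>u\<in>N n. x \<otimes> u \<in> N (Suc n))"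

text \<open>Finite generation of every ideal of \<open>A\<close>, with generation expressed by
  minimality among stable subgroups instead of an explicit span.\<close>

definition noeth_over :: "'a set \<Rightarrow> bool" where
  "noeth_over A \<longleftrightarrow> (\<forall>U. asub R A U \<and> U \<subseteq> A \<longrightarrow>
     (\<exists>S\<subseteq>U. finite S \<and> (\<forall>V. asub R A V \<and> S \<subseteq> V \<longrightarrow> U \<subseteq> V)))"

lemma gfamD:
  assumes "gfam A T N"
  shows "asub R A (N n)" "x \<in> T \<Longrightarrow> u \<in> N n \<Longrightarrow> x \<otimes> u \<in> N (Suc n)"
  using assms unfolding gfam_def by auto

lemma Gen_least:
  assumes "gfam A T N" "\<And>d g. (d, g) \<in> F \<Longrightarrow> g \<in> N d" "Gen A T F n u"
  shows "u \<in> N n"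
  using assms(3)
proof induction
  case (Gzero n) show ?case using asubD(3)[OF gfamD(1)[OF assms(1)]] .
next
  case (Gbase n g) thus ?case using assms(2) by auto
next
  case (Gadd n u v) thus ?case using asubD(4)[OF gfamD(1)[OF assms(1)]] by auto
next
  case (Gneg n u) thus ?case using asubD(5)[OF gfamD(1)[OF assms(1)]] by auto
next
  case (Gsmult a n u) thus ?case using asubD(6)[OF gfamD(1)[OF assms(1)]] by auto
next
  case (Gmult x n u) thus ?case using gfamD(2)[OF assms(1)] by auto
qed

lemma gfam_Gen:
  assumes "A \<subseteq> carrier R" "T \<subseteq> carrier R" "\<And>d g. (d, g) \<in> F \<Longrightarrow> g \<in> carrier R"
  shows "gfam A T (\<lambda>n. {u. Gen A T F n u})"
proof -
  have c: "u \<in> carrier R" if "Gen A T F n u" for n u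
    using that by induction (use assms in auto)
  show ?thesis unfolding gfam_def asub_def
    using c by (auto intro: Gen.intros)
qed

text \<open>Values of forms of degree n in \<open>T\<close> with coefficients in \<open>A\<close>:
  the component of degree n of A[Tt].\<close>

abbreviation hom_part :: "'a set \<Rightarrow> 'a set \<Rightarrow> nat \<Rightarrow> 'a set" where
  "hom_part A T n \<equiv> {u. Gen A T {(0, \<one>)} n u}"

lemma gfam_hom_part:
  assumes "A \<subseteq> carrier R" "T \<subseteq> carrier R"
  shows "gfam A T (hom_part A T)"
  using gfam_Gen[OF assms, of "{(0, \<one>)}"] by auto

text \<open>Sums of y^i h with i < k and h a form of degree n - i in \<open>T\<close>: the forms of
  degree n whose degree in y is below k. The condition \<open>k \<le> n\<close> guards against
  truncated subtraction.\<close>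

fun Low :: "'a set \<Rightarrow> 'a set \<Rightarrow> 'a \<Rightarrow> nat \<Rightarrow> nat \<Rightarrow> 'a set" where
  "Low A T y 0 n = {\<zero>}"
| "Low A T y (Suc k) n = (if k \<le> n then Low A T y k n <+> ximg (y [^] k) (hom_part A T (n - k))
                          else Low A T y k n)"

lemma asub_Low:
  assumes "A \<subseteq> carrier R" "T \<subseteq> carrier R" "y \<in> carrier R"
  shows "asub R A (Low A T y k n)"
proof (induction k)
  case (Suc k)
  have "asub R A (ximg (y [^] k) (hom_part A T (n - k)))"
    using asub_ximg[OF gfamD(1)[OF gfam_hom_part[OF assms(1,2)]] _ assms(1)] assms(3) by simp
  thus ?case using Suc asub_add[OF _ _ assms(1)] by simp
qed (use asub_zero assms in simp)

lemma Low_up: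
  assumes "A \<subseteq> carrier R" "T \<subseteq> carrier R" "y \<in> carrier R"
  shows "Low A T y k n \<subseteq> Low A T y (Suc k) n"
proof (cases "k \<le> n")
  case True
  thus ?thesis
    using add_subset(1)[OF asub_Low[OF assms] asub_ximg[OF gfamD(1)[OF gfam_hom_part[OF assms(1,2)]] _ assms(1)]]
      assms(3) by simp
qed simp

lemma Low_mult:
  assumes "A \<subseteq> carrier R" "T \<subseteq> carrier R" "y \<in> carrier R" "x \<in> T" "u \<in> Low A T y k n"
  shows "x \<otimes> u \<in> Low A T y k (Suc n)"
  using assms(5)
proof (induction k arbitrary: u)
  case 0 thus ?case using assms(2,4) by auto
next
  case (Suc k)
  have x: "x \<in> carrier R" using assms(2,4) by auto
  show ?case
  proof (cases "k \<le> n")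
    case True
    with Suc.prems obtain w v where wv: "w \<in> Low A T y k n" "v \<in> hom_part A T (n - k)" "u = w \<oplus> y [^] k \<otimes> v"
      by (auto simp: mem_set_add mem_ximg)
    have c: "w \<in> carrier R" using wv(1) asubD(2)[OF asub_Low[OF assms(1-3)]] by blast
    have d: "v \<in> carrier R" using wv(2) asubD(2)[OF gfamD(1)[OF gfam_hom_part[OF assms(1,2)]]] by blast
    have "x \<otimes> u = x \<otimes> w \<oplus> y [^] k \<otimes> (x \<otimes> v)"
      unfolding wv(3) using c d x assms(3) by (simp add: r_distr m_lcomm)
    moreover have "x \<otimes> w \<in> Low A T y k (Suc n)" using Suc.IH wv by blast
    moreover have "x \<otimes> v \<in> hom_part A T (Suc n - k)" using wv(2) assms(4) Gen.Gmult[of x T A _ "n - k" v] True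
      by (simp add: Suc_diff_le)
    hence "y [^] k \<otimes> (x \<otimes> v) \<in> ximg (y [^] k) (hom_part A T (Suc n - k))" unfolding mem_ximg by blast
    ultimately have "x \<otimes> u \<in> Low A T y k (Suc n) <+> ximg (y [^] k) (hom_part A T (Suc n - k))"
      unfolding mem_set_add by blast
    thus ?thesis using True by simp
  next
    case False
    hence "x \<otimes> u \<in> Low A T y k (Suc n)" using Suc by simp
    thus ?thesis using Low_up[OF assms(1-3), of k "Suc n"] by (rule subsetD[rotated])
  qed
qed

lemma Low_shift:
  assumes "A \<subseteq> carrier R" "T \<subseteq> carrier R" "y \<in> carrier R" "u \<in> Low A T y k n"
  shows "y \<otimes> u \<in> Low A T y (Suc k) (Suc n)"
  using assms(4)
proof (induction k arbitrary: u)
  case 0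
  have "asub R A (Low A T y (Suc 0) (Suc n))" using asub_Low[OF assms(1-3)] by blast
  thus ?case using 0 assms(3) asubD(3) by fastforce
next
  case (Suc k)
  show ?case
  proof (cases "k \<le> n")
    case True
    with Suc.prems obtain w v where wv: "w \<in> Low A T y k n" "v \<in> hom_part A T (n - k)" "u = w \<oplus> y [^] k \<otimes> v"
      by (auto simp: mem_set_add mem_ximg)
    have c: "w \<in> carrier R" using wv(1) asubD(2)[OF asub_Low[OF assms(1-3)]] by blast
    have d: "v \<in> carrier R" using wv(2) asubD(2)[OF gfamD(1)[OF gfam_hom_part[OF assms(1,2)]]] by blast
    have "y \<otimes> u = y \<otimes> w \<oplus> y \<otimes> (y [^] k \<otimes> v)"
      unfolding wv(3) using c d assms(3) by (simp add: r_distr)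
    also have "y \<otimes> (y [^] k \<otimes> v) = y [^] Suc k \<otimes> v"
      using d assms(3) by (simp add: m_assoc[symmetric] m_comm)
    finally have "y \<otimes> u = y \<otimes> w \<oplus> y [^] Suc k \<otimes> v" .
    note e1 = this
    have 1: "y \<otimes> w \<in> Low A T y (Suc k) (Suc n)" using Suc.IH wv by blast
    have e2: "Low A T y (Suc (Suc k)) (Suc n) = Low A T y (Suc k) (Suc n) <+> ximg (y [^] Suc k) (hom_part A T (n - k))"
      by (subst Low.simps(2)) (simp add: True)
    have 2: "y [^] Suc k \<otimes> v \<in> ximg (y [^] Suc k) (hom_part A T (n - k))" using wv(2) unfolding mem_ximg by blast
    show ?thesis unfolding e1 e2 mem_set_add by (intro bexI[OF _ 1] bexI[OF _ 2] refl)
  next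
    case False
    hence "y \<otimes> u \<in> Low A T y (Suc k) (Suc n)" using Suc by simp
    thus ?thesis using Low_up[OF assms(1-3)] by blast
  qed
qed

lemma Low_shift_pow:
  assumes "A \<subseteq> carrier R" "T \<subseteq> carrier R" "y \<in> carrier R" "u \<in> Low A T y k n"
  shows "y [^] (j::nat) \<otimes> u \<in> Low A T y (k + j) (n + j)"
proof (induction j)
  case 0
  have "u \<in> carrier R" using assms(4) asubD(2)[OF asub_Low[OF assms(1-3)]] by blast
  thus ?case using assms(4) by simp
next
  case (Suc j)
  have "u \<in> carrier R" using assms(4) asubD(2)[OF asub_Low[OF assms(1-3)]] by blast
  hence "y [^] Suc j \<otimes> u = y \<otimes> (y [^] j \<otimes> u)" using assms(3)
    by (simp add: m_assoc[symmetric] m_comm)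
  thus ?case using Low_shift[OF assms(1-3) Suc] by simp
qed

lemma hom_part_insert_Low:
  assumes "A \<subseteq> carrier R" "T \<subseteq> carrier R" "y \<in> carrier R"
  shows "hom_part A (insert y T) n \<subseteq> Low A T y (Suc n) n"
proof -
  have g: "gfam A (insert y T) (\<lambda>n. Low A T y (Suc n) n)"
    unfolding gfam_def
  proof (intro conjI allI ballI)
    fix n x u assume "x \<in> insert y T" and u: "u \<in> Low A T y (Suc n) n"
    then consider "x = y" | "x \<in> T" by blast
    thus "x \<otimes> u \<in> Low A T y (Suc (Suc n)) (Suc n)"
    proof cases
      case 1 thus ?thesis using Low_shift[OF assms u] by simp
    next
      case 2 show ?thesis using Low_mult[OF assms 2 u] Low_up[OF assms] by blast
    qed
  qed (rule asub_Low[OF assms])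
  have "\<one> \<in> Low A T y (Suc 0) 0"
    using l_zero[OF one_closed] by (auto simp: mem_set_add mem_ximg intro!: bexI[of _ \<one>] exI[of _ \<one>] Gen.Gbase)
  thus ?thesis using Gen_least[OF g, of "{(0, \<one>)}" n] by auto
qed

text \<open>Leading coefficients with respect to \<open>y\<close> of the elements of a graded family.\<close>

lemma lead_gfam:
  assumes A: "subring A R" and T: "T \<subseteq> carrier R" "y \<in> carrier R"
    and B: "gfam A T B" and N: "gfam A (insert y T) N"
  shows "gfam A T (\<lambda>d. {u \<in> B d. \<exists>w \<in> Low A T y k (d + k). y [^] k \<otimes> u \<oplus> w \<in> N (d + k)})" (is "gfam A T ?L")
  unfolding gfam_def
proof (intro conjI allI ballI)
  fix d
  have Ac: "A \<subseteq> carrier R" using A subringE(1) by blast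
  note LowA = asub_Low[OF Ac T] and Nn = gfamD[OF N] and Bn = gfamD[OF B]
  have c: "u \<in> carrier R" "w \<in> carrier R" if "u \<in> B d" "w \<in> Low A T y k (d + k)" for u w
    using asubD(2)[OF Bn(1) that(1)] asubD(2)[OF LowA that(2)] .
  have yk: "y [^] k \<in> carrier R" using T(2) by simp
  show "asub R A (?L d)"
  proof (rule asubI[OF A])
    show "?L d \<subseteq> carrier R" using asubD(2)[OF Bn(1)] by blast
    have "y [^] k \<otimes> \<zero> \<oplus> \<zero> \<in> N (d + k)" using asubD(3)[OF Nn(1)] yk by simp
    thus "\<zero> \<in> ?L d" using asubD(3)[OF Bn(1)] asubD(3)[OF LowA] by blast
    fix u assume "u \<in> ?L d"
    then obtain w where w: "w \<in> Low A T y k (d + k)" "y [^] k \<otimes> u \<oplus> w \<in> N (d + k)" "u \<in> B d" by blast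
    note uc = c[OF w(3,1)]
    show "a \<otimes> u \<in> ?L d" if a: "a \<in> A" for a
    proof -
      have "y [^] k \<otimes> (a \<otimes> u) \<oplus> a \<otimes> w = a \<otimes> (y [^] k \<otimes> u \<oplus> w)"
        using uc yk subsetD[OF Ac a] by (simp add: r_distr m_lcomm)
      hence "y [^] k \<otimes> (a \<otimes> u) \<oplus> a \<otimes> w \<in> N (d + k)" using asubD(6)[OF Nn(1) a w(2)] by simp
      thus ?thesis using asubD(6)[OF Bn(1) a w(3)] asubD(6)[OF LowA a w(1)] by blast
    qed
    fix v assume "v \<in> ?L d"
    then obtain z where z: "z \<in> Low A T y k (d + k)" "y [^] k \<otimes> v \<oplus> z \<in> N (d + k)" "v \<in> B d" by blast
    have "y [^] k \<otimes> (u \<oplus> v) \<oplus> (w \<oplus> z) = (y [^] k \<otimes> u \<oplus> w) \<oplus> (y [^] k \<otimes> v \<oplus> z)"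
      using uc c[OF z(3,1)] yk by (simp add: r_distr a_ac)
    hence "y [^] k \<otimes> (u \<oplus> v) \<oplus> (w \<oplus> z) \<in> N (d + k)" using asubD(4)[OF Nn(1) w(2) z(2)] by simp
    thus "u \<oplus> v \<in> ?L d" using asubD(4)[OF Bn(1) w(3) z(3)] asubD(4)[OF LowA w(1) z(1)] by blast
  qed
  fix x u assume x: "x \<in> T" and "u \<in> ?L d"
  then obtain w where w: "w \<in> Low A T y k (d + k)" "y [^] k \<otimes> u \<oplus> w \<in> N (d + k)" "u \<in> B d" by blast
  have "y [^] k \<otimes> (x \<otimes> u) \<oplus> x \<otimes> w = x \<otimes> (y [^] k \<otimes> u \<oplus> w)"
    using c[OF w(3,1)] yk subsetD[OF T(1) x] by (simp add: r_distr m_lcomm)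
  hence "y [^] k \<otimes> (x \<otimes> u) \<oplus> x \<otimes> w \<in> N (Suc d + k)" using Nn(2)[of x "y [^] k \<otimes> u \<oplus> w" "d + k"] w x by simp
  moreover have "x \<otimes> w \<in> Low A T y k (Suc d + k)" using Low_mult[OF Ac T x w(1)] by simp
  ultimately show "x \<otimes> u \<in> ?L (Suc d)" using Bn(2)[OF x w(3)] by blast
qed

text \<open>Hilbert's basis theorem for submodules of A[Tt], by induction on \<open>T\<close> with
  leading coefficients in the new generator y. Noetherianity of algebras, the Artin-Rees lemma and
  the generation of initial forms in the completion are all drawn from it.\<close>

theorem graded_noetherian:
  assumes A: "subring A R" "noeth_over A" and T: "finite T" "T \<subseteq> carrier R"
    and N: "gfam A T N" "\<And>n. N n \<subseteq> hom_part A T n"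
  shows "\<exists>F. finite F \<and> (\<forall>(d, g)\<in>F. g \<in> N d) \<and> (\<forall>n. N n \<subseteq> {u. Gen A T F n u})"
  using T N
proof (induction T arbitrary: N rule: finite_induct)
  case empty
  have Ac: "A \<subseteq> carrier R" using A subringE(1) by blast
  have AA: "asub R A A" unfolding asub_def using subringE[OF A(1)] Ac by auto
  \<comment> \<open>Without generators the forms are \<open>A\<close> in degree 0 and zero in all
    other degrees, so Noetherianity of \<open>A\<close> settles this case.\<close>
  have h: "gfam A {} (\<lambda>n. if n = 0 then A else {\<zero>})"
    unfolding gfam_def using AA asub_zero[OF Ac] by auto
  have hp: "hom_part A {} n \<subseteq> (if n = 0 then A else {\<zero>})" for n
    using Gen_least[OF h, of "{(0,\<one>)}" n] subringE(3)[OF A(1)] by auto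
  hence "N 0 \<subseteq> A" using empty(3)[of 0] by (metis (mono_tags, lifting) order_trans)
  then obtain S where S: "S \<subseteq> N 0" "finite S" "\<And>V. asub R A V \<Longrightarrow> S \<subseteq> V \<Longrightarrow> N 0 \<subseteq> V"
    using A(2) gfamD(1)[OF empty(2), of 0] unfolding noeth_over_def by meson
  have Sc: "S \<subseteq> carrier R" using S asubD(1)[OF gfamD(1)[OF empty(2), of 0]] by auto
  let ?F = "(\<lambda>g. (0::nat, g)) ` S"
  have G: "gfam A {} (\<lambda>n. {u. Gen A {} ?F n u})"
    by (rule gfam_Gen) (use Ac Sc in auto)
  have "N n \<subseteq> {u. Gen A {} ?F n u}" for n
  proof (cases "n = 0")
    case True
    have "S \<subseteq> {u. Gen A {} ?F 0 u}" by (auto intro!: Gen.Gbase)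
    thus ?thesis using S(3)[OF gfamD(1)[OF G, of 0]] True by simp
  next
    case False
    hence "N n \<subseteq> {\<zero>}" using hp[of n] empty(3)[of n] by auto
    thus ?thesis by (auto intro: Gen.Gzero)
  qed
  thus ?case using S by (intro exI[of _ ?F]) auto
next
  case (insert y T)
  have Ac: "A \<subseteq> carrier R" using A subringE(1) by blast
  have Xc: "T \<subseteq> carrier R" and yc: "y \<in> carrier R" using insert by auto
  note LowA = asub_Low[OF Ac Xc yc]
  note Nn = gfamD[OF insert.prems(2)]
  have hpA: "asub R A (hom_part A T d)" for d using gfamD(1)[OF gfam_hom_part[OF Ac Xc]] .
  \<comment> \<open>Expansions in y are not unique in R, so u need not be the coefficient of a
    well-defined polynomial. It is enough that some element of \<open>N\<close> has the form y^k u
    plus terms of lower degree in y.\<close>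
  define L where "L k d = {u \<in> hom_part A T d. \<exists>w \<in> Low A T y k (d + k). y [^] k \<otimes> u \<oplus> w \<in> N (d + k)}" for k d
  have Lc: "u \<in> carrier R" if "u \<in> L k d" for u k d using that asubD(2)[OF hpA] unfolding L_def by auto
  have LowC: "w \<in> carrier R" if "w \<in> Low A T y k n" for w k n using that asubD(2)[OF LowA] by blast
  have Lg: "gfam A T (L k)" for k
    unfolding L_def by (rule lead_gfam[OF A(1) Xc yc gfam_hom_part[OF Ac Xc] insert.prems(2)])
  have Lhp: "L k d \<subseteq> hom_part A T d" for k d unfolding L_def by auto
  have Lup: "L k d \<subseteq> L (Suc k) d" for k d
  proof
    fix u assume u: "u \<in> L k d"
    then obtain w where w: "w \<in> Low A T y k (d + k)" "y [^] k \<otimes> u \<oplus> w \<in> N (d + k)" "u \<in> hom_part A T d"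
      unfolding L_def by blast
    have c: "u \<in> carrier R" "w \<in> carrier R" using Lc u LowC w by auto
    have "y \<otimes> (y [^] k \<otimes> u \<oplus> w) = y [^] Suc k \<otimes> u \<oplus> y \<otimes> w" using c yc
      by (simp add: r_distr m_assoc[symmetric] m_comm)
    hence "y [^] Suc k \<otimes> u \<oplus> y \<otimes> w \<in> N (d + Suc k)"
      using Nn(2)[of y "y [^] k \<otimes> u \<oplus> w" "d + k"] w by simp
    moreover have "y \<otimes> w \<in> Low A T y (Suc k) (d + Suc k)" using Low_shift[OF Ac Xc yc w(1)] by simp
    ultimately show "u \<in> L (Suc k) d" unfolding L_def using w(3) by blast
  qed
  have Lmono: "L k d \<subseteq> L l d" if "k \<le> l" for k l d using that
  proof (induction l rule: dec_induct)
    case (step l) thus ?case using Lup[of l d] by blast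
  qed simp
  \<comment> \<open>The induction hypothesis is applied to the union of the increasing families
    \<open>L k\<close>; its finitely many generators occur at a common stage \<open>k0\<close>, so
    the families are constant from there on.\<close>
  define LU where "LU d = (\<Union>k. L k d)" for d
  have LUg: "gfam A T LU"
    unfolding gfam_def
  proof (intro conjI allI ballI)
    fix d
    show "asub R A (LU d)"
    proof (rule asubI[OF A(1)])
      show "LU d \<subseteq> carrier R" using Lc unfolding LU_def by blast
      show "\<zero> \<in> LU d" using asubD(3)[OF gfamD(1)[OF Lg]] unfolding LU_def by blast
      fix u assume "u \<in> LU d"
      then obtain k where k: "u \<in> L k d" unfolding LU_def by blast
      show "a \<otimes> u \<in> LU d" if "a \<in> A" for a using asubD(6)[OF gfamD(1)[OF Lg] that k] unfolding LU_def by blast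
      fix v assume "v \<in> LU d"
      then obtain l where l: "v \<in> L l d" unfolding LU_def by blast
      have "u \<in> L (max k l) d" "v \<in> L (max k l) d" using k l Lmono[of k "max k l" d] Lmono[of l "max k l" d] by auto
      thus "u \<oplus> v \<in> LU d" using asubD(4)[OF gfamD(1)[OF Lg]] unfolding LU_def by blast
    qed
  next
    fix d x u assume x: "x \<in> T" and "u \<in> LU d"
    then obtain k where k: "u \<in> L k d" unfolding LU_def by blast
    thus "x \<otimes> u \<in> LU (Suc d)" using gfamD(2)[OF Lg x k] unfolding LU_def by blast
  qed
  have LUhp: "LU d \<subseteq> hom_part A T d" for d unfolding LU_def using Lhp by blast
  obtain FU where FU: "finite FU" "\<forall>(d, g)\<in>FU. g \<in> LU d" "\<forall>n. LU n \<subseteq> {u. Gen A T FU n u}"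
    using insert.IH[OF Xc LUg LUhp] by blast
  have "\<exists>k0. \<forall>(d, g)\<in>FU. g \<in> L k0 d" using FU(1,2)
  proof (induction FU rule: finite_induct)
    case (insert p F)
    obtain d g where p: "p = (d, g)" by (cases p)
    obtain k0 where k0: "\<forall>(d, g)\<in>F. g \<in> L k0 d" using insert by auto
    obtain k1 where k1: "g \<in> L k1 d" using insert(4) p unfolding LU_def by auto
    have "\<forall>(d, g)\<in>insert p F. g \<in> L (max k0 k1) d"
    proof (clarify)
      fix e h assume "(e, h) \<in> insert p F"
      hence "h \<in> L k0 e \<or> h \<in> L k1 e" using k0 k1 p by auto
      thus "h \<in> L (max k0 k1) e" using Lmono[of k0 "max k0 k1" e] Lmono[of k1 "max k0 k1" e] by auto
    qed
    thus ?case by blast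
  qed simp
  then obtain k0 where k0: "\<forall>(d, g)\<in>FU. g \<in> L k0 d" by blast
  have Lk0: "L k d \<subseteq> L k0 d" for k d
  proof
    fix u assume "u \<in> L k d"
    hence "Gen A T FU d u" using FU(3) unfolding LU_def by blast
    thus "u \<in> L k0 d" using Gen_least[OF Lg] k0 by blast
  qed
  have "\<forall>k. \<exists>F. finite F \<and> (\<forall>(d, g)\<in>F. g \<in> L k d) \<and> (\<forall>n. L k n \<subseteq> {u. Gen A T F n u})"
    using insert.IH[OF Xc Lg Lhp] by blast
  then obtain F where F: "\<And>k. finite (F k)" "\<And>k d g. (d, g) \<in> F k \<Longrightarrow> g \<in> L k d" "\<And>k n. L k n \<subseteq> {u. Gen A T (F k) n u}"
    by (metis (no_types, lifting) case_prodD)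
  have "\<exists>w. w \<in> Low A T y k (d + k) \<and> y [^] k \<otimes> g \<oplus> w \<in> N (d + k)" if "(d, g) \<in> F k" for k d g
    using F(2)[OF that] unfolding L_def by blast
  note ex = this
  define W where "W k d g = (SOME w. w \<in> Low A T y k (d + k) \<and> y [^] k \<otimes> g \<oplus> w \<in> N (d + k))" for k d g
  have W: "W k d g \<in> Low A T y k (d + k) \<and> y [^] k \<otimes> g \<oplus> W k d g \<in> N (d + k)" if "(d, g) \<in> F k" for k d g
    unfolding W_def using someI_ex[OF ex[OF that]] .
  \<comment> \<open>Lifts to \<open>N\<close> of generators of the families \<open>L 0\<close>, ...,
    \<open>L k0\<close>.\<close>
  define G where "G = (\<Union>k\<in>{..k0}. (\<lambda>(d, g). (d + k, y [^] k \<otimes> g \<oplus> W k d g)) ` F k)"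
  have Gf: "finite G" unfolding G_def using F(1) by auto
  have GN: "\<forall>(d, g)\<in>G. g \<in> N d" unfolding G_def using W by auto
  let ?G = "Gen A (insert y T) G"
  have Gg: "gfam A (insert y T) (\<lambda>n. {u. ?G n u})"
    by (rule gfam_Gen) (use Ac Xc yc GN asubD(2)[OF Nn(1)] in auto)
  have GsubN: "u \<in> N n" if "?G n u" for n u
    using Gen_least[OF insert.prems(2) _ that] GN by blast
  have key: "\<exists>w\<in>Low A T y k (d + k). ?G (d + k) (y [^] k \<otimes> v \<oplus> w)"
    if "Gen A T (F k) d v" "k \<le> k0" for k d v
  proof -
    define M where "M d = {v \<in> carrier R. \<exists>w\<in>Low A T y k (d + k). y [^] k \<otimes> v \<oplus> w \<in> {u. ?G (d + k) u}}" for d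
    have "gfam A T (\<lambda>_. carrier R)" unfolding gfam_def using asub_carrier[OF Ac] Xc by blast
    from lead_gfam[OF A(1) Xc yc this Gg] have "gfam A T M" unfolding M_def .
    moreover have "g \<in> M e" if "(e, g) \<in> F k" for e g
    proof -
      have "(e + k, y [^] k \<otimes> g \<oplus> W k e g) \<in> G" unfolding G_def using that \<open>k \<le> k0\<close> by force
      hence "?G (e + k) (y [^] k \<otimes> g \<oplus> W k e g)" by (rule Gen.Gbase)
      thus ?thesis unfolding M_def using W[OF that] Lc F(2)[OF that] by blast
    qed
    ultimately have "v \<in> M d" using Gen_least that(1) by blast
    thus ?thesis unfolding M_def by blast
  qed
  have key2: "\<exists>w\<in>Low A T y k (d + k). ?G (d + k) (y [^] k \<otimes> v \<oplus> w)"
    if "v \<in> L k d" for k d v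
  proof (cases "k \<le> k0")
    case True
    thus ?thesis using key F(3) that by blast
  next
    \<comment> \<open>Beyond \<open>k0\<close> the element found for \<open>k0\<close> is multiplied
      by y^(k - k0).\<close>
    case False
    hence "v \<in> L k0 d" using Lk0 that by blast
    then obtain w where w: "w \<in> Low A T y k0 (d + k0)" "?G (d + k0) (y [^] k0 \<otimes> v \<oplus> w)"
      using key F(3) by blast
    have c: "v \<in> carrier R" "w \<in> carrier R" using Lc that LowC w by auto
    define j where "j = k - k0"
    have kj: "k = k0 + j" using False unfolding j_def by simp
    have step: "?G (n + j) (y [^] j \<otimes> u)" if "?G n u" for n u j
    proof (induction j)
      case 0
      have "u \<in> carrier R" using asubD(2)[OF gfamD(1)[OF Gg]] that by blast
      thus ?case using that by simp
    next
      case (Suc j)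
      have "u \<in> carrier R" using asubD(2)[OF gfamD(1)[OF Gg]] that by blast
      hence "y [^] Suc j \<otimes> u = y \<otimes> (y [^] j \<otimes> u)" using yc by (simp add: m_assoc[symmetric] m_comm)
      thus ?case using Gen.Gmult[of y "insert y T", OF _ Suc] by simp
    qed
    have "y [^] j \<otimes> (y [^] k0 \<otimes> v \<oplus> w) = y [^] k \<otimes> v \<oplus> y [^] j \<otimes> w" unfolding kj using c yc
      by (simp add: r_distr m_assoc[symmetric] nat_pow_mult add.commute)
    hence "?G (d + k) (y [^] k \<otimes> v \<oplus> y [^] j \<otimes> w)" using step[OF w(2), of j] unfolding kj
      by (simp add: add.assoc)
    moreover have "y [^] j \<otimes> w \<in> Low A T y k (d + k)" using Low_shift_pow[OF Ac Xc yc w(1), of j] unfolding kj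
      by (simp add: add.assoc)
    ultimately show ?thesis by blast
  qed
  \<comment> \<open>Induction on the degree in y: subtracting an element generated by
    \<open>G\<close> with the same leading term leaves an element of \<open>N\<close> of smaller
    degree in y.\<close>
  have main: "?G n u" if "u \<in> N n" "u \<in> Low A T y k n" for k n u
    using that
  proof (induction k arbitrary: u)
    case 0 thus ?case by (auto intro: Gen.Gzero)
  next
    case (Suc k)
    show ?case
    proof (cases "k \<le> n")
      case False thus ?thesis using Suc by auto
    next
      case True
      define d where "d = n - k"
      have n: "n = d + k" using True unfolding d_def by simp
      obtain w v where wv: "w \<in> Low A T y k n" "v \<in> hom_part A T d" "u = w \<oplus> y [^] k \<otimes> v"
        using Suc.prems True unfolding d_def by (auto simp: mem_set_add mem_ximg)
      have c: "w \<in> carrier R" "v \<in> carrier R" using LowC[OF wv(1)] asubD(2)[OF hpA wv(2)] by auto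
      have "y [^] k \<otimes> v \<oplus> w = u" unfolding wv(3) using c yc by (simp add: a_comm)
      hence "v \<in> L k d" unfolding L_def using wv Suc.prems(1) n by blast
      then obtain w' where w': "w' \<in> Low A T y k n" "?G n (y [^] k \<otimes> v \<oplus> w')"
        using key2 n by blast
      have c': "w' \<in> carrier R" using LowC w' by blast
      have "u \<ominus> (y [^] k \<otimes> v \<oplus> w') = w \<ominus> w'" unfolding wv(3) using c c' nat_pow_closed[OF yc, of k] by algebra
      hence "w \<ominus> w' \<in> N n" using asubD(7)[OF Nn(1) Suc.prems(1) GsubN[OF w'(2)]] by simp
      moreover have "w \<ominus> w' \<in> Low A T y k n" using asubD(7)[OF LowA wv(1) w'(1)] .
      ultimately have "?G n (w \<ominus> w')" using Suc.IH by blast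
      hence "?G n ((w \<ominus> w') \<oplus> (y [^] k \<otimes> v \<oplus> w'))" using Gen.Gadd w'(2) by blast
      moreover have "(w \<ominus> w') \<oplus> (y [^] k \<otimes> v \<oplus> w') = u" unfolding wv(3) using c c' nat_pow_closed[OF yc, of k] by algebra
      ultimately show ?thesis by simp
    qed
  qed
  have "N n \<subseteq> {u. ?G n u}" for n
  proof
    fix u assume u: "u \<in> N n"
    hence "u \<in> Low A T y (Suc n) n" using insert.prems(3) hom_part_insert_Low[OF Ac Xc yc] by blast
    thus "u \<in> {u. ?G n u}" using main[OF u] by blast
  qed
  thus ?case using Gf GN by blast
qed

end

section \<open>Noetherian rings and powers of an ideal\<close>

context cring begin

abbreviation ipow :: "'a set \<Rightarrow> nat \<Rightarrow> 'a set" where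
  "ipow I n \<equiv> I [^]\<^bsub>ideals_set R\<^esub> n"

abbreviation idlat :: "'a set set" where "idlat \<equiv> sublat R (carrier R)"

abbreviation colen :: "'a set \<Rightarrow> enat" where "colen I \<equiv> len idlat I (carrier R)"

lemma ideals_set_simps [simp]: "\<one>\<^bsub>ideals_set R\<^esub> = carrier R"
  "I \<otimes>\<^bsub>ideals_set R\<^esub> J = ideal_prod R I J"
  by (simp_all add: ideals_set_def)

lemma ipow_0: "ipow I 0 = carrier R"
  by (simp add: nat_pow_def ideals_set_def)

lemma ipow_Suc: "ipow I (Suc n) = ideal_prod R (ipow I n) I"
  by (simp add: nat_pow_def ideals_set_def)

lemma ideal_prod_least:
  assumes "ideal K R" "\<And>i j. i \<in> I \<Longrightarrow> j \<in> J \<Longrightarrow> i \<otimes> j \<in> K"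
  shows "ideal_prod R I J \<subseteq> K"
proof
  fix x assume "x \<in> ideal_prod R I J"
  thus "x \<in> K"
    by induction (use assms idealD(5)[OF assms(1)] in auto)
qed

lemma ipow_ideal: "ideal I R \<Longrightarrow> ideal (ipow I n) R"
  by (induction n) (simp_all add: ipow_0 ipow_Suc oneideal ideal_prod_is_ideal)

lemma ipow_add:
  assumes "ideal I R" shows "ideal_prod R (ipow I i) (ipow I j) = ipow I (i + j)"
proof -
  interpret M: Group.comm_monoid "ideals_set R" by (rule ideals_set_is_comm_monoid)
  have "I \<in> carrier (ideals_set R)" using assms by (simp add: ideals_set_def)
  from M.nat_pow_mult[OF this, of i j] show ?thesis unfolding ideals_set_simps(2) .
qed

lemma ipow_mult:
  assumes "ideal I R" "u \<in> ipow I i" "v \<in> ipow I j" shows "u \<otimes> v \<in> ipow I (i + j)"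
  unfolding ipow_add[OF assms(1), symmetric] using assms(2,3) by (rule ideal_prod.prod)

lemma ipow_1: assumes "ideal I R" shows "ipow I (Suc 0) = I"
proof
  show "ipow I (Suc 0) \<subseteq> I" unfolding ipow_Suc ipow_0
    by (rule ideal_prod_least[OF assms]) (use idealD(7)[OF assms] in auto)
  show "I \<subseteq> ipow I (Suc 0)"
  proof
    fix x assume x: "x \<in> I"
    hence "\<one> \<otimes> x \<in> ipow I (Suc 0)" unfolding ipow_Suc ipow_0 by (intro ideal_prod.prod) auto
    thus "x \<in> ipow I (Suc 0)" using idealD(3)[OF assms x] by simp
  qed
qed

lemma ipow_Suc_subset: assumes "ideal I R" shows "ipow I (Suc n) \<subseteq> ipow I n"
  unfolding ipow_Suc using ideal_prod_inter[OF ipow_ideal[OF assms] assms] by blast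

lemma ipow_antimono: assumes "ideal I R" "i \<le> j" shows "ipow I j \<subseteq> ipow I i"
  using assms(2)
proof (induction j rule: dec_induct)
  case (step j) thus ?case using ipow_Suc_subset[OF assms(1), of j] by (meson order_trans)
qed simp

lemma ipow_subset: assumes "ideal I R" "0 < n" shows "ipow I n \<subseteq> I"
  using ipow_antimono[of I "Suc 0" n] ipow_1 assms by auto

section \<open>Noetherian rings and the Artin-Rees lemma\<close>

lemma noeth_fg:
  assumes "noeth_over (carrier R)" "ideal I R"
  obtains S where "S \<subseteq> I" "finite S" "\<And>J. ideal J R \<Longrightarrow> S \<subseteq> J \<Longrightarrow> I \<subseteq> J"
proof -
  have "\<exists>S\<subseteq>I. finite S \<and> (\<forall>V. asub R (carrier R) V \<and> S \<subseteq> V \<longrightarrow> I \<subseteq> V)"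
    using assms(1) idealD(1,2)[OF assms(2)] unfolding noeth_over_def by simp
  thus ?thesis using that unfolding asub_ideal_iff by auto
qed

lemma noeth_overI:
  assumes "\<And>I. ideal I R \<Longrightarrow> \<exists>S\<subseteq>I. finite S \<and> (\<forall>J. ideal J R \<longrightarrow> S \<subseteq> J \<longrightarrow> I \<subseteq> J)"
  shows "noeth_over (carrier R)"
  unfolding noeth_over_def asub_ideal_iff
proof (intro allI impI)
  fix U assume "ideal U R \<and> U \<subseteq> carrier R"
  then obtain S where "S \<subseteq> U" "finite S" "\<forall>J. ideal J R \<longrightarrow> S \<subseteq> J \<longrightarrow> U \<subseteq> J"
    using assms[of U] by auto
  thus "\<exists>S\<subseteq>U. finite S \<and> (\<forall>V. ideal V R \<and> S \<subseteq> V \<longrightarrow> U \<subseteq> V)" by (intro exI[of _ S]) auto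
qed

lemma noeth_maximal:
  assumes N: "noeth_over (carrier R)" and A: "A \<noteq> {}" "\<And>I. I \<in> A \<Longrightarrow> ideal I R"
  shows "\<exists>M\<in>A. \<forall>I\<in>A. M \<subseteq> I \<longrightarrow> I = M"
proof (rule subset_Zorn_nonempty[OF A(1)])
  interpret noetherian_ring R
  proof (rule noetherian_ringI)
    fix I assume I: "ideal I R"
    obtain S where S: "S \<subseteq> I" "finite S" "\<And>J. ideal J R \<Longrightarrow> S \<subseteq> J \<Longrightarrow> I \<subseteq> J"
      using noeth_fg[OF N I] by blast
    have Sc: "S \<subseteq> carrier R" using S idealD(2)[OF I] by blast
    have "I = Idl S"
      using S(3)[OF genideal_ideal[OF Sc] genideal_self[OF Sc]] genideal_minimal[OF I S(1)] by blast
    thus "\<exists>A\<subseteq>carrier R. finite A \<and> I = Idl A" using S Sc by blast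
  qed
  fix C assume C: "C \<noteq> {}" "subset.chain A C"
  hence "subset.chain {I. ideal I R} C" using A(2) unfolding subset_chain_def by blast
  hence "\<Union>C \<in> C" using ideal_chain_is_trivial[OF C(1)] by blast
  thus "\<Union>C \<in> A" using C(2) unfolding subset_chain_def by blast
qed

lemma noeth_induct[consumes 2]:
  assumes N: "noeth_over (carrier R)" and I: "ideal I R"
    and step: "\<And>I. ideal I R \<Longrightarrow> (\<And>J. ideal J R \<Longrightarrow> I \<subset> J \<Longrightarrow> P J) \<Longrightarrow> P I"
  shows "P I"
proof (rule ccontr)
  assume "\<not> P I"
  hence "{I. ideal I R \<and> \<not> P I} \<noteq> {}" using I by blast
  from noeth_maximal[OF N this] obtain M where M: "ideal M R" "\<not> P M"
    "\<And>J. ideal J R \<Longrightarrow> \<not> P J \<Longrightarrow> M \<subseteq> J \<Longrightarrow> J = M" by auto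
  show False using step[OF M(1)] M(2,3) by blast
qed

text \<open>The groups I \<inter> m^n form a graded submodule of the Rees algebra, and this
  submodule is generated in degrees at most c. In degree n + c its elements are therefore
  combinations of elements of I with coefficients in m^n.\<close>

lemma artin_rees:
  assumes N: "noeth_over (carrier R)" and m: "ideal m R" and I: "ideal I R"
  shows "\<exists>c. \<forall>n. I \<inter> ipow m (n + c) \<subseteq> ideal_prod R (ipow m n) I"
proof -
  obtain T where T: "T \<subseteq> m" "finite T" "\<And>J. ideal J R \<Longrightarrow> T \<subseteq> J \<Longrightarrow> m \<subseteq> J"
    using noeth_fg[OF N m] by blast
  have Tc: "T \<subseteq> carrier R" using T idealD(2)[OF m] by blast
  note hp = gfamD(1)[OF gfam_hom_part[OF subset_refl Tc]]
  let ?H = "hom_part (carrier R) T"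
  have mX: "ipow m n \<subseteq> ?H n" for n
  proof (induction n)
    case 0
    have "Gen (carrier R) T {(0, \<one>)} 0 (r \<otimes> \<one>)" if "r \<in> carrier R" for r
      using that by (intro Gen.Gsmult Gen.Gbase) auto
    thus ?case by (auto simp: ipow_0)
  next
    case (Suc n)
    \<comment> \<open>The elements carrying degree n into degree n + 1 form an ideal; it contains
      \<open>T\<close>, hence m.\<close>
    let ?V = "{v \<in> carrier R. \<forall>u\<in>?H n. u \<otimes> v \<in> ?H (Suc n)}"
    have "m \<subseteq> ?V"
    proof (rule T(3))
      have e: "?V
         = carrier R \<inter> (\<Inter>u\<in>?H n. xpre u (?H (Suc n)))"
        unfolding xpre_def by auto
      have "ideal (xpre u (?H (Suc n))) R" if "u \<in> ?H n" for u
        using asub_xpre[OF hp _ subset_refl] asubD(2)[OF hp that] asub_ideal_iff by blast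
      hence "ideal (\<Inter>(insert (carrier R) ((\<lambda>u. xpre u (?H (Suc n))) ` ?H n))) R"
        by (intro i_Intersect) (auto simp: oneideal)
      thus "ideal ?V R"
        unfolding e by simp
      show "T \<subseteq> ?V"
      proof
        fix x assume x: "x \<in> T"
        have "u \<otimes> x \<in> ?H (Suc n)" if u: "u \<in> ?H n" for u
        proof -
          have "x \<otimes> u \<in> ?H (Suc n)" using u x by (auto intro: Gen.Gmult)
          thus ?thesis using m_comm asubD(2)[OF hp u] x Tc by auto
        qed
        thus "x \<in> ?V"
          using x Tc by auto
      qed
    qed
    hence "u \<otimes> v \<in> ?H (Suc n)" if "u \<in> ipow m n" "v \<in> m" for u v
      using Suc that by blast
    thus ?case unfolding ipow_Suc using hp[of "Suc n"] asub_ideal_iff by (intro ideal_prod_least) auto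
  qed
  define NN where "NN n = I \<inter> ipow m n" for n
  have g: "gfam (carrier R) T NN"
    unfolding gfam_def NN_def
  proof (intro conjI allI ballI)
    fix n show "asub R (carrier R) (I \<inter> ipow m n)"
      using asub_inter idealD(1)[OF I] idealD(1)[OF ipow_ideal[OF m]] by blast
    fix x u assume h: "x \<in> T" "u \<in> I \<inter> ipow m n"
    have "x \<in> ipow m 1" using h T ipow_1[OF m] by auto
    hence "x \<otimes> u \<in> ipow m (1 + n)" using ipow_mult[OF m, of x 1 u n] h by blast
    thus "x \<otimes> u \<in> I \<inter> ipow m (Suc n)" using h Tc idealD(7)[OF I] by auto
  qed
  have "NN n \<subseteq> ?H n" for n using mX unfolding NN_def by blast
  from graded_noetherian[OF carrier_is_subring N T(2) Tc g this] obtain F where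
    F: "finite F" "\<forall>(d, g)\<in>F. g \<in> NN d" "\<forall>n. NN n \<subseteq> {u. Gen (carrier R) T F n u}" by blast
  define c where "c = Max (insert 0 (fst ` F))"
  have c: "d \<le> c" if "(d, g) \<in> F" for d g
    unfolding c_def using F(1) that by (intro Max_ge) (auto simp: image_iff intro: bexI[rotated])
  \<comment> \<open>Truncated subtraction makes the comparison family equal to I in degrees up to
    \<open>c\<close>, where the generators live.\<close>
  have g2: "gfam (carrier R) T (\<lambda>n. ideal_prod R (ipow m (n - c)) I)"
    unfolding gfam_def
  proof (intro conjI allI ballI)
    fix n show "asub R (carrier R) (ideal_prod R (ipow m (n - c)) I)"
      using idealD(1)[OF ideal_prod_is_ideal[OF ipow_ideal[OF m] I]] .
    fix x u assume x: "x \<in> T" and u: "u \<in> ideal_prod R (ipow m (n - c)) I"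
    have "x \<in> ipow m 1" using x T ipow_1[OF m] by auto
    hence "x \<otimes> u \<in> ideal_prod R (ipow m 1) (ideal_prod R (ipow m (n - c)) I)" using u by (rule ideal_prod.prod)
    also have "\<dots> = ideal_prod R (ipow m (1 + (n - c))) I"
      unfolding ipow_add[OF m, symmetric] by (rule ideal_prod_assoc[OF ipow_ideal[OF m] ipow_ideal[OF m] I, symmetric])
    also have "\<dots> \<subseteq> ideal_prod R (ipow m (Suc n - c)) I"
    proof (rule ideal_prod_least[OF ideal_prod_is_ideal[OF ipow_ideal[OF m] I]])
      fix i j assume ij: "i \<in> ipow m (1 + (n - c))" "j \<in> I"
      have "Suc n - c \<le> 1 + (n - c)" by simp
      from subsetD[OF ipow_antimono[OF m this] ij(1)] ij(2)
      show "i \<otimes> j \<in> ideal_prod R (ipow m (Suc n - c)) I" by (rule ideal_prod.prod)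
    qed
    finally show "x \<otimes> u \<in> ideal_prod R (ipow m (Suc n - c)) I" .
  qed
  have gb: "g \<in> ideal_prod R (ipow m (d - c)) I" if dg: "(d, g) \<in> F" for d g
  proof -
    have "g \<in> I" using F(2) dg unfolding NN_def by auto
    hence "\<one> \<otimes> g \<in> ideal_prod R (carrier R) I" by (intro ideal_prod.prod) auto
    thus ?thesis using c[OF dg] idealD(3)[OF I \<open>g \<in> I\<close>] by (simp add: ipow_0)
  qed
  have "I \<inter> ipow m (n + c) \<subseteq> ideal_prod R (ipow m n) I" for n
  proof
    fix u assume "u \<in> I \<inter> ipow m (n + c)"
    hence "Gen (carrier R) T F (n + c) u" using F(3) unfolding NN_def by blast
    from Gen_least[OF g2 gb this] show "u \<in> ideal_prod R (ipow m n) I" by simp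
  qed
  thus ?thesis by blast
qed

lemma noeth_over_field:
  assumes "A \<subseteq> carrier R" "\<And>a. a \<in> A \<Longrightarrow> a \<noteq> \<zero> \<Longrightarrow> \<exists>b\<in>A. b \<otimes> a = \<one>"
  shows "noeth_over A"
  unfolding noeth_over_def
proof (intro allI impI)
  fix U assume U: "asub R A U \<and> U \<subseteq> A"
  show "\<exists>S\<subseteq>U. finite S \<and> (\<forall>V. asub R A V \<and> S \<subseteq> V \<longrightarrow> U \<subseteq> V)"
  proof (cases "U \<subseteq> {\<zero>}")
    case True
    thus ?thesis using asubD(3) by (intro exI[of _ "{}"]) blast
  next
    case False
    then obtain a where a: "a \<in> U" "a \<noteq> \<zero>" by blast
    then obtain b where b: "b \<in> A" "b \<otimes> a = \<one>" using assms(2) U by blast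
    have "U \<subseteq> V" if V: "asub R A V" "a \<in> V" for V
    proof
      fix u assume u: "u \<in> U"
      have c: "u \<in> carrier R" using u U assms(1) by blast
      have "b \<otimes> a \<in> V" using asubD(6)[OF V(1) b(1) V(2)] .
      hence "u \<otimes> \<one> \<in> V" using asubD(6)[OF V(1), of u "\<one>"] b(2) u U by auto
      thus "u \<in> V" using c by simp
    qed
    thus ?thesis using a by (intro exI[of _ "{a}"]) auto
  qed
qed

section \<open>Finitely generated subalgebras and rings of fractions over them\<close>

definition homalg :: "'a set \<Rightarrow> 'a set \<Rightarrow> 'a set" where
  "homalg A T = (\<Union>n. hom_part A (insert \<one> T) n)"

context
  fixes A T
  assumes A: "subring A R" and T: "T \<subseteq> carrier R"
begin

lemma Ac: "A \<subseteq> carrier R" using A subringE(1) by blast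

lemma T1c: "insert \<one> T \<subseteq> carrier R" using T by auto

text \<open>Adjoining the element 1 to \<open>T\<close> dehomogenizes: \<open>hA n\<close> consists
  of the values of polynomials of degree at most n, and the union over n is A[T].\<close>

abbreviation hA :: "nat \<Rightarrow> 'a set" where "hA \<equiv> hom_part A (insert \<one> T)"

lemmas hp1 = gfamD(1)[OF gfam_hom_part[OF Ac T1c]]

lemma hom_part_up: "n \<le> k \<Longrightarrow> hA n \<subseteq> hA k"
proof (induction k rule: dec_induct)
  case (step k)
  have "u \<in> hA (Suc k)" if u: "u \<in> hA k" for u
  proof -
    have "\<one> \<otimes> u \<in> hA (Suc k)" using u by (auto intro: Gen.Gmult)
    thus ?thesis using asubD(2)[OF hp1 u] by simp
  qed
  thus ?case using step by blast
qed simp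

lemma hom_part_mult:
  assumes "u \<in> hA i" "v \<in> hA j"
  shows "u \<otimes> v \<in> hA (i + j)"
proof -
  define M where "M i = {u \<in> carrier R. u \<otimes> v \<in> hA (i + j)}" for i
  have vc: "v \<in> carrier R" using asubD(2)[OF hp1 assms(2)] .
  have e: "M i = xpre v (hA (i + j))" for i
    unfolding M_def xpre_def using vc m_comm by auto
  have "gfam A (insert \<one> T) M" unfolding gfam_def
  proof (intro conjI allI ballI)
    fix n show "asub R A (M n)" unfolding e using asub_xpre[OF hp1 vc Ac] .
    fix x u assume x: "x \<in> insert \<one> T" and u: "u \<in> M n"
    have c: "x \<in> carrier R" "u \<in> carrier R" using x T1c u unfolding M_def by auto
    have "x \<otimes> (u \<otimes> v) \<in> hA (Suc (n + j))"
      using x u unfolding M_def by (auto intro: Gen.Gmult)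
    thus "x \<otimes> u \<in> M (Suc n)" unfolding M_def using c vc by (simp add: m_assoc)
  qed
  moreover have "\<one> \<in> M 0" unfolding M_def using assms(2) vc by simp
  ultimately have "u \<in> M i" using Gen_least[of A "insert \<one> T" M "{(0, \<one>)}" i u] assms(1) by auto
  thus ?thesis unfolding M_def by blast
qed

lemma homalg_subring: "subring (homalg A T) R"
proof (rule subringI)
  show "homalg A T \<subseteq> carrier R" unfolding homalg_def using asubD(1)[OF hp1] by blast
  show "\<one> \<in> homalg A T" unfolding homalg_def by (auto intro!: exI[of _ 0] Gen.Gbase)
  show "\<ominus> h \<in> homalg A T" if "h \<in> homalg A T" for h
    using that asubD(5)[OF hp1] unfolding homalg_def by blast
  fix u v assume "u \<in> homalg A T" "v \<in> homalg A T"
  then obtain i j where ij: "u \<in> hA i" "v \<in> hA j"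
    unfolding homalg_def by blast
  show "u \<otimes> v \<in> homalg A T" using hom_part_mult[OF ij] unfolding homalg_def by blast
  have "u \<in> hA (max i j)" "v \<in> hA (max i j)"
    using ij hom_part_up[of i "max i j"] hom_part_up[of j "max i j"] by auto
  thus "u \<oplus> v \<in> homalg A T" using asubD(4)[OF hp1] unfolding homalg_def by blast
qed

lemma homalg_incl: "A \<subseteq> homalg A T" "T \<subseteq> homalg A T"
proof -
  have "a \<in> hA 0" if "a \<in> A" for a
  proof -
    have "Gen A (insert \<one> T) {(0, \<one>)} 0 (a \<otimes> \<one>)" using that by (intro Gen.Gsmult Gen.Gbase) auto
    thus ?thesis using that Ac by auto
  qed
  thus "A \<subseteq> homalg A T" unfolding homalg_def by blast
  have "x \<in> hA 1" if "x \<in> T" for x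
  proof -
    have "Gen A (insert \<one> T) {(0, \<one>)} (Suc 0) (x \<otimes> \<one>)" using that by (intro Gen.Gmult Gen.Gbase) auto
    thus ?thesis using that T by auto
  qed
  thus "T \<subseteq> homalg A T" unfolding homalg_def by blast
qed

lemma generate_ring_homalg: "generate_ring R (A \<union> T) \<subseteq> homalg A T"
  using generate_ring_min_subring1[OF _ homalg_subring] homalg_incl Ac T by simp

text \<open>The intersections of an ideal with the polynomials of degree at most n form a finitely
  generated graded family. Its generators generate the ideal, because every element of R has a unit
  multiple in A[T].\<close>

lemma noeth_ess_finite:
  assumes nA: "noeth_over A" and "finite T" and loc: "\<And>r. r \<in> carrier R \<Longrightarrow> \<exists>w\<in>Units R. w \<otimes> r \<in> homalg A T"
  shows "noeth_over (carrier R)"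
proof (rule noeth_overI)
  fix I assume I: "ideal I R"
  define NN where "NN n = I \<inter> hA n" for n
  have g: "gfam A (insert \<one> T) NN"
    unfolding gfam_def NN_def
  proof (intro conjI allI ballI)
    fix n show "asub R A (I \<inter> hA n)"
      using asub_inter[OF asub_mono[OF idealD(1)[OF I] Ac] hp1] .
    fix x u assume h: "x \<in> insert \<one> T" "u \<in> I \<inter> hA n"
    hence "x \<otimes> u \<in> I" using idealD(7)[OF I, of x u] T1c by auto
    thus "x \<otimes> u \<in> I \<inter> hA (Suc n)" using h by (auto intro: Gen.Gmult)
  qed
  have "NN n \<subseteq> hA n" for n unfolding NN_def by blast
  from graded_noetherian[OF A nA _ T1c g this] \<open>finite T\<close> obtain F where
    F: "finite F" "\<forall>(d, g)\<in>F. g \<in> NN d" "\<forall>n. NN n \<subseteq> {u. Gen A (insert \<one> T) F n u}" by auto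
  have "I \<subseteq> J" if J: "ideal J R" "snd ` F \<subseteq> J" for J
  proof
    fix r assume r: "r \<in> I"
    have rc: "r \<in> carrier R" using idealD(3)[OF I r] .
    obtain w where w: "w \<in> Units R" "w \<otimes> r \<in> homalg A T" using loc[OF rc] by blast
    have wc: "w \<in> carrier R" using w by auto
    obtain n where "w \<otimes> r \<in> hA n" using w(2) unfolding homalg_def by blast
    hence "w \<otimes> r \<in> NN n" unfolding NN_def using idealD(7)[OF I wc r] by blast
    hence G: "Gen A (insert \<one> T) F n (w \<otimes> r)" using F(3) by blast
    have "gfam A (insert \<one> T) (\<lambda>n. J)" unfolding gfam_def
      using asub_mono[OF idealD(1)[OF J(1)] Ac] idealD(7)[OF J(1)] T1c by blast
    from Gen_least[OF this _ G] J(2) have "w \<otimes> r \<in> J" by (force simp: image_subset_iff)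
    hence "inv w \<otimes> (w \<otimes> r) \<in> J" using idealD(7)[OF J(1)] w by blast
    thus "r \<in> J" using w wc rc by (simp add: m_assoc[symmetric])
  qed
  thus "\<exists>S\<subseteq>I. finite S \<and> (\<forall>J. ideal J R \<longrightarrow> S \<subseteq> J \<longrightarrow> I \<subseteq> J)"
    using F(1,2) by (intro exI[of _ "snd ` F"]) (force simp: NN_def)
qed

end

end

section \<open>Dimension and growth\<close>

text \<open>Growth at least of order n^k, stated along the multiples of one constant so that natural
  numbers suffice and infinite values are allowed.\<close>

definition growth_ge :: "nat \<Rightarrow> (nat \<Rightarrow> enat) \<Rightarrow> bool" where
  "growth_ge k F \<longleftrightarrow> (\<exists>c\<ge>1. \<forall>t\<ge>1. enat (t ^ k) \<le> F (c * t))"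

text \<open>Summation raises the exponent: each step by a fixed amount adds at least
  \<open>G n\<close>, and t steps from a starting point proportional to t add t times t^k.\<close>

lemma growth_ge_Suc:
  assumes "\<And>n. F n + G (n + c) \<le> F (n + c)" "mono F" "mono G" "growth_ge k G"
  shows "growth_ge (Suc k) F"
proof -
  have rec: "F n + G n \<le> F (n + Suc c)" for n
  proof -
    have "F n + G n \<le> F (Suc n) + G (Suc n + c)"
      using monoD[OF assms(2), of n "Suc n"] monoD[OF assms(3), of n "Suc n + c"] by (simp add: add_mono)
    also have "\<dots> \<le> F (Suc n + c)" by (rule assms(1))
    finally show ?thesis by simp
  qed
  have it: "enat j * G n \<le> F (n + Suc c * j)" for n j
  proof (induction j)
    case 0 thus ?case by (simp add: zero_enat_def[symmetric])
  next
    case (Suc j)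
    have "enat (Suc j) * G n = enat j * G n + G n"
      by (metis (no_types, lifting) add.commute eSuc_enat mult_eSuc)
    also have "\<dots> \<le> F (n + Suc c * j) + G (n + Suc c * j)"
      using Suc monoD[OF assms(3), of n "n + Suc c * j"] by (simp add: add_mono)
    also have "\<dots> \<le> F (n + Suc c * j + Suc c)" by (rule rec)
    finally show ?case by (simp add: algebra_simps)
  qed
  obtain b where b: "b \<ge> 1" "\<And>t. t \<ge> 1 \<Longrightarrow> enat (t ^ k) \<le> G (b * t)"
    using assms(4) unfolding growth_ge_def by blast
  have "enat (t ^ Suc k) \<le> F ((b + Suc c) * t)" if "t \<ge> 1" for t
  proof -
    have "enat (t ^ Suc k) = enat t * enat (t ^ k)" by simp
    also have "\<dots> \<le> enat t * G (b * t)" using b(2)[OF that] by (intro mult_left_mono) auto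
    also have "\<dots> \<le> F (b * t + Suc c * t)" by (rule it)
    finally show ?thesis by (simp add: algebra_simps)
  qed
  thus ?thesis unfolding growth_ge_def using b(1) by (intro exI[of _ "b + Suc c"]) auto
qed

lemma growth_ge_bound:
  assumes "growth_ge k F" "\<And>n. F n \<le> enat (C * (n + a) ^ h)"
  shows "k \<le> h"
proof (rule ccontr)
  assume "\<not> k \<le> h"
  hence kh: "Suc h \<le> k" by simp
  obtain c where c: "c \<ge> 1" "\<And>t. t \<ge> 1 \<Longrightarrow> enat (t ^ k) \<le> F (c * t)"
    using assms(1) unfolding growth_ge_def by blast
  \<comment> \<open>Chosen larger than the constant C (c + a)^h that appears when the bound is taken
    at c t, since c t + a \<le> (c + a) t.\<close>
  define t where "t = Suc (C * (c + a) ^ h)"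
  have t: "t \<ge> 1" unfolding t_def by simp
  have "enat (t ^ k) \<le> enat (C * (c * t + a) ^ h)" using c(2)[OF t] assms(2) order_trans by blast
  hence "t ^ k \<le> C * (c * t + a) ^ h" by simp
  also have "\<dots> \<le> C * ((c + a) * t) ^ h"
    using t by (intro mult_left_mono power_mono) (auto simp: algebra_simps)
  also have "\<dots> = C * (c + a) ^ h * t ^ h" by (simp add: power_mult_distrib)
  also have "\<dots> < t * t ^ h" using t unfolding t_def by (intro mult_strict_right_mono) auto
  also have "\<dots> = t ^ Suc h" by simp
  also have "\<dots> \<le> t ^ k" using kh t by (intro power_increasing) auto
  finally show False by simp
qed

context cring begin

section \<open>Colengths of powers of a maximal ideal and chains of primes below it\<close>

definition pchain :: "'a set \<Rightarrow> 'a set \<Rightarrow> nat \<Rightarrow> (nat \<Rightarrow> 'a set) \<Rightarrow> bool" where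
  "pchain I m k P \<longleftrightarrow> (\<forall>i\<le>k. primeideal (P i) R \<and> I \<subseteq> P i \<and> P i \<subseteq> m) \<and> (\<forall>i<k. P i \<subset> P (Suc i))"

lemma ideal_add: "ideal I R \<Longrightarrow> ideal J R \<Longrightarrow> ideal (I <+> J) R"
  using add_ideals by blast

abbreviation pid :: "'a \<Rightarrow> 'a set" where "pid x \<equiv> ximg x (carrier R)"

lemma ideal_ximg: "x \<in> carrier R \<Longrightarrow> ideal (pid x) R"
  using asub_ximg[OF asub_carrier[OF subset_refl] _ subset_refl] asub_ideal_iff by blast

lemma ideal_xpre: "x \<in> carrier R \<Longrightarrow> ideal I R \<Longrightarrow> ideal (xpre x I) R"
  using asub_xpre[OF idealD(1) _ subset_refl] asub_ideal_iff by blast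

lemma ideal_subset_add:
  assumes "ideal I R" "ideal J R" shows "I \<subseteq> I <+> J" "J \<subseteq> I <+> J"
  using add_subset[OF idealD(1)[OF assms(1)] idealD(1)[OF assms(2)]] by blast+

lemma ideal_add_least:
  assumes "ideal K R" "I \<subseteq> K" "J \<subseteq> K" shows "I <+> J \<subseteq> K"
  using add_least[OF idealD(1)[OF assms(1)] assms(2,3)] .

lemma self_ximg: assumes "x \<in> carrier R" shows "x \<in> pid x"
proof -
  have "x = x \<otimes> \<one>" using assms by simp
  thus ?thesis unfolding mem_ximg by blast
qed

lemma ximg_subset: assumes "ideal I R" "x \<in> I" shows "pid x \<subseteq> I"
  using idealD(8)[OF assms(1) _ assms(2)] unfolding ximg_def by blast

lemma len_ideal_add:
  assumes "ideal J R" "I \<subseteq> J"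
  shows "colen I = len idlat I J + colen J"
  by (rule len_add) (use assms idealD(1,2) asub_carrier in auto)

lemma len_ideal_ximg:
  assumes "ideal B R" "x \<in> carrier R"
  shows "len idlat B (B <+> pid x) = colen (xpre x B)"
proof -
  have "carrier R \<inter> xpre x B = xpre x B" unfolding xpre_def by blast
  thus ?thesis using len_ximg[OF idealD(1)[OF assms(1)] asub_carrier[OF subset_refl] assms(2) subset_refl] by simp
qed

lemma len_antimono: "I \<subseteq> J \<Longrightarrow> len L J V \<le> len L I V"
  by (rule len_mono) auto

text \<open>In the filtration by the ideals B + (x^j), j \<le> n, each quotient is generated by the
  class of x^j and annihilated by B + (x); so its length is at most that of R / (B + (x)).\<close>

lemma len_pow_bound:
  assumes B: "ideal B R" and x: "x \<in> carrier R" "x [^] n \<in> B"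
  shows "colen B \<le> enat n * colen (B <+> pid x)"
proof -
  let ?l = "colen (B <+> pid x)"
  have xp: "x [^] j \<in> carrier R" for j :: nat using x by simp
  have ip: "ideal (B <+> pid (x [^] j)) R" for j :: nat
    using ideal_add[OF B ideal_ximg[OF xp]] .
  have "colen (B <+> pid (x [^] j)) \<le> enat j * ?l" for j :: nat
  proof (induction j)
    case 0
    have "\<one> \<in> B <+> pid (x [^] (0::nat))"
      using ideal_subset_add(2)[OF B ideal_ximg[OF xp[of 0]]] self_ximg[OF xp[of 0]] by auto
    hence "B <+> pid (x [^] (0::nat)) = carrier R"
      using ideal.one_imp_carrier[OF ip] by blast
    thus ?case by (simp add: len_self zero_enat_def[symmetric])
  next
    case (Suc j)
    let ?B' = "B <+> pid (x [^] Suc j)" and ?C = "B <+> pid (x [^] j)"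
    have xs: "x [^] Suc j = x [^] j \<otimes> x" by simp
    have sub: "pid (x [^] Suc j) \<subseteq> pid (x [^] j)"
      using ximg_subset[OF ideal_ximg[OF xp], of "x [^] Suc j" j] x(1) unfolding mem_ximg xs by blast
    have "?B' \<subseteq> ?C" by (rule set_add_mono[OF subset_refl sub])
    hence "colen ?B' = len idlat ?B' ?C + colen ?C"
      by (rule len_ideal_add[OF ip])
    moreover have "len idlat ?B' ?C \<le> ?l"
    proof -
      have "?C \<subseteq> ?B' <+> pid (x [^] j)"
        by (rule set_add_mono[OF ideal_subset_add(1)[OF B ideal_ximg[OF xp]] subset_refl])
      hence "len idlat ?B' ?C \<le> len idlat ?B' (?B' <+> pid (x [^] j))" by (intro len_mono) auto
      also have "\<dots> = colen (xpre (x [^] j) ?B')" by (rule len_ideal_ximg[OF ip xp])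
      also have "\<dots> \<le> ?l"
      proof (rule len_antimono, rule ideal_add_least[OF ideal_xpre[OF xp ip]])
        have "x [^] j \<otimes> b \<in> ?B'" if "b \<in> B" for b
          using ideal_subset_add(1)[OF B ideal_ximg[OF xp, of "Suc j"]] idealD(7)[OF B xp that] by blast
        thus "B \<subseteq> xpre (x [^] j) ?B'" unfolding xpre_def using idealD(2)[OF B] by blast
        have "x [^] Suc j \<in> ?B'" using ideal_subset_add(2)[OF B ideal_ximg[OF xp]] self_ximg[OF xp, of "Suc j"] by blast
        hence "x \<in> xpre (x [^] j) ?B'" unfolding xpre_def using x(1) by simp
        thus "pid x \<subseteq> xpre (x [^] j) ?B'" by (rule ximg_subset[OF ideal_xpre[OF xp ip]])
      qed
      finally show ?thesis .
    qed
    ultimately have "colen ?B' \<le> ?l + enat j * ?l" using Suc by (simp add: add_mono)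
    also have "\<dots> = enat (Suc j) * ?l" by (metis eSuc_enat mult_eSuc)
    finally show ?case .
  qed
  from this[of n] show ?thesis
    using add_absorb[OF idealD(1)[OF B] idealD(1)[OF ideal_ximg[OF xp]] ximg_subset[OF B x(2)]] by simp
qed

lemma pow_mem_ipow: "ideal m R \<Longrightarrow> x \<in> m \<Longrightarrow> x [^] n \<in> ipow m n"
proof (induction n)
  case 0 thus ?case unfolding ipow_0 by simp
next
  case (Suc n) thus ?case unfolding ipow_Suc nat_pow_Suc by (intro ideal_prod.prod) auto
qed

lemma len_maximal:
  assumes "maximalideal m R" shows "colen m \<le> 1"
proof (rule len_le_one)
  fix N assume "N \<in> idlat" "m \<subset> N" "N \<subseteq> carrier R"
  thus "N = carrier R" using maximalideal.I_maximal[OF assms, of N] asub_ideal_iff by auto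
qed

text \<open>Each of the s generators of m is adjoined to m^n in turn, at the cost of a factor n
  since its n-th power already lies in m^n. This crude bound makes the height of m finite.\<close>

lemma len_ipow_generators:
  assumes N: "noeth_over (carrier R)" and m: "maximalideal m R"
  shows "\<exists>s. \<forall>n. colen (ipow m n) \<le> enat (n ^ s)"
proof -
  have mi: "ideal m R" using m maximalideal.axioms(1) by blast
  obtain S where S: "S \<subseteq> m" "finite S" "\<And>J. ideal J R \<Longrightarrow> S \<subseteq> J \<Longrightarrow> m \<subseteq> J"
    using noeth_fg[OF N mi] by blast
  have "colen (ipow m n) \<le> enat (n ^ card S)" if n: "n \<ge> 1" for n
  proof -
    have "\<exists>B. ideal B R \<and> ipow m n \<subseteq> B \<and> B \<subseteq> m \<and> U \<subseteq> B \<and>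
       colen (ipow m n) \<le> enat (n ^ card U) * colen B"
      if "finite U" "U \<subseteq> m" for U using that
    proof (induction U rule: finite_induct)
      case empty
      thus ?case using ipow_ideal[OF mi] ipow_subset[OF mi] n
        by (intro exI[of _ "ipow m n"]) (auto simp flip: one_enat_def simp del: One_nat_def)
    next
      case (insert x U)
      then obtain B where B: "ideal B R" "ipow m n \<subseteq> B" "B \<subseteq> m" "U \<subseteq> B"
        "colen (ipow m n) \<le> enat (n ^ card U) * colen B" by auto
      have x: "x \<in> m" "x \<in> carrier R" using insert idealD(2)[OF mi] by auto
      let ?B = "B <+> pid x"
      have "x [^] n \<in> B" using pow_mem_ipow[OF mi x(1)] B(2) by blast
      from len_pow_bound[OF B(1) x(2) this] have "enat (n ^ card U) * colen B
        \<le> enat (n ^ card U) * (enat n * colen ?B)" by (intro mult_left_mono) auto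
      also have "\<dots> = enat (n ^ card (insert x U)) * colen ?B"
        using insert(1,2) by (simp add: mult.assoc[symmetric] mult.commute)
      finally have "colen (ipow m n) \<le> enat (n ^ card (insert x U)) * colen ?B"
        using B(5) by (rule order_trans[rotated])
      moreover have "ideal ?B R" using ideal_add[OF B(1) ideal_ximg[OF x(2)]] .
      moreover have "B \<subseteq> ?B" "pid x \<subseteq> ?B" using ideal_subset_add[OF B(1) ideal_ximg[OF x(2)]] by auto
      moreover have "?B \<subseteq> m" using ideal_add_least[OF mi B(3) ximg_subset[OF mi x(1)]] .
      ultimately show ?case using B self_ximg[OF x(2)] by (intro exI[of _ ?B]) auto
    qed
    from this[OF S(2,1)] obtain B where B: "ideal B R" "S \<subseteq> B"
      "colen (ipow m n) \<le> enat (n ^ card S) * colen B" by blast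
    have "colen B \<le> 1" using len_antimono[OF S(3)[OF B(1,2)], of idlat "carrier R"] len_maximal[OF m]
      by (meson order_trans)
    hence "enat (n ^ card S) * colen B \<le> enat (n ^ card S) * 1" by (intro mult_left_mono) auto
    thus ?thesis using B(3) by (simp add: order_trans)
  qed
  moreover have "colen (ipow m 0) \<le> enat (0 ^ card S)"
    unfolding ipow_0 len_self by simp
  ultimately show ?thesis by (metis less_one linorder_not_less)
qed

text \<open>Some a in I and b in m have sum 1; multiplying the second summand of such a
  decomposition by a + b moves it one power of m deeper.\<close>

lemma add_ipow_full:
  assumes I: "ideal I R" and m: "maximalideal m R" and n: "\<not> I \<subseteq> m"
  shows "I <+> ipow m n = carrier R"
proof -
  have mi: "ideal m R" using m maximalideal.axioms(1) by blast
  have Im: "ideal (I <+> m) R" using ideal_add[OF I mi] .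
  note s = ideal_subset_add[OF I mi]
  have "I <+> m = carrier R"
    using maximalideal.I_maximal[OF m Im s(2) idealD(2)[OF Im]] s(1) n by blast
  hence "\<one> \<in> I <+> m" by simp
  then obtain a b where ab: "a \<in> I" "b \<in> m" "\<one> = a \<oplus> b" unfolding mem_set_add by blast
  have c: "a \<in> carrier R" "b \<in> carrier R" using ab idealD(3)[OF I] idealD(3)[OF mi] by auto
  have "\<one> \<in> I <+> ipow m n"
  proof (induction n)
    case 0
    thus ?case using ideal_subset_add(2)[OF I oneideal] unfolding ipow_0 by blast
  next
    case (Suc n)
    then obtain a' b' where ab': "a' \<in> I" "b' \<in> ipow m n" "\<one> = a' \<oplus> b'" unfolding mem_set_add by blast
    have c': "a' \<in> carrier R" "b' \<in> carrier R" using ab' idealD(3)[OF I] idealD(3)[OF ipow_ideal[OF mi]] by auto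
    have "\<one> = a' \<oplus> b' \<otimes> (a \<oplus> b)" using ab'(3) c' ab(3)[symmetric] by (metis r_one)
    also have "\<dots> = (a' \<oplus> b' \<otimes> a) \<oplus> b' \<otimes> b" using c c' by (simp add: r_distr a_assoc)
    finally have e: "\<one> = (a' \<oplus> b' \<otimes> a) \<oplus> b' \<otimes> b" .
    have 1: "a' \<oplus> b' \<otimes> a \<in> I" using idealD(5,7)[OF I] ab(1) ab'(1) c' by blast
    have 2: "b' \<otimes> b \<in> ipow m (Suc n)" unfolding ipow_Suc using ab'(2) ab(2) by (rule ideal_prod.prod)
    show ?case unfolding mem_set_add using e 1 2 by blast
  qed
  thus ?thesis using ideal.one_imp_carrier[OF ideal_add[OF I ipow_ideal[OF mi]]] by blast
qed

text \<open>Noetherian induction on I. If a b lies in I with neither factor in I, the length is at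
  most the sum of the bounds for I + (a) and (I : a). If I is prime and x lies in m but not in I,
  then x^n lies in I + m^n, and the factor n from \<open>len_pow_bound\<close> pays for the prime
  lost in passing to I + (x).\<close>

theorem growth_upper:
  assumes N: "noeth_over (carrier R)" and m: "maximalideal m R" and I: "ideal I R"
    and "\<And>k P. pchain I m k P \<Longrightarrow> k \<le> h"
  shows "\<exists>C. \<forall>n. colen (I <+> ipow m n) \<le> enat (C * n ^ h)"
  using N I assms(4)
proof (induction I arbitrary: h rule: noeth_induct)
  fix I h
  assume I: "ideal I R"
    and IH: "\<And>J h. ideal J R \<Longrightarrow> I \<subset> J \<Longrightarrow> (\<And>k P. pchain J m k P \<Longrightarrow> k \<le> h) \<Longrightarrow>
        \<exists>C. \<forall>n. colen (J <+> ipow m n) \<le> enat (C * n ^ h)"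
    and h: "\<And>k P. pchain I m k P \<Longrightarrow> k \<le> h"
  have mi: "ideal m R" using m maximalideal.axioms(1) by blast
  note mn = ipow_ideal[OF mi]
  have pm: "pchain J m k P \<Longrightarrow> J' \<subseteq> J \<Longrightarrow> pchain J' m k P" for J J' k P
    unfolding pchain_def by blast
  show "\<exists>C. \<forall>n. colen (I <+> ipow m n) \<le> enat (C * n ^ h)"
  proof (cases "I \<subseteq> m")
    case False
    thus ?thesis using add_ipow_full[OF I m] by (auto simp: len_self zero_enat_def[symmetric])
  next
    case Im: True
    have Inc: "carrier R \<noteq> I" using Im maximalideal.I_notcarr[OF m] idealD(2)[OF mi] by blast
    show ?thesis
    proof (cases "primeideal I R")
      case False
      then obtain a b where ab: "a \<in> carrier R" "b \<in> carrier R" "a \<otimes> b \<in> I" "a \<notin> I" "b \<notin> I"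
        using primeidealI[OF I cring_axioms Inc] by blast
      let ?J = "I <+> pid a" and ?K = "xpre a I"
      have J: "ideal ?J R" using ideal_add[OF I ideal_ximg[OF ab(1)]] .
      have IJ: "I \<subseteq> ?J" "pid a \<subseteq> ?J" using ideal_subset_add[OF I ideal_ximg[OF ab(1)]] by auto
      hence "I \<subset> ?J" using self_ximg[OF ab(1)] ab(4) by blast
      from IH[OF J this] obtain C1 where C1: "\<And>n. colen (?J <+> ipow m n) \<le> enat (C1 * n ^ h)"
        using h pm IJ(1) by metis
      have K: "ideal ?K R" using ideal_xpre[OF ab(1) I] .
      have IK: "I \<subseteq> ?K" using idealD(7)[OF I ab(1)] idealD(2)[OF I] unfolding xpre_def by blast
      moreover have "b \<in> ?K" using ab unfolding xpre_def by blast
      ultimately have "I \<subset> ?K" using ab(5) by blast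
      from IH[OF K this] obtain C2 where C2: "\<And>n. colen (?K <+> ipow m n) \<le> enat (C2 * n ^ h)"
        using h pm IK by metis
      have "colen (I <+> ipow m n) \<le> enat ((C1 + C2) * n ^ h)" for n
      proof -
        let ?B = "I <+> ipow m n"
        have B: "ideal ?B R" using ideal_add[OF I mn] .
        have IB: "I \<subseteq> ?B" "ipow m n \<subseteq> ?B" using ideal_subset_add[OF I mn] by auto
        let ?D = "?B <+> pid a"
        have D: "ideal ?D R" using ideal_add[OF B ideal_ximg[OF ab(1)]] .
        have BD: "?B \<subseteq> ?D" "pid a \<subseteq> ?D" using ideal_subset_add[OF B ideal_ximg[OF ab(1)]] by auto
        have "?J <+> ipow m n \<subseteq> ?D"
          using IB BD by (intro ideal_add_least[OF D]) blast+
        hence 1: "colen ?D \<le> enat (C1 * n ^ h)" using len_antimono C1 order_trans by blast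
        have X: "ideal (xpre a ?B) R" by (rule ideal_xpre[OF ab(1) B])
        have "?K <+> ipow m n \<subseteq> xpre a ?B"
        proof (rule ideal_add_least[OF X])
          show "?K \<subseteq> xpre a ?B" unfolding xpre_def using IB by blast
          show "ipow m n \<subseteq> xpre a ?B" unfolding xpre_def using idealD(7)[OF mn ab(1)] idealD(2)[OF mn] IB by blast
        qed
        hence "colen (xpre a ?B) \<le> enat (C2 * n ^ h)" using len_antimono C2 order_trans by blast
        hence 2: "len idlat ?B ?D \<le> enat (C2 * n ^ h)" using len_ideal_ximg[OF B ab(1)] by simp
        have "colen ?B = len idlat ?B ?D + colen ?D" by (rule len_ideal_add[OF D BD(1)])
        also have "\<dots> \<le> enat (C2 * n ^ h) + enat (C1 * n ^ h)" using 1 2 by (rule add_mono[rotated])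
        finally show ?thesis by (simp add: algebra_simps)
      qed
      thus ?thesis by blast
    next
      case prime: True
      show ?thesis
      proof (cases "I = m")
        case True
        have "colen (I <+> ipow m n) \<le> enat (1 * n ^ h)" for n
        proof (cases "n = 0")
          case True
          have "I <+> carrier R = carrier R" using ideal_subset_add(2)[OF I oneideal] idealD(2)[OF ideal_add[OF I oneideal]] by blast
          thus ?thesis unfolding True ipow_0 by (simp add: len_self)
        next
          case False
          have "colen (I <+> ipow m n) \<le> 1"
            using len_antimono[OF ideal_subset_add(1)[OF I mn[of n]], of idlat "carrier R"] len_maximal[OF m] True
            by (meson order_trans)
          also have "1 \<le> enat (1 * n ^ h)" using False by (simp add: one_enat_def)
          finally show ?thesis .
        qed
        thus ?thesis by blast
      next
        case False
        then obtain x where x: "x \<in> m" "x \<notin> I" using Im by blast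
        have xc: "x \<in> carrier R" using x idealD(3)[OF mi] by blast
        have "primeideal m R" using maximalideal_prime[OF m] .
        hence "pchain I m 1 (\<lambda>i. if i = 0 then I else m)" unfolding pchain_def using prime Im False by auto
        hence h1: "1 \<le> h" using h by blast
        let ?J = "I <+> pid x"
        have J: "ideal ?J R" using ideal_add[OF I ideal_ximg[OF xc]] .
        have IJ: "I \<subseteq> ?J" "pid x \<subseteq> ?J" using ideal_subset_add[OF I ideal_ximg[OF xc]] by auto
        hence sub: "I \<subset> ?J" using self_ximg[OF xc] x by blast
        \<comment> \<open>A chain above I + (x) is prolonged downwards by I itself.\<close>
        have hb: "k \<le> h - 1" if P: "pchain ?J m k P" for k P
        proof -
          have "pchain I m (Suc k) (\<lambda>i. case i of 0 \<Rightarrow> I | Suc j \<Rightarrow> P j)"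
            unfolding pchain_def
          proof (intro conjI allI impI)
            fix i assume "i \<le> Suc k"
            thus "primeideal (case i of 0 \<Rightarrow> I | Suc j \<Rightarrow> P j) R" "I \<subseteq> (case i of 0 \<Rightarrow> I | Suc j \<Rightarrow> P j)"
              "(case i of 0 \<Rightarrow> I | Suc j \<Rightarrow> P j) \<subseteq> m"
              using P prime Im IJ(1) unfolding pchain_def by (auto split: nat.splits)
          next
            fix i assume i: "i < Suc k"
            show "(case i of 0 \<Rightarrow> I | Suc j \<Rightarrow> P j) \<subset> (case Suc i of 0 \<Rightarrow> I | Suc j \<Rightarrow> P j)"
              using P sub i unfolding pchain_def by (cases i) auto
          qed
          thus ?thesis using h by fastforce
        qed
        obtain C where C: "\<And>n. colen (?J <+> ipow m n) \<le> enat (C * n ^ (h - 1))"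
          using IH[OF J sub, of "h - 1"] hb by blast
        have "colen (I <+> ipow m n) \<le> enat (C * n ^ h)" for n
        proof -
          let ?B = "I <+> ipow m n"
          have B: "ideal ?B R" using ideal_add[OF I mn] .
          have IB: "I \<subseteq> ?B" "ipow m n \<subseteq> ?B" using ideal_subset_add[OF I mn] by auto
          let ?D = "?B <+> pid x"
          have D: "ideal ?D R" using ideal_add[OF B ideal_ximg[OF xc]] .
          have BD: "?B \<subseteq> ?D" "pid x \<subseteq> ?D" using ideal_subset_add[OF B ideal_ximg[OF xc]] by auto
          have "?J <+> ipow m n \<subseteq> ?D" using IB BD by (intro ideal_add_least[OF D]) blast+
          hence 1: "colen ?D \<le> enat (C * n ^ (h - 1))" using len_antimono C order_trans by blast
          have "x [^] n \<in> ?B" using pow_mem_ipow[OF mi x(1)] IB by blast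
          from len_pow_bound[OF B xc this] have "colen ?B \<le> enat n * colen ?D" .
          also have "\<dots> \<le> enat n * enat (C * n ^ (h - 1))" using 1 by (intro mult_left_mono) auto
          also have "\<dots> = enat (C * n ^ h)" using h1 by (cases h) auto
          finally show ?thesis .
        qed
        thus ?thesis by blast
      qed
    qed
  qed
qed

text \<open>Artin-Rees for P + (f): modulo P, an element f r that lies in m^(n + c) is f times an
  element of m^n, and f cancels modulo the prime P.\<close>

lemma colon_linear:
  assumes N: "noeth_over (carrier R)" and m: "ideal m R" and P: "primeideal P R"
    and f: "f \<in> carrier R" "f \<notin> P"
  shows "\<exists>c. \<forall>n. xpre f (P <+> ipow m (n + c)) \<subseteq> P <+> ipow m n"
proof -
  have Pi: "ideal P R" using P primeideal.axioms(1) by blast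
  note mn = ipow_ideal[OF m]
  let ?I = "P <+> pid f"
  have I: "ideal ?I R" using ideal_add[OF Pi ideal_ximg[OF f(1)]] .
  have IP: "P \<subseteq> ?I" "pid f \<subseteq> ?I" using ideal_subset_add[OF Pi ideal_ximg[OF f(1)]] by auto
  obtain c where c: "\<And>n. ?I \<inter> ipow m (n + c) \<subseteq> ideal_prod R (ipow m n) ?I"
    using artin_rees[OF N m I] by blast
  have prodsub: "ideal_prod R (ipow m n) ?I \<subseteq> P <+> ximg f (ipow m n)" for n
  proof (rule ideal_prod_least)
    have xi: "ideal (ximg f (ipow m n)) R" using asub_ximg[OF idealD(1)[OF mn] f(1) subset_refl] asub_ideal_iff by blast
    show "ideal (P <+> ximg f (ipow m n)) R" using ideal_add[OF Pi xi] .
    fix i j assume i: "i \<in> ipow m n" and "j \<in> ?I"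
    then obtain p r where j: "p \<in> P" "r \<in> carrier R" "j = p \<oplus> f \<otimes> r" by (auto simp: mem_set_add mem_ximg)
    have ic: "i \<in> carrier R" "p \<in> carrier R" using i idealD(3)[OF mn] j idealD(3)[OF Pi] by auto
    have "i \<otimes> j = i \<otimes> p \<oplus> f \<otimes> (i \<otimes> r)" unfolding j(3) using ic j(2) f(1) by (simp add: r_distr m_lcomm)
    moreover have "i \<otimes> p \<in> P" using idealD(7)[OF Pi ic(1) j(1)] .
    moreover have "i \<otimes> r \<in> ipow m n" using idealD(8)[OF mn j(2) i] .
    hence "f \<otimes> (i \<otimes> r) \<in> ximg f (ipow m n)" unfolding mem_ximg by blast
    ultimately show "i \<otimes> j \<in> P <+> ximg f (ipow m n)" unfolding mem_set_add by blast
  qed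
  have "xpre f (P <+> ipow m (n + c)) \<subseteq> P <+> ipow m n" for n
  proof
    fix r assume "r \<in> xpre f (P <+> ipow m (n + c))"
    then obtain p y where r: "r \<in> carrier R" "f \<otimes> r = p \<oplus> y" "p \<in> P" "y \<in> ipow m (n + c)"
      unfolding xpre_def mem_set_add by blast
    have pc: "p \<in> carrier R" "y \<in> carrier R" using r idealD(3)[OF Pi] idealD(3)[OF mn] by auto
    have "y = f \<otimes> r \<ominus> p" unfolding r(2) using pc by algebra
    moreover have "f \<otimes> r \<in> pid f" using r(1) unfolding mem_ximg by blast
    hence "f \<otimes> r \<in> ?I" "p \<in> ?I" using IP r(3) by blast+
    ultimately have "y \<in> ?I" using idealD(9)[OF I] by simp
    hence "y \<in> P <+> ximg f (ipow m n)" using c prodsub r(4) by blast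
    then obtain p' a where p': "p' \<in> P" "a \<in> ipow m n" "y = p' \<oplus> f \<otimes> a" by (auto simp: mem_set_add mem_ximg)
    have pc': "p' \<in> carrier R" "a \<in> carrier R" using p' idealD(3)[OF Pi] idealD(3)[OF mn] by auto
    have "f \<otimes> (r \<ominus> a) = f \<otimes> r \<ominus> f \<otimes> a" using f(1) r(1) pc' by algebra
    also have "\<dots> = p \<oplus> p'" unfolding r(2) p'(3) using f(1) pc pc' by algebra
    finally have "f \<otimes> (r \<ominus> a) \<in> P" using idealD(5)[OF Pi r(3) p'(1)] by simp
    hence "r \<ominus> a \<in> P" using primeideal.I_prime[OF P f(1)] f(2) r(1) pc' by auto
    moreover have "r = (r \<ominus> a) \<oplus> a" using r(1) pc' by algebra
    ultimately show "r \<in> P <+> ipow m n" unfolding mem_set_add using p'(2) by blast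
  qed
  thus ?thesis by blast
qed

text \<open>With f in \<open>P 1\<close> but not in \<open>P 0\<close>, the interval above P 0 +
  m^(n + c) is split at P 0 + (f) + m^(n + c). By \<open>colon_linear\<close> the lower part is at
  least the length for \<open>P 0\<close> at n, and the upper part is at least that for
  \<open>P 1\<close> at n + c. So each further prime raises the exponent by one.\<close>

theorem growth_lower:
  assumes N: "noeth_over (carrier R)" and m: "maximalideal m R" and "pchain I m k P"
  shows "growth_ge k (\<lambda>n. colen (P 0 <+> ipow m n))"
  using assms(3)
proof (induction k arbitrary: I P)
  case 0
  have mi: "ideal m R" using m maximalideal.axioms(1) by blast
  have P: "primeideal (P 0) R" "P 0 \<subseteq> m" using 0 unfolding pchain_def by auto
  have Pi: "ideal (P 0) R" using P primeideal.axioms(1) by blast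
  have "1 \<le> colen (P 0 <+> ipow m t)" if "t \<ge> 1" for t
  proof (rule len_pos)
    show "P 0 <+> ipow m t \<in> idlat" using idealD(1)[OF ideal_add[OF Pi ipow_ideal[OF mi]]] by simp
    show "carrier R \<in> idlat" using asub_carrier by simp
    have "P 0 <+> ipow m t \<subseteq> m" using ideal_add_least[OF mi P(2)] ipow_subset[OF mi] that by auto
    moreover have "m \<subset> carrier R" using idealD(2)[OF mi] maximalideal.I_notcarr[OF m] by blast
    ultimately show "P 0 <+> ipow m t \<subset> carrier R" by blast
  qed
  thus ?case unfolding growth_ge_def by (intro exI[of _ 1]) (auto simp: one_enat_def)
next
  case (Suc k)
  have mi: "ideal m R" using m maximalideal.axioms(1) by blast
  note mn = ipow_ideal[OF mi]
  have P: "primeideal (P 0) R" "primeideal (P 1) R" "P 0 \<subset> P 1" using Suc.prems unfolding pchain_def by auto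
  have Pi: "ideal (P 0) R" "ideal (P 1) R" using P primeideal.axioms(1) by blast+
  have "pchain I m k (\<lambda>i. P (Suc i))" using Suc.prems unfolding pchain_def by auto
  from Suc.IH[OF this] have IH: "growth_ge k (\<lambda>n. colen (P 1 <+> ipow m n))" by simp
  obtain f where f: "f \<in> P 1" "f \<notin> P 0" using P(3) by blast
  have fc: "f \<in> carrier R" using f idealD(3)[OF Pi(2)] by blast
  obtain c where c: "\<And>n. xpre f (P 0 <+> ipow m (n + c)) \<subseteq> P 0 <+> ipow m n"
    using colon_linear[OF N mi P(1) fc f(2)] by blast
  have mono: "mono (\<lambda>n. colen (Q <+> ipow m n))" for Q
    by (intro monoI len_antimono set_add_mono subset_refl ipow_antimono[OF mi])
  show ?case
  proof (rule growth_ge_Suc[OF _ mono mono IH])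
    fix n
    let ?B = "P 0 <+> ipow m (n + c)"
    have B: "ideal ?B R" using ideal_add[OF Pi(1) mn] .
    let ?D = "?B <+> pid f"
    have D: "ideal ?D R" using ideal_add[OF B ideal_ximg[OF fc]] .
    have BD: "?B \<subseteq> ?D" using ideal_subset_add[OF B ideal_ximg[OF fc]] by auto
    have 1: "colen (P 0 <+> ipow m n) \<le> len idlat ?B ?D"
      unfolding len_ideal_ximg[OF B fc] by (rule len_antimono[OF c])
    have E: "ideal (P 1 <+> ipow m (n + c)) R" using ideal_add[OF Pi(2) mn] .
    note EP = ideal_subset_add[OF Pi(2) mn]
    have "?D \<subseteq> P 1 <+> ipow m (n + c)"
    proof (rule ideal_add_least[OF E])
      show "?B \<subseteq> P 1 <+> ipow m (n + c)" using P(3) by (intro set_add_mono) auto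
      show "pid f \<subseteq> P 1 <+> ipow m (n + c)" using ximg_subset[OF E] f(1) EP(1) by blast
    qed
    hence 2: "colen (P 1 <+> ipow m (n + c)) \<le> colen ?D" by (rule len_antimono)
    show "colen (P 0 <+> ipow m n) + colen (P 1 <+> ipow m (n + c))
       \<le> colen ?B"
      unfolding len_ideal_add[OF D BD] using 1 2 by (rule add_mono_thms_linordered_semiring(1)[OF conjI])
  qed
qed

text \<open>The upper and the lower bound meet at the greatest length of a chain of primes below m.
  Since the same lengths occur in the completion, comparing growth is enough to compare
  heights.\<close>

theorem height_growth:
  assumes N: "noeth_over (carrier R)" and m: "maximalideal m R"
  shows "\<exists>h C P. pchain {\<zero>} m h P \<and> (\<forall>k P. pchain {\<zero>} m k P \<longrightarrow> k \<le> h) \<and>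
     (\<forall>n. colen (ipow m n) \<le> enat (C * n ^ h)) \<and>
     growth_ge h (\<lambda>n. colen (ipow m n))"
proof -
  have mi: "ideal m R" using m maximalideal.axioms(1) by blast
  note mn = ipow_ideal[OF mi]
  obtain s where s: "\<And>n. colen (ipow m n) \<le> enat (n ^ s)" using len_ipow_generators[OF N m] by blast
  have low: "growth_ge k (\<lambda>n. colen (ipow m n))" if P: "pchain {\<zero>} m k P" for k P
  proof -
    have "ideal (P 0) R" using P primeideal.axioms(1) unfolding pchain_def by blast
    hence le: "colen (P 0 <+> ipow m n) \<le> colen (ipow m n)" for n
      using len_antimono ideal_subset_add(2)[OF _ mn] by blast
    thus ?thesis using growth_lower[OF N m P] unfolding growth_ge_def by (meson order_trans)
  qed
  \<comment> \<open>The crude bound n^s caps the length of chains, so a longest chain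
    exists.\<close>
  have bnd: "k \<le> s" if "pchain {\<zero>} m k P" for k P
    using growth_ge_bound[OF low[OF that], of 1 0 s] s by simp
  have "pchain {\<zero>} m 0 (\<lambda>_. m)"
    unfolding pchain_def using maximalideal_prime[OF m] idealD(4)[OF mi] by auto
  hence ex: "\<exists>k. \<exists>P. pchain {\<zero>} m k P" by blast
  define h where "h = (GREATEST k. \<exists>P. pchain {\<zero>} m k P)"
  have h1: "\<exists>P. pchain {\<zero>} m h P"
    unfolding h_def by (rule GreatestI_ex_nat[where b = s]) (use ex bnd in auto)
  have h2: "k \<le> h" if "pchain {\<zero>} m k P" for k P
    unfolding h_def by (rule Greatest_le_nat[where b = s]) (use that bnd in auto)
  obtain C where C: "\<And>n. colen ({\<zero>} <+> ipow m n) \<le> enat (C * n ^ h)"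
    using growth_upper[OF N m zeroideal, of h] h2 by blast
  have "{\<zero>} <+> ipow m n = ipow m n" for n
    using set_add_commute[of "{\<zero>}" "ipow m n"] idealD(2)[OF mn]
      add_absorb[OF idealD(1)[OF mn] idealD(1)[OF zeroideal], of n] idealD(4)[OF mn] by simp
  note e = this
  obtain P where P: "pchain {\<zero>} m h P" using h1 by blast
  have "\<forall>n. colen (ipow m n) \<le> enat (C * n ^ h)" using C unfolding e by blast
  thus ?thesis using P h2 low[OF P] by blast
qed

end

section \<open>Counting lattice points of down-closed sets\<close>

fun wt :: "nat list \<Rightarrow> nat list \<Rightarrow> nat" where
  "wt (d # ds) (a # as) = d * a + wt ds as"
| "wt _ _ = 0"

definition down_closed :: "nat list set \<Rightarrow> bool" where
  "down_closed S \<longleftrightarrow> (\<forall>a\<in>S. \<forall>b. list_all2 (\<le>) b a \<longrightarrow> b \<in> S)"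

section \<open>Dickson's lemma and descending chains of down-closed sets\<close>

lemma nat_mono_subseq: "\<exists>g :: nat \<Rightarrow> nat. strict_mono g \<and> (\<forall>i j. i \<le> j \<longrightarrow> (h (g i) :: nat) \<le> h (g j))"
proof -
  have ex: "\<exists>y>x. \<forall>j\<ge>y. h y \<le> h j" for x
  proof -
    \<comment> \<open>The minimum of the values beyond x is attained at some y, and no later value
      is smaller; iterating this choice gives the subsequence.\<close>
    define m where "m = (LEAST v. \<exists>y>x. h y = v)"
    have "\<exists>y>x. h y = m" unfolding m_def by (rule LeastI_ex) auto
    then obtain y where y: "y > x" "h y = m" by blast
    have "m \<le> h j" if "j \<ge> y" for j unfolding m_def
      by (rule Least_le, rule exI[of _ j]) (use that y in auto)
    thus ?thesis using y by auto
  qed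
  have "\<exists>g :: nat \<Rightarrow> nat. \<forall>n. (\<forall>j\<ge>g n. h (g n) \<le> h j) \<and> g n < g (Suc n)"
    by (rule dependent_nat_choice) (use ex in blast)+
  then obtain g :: "nat \<Rightarrow> nat" where g: "\<And>n j. j \<ge> g n \<Longrightarrow> h (g n) \<le> h j" "\<And>n. g n < g (Suc n)" by blast
  have sm: "strict_mono g" using g(2) by (simp add: strict_mono_Suc_iff)
  thus ?thesis using g(1) by (intro exI[of _ g]) (auto simp: strict_mono_less_eq)
qed

lemma dickson:
  assumes "\<And>i. length (a i :: nat list) = s"
  shows "\<exists>g :: nat \<Rightarrow> nat. strict_mono g \<and> (\<forall>i j. i \<le> j \<longrightarrow> list_all2 (\<le>) (a (g i)) (a (g j)))"
  using assms
proof (induction s arbitrary: a)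
  case 0
  thus ?case by (intro exI[of _ id]) (auto simp: strict_mono_def)
next
  case (Suc s)
  have "length (tl (a i)) = s" for i using Suc.prems[of i] by simp
  note Suc.IH[of "\<lambda>i. tl (a i)", OF this]
  then obtain g :: "nat \<Rightarrow> nat" where g0: "strict_mono g \<and> (\<forall>i j. i \<le> j \<longrightarrow> list_all2 (\<le>) (tl (a (g i))) (tl (a (g j))))"
    by (rule exE)
  note g = conjunct1[OF g0] conjunct2[OF g0]
  obtain k :: "nat \<Rightarrow> nat" where k0: "strict_mono k \<and> (\<forall>i j. i \<le> j \<longrightarrow> hd (a (g (k i))) \<le> hd (a (g (k j))))"
    using nat_mono_subseq[of "\<lambda>i. hd (a (g i))"] by (rule exE)
  note k = conjunct1[OF k0] conjunct2[OF k0, rule_format]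
  have la: "list_all2 (\<le>) (a (g (k i))) (a (g (k j)))" if "i \<le> j" for i j
  proof -
    have ne: "a x \<noteq> []" for x using Suc.prems[of x] by auto
    have "k i \<le> k j" using that k(1) by (simp add: strict_mono_less_eq)
    hence "list_all2 (\<le>) (hd (a (g (k i))) # tl (a (g (k i)))) (hd (a (g (k j))) # tl (a (g (k j))))"
      using g(2) k(2)[OF that] by simp
    thus ?thesis using ne by simp
  qed
  have "strict_mono (g \<circ> k)" using g(1) k(1) by (rule strict_mono_o)
  thus ?case using la by (intro exI[of _ "g \<circ> k"] conjI) (assumption, simp)
qed

text \<open>If the chain dropped infinitely often, Dickson's lemma would give two dropped elements a
  \<le> a', with a' still present in a set that a has already left. Down-closedness forbids
  this.\<close>

lemma down_closed_stabilise:
  assumes "\<And>j. down_closed (S j)" "\<And>j. S (Suc j) \<subseteq> S j" "\<And>j a. a \<in> S j \<Longrightarrow> length a = s"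
  shows "\<exists>k. \<forall>j\<ge>k. S j = S k"
proof (rule ccontr)
  assume no: "\<nexists>k. \<forall>j\<ge>k. S j = S k"
  have anti: "S j \<subseteq> S i" if "i \<le> j" for i j using that
  proof (induction j rule: dec_induct)
    case (step j) thus ?case using assms(2)[of j] by blast
  qed simp
  have "\<exists>j>k. \<exists>a. a \<in> S k - S j" for k
  proof -
    obtain j where j: "j \<ge> k" "S j \<noteq> S k" using no by blast
    hence "j > k" using le_neq_implies_less by blast
    thus ?thesis using j anti[of k j] by blast
  qed
  hence "\<exists>j. \<forall>k. j k > k \<and> (\<exists>a. a \<in> S k - S (j k))" by metis
  then obtain j where j: "\<And>k. j k > k" "\<And>k. \<exists>a. a \<in> S k - S (j k)" by blast
  then obtain a where a: "\<And>k. a k \<in> S k - S (j k)" by metis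
  define f where "f n = (j ^^ n) 0" for n
  have fS: "f (Suc n) = j (f n)" for n unfolding f_def by simp
  have sm: "strict_mono f" using j(1) fS by (simp add: strict_mono_Suc_iff)
  have "length (a (f i)) = s" for i using a assms(3) by blast
  from dickson[of "\<lambda>i. a (f i)", OF this] obtain g :: "nat \<Rightarrow> nat" where
    g: "strict_mono g" "\<forall>i j. i \<le> j \<longrightarrow> list_all2 (\<le>) (a (f (g i))) (a (f (g j)))" by (elim exE conjE)
  have "f (Suc (g 0)) \<le> f (g 1)" using g(1) sm by (simp add: strict_mono_less_eq strict_mono_Suc_iff Suc_le_eq)
  hence "a (f (g 1)) \<in> S (f (Suc (g 0)))" using a anti by blast
  hence "a (f (g 0)) \<in> S (f (Suc (g 0)))" using g(2)[rule_format, of 0 1] assms(1) unfolding down_closed_def by auto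
  thus False using a[of "f (g 0)"] fS by auto
qed

text \<open>The coefficient is required to be positive so that leading terms cannot cancel in sums;
  this makes the zero function a separate case.\<close>

definition rational_growth :: "(nat \<Rightarrow> nat) \<Rightarrow> bool" where
  "rational_growth f \<longleftrightarrow> (\<forall>n. f n = 0) \<or>
     (\<exists>e q. q \<in> \<rat> \<and> 0 < q \<and> (\<lambda>n. real (f n) / real n ^ e) \<longlonglongrightarrow> q)"

lemma tendsto_over_higher_power:
  assumes "(\<lambda>n. real (f n) / real n ^ e) \<longlonglongrightarrow> q" "e < h"
  shows "(\<lambda>n. real (f n) / real n ^ h) \<longlonglongrightarrow> 0"
proof -
  have "(\<lambda>n. real (f n) / real n ^ e * (1 / real n ^ (h - e))) \<longlonglongrightarrow> q * 0"
  proof (intro tendsto_mult assms(1))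
    have "(\<lambda>n. (1 / real n) ^ (h - e)) \<longlonglongrightarrow> 0 ^ (h - e)" by (intro tendsto_power lim_1_over_n)
    thus "(\<lambda>n. 1 / real n ^ (h - e)) \<longlonglongrightarrow> 0" using assms(2) by (simp add: power_one_over zero_power)
  qed
  moreover have "(\<lambda>n. real (f n) / real n ^ e * (1 / real n ^ (h - e))) = (\<lambda>n. real (f n) / real n ^ h)"
    using assms(2) by (simp add: fun_eq_iff power_add[symmetric])
  ultimately show ?thesis by (simp only: mult_zero_right)
qed

lemma rational_growth_add:
  assumes "rational_growth f" "rational_growth g"
  shows "rational_growth (\<lambda>n. f n + g n)"
proof (cases "(\<forall>n. f n = 0) \<or> (\<forall>n. g n = 0)")
  case True
  hence "(\<lambda>n. f n + g n) = g \<or> (\<lambda>n. f n + g n) = f" by auto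
  thus ?thesis using assms by auto
next
  case False
  then obtain e q e' q' where 1: "q \<in> \<rat>" "0 < q" "(\<lambda>n. real (f n) / real n ^ e) \<longlonglongrightarrow> q"
    and 2: "q' \<in> \<rat>" "0 < q'" "(\<lambda>n. real (g n) / real n ^ e') \<longlonglongrightarrow> q'"
    using assms unfolding rational_growth_def by blast
  consider "e = e'" | "e < e'" | "e' < e" by linarith
  thus ?thesis
  proof cases
    case 1
    have "(\<lambda>n. real (f n) / real n ^ e + real (g n) / real n ^ e) \<longlonglongrightarrow> q + q'"
      using \<open>(\<lambda>n. real (f n) / real n ^ e) \<longlonglongrightarrow> q\<close> 2(3) unfolding 1 by (rule tendsto_add)
    thus ?thesis unfolding rational_growth_def using \<open>q \<in> \<rat>\<close> \<open>0 < q\<close> 2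
      by (intro disjI2 exI[of _ e] exI[of _ "q + q'"]) (auto simp: add_divide_distrib)
  next
    case c: 2
    have "(\<lambda>n. real (f n) / real n ^ e' + real (g n) / real n ^ e') \<longlonglongrightarrow> 0 + q'"
      using tendsto_over_higher_power[OF 1(3) c] 2(3) by (rule tendsto_add)
    thus ?thesis unfolding rational_growth_def using 2
      by (intro disjI2 exI[of _ e'] exI[of _ q']) (auto simp: add_divide_distrib)
  next
    case c: 3
    have "(\<lambda>n. real (f n) / real n ^ e + real (g n) / real n ^ e) \<longlonglongrightarrow> q + 0"
      using 1(3) tendsto_over_higher_power[OF 2(3) c] by (rule tendsto_add)
    thus ?thesis unfolding rational_growth_def using 1
      by (intro disjI2 exI[of _ e] exI[of _ q]) (auto simp: add_divide_distrib)
  qed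
qed

lemma tendsto_shift_ratio: "(\<lambda>n. real (n - d) / real n) \<longlonglongrightarrow> 1"
proof -
  have "(\<lambda>n. 1 - real d * (1 / real n)) \<longlonglongrightarrow> 1 - real d * 0"
    by (intro tendsto_intros lim_1_over_n)
  moreover have "eventually (\<lambda>n. 1 - real d * (1 / real n) = real (n - d) / real n) sequentially"
    using eventually_ge_at_top[of "Suc d"] by eventually_elim (auto simp: field_simps of_nat_diff)
  ultimately have "(\<lambda>n. real (n - d) / real n) \<longlonglongrightarrow> 1 - real d * 0" by (rule Lim_transform_eventually)
  thus ?thesis by simp
qed

lemma tendsto_shift:
  assumes "(\<lambda>n. real (f n) / real n ^ e) \<longlonglongrightarrow> q"
  shows "(\<lambda>n. real (f (n - d)) / real n ^ e) \<longlonglongrightarrow> q"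
proof -
  have "(\<lambda>n. real (f (n - d)) / real (n - d) ^ e * (real (n - d) / real n) ^ e) \<longlonglongrightarrow> q * 1 ^ e"
    by (intro tendsto_mult tendsto_power tendsto_shift_ratio
          filterlim_compose[OF assms filterlim_minus_const_nat_at_top])
  moreover have "eventually (\<lambda>n. real (f (n - d)) / real (n - d) ^ e * (real (n - d) / real n) ^ e
     = real (f (n - d)) / real n ^ e) sequentially"
    using eventually_ge_at_top[of "Suc d"] by eventually_elim (auto simp: power_divide)
  ultimately have "(\<lambda>n. real (f (n - d)) / real n ^ e) \<longlonglongrightarrow> q * 1 ^ e" by (rule Lim_transform_eventually)
  thus ?thesis by simp
qed

lemma rational_growth_shift:
  assumes "rational_growth f"
  shows "rational_growth (\<lambda>n. if n < d then 0 else f (n - d))"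
proof (cases "\<forall>n. f n = 0")
  case True thus ?thesis unfolding rational_growth_def by auto
next
  case False
  then obtain e q where 1: "q \<in> \<rat>" "0 < q" "(\<lambda>n. real (f n) / real n ^ e) \<longlonglongrightarrow> q"
    using assms unfolding rational_growth_def by blast
  have "eventually (\<lambda>n. real (f (n - d)) / real n ^ e = real (if n < d then 0 else f (n - d)) / real n ^ e) sequentially"
    using eventually_ge_at_top[of d] by eventually_elim auto
  hence "(\<lambda>n. real (if n < d then 0 else f (n - d)) / real n ^ e) \<longlonglongrightarrow> q"
    by (rule Lim_transform_eventually[OF tendsto_shift[OF 1(3)]])
  thus ?thesis unfolding rational_growth_def using 1 by blast
qed

text \<open>The Stolz-Cesaro theorem for differences over steps of length d. The error |g - c P| is
  bounded by telescoping along n, n - d, n - 2d, ... down to a finite initial range.\<close>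

lemma stolz_step:
  fixes g P :: "nat \<Rightarrow> real"
  assumes d: "d \<ge> 1" and P: "filterlim P at_top sequentially" "strict_mono P" "\<And>n. P n \<ge> 0"
    and lim: "(\<lambda>n. (g n - g (n - d)) / (P n - P (n - d))) \<longlonglongrightarrow> c"
  shows "(\<lambda>n. g n / P n) \<longlonglongrightarrow> c"
proof (rule LIMSEQ_I)
  fix r :: real assume r: "0 < r"
  define \<epsilon> where "\<epsilon> = r / 3"
  have \<epsilon>: "\<epsilon> > 0" unfolding \<epsilon>_def using r by simp
  obtain N0 where N0: "\<And>n. n \<ge> N0 \<Longrightarrow> norm ((g n - g (n - d)) / (P n - P (n - d)) - c) < \<epsilon>"
    using LIMSEQ_D[OF lim \<epsilon>] by blast
  define N where "N = max N0 d"
  \<comment> \<open>Absorbs the starting values below \<open>N\<close>, where the telescoping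
    stops.\<close>
  define M where "M = (\<Sum>n<N. \<bar>g n - c * P n\<bar>)"
  have M: "\<bar>g n - c * P n\<bar> \<le> \<epsilon> * P n + M" for n
  proof (induction n rule: less_induct)
    case (less n)
    show ?case
    proof (cases "n < N")
      case True
      hence "\<bar>g n - c * P n\<bar> \<le> M" unfolding M_def by (intro member_le_sum) auto
      thus ?thesis using \<epsilon> P(3)[of n] by (simp add: add_increasing)
    next
      case False
      hence n: "n \<ge> N0" "n \<ge> d" unfolding N_def by auto
      hence Pn: "P n - P (n - d) > 0" using d P(2) by (simp add: strict_mono_less)
      have "\<bar>(g n - g (n - d)) / (P n - P (n - d)) - c\<bar> * (P n - P (n - d)) \<le> \<epsilon> * (P n - P (n - d))"
        using N0[OF n(1)] Pn by (intro mult_right_mono) auto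
      also have "\<bar>(g n - g (n - d)) / (P n - P (n - d)) - c\<bar> * (P n - P (n - d))
         = \<bar>((g n - g (n - d)) / (P n - P (n - d)) - c) * (P n - P (n - d))\<bar>"
        using Pn by (simp add: abs_mult)
      also have "((g n - g (n - d)) / (P n - P (n - d)) - c) * (P n - P (n - d)) = g n - g (n - d) - c * (P n - P (n - d))"
        using Pn by (simp add: field_simps)
      finally have 1: "\<bar>g n - g (n - d) - c * (P n - P (n - d))\<bar> \<le> \<epsilon> * (P n - P (n - d))" .
      have 2: "\<bar>g (n - d) - c * P (n - d)\<bar> \<le> \<epsilon> * P (n - d) + M" using less n d by simp
      have "g n - c * P n = (g n - g (n - d) - c * (P n - P (n - d))) + (g (n - d) - c * P (n - d))"
        by (simp add: algebra_simps)
      hence "\<bar>g n - c * P n\<bar> \<le> \<epsilon> * (P n - P (n - d)) + (\<epsilon> * P (n - d) + M)" using 1 2 by linarith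
      thus ?thesis by (simp add: algebra_simps)
    qed
  qed
  have "eventually (\<lambda>n. P n \<ge> max 1 (M / \<epsilon>)) sequentially" using P(1) unfolding filterlim_at_top by blast
  then obtain N1 where N1: "\<And>n. n \<ge> N1 \<Longrightarrow> P n \<ge> max 1 (M / \<epsilon>)" unfolding eventually_sequentially by blast
  have "norm (g n / P n - c) < r" if "n \<ge> N1" for n
  proof -
    have p: "P n \<ge> 1" "P n \<ge> M / \<epsilon>" using N1[OF that] by auto
    have "M \<le> \<epsilon> * P n" using p(2) \<epsilon> by (simp add: field_simps)
    hence "\<bar>g n - c * P n\<bar> \<le> 2 * \<epsilon> * P n" using M[of n] by linarith
    hence "\<bar>g n - c * P n\<bar> / P n \<le> 2 * \<epsilon>" using p by (simp add: field_simps)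
    moreover have "(g n - c * P n) / P n = g n / P n - c" using p by (simp add: field_simps)
    hence "\<bar>g n - c * P n\<bar> / P n = \<bar>g n / P n - c\<bar>" using p by (metis abs_divide abs_of_pos less_le_trans zero_less_one)
    ultimately show ?thesis using r unfolding \<epsilon>_def by simp
  qed
  thus "\<exists>no. \<forall>n\<ge>no. norm (g n / P n - c) < r" by blast
qed

text \<open>If f is asymptotic to q n^e, then g is compared with n^(e + 1), whose difference over a
  step of length d is asymptotic to d (e + 1) n^e. The coefficient of g is q / (d (e + 1)).\<close>

lemma rational_growth_rec:
  assumes f: "rational_growth f" and d: "d \<ge> 1"
    and g: "\<And>n. g n = f n + (if n < d then 0 else g (n - d))"
  shows "rational_growth g"
proof (cases "\<forall>n. f n = 0")
  case True
  have "g n = 0" for n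
  proof (induction n rule: less_induct)
    case (less n) thus ?case using g[of n] True d by auto
  qed
  thus ?thesis unfolding rational_growth_def by blast
next
  case False
  then obtain e q where 1: "q \<in> \<rat>" "0 < q" "(\<lambda>n. real (f n) / real n ^ e) \<longlonglongrightarrow> q"
    using f unfolding rational_growth_def by blast
  define P where "P n = real n ^ Suc e" for n
  have Pd: "(P n - P (n - d)) / real n ^ e = real d * (\<Sum>p<Suc e. (real (n - d) / real n) ^ (e - p))" if n: "n \<ge> d" "n \<ge> 1" for n
  proof -
    have "P n - P (n - d) = (real n - real (n - d)) * (\<Sum>p<Suc e. real n ^ p * real (n - d) ^ (e - p))"
      unfolding P_def by (rule diff_power_eq_sum)
    also have "real n - real (n - d) = real d" using n by (simp add: of_nat_diff)
    finally have "(P n - P (n - d)) / real n ^ e = real d * (\<Sum>p<Suc e. real n ^ p * real (n - d) ^ (e - p) / real n ^ e)"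
      by (simp only: sum_divide_distrib times_divide_eq_right[symmetric])
    also have "(\<Sum>p<Suc e. real n ^ p * real (n - d) ^ (e - p) / real n ^ e) = (\<Sum>p<Suc e. (real (n - d) / real n) ^ (e - p))"
    proof (rule sum.cong[OF refl])
      fix p assume "p \<in> {..<Suc e}"
      hence "real n ^ e = real n ^ p * real n ^ (e - p)" by (simp add: power_add[symmetric])
      thus "real n ^ p * real (n - d) ^ (e - p) / real n ^ e = (real (n - d) / real n) ^ (e - p)"
        using n by (simp add: power_divide)
    qed
    finally show ?thesis .
  qed
  have "(\<lambda>n. real d * (\<Sum>p<Suc e. (real (n - d) / real n) ^ (e - p))) \<longlonglongrightarrow> real d * (\<Sum>p<Suc e. 1 ^ (e - p))"
    by (intro tendsto_mult tendsto_const tendsto_sum tendsto_power tendsto_shift_ratio)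
  moreover have "eventually (\<lambda>n. real d * (\<Sum>p<Suc e. (real (n - d) / real n) ^ (e - p)) = (P n - P (n - d)) / real n ^ e) sequentially"
    using eventually_ge_at_top[of "max d 1"] by eventually_elim (use Pd in auto)
  ultimately have Pl: "(\<lambda>n. (P n - P (n - d)) / real n ^ e) \<longlonglongrightarrow> real d * real (Suc e)"
    by (simp add: Lim_transform_eventually)
  have "(\<lambda>n. (real (f n) / real n ^ e) / ((P n - P (n - d)) / real n ^ e)) \<longlonglongrightarrow> q / (real d * real (Suc e))"
    using 1(3) Pl by (rule tendsto_divide) (use d in auto)
  moreover have "eventually (\<lambda>n. (real (f n) / real n ^ e) / ((P n - P (n - d)) / real n ^ e)
      = (real (g n) - real (g (n - d))) / (P n - P (n - d))) sequentially"
    using eventually_ge_at_top[of "max d 1"]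
  proof eventually_elim
    case (elim n)
    hence "real (g n) - real (g (n - d)) = real (f n)" using g[of n] by auto
    thus ?case using elim by simp
  qed
  ultimately have "(\<lambda>n. (real (g n) - real (g (n - d))) / (P n - P (n - d))) \<longlonglongrightarrow> q / (real d * real (Suc e))"
    by (rule Lim_transform_eventually)
  note lim = this
  have "(\<lambda>n. real (g n) / P n) \<longlonglongrightarrow> q / (real d * real (Suc e))"
  proof (rule stolz_step[OF d _ _ _ lim])
    show "filterlim P at_top sequentially" unfolding P_def
      by (intro filterlim_pow_at_top filterlim_real_sequentially) auto
    show "strict_mono P" unfolding P_def strict_mono_def by (intro allI impI power_strict_mono) auto
    show "P n \<ge> 0" for n unfolding P_def by simp
  qed
  moreover have "q / (real d * real (Suc e)) \<in> \<rat>" using 1 by (intro Rats_divide Rats_mult) auto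
  moreover have "q / (real d * real (Suc e)) > 0" using 1 d by (intro divide_pos_pos mult_pos_pos) auto
  ultimately show ?thesis unfolding rational_growth_def P_def by blast
qed

section \<open>Counting down-closed sets by slices\<close>

definition cnt :: "nat list \<Rightarrow> nat list set \<Rightarrow> nat \<Rightarrow> nat" where
  "cnt ds S n = card {a \<in> S. wt ds a \<le> n}"

lemma finite_wt:
  assumes "\<forall>d\<in>set ds. 1 \<le> d"
  shows "finite {a. length a = length ds \<and> wt ds a \<le> n}"
proof (rule finite_subset)
  have "set a \<subseteq> {..n}" if "length a = length ds" "wt ds a \<le> n" for a
    using that assms
  proof (induction ds a rule: wt.induct)
    case (1 d ds a as)
    have "1 * a \<le> d * a" using 1(4) by (intro mult_right_mono) auto
    also have "d * a \<le> n" using 1(3) by simp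
    finally have "a \<le> n" by simp
    moreover have "set as \<subseteq> {..n}" using 1 by auto
    ultimately show ?case by simp
  qed auto
  thus "{a. length a = length ds \<and> wt ds a \<le> n} \<subseteq> {a. set a \<subseteq> {..n} \<and> length a = length ds}" by auto
  show "finite {a. set a \<subseteq> {..n} \<and> length a = length ds}" by (rule finite_lists_length_eq) simp
qed

text \<open>The slices at a fixed first exponent decrease and become constant from some k on.
  Peeling off the slices below k one by one leaves a set whose slices are all equal, and its count
  satisfies the recursion g(n) = f(n) + g(n - d).\<close>

theorem rational_growth_cnt:
  assumes "\<forall>d\<in>set ds. 1 \<le> d" "down_closed S" "\<And>a. a \<in> S \<Longrightarrow> length a = length ds"
  shows "rational_growth (cnt ds S)"
  using assms
proof (induction ds arbitrary: S)
  case Nil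
  hence "S = {} \<or> S = {[]}" by auto
  thus ?case
  proof
    assume "S = {[]}"
    hence "cnt [] S = (\<lambda>n. 1)" unfolding cnt_def by (auto simp: fun_eq_iff card_1_singleton_iff)
    thus ?thesis unfolding rational_growth_def by (intro disjI2 exI[of _ 0] exI[of _ 1]) auto
  qed (auto simp: cnt_def rational_growth_def)
next
  case (Cons d ds)
  define slice where "slice S j = {as. j # as \<in> S}" for S :: "nat list set" and j
  have dcs: "down_closed (slice S j)" if "down_closed S" for S and j :: nat
    using that unfolding down_closed_def slice_def by auto
  have anti: "slice S (Suc j) \<subseteq> slice S j" if "down_closed S" for S and j :: nat
    using that unfolding down_closed_def slice_def by (auto simp: list_all2_refl)
  \<comment> \<open>Passing to \<open>tail\<close> discards the slice at 0 and renumbers the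
    others.\<close>
  define tail where "tail S = {a # as | a as. Suc a # as \<in> S}" for S
  have slice_tail: "slice (tail S) j = slice S (Suc j)" for S j unfolding slice_def tail_def by auto
  have dct: "down_closed (tail S)" if "down_closed S" for S
    unfolding down_closed_def
  proof (intro ballI allI impI)
    fix a b assume "a \<in> tail S" "list_all2 (\<le>) b a"
    then obtain x as y bs where h: "a = x # as" "b = y # bs" "Suc x # as \<in> S" "y \<le> x" "list_all2 (\<le>) bs as"
      unfolding tail_def by (auto simp: list_all2_Cons2)
    hence "list_all2 (\<le>) (Suc y # bs) (Suc x # as)" by simp
    hence "Suc y # bs \<in> S" using that h(3) unfolding down_closed_def by blast
    thus "b \<in> tail S" using h(2) unfolding tail_def by simp
  qed
  have rec: "cnt (d # ds) S n = cnt ds (slice S 0) n + (if n < d then 0 else cnt (d # ds) (tail S) (n - d))"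
    if len: "\<forall>a\<in>S. length a = Suc (length ds)" for S n
  proof -
    have f: "finite {a. length a = length (d # ds) \<and> wt (d # ds) a \<le> n}" by (rule finite_wt[OF Cons.prems(1)])
    let ?A = "{a \<in> S. wt (d # ds) a \<le> n \<and> hd a = 0}" and ?B = "{a \<in> S. wt (d # ds) a \<le> n \<and> hd a \<noteq> 0}"
    have fin: "finite ?A" "finite ?B" using len by (auto intro!: finite_subset[OF _ f])
    have ne: "\<exists>x as. a = x # as" if "a \<in> S" for a using len that by (cases a) auto
    have u: "{a \<in> S. wt (d # ds) a \<le> n} = ?A \<union> ?B" by blast
    have "?A \<inter> ?B = {}" by blast
    hence 0: "cnt (d # ds) S n = card ?A + card ?B" unfolding cnt_def u
      by (rule card_Un_disjoint[OF fin])
    have "?A = (#) 0 ` {as \<in> slice S 0. wt ds as \<le> n}" unfolding slice_def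
    proof (intro equalityI subsetI)
      fix a assume a: "a \<in> ?A"
      then obtain x as where "a = x # as" using ne by blast
      thus "a \<in> (#) 0 ` {as \<in> {as. 0 # as \<in> S}. wt ds as \<le> n}" using a by auto
    qed auto
    hence A: "card ?A = cnt ds (slice S 0) n" unfolding cnt_def by (simp add: card_image)
    have B: "card ?B = (if n < d then 0 else cnt (d # ds) (tail S) (n - d))"
    proof (cases "n < d")
      case True
      have "?B = {}"
      proof (rule ccontr)
        assume "?B \<noteq> {}"
        then obtain a where a: "a \<in> ?B" by blast
        then obtain x as where x: "a = x # as" using ne by blast
        hence "d * x \<le> n" "1 \<le> x" using a by auto
        hence "d \<le> n" using mult_le_mono2[of 1 x d] by linarith
        thus False using True by simp
      qed
      thus ?thesis using True by (simp only: if_True card.empty)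
    next
      case False
      let ?u = "\<lambda>a :: nat list. Suc (hd a) # tl a"
      have "?B = ?u ` {a \<in> tail S. wt (d # ds) a \<le> n - d}"
      proof (intro equalityI subsetI)
        fix a assume a: "a \<in> ?B"
        then obtain x as where x: "a = x # as" using ne by blast
        then obtain y where y: "x = Suc y" using a by (cases x) auto
        have "y # as \<in> tail S" unfolding tail_def using a x y by auto
        moreover have "wt (d # ds) (y # as) + d \<le> n" using a x y by simp
        hence "wt (d # ds) (y # as) \<le> n - d" by linarith
        ultimately show "a \<in> ?u ` {a \<in> tail S. wt (d # ds) a \<le> n - d}" using x y
          by (intro image_eqI[of _ _ "y # as"]) auto
      next
        fix a assume "a \<in> ?u ` {a \<in> tail S. wt (d # ds) a \<le> n - d}"
        thus "a \<in> ?B" using False unfolding tail_def by auto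
      qed
      moreover have "inj_on ?u {a \<in> tail S. wt (d # ds) a \<le> n - d}"
        unfolding inj_on_def tail_def by auto
      ultimately show ?thesis using False unfolding cnt_def by (simp add: card_image)
    qed
    show ?thesis unfolding 0 A B ..
  qed
  \<comment> \<open>Induction on the place k from which the slices are constant; \<open>tail\<close>
    lowers it by one.\<close>
  have main: "rational_growth (cnt (d # ds) S)"
    if "down_closed S" "\<And>a. a \<in> S \<Longrightarrow> length a = Suc (length ds)" "\<forall>j\<ge>k. slice S j = slice S k" for k S
    using that
  proof (induction k arbitrary: S)
    case 0
    have lenS: "length as = length ds" if "as \<in> slice S 0" for as
      using 0(2) that unfolding slice_def by force
    have ne: "\<exists>x as. a = x # as" if "a \<in> S" for a using 0(2)[OF that] by (cases a) auto
    have sl: "slice S (Suc x) = slice S x" for x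
      by (rule trans[OF 0(3)[rule_format, of "Suc x"] 0(3)[rule_format, of x, symmetric]]) simp_all
    \<comment> \<open>All slices being equal, raising the first exponent maps S onto its part with
      positive first exponent; so \<open>tail\<close> fixes S and the count recurs to
      itself.\<close>
    have ts: "tail S = S"
    proof (intro equalityI subsetI)
      fix a assume "a \<in> tail S"
      then obtain x as where "a = x # as" "as \<in> slice S (Suc x)" unfolding tail_def slice_def by auto
      hence "as \<in> slice S x" unfolding sl by simp
      thus "a \<in> S" using \<open>a = x # as\<close> unfolding slice_def by simp
    next
      fix a assume a: "a \<in> S"
      then obtain x as where x: "a = x # as" using ne by blast
      hence "as \<in> slice S x" using a unfolding slice_def by simp
      hence "as \<in> slice S (Suc x)" unfolding sl .
      thus "a \<in> tail S" using x unfolding tail_def slice_def by auto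
    qed
    have 1: "rational_growth (cnt ds (slice S 0))"
      by (rule Cons.IH) (use Cons.prems(1) dcs[OF 0(1)] lenS in auto)
    have d: "1 \<le> d" using Cons.prems(1) by simp
    have "cnt (d # ds) S n = cnt ds (slice S 0) n + (if n < d then 0 else cnt (d # ds) S (n - d))" for n
    proof -
      have "\<forall>a\<in>S. length a = Suc (length ds)" using 0(2) by blast
      from rec[OF this, of n] show ?thesis unfolding ts .
    qed
    thus ?case by (rule rational_growth_rec[OF 1 d])
  next
    case (Suc k)
    have lenS: "length as = length ds" if "as \<in> slice S 0" for as
      using Suc.prems(2) that unfolding slice_def by force
    have 1: "rational_growth (cnt ds (slice S 0))"
      by (rule Cons.IH) (use Cons.prems(1) dcs[OF Suc.prems(1)] lenS in auto)
    have 2: "rational_growth (cnt (d # ds) (tail S))"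
    proof (rule Suc.IH)
      show "down_closed (tail S)" by (rule dct[OF Suc.prems(1)])
      show "length a = Suc (length ds)" if "a \<in> tail S" for a using that Suc.prems(2) unfolding tail_def by fastforce
      show "\<forall>j\<ge>k. slice (tail S) j = slice (tail S) k" unfolding slice_tail using Suc.prems(3) by (metis Suc_le_mono le_refl)
    qed
    have "cnt (d # ds) S = (\<lambda>n. cnt ds (slice S 0) n + (if n < d then 0 else cnt (d # ds) (tail S) (n - d)))"
    proof
      fix n
      have "\<forall>a\<in>S. length a = Suc (length ds)" using Suc.prems(2) by blast
      from rec[OF this, of n] show "cnt (d # ds) S n = cnt ds (slice S 0) n + (if n < d then 0 else cnt (d # ds) (tail S) (n - d))" .
    qed
    thus ?case using rational_growth_add[OF 1 rational_growth_shift[OF 2]] by simp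
  qed
  have "\<exists>k. \<forall>j\<ge>k. slice S j = slice S k"
    by (rule down_closed_stabilise[where s = "length ds"])
      (use dcs[OF Cons.prems(2)] anti[OF Cons.prems(2)] Cons.prems(3) in \<open>force simp: slice_def\<close>)+
  thus ?case using main[OF Cons.prems(2)] Cons.prems(3) by auto
qed

text \<open>For f not identically zero the bound forces e \<le> h, since the leading coefficient is
  positive; the limit is q h! for e = h and 0 otherwise. The argument n - 1 reflects that the n-th
  differential power is defined by operators of order at most n - 1.\<close>

lemma rational_growth_limit:
  assumes "rational_growth f" "\<And>n. f n \<le> C * Suc n ^ h"
  shows "\<exists>q\<in>\<rat>. (\<lambda>n. real (f (n - 1)) / (real n ^ h / fact h)) \<longlonglongrightarrow> q"
proof (cases "\<forall>n. f n = 0")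
  case True thus ?thesis by (intro bexI[of _ 0]) auto
next
  case False
  then obtain e q where 1: "q \<in> \<rat>" "0 < q" "(\<lambda>n. real (f n) / real n ^ e) \<longlonglongrightarrow> q"
    using assms(1) unfolding rational_growth_def by blast
  have eh: "e \<le> h"
  proof (rule ccontr)
    assume "\<not> e \<le> h"
    hence he: "h < e" by simp
    have "(\<lambda>n. real C * (real (Suc n) / real n) ^ h * (1 / real n) ^ (e - h)) \<longlonglongrightarrow> real C * 1 ^ h * 0 ^ (e - h)"
      by (intro tendsto_mult tendsto_const tendsto_power lim_1_over_n LIMSEQ_Suc_n_over_n)
    hence z: "(\<lambda>n. real C * (real (Suc n) / real n) ^ h * (1 / real n) ^ (e - h)) \<longlonglongrightarrow> 0"
      using he by (simp add: zero_power)
    have "eventually (\<lambda>n. real (f n) / real n ^ e \<le> real C * (real (Suc n) / real n) ^ h * (1 / real n) ^ (e - h)) sequentially"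
      using eventually_ge_at_top[of 1]
    proof eventually_elim
      case (elim n)
      have "real (f n) \<le> real (C * Suc n ^ h)" using assms(2)[of n] of_nat_le_iff by blast
      hence "real (f n) / real n ^ e \<le> real C * real (Suc n) ^ h / real n ^ e"
        by (intro divide_right_mono) auto
      also have "real n ^ e = real n ^ h * real n ^ (e - h)" using he by (simp add: power_add[symmetric])
      finally show ?case using he by (simp add: power_divide power_add[symmetric])
    qed
    from LIMSEQ_le[OF 1(3) z] this have "q \<le> 0" unfolding eventually_sequentially by blast
    thus False using 1(2) by simp
  qed
  have "\<exists>q\<in>\<rat>. (\<lambda>n. real (f (n - 1)) / real n ^ h) \<longlonglongrightarrow> q"
  proof (cases "e = h")
    case True thus ?thesis using tendsto_shift[OF 1(3)] 1(1) by auto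
  next
    case False
    hence "e < h" using eh by simp
    from tendsto_shift[OF tendsto_over_higher_power[OF 1(3) this]] show ?thesis by (intro bexI[of _ 0]) auto
  qed
  then obtain q where q: "q \<in> \<rat>" "(\<lambda>n. real (f (n - 1)) / real n ^ h) \<longlonglongrightarrow> q" by blast
  have "(\<lambda>n. real (f (n - 1)) / real n ^ h * fact h) \<longlonglongrightarrow> q * fact h"
    using q(2) by (intro tendsto_mult tendsto_const)
  moreover have "q * fact h \<in> \<rat>" using q(1) by (metis Rats_mult Rats_of_nat of_nat_fact)
  ultimately show ?thesis by (intro bexI[of _ "q * fact h"]) auto
qed

section \<open>Differential operators\<close>

text \<open>K acts on R through its image \<open>KK\<close>, and linearity is tested against
  \<open>KK\<close>. The completion is later made a second instance.\<close>

locale kalg = cring R for K :: "('k, 'p) ring_scheme" and R :: "('k, 'a, 'q) module_scheme" (structure) +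
  assumes smult_sm: "k \<in> carrier K \<Longrightarrow> x \<in> carrier R \<Longrightarrow> k \<odot>\<^bsub>R\<^esub> x = structure_map R k \<otimes> x"
    and sm_closed: "k \<in> carrier K \<Longrightarrow> structure_map R k \<in> carrier R"
begin

abbreviation KK :: "'a set" where "KK \<equiv> structure_map R ` carrier K"

abbreviation klen :: "'a set \<Rightarrow> 'a set \<Rightarrow> enat" where "klen \<equiv> len (sublat R KK)"

lemma KK_carrier: "KK \<subseteq> carrier R" using sm_closed by auto

lemma linear_endos_iff:
  "f \<in> linear_endos K R \<longleftrightarrow> f \<in> carrier R \<rightarrow>\<^sub>E carrier R \<and>
     (\<forall>x \<in> carrier R. \<forall>y \<in> carrier R. f (x \<oplus> y) = f x \<oplus> f y) \<and>
     (\<forall>a \<in> KK. \<forall>x \<in> carrier R. f (a \<otimes> x) = a \<otimes> f x)"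
proof -
  have "(\<forall>k \<in> carrier K. \<forall>x \<in> carrier R. f (k \<odot>\<^bsub>R\<^esub> x) = k \<odot>\<^bsub>R\<^esub> f x) \<longleftrightarrow>
        (\<forall>a \<in> KK. \<forall>x \<in> carrier R. f (a \<otimes> x) = a \<otimes> f x)" if "f \<in> carrier R \<rightarrow>\<^sub>E carrier R"
    using smult_sm PiE_mem[OF that] by simp
  thus ?thesis unfolding linear_endos_def by blast
qed

abbreviation Lin :: "('a \<Rightarrow> 'a) set" where "Lin \<equiv> linear_endos K R"

definition oadd :: "('a \<Rightarrow> 'a) \<Rightarrow> ('a \<Rightarrow> 'a) \<Rightarrow> 'a \<Rightarrow> 'a" where
  "oadd f g = (\<lambda>x\<in>carrier R. f x \<oplus> g x)"
definition osc :: "'a \<Rightarrow> ('a \<Rightarrow> 'a) \<Rightarrow> 'a \<Rightarrow> 'a" where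
  "osc r f = (\<lambda>x\<in>carrier R. r \<otimes> f x)"
definition ozero :: "'a \<Rightarrow> 'a" where "ozero = (\<lambda>x\<in>carrier R. \<zero>)"
definition oid :: "'a \<Rightarrow> 'a" where "oid = (\<lambda>x\<in>carrier R. x)"
abbreviation ocomp :: "('a \<Rightarrow> 'a) \<Rightarrow> ('a \<Rightarrow> 'a) \<Rightarrow> 'a \<Rightarrow> 'a" where
  "ocomp f g \<equiv> compose (carrier R) f g"

text \<open>Operators of order less than \<open>n\<close>, so that the zero operator is the only element for \<open>n = 0\<close>.\<close>

definition Dlt :: "nat \<Rightarrow> ('a \<Rightarrow> 'a) set" where
  "Dlt n = filt_pred (diffop_ring K R) (diffop K R) n"

lemma Dlt_0: "Dlt 0 = {ozero}" unfolding Dlt_def filt_pred_def ozero_def diffop_ring_def by simp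
lemma Dlt_Suc_diffop: "Dlt (Suc n) = diffop K R n" unfolding Dlt_def filt_pred_def by simp

lemma linD:
  assumes "f \<in> Lin"
  shows "x \<in> carrier R \<Longrightarrow> f x \<in> carrier R"
    "x \<in> carrier R \<Longrightarrow> y \<in> carrier R \<Longrightarrow> f (x \<oplus> y) = f x \<oplus> f y"
    "a \<in> KK \<Longrightarrow> x \<in> carrier R \<Longrightarrow> f (a \<otimes> x) = a \<otimes> f x"
    "f \<in> extensional (carrier R)"
  using assms unfolding linear_endos_iff PiE_def by auto

lemma lin_zero: assumes "f \<in> Lin" shows "f \<zero> = \<zero>"
proof -
  have "f \<zero> \<oplus> f \<zero> = f \<zero> \<oplus> \<zero>" using linD(1,2)[OF assms] by (metis r_zero zero_closed)
  thus ?thesis using linD(1)[OF assms] add.l_cancel zero_closed by blast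
qed

lemma lin_neg: assumes "f \<in> Lin" "x \<in> carrier R" shows "f (\<ominus> x) = \<ominus> f x"
proof -
  have "f (\<ominus> x) \<oplus> f x = \<zero>"
    using linD(2)[OF assms(1), of "\<ominus> x" x] assms(2) lin_zero[OF assms(1)] by (simp add: l_neg)
  thus ?thesis using assms linD(1)[OF assms(1)] by (intro minus_equality[symmetric]) auto
qed

lemma lin_minus:
  assumes "f \<in> Lin" "x \<in> carrier R" "y \<in> carrier R" shows "f (x \<ominus> y) = f x \<ominus> f y"
  using assms linD(2)[OF assms(1)] lin_neg[OF assms(1)] by (simp add: a_minus_def)

lemma op_eqI:
  assumes "f \<in> extensional (carrier R)" "g \<in> extensional (carrier R)" "\<And>x. x \<in> carrier R \<Longrightarrow> f x = g x"
  shows "f = g"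
  using assms by (rule extensionalityI)

lemma op_apply [simp]:
  "x \<in> carrier R \<Longrightarrow> oadd f g x = f x \<oplus> g x" "x \<in> carrier R \<Longrightarrow> osc r f x = r \<otimes> f x"
  "x \<in> carrier R \<Longrightarrow> ozero x = \<zero>" "x \<in> carrier R \<Longrightarrow> oid x = x"
  "x \<in> carrier R \<Longrightarrow> ocomp f g x = f (g x)"
  "x \<in> carrier R \<Longrightarrow> commutator R f r x = f (r \<otimes> x) \<ominus> r \<otimes> f x"
  unfolding oadd_def osc_def ozero_def oid_def commutator_def compose_def by auto

lemma op_ext [simp]:
  "oadd f g \<in> extensional (carrier R)" "osc r f \<in> extensional (carrier R)"
  "ozero \<in> extensional (carrier R)" "oid \<in> extensional (carrier R)"
  "ocomp f g \<in> extensional (carrier R)" "commutator R f r \<in> extensional (carrier R)"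
  unfolding oadd_def osc_def ozero_def oid_def commutator_def by auto

lemma linI:
  assumes "f \<in> extensional (carrier R)" "\<And>x. x \<in> carrier R \<Longrightarrow> f x \<in> carrier R"
    "\<And>x y. x \<in> carrier R \<Longrightarrow> y \<in> carrier R \<Longrightarrow> f (x \<oplus> y) = f x \<oplus> f y"
    "\<And>a x. a \<in> KK \<Longrightarrow> x \<in> carrier R \<Longrightarrow> f (a \<otimes> x) = a \<otimes> f x"
  shows "f \<in> Lin"
  using assms unfolding linear_endos_iff PiE_def by auto

lemma KKc: "a \<in> KK \<Longrightarrow> a \<in> carrier R" using KK_carrier by blast

lemma lin_ops:
  assumes "f \<in> Lin" "g \<in> Lin" "r \<in> carrier R"
  shows "oadd f g \<in> Lin" "osc r f \<in> Lin" "ocomp f g \<in> Lin"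
    "commutator R f r \<in> Lin"
proof -
  note f = linD[OF assms(1)] and g = linD[OF assms(2)]
  show "oadd f g \<in> Lin"
    by (rule linI) (use f g KKc in \<open>auto simp: a_ac r_distr\<close>)
  show "osc r f \<in> Lin"
    by (rule linI) (use f assms(3) KKc in \<open>auto simp: r_distr m_lcomm\<close>)
  show "ocomp f g \<in> Lin"
    by (rule linI) (use f g KKc in auto)
  show "commutator R f r \<in> Lin"
  proof (rule linI)
    fix x y assume xy: "x \<in> carrier R" "y \<in> carrier R"
    have "f (r \<otimes> (x \<oplus> y)) \<ominus> r \<otimes> f (x \<oplus> y) = (f (r \<otimes> x) \<oplus> f (r \<otimes> y)) \<ominus> r \<otimes> (f x \<oplus> f y)"
      using f xy assms(3) by (simp add: r_distr)
    also have "\<dots> = (f (r \<otimes> x) \<ominus> r \<otimes> f x) \<oplus> (f (r \<otimes> y) \<ominus> r \<otimes> f y)"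
      using f(1)[OF xy(1)] f(1)[OF xy(2)] f(1)[of "r \<otimes> x"] f(1)[of "r \<otimes> y"] assms(3) xy by algebra
    finally show "commutator R f r (x \<oplus> y) = commutator R f r x \<oplus> commutator R f r y" using xy by simp
  next
    fix a x assume a: "a \<in> KK" and x: "x \<in> carrier R"
    have ac: "a \<in> carrier R" using a KKc by blast
    have "f (r \<otimes> (a \<otimes> x)) = a \<otimes> f (r \<otimes> x)" using f(3)[OF a, of "r \<otimes> x"] x ac assms(3) by (simp add: m_lcomm)
    hence "f (r \<otimes> (a \<otimes> x)) \<ominus> r \<otimes> f (a \<otimes> x) = a \<otimes> f (r \<otimes> x) \<ominus> r \<otimes> (a \<otimes> f x)" using f(3)[OF a x] by simp
    also have "\<dots> = a \<otimes> (f (r \<otimes> x) \<ominus> r \<otimes> f x)" using f(1)[OF x] f(1)[of "r \<otimes> x"] assms(3) x ac by algebra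
    finally show "commutator R f r (a \<otimes> x) = a \<otimes> commutator R f r x" using x ac by simp
  qed (use f assms(3) in auto)
qed

lemma lin_basic: "ozero \<in> Lin" "oid \<in> Lin"
  by (rule linI; use KKc in auto)+

text \<open>With the zero operator as bottom step the recursion is uniform: operators of order 0 are
  the K-linear maps all of whose commutators vanish. Inductions on the order can thus start at the
  zero operator.\<close>

lemma Dlt_Suc: "Dlt (Suc n) = {f \<in> Lin. \<forall>r\<in>carrier R. commutator R f r \<in> Dlt n}"
proof (cases n)
  case (Suc k) thus ?thesis by (simp add: Dlt_Suc_diffop)
next
  case 0
  have "f \<in> ring_linear_endos R \<longleftrightarrow> f \<in> Lin \<and> (\<forall>r\<in>carrier R. commutator R f r = ozero)" for f
  proof
    assume f: "f \<in> ring_linear_endos R"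
    have fl: "f \<in> Lin"
      by (rule linI) (use f KKc in \<open>auto simp: ring_linear_endos_def PiE_def\<close>)
    have "commutator R f r = ozero" if "r \<in> carrier R" for r
      by (rule op_eqI) (use f that linD(1)[OF fl] in \<open>auto simp: ring_linear_endos_def r_neg a_minus_def\<close>)
    thus "f \<in> Lin \<and> (\<forall>r\<in>carrier R. commutator R f r = ozero)" using fl by blast
  next
    assume f: "f \<in> Lin \<and> (\<forall>r\<in>carrier R. commutator R f r = ozero)"
    have "f (r \<otimes> x) = r \<otimes> f x" if "r \<in> carrier R" "x \<in> carrier R" for r x
    proof -
      have "f (r \<otimes> x) \<ominus> r \<otimes> f x = \<zero>" using f that op_apply(6)[of x f r] by simp
      thus ?thesis using that linD(1)[of f] f by simp
    qed
    thus "f \<in> ring_linear_endos R" using f unfolding ring_linear_endos_def linear_endos_def by auto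
  qed
  thus ?thesis unfolding 0 Dlt_Suc_diffop Dlt_0 by auto
qed

lemma Dlt_lin: "f \<in> Dlt n \<Longrightarrow> f \<in> Lin"
  using lin_basic by (cases n) (auto simp: Dlt_0 Dlt_Suc)

lemma Dlt_comm: "f \<in> Dlt (Suc n) \<Longrightarrow> r \<in> carrier R \<Longrightarrow> commutator R f r \<in> Dlt n"
  by (simp add: Dlt_Suc)

lemma ozero_Dlt: "ozero \<in> Dlt n"
proof (induction n)
  case (Suc n)
  have "commutator R ozero r = ozero" if "r \<in> carrier R" for r
    by (rule op_eqI) (use that in auto)
  thus ?case using Suc lin_basic by (simp add: Dlt_Suc)
qed (simp add: Dlt_0)

lemma Dlt_oadd: "f \<in> Dlt n \<Longrightarrow> g \<in> Dlt n \<Longrightarrow> oadd f g \<in> Dlt n"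
proof (induction n arbitrary: f g)
  case 0
  have "oadd ozero ozero = ozero" by (rule op_eqI) auto
  thus ?case using 0 by (simp add: Dlt_0)
next
  case (Suc n)
  note l = linD(1)[OF Dlt_lin[OF Suc.prems(1)]] linD(1)[OF Dlt_lin[OF Suc.prems(2)]]
  have "commutator R (oadd f g) r = oadd (commutator R f r) (commutator R g r)" if r: "r \<in> carrier R" for r
  proof (rule op_eqI)
    fix x assume x: "x \<in> carrier R"
    have c: "f (r \<otimes> x) \<in> carrier R" "f x \<in> carrier R" "g (r \<otimes> x) \<in> carrier R" "g x \<in> carrier R" using l r x by auto
    have "f (r \<otimes> x) \<oplus> g (r \<otimes> x) \<ominus> r \<otimes> (f x \<oplus> g x) = f (r \<otimes> x) \<ominus> r \<otimes> f x \<oplus> (g (r \<otimes> x) \<ominus> r \<otimes> g x)"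
      using c r by algebra
    thus "commutator R (oadd f g) r x = oadd (commutator R f r) (commutator R g r) x" using x r by simp
  qed auto
  thus ?case using Suc lin_ops(1)[OF _ _ one_closed, of f g] by (simp add: Dlt_Suc)
qed

lemma Dlt_osc: "f \<in> Dlt n \<Longrightarrow> s \<in> carrier R \<Longrightarrow> osc s f \<in> Dlt n"
proof (induction n arbitrary: f)
  case 0
  have "osc s ozero = ozero" by (rule op_eqI) (use 0 in auto)
  thus ?case using 0 by (simp add: Dlt_0)
next
  case (Suc n)
  note l = linD(1)[OF Dlt_lin[OF Suc.prems(1)]]
  have "commutator R (osc s f) r = osc s (commutator R f r)" if r: "r \<in> carrier R" for r
  proof (rule op_eqI)
    fix x assume x: "x \<in> carrier R"
    have c: "f (r \<otimes> x) \<in> carrier R" "f x \<in> carrier R" using l r x by auto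
    have "s \<otimes> f (r \<otimes> x) \<ominus> r \<otimes> (s \<otimes> f x) = s \<otimes> (f (r \<otimes> x) \<ominus> r \<otimes> f x)"
      using c r Suc.prems(2) by algebra
    thus "commutator R (osc s f) r x = osc s (commutator R f r) x" using x r by simp
  qed auto
  thus ?case using Suc lin_ops(2)[of f f s] by (simp add: Dlt_Suc)
qed

lemma Dlt_up: "Dlt n \<subseteq> Dlt (Suc n)"
proof (induction n)
  case 0 thus ?case using ozero_Dlt by (simp add: Dlt_0)
next
  case (Suc n) thus ?case by (auto simp: Dlt_Suc)
qed

lemma Dlt_mono: "n \<le> k \<Longrightarrow> Dlt n \<subseteq> Dlt k"
proof (induction k rule: dec_induct)
  case (step k) thus ?case using Dlt_up[of k] by blast
qed simp

lemma oid_Dlt: "oid \<in> Dlt (Suc 0)"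
proof -
  have "commutator R oid r = ozero" if "r \<in> carrier R" for r
    by (rule op_eqI) (use that in \<open>auto simp: r_neg a_minus_def\<close>)
  thus ?thesis using lin_basic by (simp add: Dlt_Suc Dlt_0)
qed

text \<open>[fg, r] = f [g, r] + [f, r] g. Orders below i and below j compose to an order below i +
  j - 1, which explains \<open>Suc n\<close>; the inequality avoids subtraction.\<close>

lemma Dlt_ocomp:
  assumes "f \<in> Dlt i" "g \<in> Dlt j" "i + j \<le> Suc n" shows "ocomp f g \<in> Dlt n"
  using assms
proof (induction n arbitrary: i j f g)
  case 0
  have l: "f \<in> Lin" "g \<in> Lin" using 0 Dlt_lin by auto
  have "i = 0 \<or> j = 0" using 0 by auto
  hence "ocomp f g = ozero"
  proof
    assume "i = 0" hence "f = ozero" using 0 by (simp add: Dlt_0)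
    thus ?thesis by (intro op_eqI) (use linD(1)[OF l(2)] in auto)
  next
    assume "j = 0" hence "g = ozero" using 0 by (simp add: Dlt_0)
    thus ?thesis by (intro op_eqI) (use lin_zero[OF l(1)] in auto)
  qed
  thus ?case by (simp add: Dlt_0)
next
  case (Suc n)
  have l: "f \<in> Lin" "g \<in> Lin" using Suc Dlt_lin by auto
  have e: "commutator R (ocomp f g) r = oadd (ocomp f (commutator R g r)) (ocomp (commutator R f r) g)"
    if r: "r \<in> carrier R" for r
  proof (rule op_eqI)
    fix x assume x: "x \<in> carrier R"
    have c: "g x \<in> carrier R" "g (r \<otimes> x) \<in> carrier R" using linD(1)[OF l(2)] x r by auto
    have d: "f (g (r \<otimes> x)) \<in> carrier R" "f (r \<otimes> g x) \<in> carrier R" "f (g x) \<in> carrier R"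
      using linD(1)[OF l(1)] c r by auto
    have "f (g (r \<otimes> x) \<ominus> r \<otimes> g x) = f (g (r \<otimes> x)) \<ominus> f (r \<otimes> g x)" using lin_minus[OF l(1)] c r by simp
    hence "f (g (r \<otimes> x) \<ominus> r \<otimes> g x) \<oplus> (f (r \<otimes> g x) \<ominus> r \<otimes> f (g x)) = f (g (r \<otimes> x)) \<ominus> r \<otimes> f (g x)"
      using d r by algebra
    thus "commutator R (ocomp f g) r x = oadd (ocomp f (commutator R g r)) (ocomp (commutator R f r) g) x"
      using x r c by simp
  qed auto
  have "commutator R (ocomp f g) r \<in> Dlt n" if r: "r \<in> carrier R" for r
    unfolding e[OF r]
  proof (rule Dlt_oadd)
    show "ocomp f (commutator R g r) \<in> Dlt n"
    proof (cases j)
      case 0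
      hence "g = ozero" using Suc by (simp add: Dlt_0)
      hence "commutator R g r = ozero" by (intro op_eqI) (use r in auto)
      hence "ocomp f (commutator R g r) = ozero" by (intro op_eqI) (use lin_zero[OF l(1)] in auto)
      thus ?thesis using ozero_Dlt by simp
    next
      case (Suc j')
      thus ?thesis using Suc.IH[of f i "commutator R g r" j'] Suc.prems Dlt_comm r by simp
    qed
    show "ocomp (commutator R f r) g \<in> Dlt n"
    proof (cases i)
      case 0
      hence "f = ozero" using Suc by (simp add: Dlt_0)
      hence "ocomp (commutator R f r) g = ozero" by (intro op_eqI) (use r linD(1)[OF l(2)] in auto)
      thus ?thesis using ozero_Dlt by simp
    next
      case (Suc i')
      thus ?thesis using Suc.IH[of "commutator R f r" i' g j] Suc.prems Dlt_comm r by simp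
    qed
  qed
  thus ?case using lin_ops(3)[OF l one_closed] by (simp add: Dlt_Suc)
qed

definition obr :: "('a \<Rightarrow> 'a) \<Rightarrow> ('a \<Rightarrow> 'a) \<Rightarrow> 'a \<Rightarrow> 'a" where
  "obr f g = oadd (ocomp f g) (osc (\<ominus> \<one>) (ocomp g f))"

lemma obr_apply: assumes "f \<in> Lin" "g \<in> Lin" "x \<in> carrier R"
  shows "obr f g x = f (g x) \<ominus> g (f x)"
proof -
  have "f (g x) \<in> carrier R" "g (f x) \<in> carrier R" using linD(1)[OF assms(1)] linD(1)[OF assms(2)] assms(3) by auto
  thus ?thesis unfolding obr_def using assms(3) by (simp add: l_minus a_minus_def)
qed

lemma obr_lin: assumes "f \<in> Lin" "g \<in> Lin" shows "obr f g \<in> Lin"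
  unfolding obr_def using assms by (intro lin_ops one_closed a_inv_closed) auto

text \<open>The Jacobi identity [[f, g], r] = [[f, r], g] + [f, [g, r]] lowers the order of one
  factor, down to multiplications by elements, which commute. So symbols commute in the associated
  graded ring.\<close>

lemma Dlt_obr:
  assumes "f \<in> Dlt (Suc i)" "g \<in> Dlt (Suc j)" shows "obr f g \<in> Dlt (i + j)"
  using assms
proof (induction "i + j" arbitrary: i j f g)
  case 0
  have l: "f \<in> Lin" "g \<in> Lin" using 0 Dlt_lin by auto
  have R: "h (r \<otimes> x) = r \<otimes> h x" if "h \<in> Dlt (Suc 0)" "r \<in> carrier R" "x \<in> carrier R" for h r x
    using that unfolding Dlt_Suc_diffop by (simp add: ring_linear_endos_def)
  have o: "h x = x \<otimes> h \<one>" if "h \<in> Dlt (Suc 0)" "x \<in> carrier R" for h x using R[OF that(1), of x \<one>] that(2) by simp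
  have "obr f g = ozero"
  proof (rule op_eqI)
    fix x assume x: "x \<in> carrier R"
    have c: "f \<one> \<in> carrier R" "g \<one> \<in> carrier R" using linD(1)[OF l(1)] linD(1)[OF l(2)] by auto
    have fg: "f \<in> Dlt (Suc 0)" "g \<in> Dlt (Suc 0)" using 0 by auto
    have "f (g x) = x \<otimes> g \<one> \<otimes> f \<one>" using o[OF fg(1), of "g x"] o[OF fg(2) x] c x by simp
    moreover have "g (f x) = x \<otimes> f \<one> \<otimes> g \<one>" using o[OF fg(2), of "f x"] o[OF fg(1) x] c x by simp
    ultimately have "f (g x) \<ominus> g (f x) = \<zero>" using c x by algebra
    thus "obr f g x = ozero x" using obr_apply[OF l x] x by simp
  qed (use linD(4)[OF obr_lin[OF l]] in auto)
  thus ?case using ozero_Dlt by simp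
next
  case (Suc k)
  have l: "f \<in> Lin" "g \<in> Lin" using Suc.prems Dlt_lin by auto
  have "commutator R (obr f g) r \<in> Dlt k" if r: "r \<in> carrier R" for r
  proof -
    note cl = lin_ops(4)[OF l(1) l(1) r] lin_ops(4)[OF l(2) l(2) r]
    have e: "commutator R (obr f g) r = oadd (obr (commutator R f r) g) (obr f (commutator R g r))"
    proof (rule op_eqI)
      fix x assume x: "x \<in> carrier R"
      note rx = m_closed[OF r x]
      have c: "f x \<in> carrier R" "g x \<in> carrier R" "f (r \<otimes> x) \<in> carrier R" "g (r \<otimes> x) \<in> carrier R"
        "r \<otimes> f x \<in> carrier R" "r \<otimes> g x \<in> carrier R"
        using linD(1)[OF l(1)] linD(1)[OF l(2)] x r by auto
      have d: "f (g (r \<otimes> x)) \<in> carrier R" "g (f (r \<otimes> x)) \<in> carrier R" "f (g x) \<in> carrier R" "g (f x) \<in> carrier R"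
        "f (r \<otimes> g x) \<in> carrier R" "g (r \<otimes> f x) \<in> carrier R"
        using linD(1)[OF l(1)] linD(1)[OF l(2)] c by auto
      have 1: "obr (commutator R f r) g x = (f (r \<otimes> g x) \<ominus> r \<otimes> f (g x)) \<ominus> (g (f (r \<otimes> x)) \<ominus> g (r \<otimes> f x))"
        using obr_apply[OF cl(1) l(2) x] c lin_minus[OF l(2) c(3) c(5)] x by simp
      have 2: "obr f (commutator R g r) x = (f (g (r \<otimes> x)) \<ominus> f (r \<otimes> g x)) \<ominus> (g (r \<otimes> f x) \<ominus> r \<otimes> g (f x))"
        using obr_apply[OF l(1) cl(2) x] c lin_minus[OF l(1) c(4) c(6)] x by simp
      have 3: "commutator R (obr f g) r x = (f (g (r \<otimes> x)) \<ominus> g (f (r \<otimes> x))) \<ominus> r \<otimes> (f (g x) \<ominus> g (f x))"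
        using obr_apply[OF l rx] obr_apply[OF l x] x by simp
      show "commutator R (obr f g) r x = oadd (obr (commutator R f r) g) (obr f (commutator R g r)) x"
        unfolding op_apply(1)[OF x] 1 2 3 using d r by algebra
    qed auto
    have A: "obr (commutator R f r) g \<in> Dlt k"
    proof (cases i)
      case 0
      hence "commutator R f r = ozero" using Suc.prems Dlt_comm[of f 0 r] r by (simp add: Dlt_0)
      hence "obr (commutator R f r) g = ozero"
        using linD(1)[OF l(2)] lin_zero[OF l(2)] obr_apply[OF cl(1) l(2)] linD(4)[OF obr_lin[OF cl(1) l(2)]]
        by (intro op_eqI) (auto simp: a_minus_def)
      thus ?thesis using ozero_Dlt by simp
    next
      case (Suc i')
      thus ?thesis using Suc.hyps(1)[of i' j "commutator R f r" g] Suc.hyps(2) Suc.prems Dlt_comm[OF _ r, of f i] by simp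
    qed
    have B: "obr f (commutator R g r) \<in> Dlt k"
    proof (cases j)
      case 0
      hence "commutator R g r = ozero" using Suc.prems Dlt_comm[of g 0 r] r by (simp add: Dlt_0)
      hence "obr f (commutator R g r) = ozero"
        using linD(1)[OF l(1)] lin_zero[OF l(1)] obr_apply[OF l(1) cl(2)] linD(4)[OF obr_lin[OF l(1) cl(2)]]
        by (intro op_eqI) (auto simp: a_minus_def)
      thus ?thesis using ozero_Dlt by simp
    next
      case (Suc j')
      thus ?thesis using Suc.hyps(1)[of i j' f "commutator R g r"] Suc.hyps(2) Suc.prems Dlt_comm[OF _ r, of g j] by simp
    qed
    show ?thesis unfolding e using Dlt_oadd[OF A B] .
  qed
  thus ?case using obr_lin[OF l] Suc.hyps(2)[symmetric] by (simp add: Dlt_Suc)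
qed

lemma lin_split:
  assumes "f \<in> Lin" "x \<in> carrier R" "r \<in> carrier R"
  shows "f (x \<otimes> r) = commutator R f r x \<oplus> r \<otimes> f x"
proof -
  have c: "f (r \<otimes> x) \<in> carrier R" "f x \<in> carrier R" using linD(1)[OF assms(1)] assms by auto
  have "f (r \<otimes> x) = (f (r \<otimes> x) \<ominus> r \<otimes> f x) \<oplus> r \<otimes> f x" using c assms(3) by algebra
  thus ?thesis unfolding m_comm[OF assms(2,3)] using assms(2) by simp
qed

text \<open>From f(xy) = [f, y](x) + y f(x): the commutator has smaller order, and the second term
  gains a factor in m. Operators are thus continuous for the m-adic topology, with a loss of depth
  bounded by the order.\<close>

lemma Dlt_ipow:
  assumes m: "ideal m R" and f: "f \<in> Dlt n" shows "x \<in> ipow m (n + k) \<Longrightarrow> f x \<in> ipow m (Suc k)"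
  using f
proof (induction n arbitrary: f k x)
  case 0
  have "x \<in> carrier R" using 0(1) idealD(3)[OF ipow_ideal[OF m]] by blast
  hence "f x = \<zero>" using 0(2) by (simp add: Dlt_0)
  thus ?case by (simp only: idealD(4)[OF ipow_ideal[OF m]])
next
  case (Suc n)
  note fl = Dlt_lin[OF Suc.prems(2)]
  note mi = ipow_ideal[OF m]
  show ?case using Suc.prems(1)
  proof (induction k arbitrary: x)
    case 0
    have "ipow m (Suc n) \<subseteq> {x \<in> carrier R. f x \<in> m}"
    proof
      fix x assume "x \<in> ipow m (Suc n)"
      hence "x \<in> ideal_prod R (ipow m n) m" by (simp only: ipow_Suc)
      hence "x \<in> carrier R \<and> f x \<in> m"
      proof induction
        case (prod i j)
        have c: "i \<in> carrier R" "j \<in> carrier R"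
          by (rule idealD(3)[OF mi prod(1)], rule idealD(3)[OF m prod(2)])
        have "i \<in> ipow m (n + 0)" using prod(1) by (simp only: add_0_right)
        from Suc.IH[OF this Dlt_comm[OF Suc.prems(2) c(2)]] have "commutator R f j i \<in> ipow m (Suc 0)" .
        hence "commutator R f j i \<in> m" unfolding ipow_1[OF m] .
        moreover have "j \<otimes> f i \<in> m" using idealD(8)[OF m] prod(2) linD(1)[OF fl c(1)] by blast
        moreover have "f (i \<otimes> j) = commutator R f j i \<oplus> j \<otimes> f i" by (rule lin_split[OF fl c])
        ultimately show ?case using idealD(5)[OF m] c by auto
      next
        case (sum s1 s2)
        thus ?case using linD(2)[OF fl] idealD(5)[OF m] by auto
      qed
      thus "x \<in> {x \<in> carrier R. f x \<in> m}" by simp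
    qed
    thus ?case using 0 unfolding ipow_1[OF m] by auto
  next
    case (Suc k)
    note fD = \<open>f \<in> Dlt (Suc n)\<close>
    have "x \<in> ideal_prod R (ipow m (Suc n + k)) m" using Suc.prems by (simp only: ipow_Suc add_Suc_right)
    hence "x \<in> carrier R \<and> f x \<in> ipow m (Suc (Suc k))"
    proof induction
      case (prod i j)
      have c: "i \<in> carrier R" "j \<in> carrier R"
          by (rule idealD(3)[OF mi prod(1)], rule idealD(3)[OF m prod(2)])
      have fi: "f i \<in> ipow m (Suc k)" by (rule Suc.IH[OF prod(1)])
      have "j \<in> ipow m (Suc 0)" unfolding ipow_1[OF m] by (rule prod(2))
      from ipow_mult[OF m this fi] have 1: "j \<otimes> f i \<in> ipow m (Suc (Suc k))" by (simp only: add_Suc add_0)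
      have "i \<in> ipow m (n + Suc k)" using prod(1) by (simp only: add_Suc add_Suc_right)
      hence 2: "commutator R f j i \<in> ipow m (Suc (Suc k))"
        using \<open>\<And>k x f. x \<in> ipow m (n + k) \<Longrightarrow> f \<in> Dlt n \<Longrightarrow> f x \<in> ipow m (Suc k)\<close> Dlt_comm[OF fD c(2)] by blast
      have "f (i \<otimes> j) = commutator R f j i \<oplus> j \<otimes> f i" by (rule lin_split[OF fl c])
      thus ?case using idealD(5)[OF mi 2 1] c by auto
    next
      case (sum s1 s2)
      hence c: "s1 \<in> carrier R" "s2 \<in> carrier R" by auto
      have "f s1 \<oplus> f s2 \<in> ipow m (Suc (Suc k))"
        using sum.IH by (intro idealD(5)[OF mi]) (elim conjE, assumption)+
      thus ?case using linD(2)[OF fl c] c by (metis add.m_closed)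
    qed
    thus ?case by simp
  qed
qed

end

section \<open>Ordered monomials in operators of known order\<close>

context kalg begin

fun opow :: "('a \<Rightarrow> 'a) \<Rightarrow> nat \<Rightarrow> ('a \<Rightarrow> 'a)" where
  "opow f 0 = oid"
| "opow f (Suc n) = ocomp f (opow f n)"

text \<open>\<open>L\<close> lists operators together with a bound on their order, and the factors
  are composed in the order of the list. Excess entries of either list are ignored, so exponents of
  the length of \<open>L\<close> are demanded wherever monomials span or are counted.\<close>

fun omon :: "(('a \<Rightarrow> 'a) \<times> nat) list \<Rightarrow> nat list \<Rightarrow> ('a \<Rightarrow> 'a)" where
  "omon ((f, d) # L) (a # as) = ocomp (opow f a) (omon L as)"
| "omon _ _ = oid"

abbreviation owt :: "(('a \<Rightarrow> 'a) \<times> nat) list \<Rightarrow> nat list \<Rightarrow> nat" where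
  "owt L \<equiv> wt (map snd L)"

inductive_set ospan :: "(('a \<Rightarrow> 'a) \<times> nat) list \<Rightarrow> nat \<Rightarrow> ('a \<Rightarrow> 'a) set" for L n where
  Szero: "ozero \<in> ospan L n"
| Sadd: "s \<in> ospan L n \<Longrightarrow> t \<in> ospan L n \<Longrightarrow> oadd s t \<in> ospan L n"
| Smon: "r \<in> carrier R \<Longrightarrow> length a = length L \<Longrightarrow> owt L a \<le> n \<Longrightarrow> osc r (omon L a) \<in> ospan L n"

definition gens :: "(('a \<Rightarrow> 'a) \<times> nat) list \<Rightarrow> bool" where
  "gens L \<longleftrightarrow> (\<forall>(f, d)\<in>set L. 1 \<le> d \<and> f \<in> Dlt (Suc d))"

lemma opow_Dlt: "f \<in> Dlt (Suc d) \<Longrightarrow> opow f n \<in> Dlt (Suc (d * n))"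
proof (induction n)
  case 0 thus ?case using oid_Dlt by simp
next
  case (Suc n) thus ?case using Dlt_ocomp[of f "Suc d" "opow f n" "Suc (d * n)" "Suc (d * Suc n)"] by simp
qed

lemma omon_Dlt: "gens L \<Longrightarrow> omon L a \<in> Dlt (Suc (owt L a))"
proof (induction L a rule: omon.induct)
  case (1 f d L a as)
  have "f \<in> Dlt (Suc d)" "gens L" using 1(2) unfolding gens_def by auto
  thus ?case using Dlt_ocomp[OF opow_Dlt[of f d a] 1(1)] by simp
next
  case ("2_1" a) thus ?case using oid_Dlt by simp
next
  case ("2_2" L) thus ?case using oid_Dlt by (cases L) auto
qed

text \<open>Congruence modulo operators of order below n: for operators of order at most n, equality
  of their classes in degree n of the associated graded ring.\<close>

definition ocong :: "nat \<Rightarrow> ('a \<Rightarrow> 'a) \<Rightarrow> ('a \<Rightarrow> 'a) \<Rightarrow> bool" where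
  "ocong n f g \<longleftrightarrow> f \<in> Lin \<and> g \<in> Lin \<and> (\<exists>e\<in>Dlt n. f = oadd g e)"

lemma oadd_ops:
  assumes "f \<in> Lin" "g \<in> Lin" "h \<in> Lin"
  shows "oadd f g = oadd g f" "oadd (oadd f g) h = oadd f (oadd g h)" "oadd f ozero = f"
    "ocomp (oadd f g) h = oadd (ocomp f h) (ocomp g h)" "ocomp f (oadd g h) = oadd (ocomp f g) (ocomp f h)"
    "ocomp (ocomp f g) h = ocomp f (ocomp g h)" "ocomp f oid = f" "ocomp oid f = f"
    "oadd f (osc (\<ominus> \<one>) f) = ozero"
proof -
  note c = linD(1)[OF assms(1)] linD(1)[OF assms(2)] linD(1)[OF assms(3)]
  note e = linD(4)[OF assms(1)]
  show "oadd f g = oadd g f" by (rule op_eqI) (use c in \<open>auto simp: a_comm\<close>)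
  show "oadd (oadd f g) h = oadd f (oadd g h)" by (rule op_eqI) (use c in \<open>auto simp: a_assoc\<close>)
  show "oadd f ozero = f" by (rule op_eqI) (use c e in auto)
  show "ocomp (oadd f g) h = oadd (ocomp f h) (ocomp g h)" by (rule op_eqI) (use c in auto)
  show "ocomp f (oadd g h) = oadd (ocomp f g) (ocomp f h)" by (rule op_eqI) (use c linD(2)[OF assms(1)] in auto)
  show "ocomp (ocomp f g) h = ocomp f (ocomp g h)" by (rule op_eqI) (use c in auto)
  show "ocomp f oid = f" "ocomp oid f = f" by (rule op_eqI; use c e in auto)+
  show "oadd f (osc (\<ominus> \<one>) f) = ozero"
    by (rule op_eqI) (use c in \<open>auto simp: l_minus r_neg\<close>)
qed

lemma ocongI: "f = oadd g e \<Longrightarrow> g \<in> Lin \<Longrightarrow> e \<in> Dlt n \<Longrightarrow> ocong n f g"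
  unfolding ocong_def using lin_ops(1)[OF _ _ one_closed] Dlt_lin by blast

lemma ocong_refl: "f \<in> Lin \<Longrightarrow> ocong n f f"
  by (rule ocongI[of _ _ ozero]) (auto simp: oadd_ops ozero_Dlt)

lemma ocong_mono: "ocong n f g \<Longrightarrow> n \<le> k \<Longrightarrow> ocong k f g"
  unfolding ocong_def using Dlt_mono by blast

lemma ocong_trans: assumes "ocong n f g" "ocong n g h" shows "ocong n f h"
proof -
  obtain e e' where e: "e \<in> Dlt n" "f = oadd g e" "e' \<in> Dlt n" "g = oadd h e'"
    and l: "f \<in> Lin" "g \<in> Lin" "h \<in> Lin"
    using assms unfolding ocong_def by blast
  have "f = oadd h (oadd e' e)" using oadd_ops(2)[OF l(3) Dlt_lin[OF e(3)] Dlt_lin[OF e(1)]] e by simp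
  thus ?thesis using ocongI Dlt_oadd e l by blast
qed

lemma ocong_sym: assumes "ocong n f g" shows "ocong n g f"
proof -
  obtain e where e: "e \<in> Dlt n" "f = oadd g e"
    and l: "f \<in> Lin" "g \<in> Lin"
    using assms unfolding ocong_def by blast
  have le: "e \<in> Lin" using e Dlt_lin by blast
  have m: "osc (\<ominus> \<one>) e \<in> Dlt n" using Dlt_osc[OF e(1)] by simp
  have "g = oadd f (osc (\<ominus> \<one>) e)"
    unfolding e(2) oadd_ops(2)[OF l(2) le Dlt_lin[OF m]] oadd_ops(9)[OF le le le] using oadd_ops(3)[OF l(2) l(2) l(2)] by simp
  thus ?thesis using ocongI m l by blast
qed

text \<open>Products of symbols do not depend on representatives: with f = f' + e and g = g' + e'
  the difference fg - f'g' is f' e' + e g.\<close>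

lemma ocong_comp:
  assumes "ocong i f f'" "ocong j g g'" "f' \<in> Dlt (Suc i)" "g' \<in> Dlt (Suc j)"
  shows "ocong (i + j) (ocomp f g) (ocomp f' g')"
proof -
  obtain e e' where e: "e \<in> Dlt i" "f = oadd f' e" "e' \<in> Dlt j" "g = oadd g' e'"
    and l: "f' \<in> Lin" "g \<in> Lin" "g' \<in> Lin"
    using assms unfolding ocong_def by blast
  have le: "e \<in> Lin" "e' \<in> Lin" using e Dlt_lin by auto
  have g: "g \<in> Dlt (Suc j)" unfolding e(4) using Dlt_oadd[OF assms(4)] Dlt_up[of j] e(3) by blast
  have "ocomp f g = oadd (ocomp f' g') (oadd (ocomp f' e') (ocomp e g))"
    unfolding e(2) oadd_ops(4)[OF l(1) le(1) l(2)]
    unfolding e(4) oadd_ops(5)[OF l(1) l(3) le(2)]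
    by (intro oadd_ops(2) lin_ops(3)[OF _ _ one_closed] l le) (use e(4) l(2) in simp)
  moreover have "ocomp f' e' \<in> Dlt (i + j)" using Dlt_ocomp[OF assms(3) e(3)] by simp
  moreover have "ocomp e g \<in> Dlt (i + j)" using Dlt_ocomp[OF e(1) g] by simp
  ultimately show ?thesis using ocongI lin_ops(3)[OF l(1,3) one_closed] Dlt_oadd by blast
qed

lemma ocong_commute:
  assumes "f \<in> Dlt (Suc i)" "g \<in> Dlt (Suc j)"
  shows "ocong (i + j) (ocomp f g) (ocomp g f)"
proof -
  have l: "f \<in> Lin" "g \<in> Lin" using assms Dlt_lin by auto
  have "ocomp f g = oadd (ocomp g f) (obr f g)"
  proof (rule op_eqI)
    fix x assume x: "x \<in> carrier R"
    have c: "f (g x) \<in> carrier R" "g (f x) \<in> carrier R" using linD(1)[OF l(1)] linD(1)[OF l(2)] x by auto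
    have "f (g x) = g (f x) \<oplus> (f (g x) \<ominus> g (f x))" using c by algebra
    thus "ocomp f g x = oadd (ocomp g f) (obr f g) x" using x obr_apply[OF l x] by simp
  qed auto
  thus ?thesis using ocongI lin_ops(3)[OF l(2,1) one_closed] Dlt_obr[OF assms] by blast
qed

lemma opow_add: assumes "f \<in> Lin" shows "opow f (m + n) = ocomp (opow f m) (opow f n)"
proof -
  have l: "opow f k \<in> Lin" for k
    by (induction k) (use assms lin_basic lin_ops(3)[OF _ _ one_closed] in auto)
  show ?thesis
  proof (induction m)
    case 0 thus ?case using oadd_ops(8)[OF l l l] by simp
  next
    case (Suc m) thus ?case using oadd_ops(6)[OF assms l l] by simp
  qed
qed

text \<open>Modulo smaller order the power of the head operator in the second factor commutes with
  the tail monomial of the first, so exponents add.\<close>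

lemma omon_mult:
  "gens L \<Longrightarrow> length a = length L \<Longrightarrow> length b = length L \<Longrightarrow>
    ocong (owt L a + owt L b) (ocomp (omon L a) (omon L b)) (omon L (map2 (+) a b)) \<and>
    owt L (map2 (+) a b) = owt L a + owt L b"
proof (induction L arbitrary: a b)
  case Nil thus ?case using ocong_refl[of "ocomp oid oid"] lin_basic oadd_ops(7)[of oid oid oid] by simp
next
  case (Cons p L)
  obtain f d where p: "p = (f, d)" by (cases p)
  obtain x as where a: "a = x # as" using Cons by (cases a) auto
  obtain y bs where b: "b = y # bs" using Cons by (cases b) auto
  have g: "gens L" "f \<in> Dlt (Suc d)" using Cons(2) unfolding gens_def p by auto
  have fl: "f \<in> Lin" using g Dlt_lin by blast
  let ?A = "omon L as" and ?B = "omon L bs" and ?i = "owt L as" and ?j = "owt L bs"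
  have AB: "?A \<in> Dlt (Suc ?i)" "?B \<in> Dlt (Suc ?j)" using omon_Dlt[OF g(1)] by auto
  have pw: "opow f k \<in> Dlt (Suc (d * k))" for k using opow_Dlt[OF g(2)] .
  note lin = Dlt_lin[OF AB(1)] Dlt_lin[OF AB(2)] Dlt_lin[OF pw]
  have IH: "ocong (?i + ?j) (ocomp ?A ?B) (omon L (map2 (+) as bs))" "owt L (map2 (+) as bs) = ?i + ?j"
    using Cons.IH[OF g(1), of as bs] Cons.prems a b by auto
  have c1: "ocong (?i + d * y) (ocomp ?A (opow f y)) (ocomp (opow f y) ?A)" by (rule ocong_commute[OF AB(1) pw])
  have yA: "ocomp (opow f y) ?A \<in> Dlt (Suc (?i + d * y))" using Dlt_ocomp[OF pw AB(1)] by simp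
  have c2: "ocong (?i + d * y + ?j) (ocomp (ocomp ?A (opow f y)) ?B) (ocomp (ocomp (opow f y) ?A) ?B)"
    by (rule ocong_comp[OF c1 ocong_refl[OF lin(2)] yA AB(2)])
  have yAB: "ocomp (ocomp (opow f y) ?A) ?B \<in> Dlt (Suc (?i + d * y + ?j))" using Dlt_ocomp[OF yA AB(2)] by simp
  have c3: "ocong (d * x + (?i + d * y + ?j)) (ocomp (opow f x) (ocomp (ocomp ?A (opow f y)) ?B)) (ocomp (opow f x) (ocomp (ocomp (opow f y) ?A) ?B))"
    by (rule ocong_comp[OF ocong_refl[OF lin(3)] c2 pw yAB])
  have e1: "ocomp (omon (p # L) a) (omon (p # L) b) = ocomp (opow f x) (ocomp (ocomp ?A (opow f y)) ?B)"
    unfolding a b p omon.simps using oadd_ops(6) lin lin_ops(3)[OF _ _ one_closed] by simp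
  have e2: "ocomp (opow f x) (ocomp (ocomp (opow f y) ?A) ?B) = ocomp (opow f (x + y)) (ocomp ?A ?B)"
    unfolding opow_add[OF fl] using oadd_ops(6) lin lin_ops(3)[OF _ _ one_closed] by simp
  have "omon L (map2 (+) as bs) \<in> Dlt (Suc (?i + ?j))" using omon_Dlt[OF g(1), of "map2 (+) as bs"] IH(2) by simp
  from ocong_comp[OF ocong_refl[OF lin(3)] IH(1) pw this, of "x + y"]
  have c4: "ocong (d * (x + y) + (?i + ?j)) (ocomp (opow f (x + y)) (ocomp ?A ?B)) (omon (p # L) (map2 (+) a b))"
    unfolding a b p by simp
  have w: "owt (p # L) a + owt (p # L) b = d * (x + y) + (?i + ?j)" "d * x + (?i + d * y + ?j) = d * (x + y) + (?i + ?j)"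
    unfolding a b p by (auto simp: algebra_simps)
  show ?case unfolding e1 w(1) using ocong_trans[OF c3[unfolded w(2) e2] c4] IH(2) unfolding a b p by (simp add: algebra_simps)
qed

lemma ospan_Dlt: assumes "gens L" "t \<in> ospan L n" shows "t \<in> Dlt (Suc n)"
  using assms(2)
proof induction
  case (Smon r a)
  have "Dlt (Suc (owt L a)) \<subseteq> Dlt (Suc n)" using Dlt_mono Smon by simp
  thus ?case using Dlt_osc[OF _ Smon(1)] omon_Dlt[OF assms(1), of a] by blast
qed (auto intro: ozero_Dlt Dlt_oadd)

lemma ospan_mono: "n \<le> k \<Longrightarrow> ospan L n \<subseteq> ospan L k"
proof
  fix t assume "n \<le> k" "t \<in> ospan L n"
  from this(2,1) show "t \<in> ospan L k" by induction (auto intro: ospan.intros)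
qed

lemma ospan_osc: assumes "gens L" "t \<in> ospan L n" "r \<in> carrier R" shows "osc r t \<in> ospan L n"
  using assms(2)
proof induction
  case Szero
  have "osc r ozero = ozero" by (rule op_eqI) (use assms(3) in auto)
  thus ?case by (simp add: ospan.Szero)
next
  case (Sadd s t)
  have "osc r (oadd s t) = oadd (osc r s) (osc r t)"
    by (rule op_eqI) (use assms(3) linD(1)[OF Dlt_lin[OF ospan_Dlt[OF assms(1)]]] Sadd in \<open>auto simp: r_distr\<close>)
  thus ?case using Sadd by (simp add: ospan.Sadd)
next
  case (Smon s a)
  have "osc r (osc s (omon L a)) = osc (r \<otimes> s) (omon L a)"
    by (rule op_eqI) (use assms(3) linD(1)[OF Dlt_lin[OF omon_Dlt[OF assms(1)]]] Smon in \<open>auto simp: m_assoc\<close>)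
  thus ?case using Smon assms(3) by (simp add: ospan.Smon)
qed

text \<open>The class of \<open>u\<close> in degree \<open>n\<close> lies in the subalgebra generated by the symbols of \<open>L\<close>.\<close>

definition inspan :: "(('a \<Rightarrow> 'a) \<times> nat) list \<Rightarrow> nat \<Rightarrow> ('a \<Rightarrow> 'a) \<Rightarrow> bool" where
  "inspan L n u \<longleftrightarrow> (\<exists>t\<in>ospan L n. ocong n u t)"

lemma inspan_lower: assumes "e \<in> Dlt n" shows "inspan L n e"
proof -
  have "oadd ozero e = e" using oadd_ops(1,3)[OF Dlt_lin[OF assms] lin_basic(1) lin_basic(1)] by simp
  thus ?thesis unfolding inspan_def using ocongI[of e ozero e n] assms lin_basic ospan.Szero by metis
qed

lemma inspan_cong: "ocong n u v \<Longrightarrow> inspan L n v \<Longrightarrow> inspan L n u"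
  unfolding inspan_def using ocong_trans by blast

lemma inspan_oadd: assumes "gens L" "inspan L n u" "inspan L n v" shows "inspan L n (oadd u v)"
proof -
  obtain s e t e' where h: "s \<in> ospan L n" "e \<in> Dlt n" "u = oadd s e" "t \<in> ospan L n" "e' \<in> Dlt n" "v = oadd t e'"
    using assms unfolding inspan_def ocong_def by blast
  have l: "s \<in> Lin" "t \<in> Lin" "e \<in> Lin" "e' \<in> Lin"
    using h ospan_Dlt[OF assms(1)] Dlt_lin by blast+
  have "oadd u v = oadd (oadd s t) (oadd e e')" unfolding h(3,6)
    by (rule op_eqI) (use linD(1)[OF l(1)] linD(1)[OF l(2)] linD(1)[OF l(3)] linD(1)[OF l(4)] in \<open>auto simp: a_ac\<close>)
  thus ?thesis unfolding inspan_def
    using ospan.Sadd[OF h(1,4)] ocongI[of "oadd u v" "oadd s t" "oadd e e'" n] lin_ops(1)[OF l(1,2) one_closed] Dlt_oadd[OF h(2,5)] by blast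
qed

lemma inspan_osc: assumes "gens L" "inspan L n u" "r \<in> carrier R" shows "inspan L n (osc r u)"
proof -
  obtain s e where h: "s \<in> ospan L n" "e \<in> Dlt n" "u = oadd s e"
    using assms unfolding inspan_def ocong_def by blast
  have l: "s \<in> Lin" "e \<in> Lin"
    using h ospan_Dlt[OF assms(1)] Dlt_lin by blast+
  have "osc r u = oadd (osc r s) (osc r e)" unfolding h(3)
    by (rule op_eqI) (use linD(1)[OF l(1)] linD(1)[OF l(2)] assms(3) in \<open>auto simp: r_distr\<close>)
  thus ?thesis unfolding inspan_def
    using ospan_osc[OF assms(1) h(1) assms(3)] ocongI[of "osc r u" "osc r s" "osc r e" n] lin_ops(2)[OF l(1,2) assms(3)] Dlt_osc[OF h(2) assms(3)] by blast
qed

lemma inspan_omon: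
  assumes "gens L" "length a = length L" "owt L a \<le> n" shows "inspan L n (omon L a)"
proof -
  have l: "omon L a \<in> Lin" using omon_Dlt[OF assms(1)] Dlt_lin by blast
  have "osc \<one> (omon L a) = omon L a" by (rule op_eqI) (use linD(1,4)[OF l] in auto)
  hence "omon L a \<in> ospan L n" using ospan.Smon[OF one_closed assms(2,3)] by simp
  thus ?thesis unfolding inspan_def using ocong_refl[OF l] by blast
qed

text \<open>Composition meets a coefficient in the middle. A monomial passes it up to a commutator,
  whose order is smaller and which therefore vanishes in this degree.\<close>

lemma inspan_comp:
  assumes G: "gens L" and "inspan L i u" "inspan L j v"
  shows "inspan L (i + j) (ocomp u v)"
proof -
  obtain s t where st: "s \<in> ospan L i" "ocong i u s" "t \<in> ospan L j" "ocong j v t" using assms unfolding inspan_def by blast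
  have sD: "s \<in> Dlt (Suc i)" if "s \<in> ospan L i" for s i using ospan_Dlt[OF G that] .
  have m: "inspan L (i + j) (ocomp (osc r (omon L a)) (osc r' (omon L b)))"
    if h: "r \<in> carrier R" "length a = length L" "owt L a \<le> i" "r' \<in> carrier R" "length b = length L" "owt L b \<le> j" for r a r' b
  proof -
    have A: "omon L a \<in> Dlt (Suc (owt L a))" and B: "omon L b \<in> Dlt (Suc (owt L b))" using omon_Dlt[OF G] by auto
    note la = Dlt_lin[OF A] and lb = Dlt_lin[OF B]
    have e: "ocomp (osc r (omon L a)) (osc r' (omon L b)) =
      oadd (osc (r \<otimes> r') (ocomp (omon L a) (omon L b))) (osc r (ocomp (commutator R (omon L a) r') (omon L b)))"
    proof (rule op_eqI)
      fix x assume x: "x \<in> carrier R"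
      have c: "omon L b x \<in> carrier R" "omon L a (omon L b x) \<in> carrier R" "omon L a (r' \<otimes> omon L b x) \<in> carrier R"
        using linD(1)[OF la] linD(1)[OF lb] x h by auto
      have "r \<otimes> omon L a (r' \<otimes> omon L b x) = r \<otimes> r' \<otimes> omon L a (omon L b x) \<oplus>
         r \<otimes> (omon L a (r' \<otimes> omon L b x) \<ominus> r' \<otimes> omon L a (omon L b x))"
        using c(2,3) h(1,4) by algebra
      thus "ocomp (osc r (omon L a)) (osc r' (omon L b)) x =
        oadd (osc (r \<otimes> r') (ocomp (omon L a) (omon L b))) (osc r (ocomp (commutator R (omon L a) r') (omon L b))) x"
        using x c h by simp
    qed auto
    have "inspan L (owt L a + owt L b) (omon L (map2 (+) a b))"
      using inspan_omon[OF G, of "map2 (+) a b"] omon_mult[OF G h(2,5)] h by simp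
    hence "inspan L (owt L a + owt L b) (ocomp (omon L a) (omon L b))"
      using inspan_cong omon_mult[OF G h(2,5)] by blast
    then obtain t' where t': "t' \<in> ospan L (owt L a + owt L b)" "ocong (owt L a + owt L b) (ocomp (omon L a) (omon L b)) t'"
      unfolding inspan_def by blast
    have "owt L a + owt L b \<le> i + j" using h by simp
    hence 1: "inspan L (i + j) (ocomp (omon L a) (omon L b))"
      unfolding inspan_def using t' ospan_mono ocong_mono by blast
    have "commutator R (omon L a) r' \<in> Dlt (owt L a)" using Dlt_comm[OF A h(4)] .
    hence "ocomp (commutator R (omon L a) r') (omon L b) \<in> Dlt (i + j)"
      using Dlt_ocomp[OF _ B, of _ "owt L a" "i + j"] h by simp
    hence 2: "inspan L (i + j) (osc r (ocomp (commutator R (omon L a) r') (omon L b)))"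
      using inspan_lower Dlt_osc h(1) by blast
    show ?thesis unfolding e using inspan_oadd[OF G inspan_osc[OF G 1] 2] h by simp
  qed
  have zero: "ocomp ozero t = ozero" "ocomp t ozero = ozero" if "t \<in> Lin" for t
    by (rule op_eqI; use linD(1)[OF that] lin_zero[OF that] in auto)+
  have m2: "inspan L (i + j) (ocomp (osc r (omon L a)) t)"
    if h: "r \<in> carrier R" "length a = length L" "owt L a \<le> i" "t \<in> ospan L j" for r a t
    using h(4)
  proof induction
    case Szero
    thus ?case using zero(2)[of "osc r (omon L a)"] sD[OF ospan.Smon[OF h(1-3)]] Dlt_lin inspan_lower ozero_Dlt by simp
  next
    case (Sadd t1 t2)
    have "ocomp (osc r (omon L a)) (oadd t1 t2) = oadd (ocomp (osc r (omon L a)) t1) (ocomp (osc r (omon L a)) t2)"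
      by (rule oadd_ops(5)) (use Sadd sD Dlt_lin ospan.Smon[OF h(1-3)] in blast)+
    thus ?case using Sadd inspan_oadd[OF G] by simp
  next
    case (Smon r' b) thus ?case using m h by blast
  qed
  have m3: "inspan L (i + j) (ocomp s t)" if h: "s \<in> ospan L i" "t \<in> ospan L j" for s t
    using h(1)
  proof induction
    case Szero thus ?case using zero(1)[of t] sD[OF h(2)] Dlt_lin inspan_lower ozero_Dlt by simp
  next
    case (Sadd t1 t2)
    have "ocomp (oadd t1 t2) t = oadd (ocomp t1 t) (ocomp t2 t)"
      by (rule oadd_ops(4)) (use Sadd h sD Dlt_lin in blast)+
    thus ?case using Sadd inspan_oadd[OF G] by simp
  next
    case (Smon r a) thus ?case using m2 h by blast
  qed
  show ?thesis
    using inspan_cong[OF ocong_comp[OF st(2,4) sD[OF st(1)] sD[OF st(3)]] m3[OF st(1,3)]] .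
qed

end

section \<open>Finitely generated associated graded rings\<close>

context kalg begin

section \<open>Cosets of the order filtration and the components of the graded ring\<close>

abbreviation Dr :: "('a \<Rightarrow> 'a) ring" where "Dr \<equiv> diffop_ring K R"
abbreviation DG :: "nat \<Rightarrow> ('a \<Rightarrow> 'a) ring" where "DG n \<equiv> Dr\<lparr>carrier := Dlt n\<rparr>"
abbreviation gr :: "nat \<Rightarrow> ('a \<Rightarrow> 'a) set monoid" where "gr n \<equiv> gr_component Dr (diffop K R) n"

definition cos :: "nat \<Rightarrow> ('a \<Rightarrow> 'a) \<Rightarrow> ('a \<Rightarrow> 'a) set" where
  "cos n u = {oadd e u | e. e \<in> Dlt n}"

lemma add_Dr [simp]: "add Dr = oadd" "\<zero>\<^bsub>Dr\<^esub> = ozero" "monoid.mult Dr = compose (carrier R)" "\<one>\<^bsub>Dr\<^esub> = oid"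
  unfolding diffop_ring_def oadd_def ozero_def oid_def by auto

lemma coset_Dr: "Dlt n +>\<^bsub>Dr\<^esub> u = cos n u" "Dlt n +>\<^bsub>Dr\<lparr>carrier := V\<rparr>\<^esub> u = cos n u"
  unfolding a_r_coset_def' cos_def by auto

lemma mem_cos: "u \<in> Lin \<Longrightarrow> v \<in> cos n u \<longleftrightarrow> ocong n v u"
proof
  assume u: "u \<in> Lin" and "v \<in> cos n u"
  then obtain e where e: "e \<in> Dlt n" "v = oadd e u" unfolding cos_def by blast
  hence "v = oadd u e" using oadd_ops(1)[OF Dlt_lin[OF e(1)] u u] by simp
  thus "ocong n v u" using ocongI u e by blast
next
  assume u: "u \<in> Lin" and "ocong n v u"
  then obtain e where e: "e \<in> Dlt n" "v = oadd u e" unfolding ocong_def by blast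
  hence "v = oadd e u" using oadd_ops(1)[OF Dlt_lin[OF e(1)] u u] by simp
  thus "v \<in> cos n u" using e unfolding cos_def by blast
qed

lemma cos_lin: "u \<in> Lin \<Longrightarrow> v \<in> cos n u \<Longrightarrow> v \<in> Lin"
  using mem_cos unfolding ocong_def by blast

lemma cos_eq: assumes "ocong n u v" shows "cos n u = cos n v"
proof -
  have l: "u \<in> Lin" "v \<in> Lin" using assms unfolding ocong_def by auto
  show ?thesis using mem_cos[OF l(1)] mem_cos[OF l(2)] ocong_trans ocong_sym assms by blast
qed

lemma cos_self: "u \<in> Lin \<Longrightarrow> u \<in> cos n u"
  using mem_cos ocong_refl by blast

lemma abelian_group_Dlt: "abelian_group (DG n)"
proof (rule abelian_groupI)
  fix f assume f: "f \<in> carrier (DG n)"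
  hence l: "f \<in> Lin" using Dlt_lin by simp
  have "oadd (osc (\<ominus> \<one>) f) f = ozero"
    using oadd_ops(1)[OF lin_ops(2)[OF l l, of "\<ominus> \<one>"] l l] oadd_ops(9)[OF l l l] by simp
  thus "\<exists>y\<in>carrier (DG n). y \<oplus>\<^bsub>DG n\<^esub> f = \<zero>\<^bsub>DG n\<^esub>"
    using f Dlt_osc[of f n "\<ominus> \<one>"] by auto
  show "\<zero>\<^bsub>DG n\<^esub> \<oplus>\<^bsub>DG n\<^esub> f = f"
    using oadd_ops(1,3)[OF l lin_basic(1) lin_basic(1)] by simp
next
  fix f g h assume "f \<in> carrier (DG n)" "g \<in> carrier (DG n)" "h \<in> carrier (DG n)"
  hence l: "f \<in> Lin" "g \<in> Lin" "h \<in> Lin" using Dlt_lin by auto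
  show "f \<oplus>\<^bsub>DG n\<^esub> g \<oplus>\<^bsub>DG n\<^esub> h = f \<oplus>\<^bsub>DG n\<^esub> (g \<oplus>\<^bsub>DG n\<^esub> h)"
    using oadd_ops(2)[OF l] by simp
next
  fix f g assume "f \<in> carrier (DG n)" "g \<in> carrier (DG n)"
  hence l: "f \<in> Lin" "g \<in> Lin" using Dlt_lin by auto
  show "f \<oplus>\<^bsub>DG n\<^esub> g = g \<oplus>\<^bsub>DG n\<^esub> f"
    using oadd_ops(1)[OF l l(1)] by simp
qed (use Dlt_oadd ozero_Dlt in auto)

lemma abelian_subgroup_Dlt: "abelian_subgroup (Dlt n) (DG (Suc n))"
proof (rule abelian_subgroupI3[OF additive_subgroup.intro abelian_group_Dlt])
  interpret B: abelian_group "DG (Suc n)" by (rule abelian_group_Dlt)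
  show "subgroup (Dlt n) (add_monoid (DG (Suc n)))"
  proof (rule B.add.subgroupI)
    show "Dlt n \<subseteq> carrier (DG (Suc n))" using Dlt_up by simp
    show "Dlt n \<noteq> {}" using ozero_Dlt by blast
    fix f assume f: "f \<in> Dlt n"
    hence l: "f \<in> Lin" using Dlt_lin by simp
    have n: "osc (\<ominus> \<one>) f \<in> Dlt n" using Dlt_osc[OF f] by simp
    have fS: "f \<in> Dlt (Suc n)" "osc (\<ominus> \<one>) f \<in> Dlt (Suc n)" using f n Dlt_up by blast+
    have "osc (\<ominus> \<one>) f \<oplus>\<^bsub>DG (Suc n)\<^esub> f = \<zero>\<^bsub>DG (Suc n)\<^esub>"
      using oadd_ops(1)[OF lin_ops(2)[OF l l, of "\<ominus> \<one>"] l l] oadd_ops(9)[OF l l l] by simp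
    hence "\<ominus>\<^bsub>DG (Suc n)\<^esub> f = osc (\<ominus> \<one>) f" using B.minus_equality fS by simp
    thus "\<ominus>\<^bsub>DG (Suc n)\<^esub> f \<in> Dlt n" using n by simp
  next
    fix f g assume "f \<in> Dlt n" "g \<in> Dlt n"
    thus "f \<oplus>\<^bsub>DG (Suc n)\<^esub> g \<in> Dlt n" using Dlt_oadd by simp
  qed
qed

lemma gr_eq: "gr n = (DG (Suc n)) A_Mod (Dlt n)"
  unfolding gr_component_def Dlt_def[symmetric] Dlt_Suc_diffop ..

lemma comm_group_gr: "comm_group (gr n)"
  unfolding gr_eq by (rule abelian_subgroup.a_factorgroup_is_comm_group[OF abelian_subgroup_Dlt])

lemma gr_carrier: "C \<in> carrier (gr n) \<longleftrightarrow> (\<exists>u\<in>Dlt (Suc n). C = cos n u)"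
  unfolding gr_eq A_FactGroup_def' A_RCOSETS_def by (auto simp: RCOSETS_def coset_Dr(2)[unfolded a_r_coset_def, simplified])

lemma gr_one: "\<one>\<^bsub>gr n\<^esub> = Dlt n"
  unfolding gr_eq A_FactGroup_def' by simp

lemma gr_mult: "C \<otimes>\<^bsub>gr n\<^esub> D = {oadd c d | c d. c \<in> C \<and> d \<in> D}"
  unfolding gr_eq by (auto simp: mem_set_add) blast+

lemma omon_zero: "omon L (replicate (length L) 0) = oid \<and> owt L (replicate (length L) 0) = 0"
proof (induction L)
  case (Cons p L)
  thus ?case using oadd_ops(7)[OF lin_basic(2) lin_basic(2) lin_basic(2)] by (cases p) simp
qed simp

lemma omon_single:
  "gens L \<Longrightarrow> (f, d) \<in> set L \<Longrightarrow> \<exists>a. length a = length L \<and> omon L a = f \<and> owt L a = d"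
proof (induction L)
  case (Cons p L)
  have fl: "f \<in> Lin" using Cons.prems Dlt_lin unfolding gens_def by blast
  show ?case
  proof (cases "(f, d) = p")
    case True
    thus ?thesis using omon_zero[of L] oadd_ops(7)[OF fl fl fl]
      by (intro exI[of _ "1 # replicate (length L) 0"]) auto
  next
    case False
    obtain g e where p: "p = (g, e)" by (cases p)
    obtain a where a: "length a = length L" "omon L a = f" "owt L a = d"
      using Cons False unfolding gens_def by auto
    thus ?thesis using oadd_ops(8)[OF fl fl fl] unfolding p by (intro exI[of _ "0 # a"]) auto
  qed
qed simp

lemma order_zero_span: assumes "gens L" "u \<in> Dlt (Suc 0)" shows "inspan L 0 u"
proof -
  have u: "u \<in> ring_linear_endos R" using assms(2) unfolding Dlt_Suc_diffop by simp
  have c: "u \<one> \<in> carrier R" using u unfolding ring_linear_endos_def by auto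
  have "u = osc (u \<one>) oid"
  proof (rule op_eqI)
    fix x assume x: "x \<in> carrier R"
    hence "u (x \<otimes> \<one>) = x \<otimes> u \<one>" using u unfolding ring_linear_endos_def by blast
    thus "u x = osc (u \<one>) oid x" using x c by (simp add: m_comm)
  qed (use u in \<open>auto simp: ring_linear_endos_def PiE_def\<close>)
  moreover have "osc (u \<one>) oid \<in> ospan L 0"
    using ospan.Smon[OF c, of "replicate (length L) 0" L 0] omon_zero[of L] by simp
  ultimately show ?thesis unfolding inspan_def using ocong_refl[OF Dlt_lin[OF assms(2)]] by auto
qed

abbreviation GG where "GG \<equiv> gr_diffop K R"

lemma GG_carrier: "f \<in> carrier GG \<longleftrightarrow> (\<forall>n. f n \<in> carrier (gr n)) \<and> finite {n. f n \<noteq> Dlt n}"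
  unfolding gr_diffop_def assoc_graded_def gr_one by simp

lemma GG_rep:
  assumes "g \<in> carrier GG" obtains u where "u \<in> Dlt (Suc n)" "g n = cos n u"
proof -
  have "g n \<in> carrier (gr n)" using assms unfolding GG_carrier by blast
  thus ?thesis using that unfolding gr_carrier by blast
qed

lemma GG_add: "f \<oplus>\<^bsub>GG\<^esub> g = (\<lambda>n. f n \<otimes>\<^bsub>gr n\<^esub> g n)"
  unfolding gr_diffop_def assoc_graded_def by simp

lemma GG_zero: "\<zero>\<^bsub>GG\<^esub> = Dlt"
  unfolding gr_diffop_def assoc_graded_def gr_one by (simp add: fun_eq_iff)

lemma GG_one: "\<one>\<^bsub>GG\<^esub> = (\<lambda>n. if n = 0 then cos 0 oid else Dlt n)"
  unfolding gr_diffop_def assoc_graded_def gr_one Dlt_def[symmetric] coset_Dr add_Dr by (simp add: fun_eq_iff)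

lemma GG_mult: "f \<otimes>\<^bsub>GG\<^esub> g = (\<lambda>n. finprod (gr n) (\<lambda>i. rcoset_mult Dr (Dlt n) (f i) (g (n - i))) {..n})"
  unfolding gr_diffop_def assoc_graded_def Dlt_def[symmetric] by simp

lemma abelian_group_GG: "abelian_group GG"
proof (rule abelian_groupI)
  fix f assume f: "f \<in> carrier GG"
  have 1: "f n \<in> carrier (gr n)" for n using f GG_carrier by blast
  interpret g: comm_group "gr n" for n by (rule comm_group_gr)
  have "{n. inv\<^bsub>gr n\<^esub> (f n) \<noteq> Dlt n} \<subseteq> {n. f n \<noteq> Dlt n}"
    using g.inv_one unfolding gr_one by auto
  hence "(\<lambda>n. inv\<^bsub>gr n\<^esub> (f n)) \<in> carrier GG" using f unfolding GG_carrier
    by (auto intro: finite_subset)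
  moreover have "(\<lambda>n. inv\<^bsub>gr n\<^esub> (f n)) \<oplus>\<^bsub>GG\<^esub> f = \<zero>\<^bsub>GG\<^esub>"
    unfolding GG_add GG_zero using g.l_inv[OF 1] gr_one by auto
  ultimately show "\<exists>y\<in>carrier GG. y \<oplus>\<^bsub>GG\<^esub> f = \<zero>\<^bsub>GG\<^esub>" by blast
  show "\<zero>\<^bsub>GG\<^esub> \<oplus>\<^bsub>GG\<^esub> f = f" unfolding GG_add GG_zero using g.l_one[OF 1] unfolding gr_one by auto
  fix h assume h: "h \<in> carrier GG"
  have 2: "h n \<in> carrier (gr n)" for n using h GG_carrier by blast
  have "{n. f n \<otimes>\<^bsub>gr n\<^esub> h n \<noteq> Dlt n} \<subseteq> {n. f n \<noteq> Dlt n} \<union> {n. h n \<noteq> Dlt n}"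
    using g.l_one[OF g.one_closed] unfolding gr_one by auto
  thus "f \<oplus>\<^bsub>GG\<^esub> h \<in> carrier GG" using f h unfolding GG_carrier GG_add
    by (auto intro: finite_subset)
  show "f \<oplus>\<^bsub>GG\<^esub> h = h \<oplus>\<^bsub>GG\<^esub> f" unfolding GG_add using g.m_comm[OF 1 2] by auto
  fix k assume k: "k \<in> carrier GG"
  have 3: "k n \<in> carrier (gr n)" for n using k GG_carrier by blast
  show "f \<oplus>\<^bsub>GG\<^esub> h \<oplus>\<^bsub>GG\<^esub> k = f \<oplus>\<^bsub>GG\<^esub> (h \<oplus>\<^bsub>GG\<^esub> k)" unfolding GG_add using g.m_assoc[OF 1 2 3] by auto
next
  have "Dlt n \<in> carrier (gr n)" for n
    using comm_group_gr[of n] gr_one[of n] by (metis comm_group_def comm_monoid_def monoid.one_closed)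
  thus "\<zero>\<^bsub>GG\<^esub> \<in> carrier GG" unfolding GG_carrier GG_zero by simp
qed

text \<open>\<open>rcoset_mult\<close> is a union of cosets over all pairs of representatives; by
  \<open>ocong_comp\<close> they are one and the same coset, the class of a composition.\<close>

lemma inspan_rcoset_mult:
  assumes "C \<in> carrier (gr i)" "D \<in> carrier (gr j)"
  shows "rcoset_mult Dr (Dlt (i + j)) C D \<in> carrier (gr (i + j))"
    "\<lbrakk>gens L; \<forall>u\<in>C. inspan L i u; \<forall>u\<in>D. inspan L j u; w \<in> rcoset_mult Dr (Dlt (i + j)) C D\<rbrakk> \<Longrightarrow> inspan L (i + j) w"
proof -
  obtain u v where uv: "u \<in> Dlt (Suc i)" "C = cos i u" "v \<in> Dlt (Suc j)" "D = cos j v"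
    using assms[unfolded gr_carrier] by blast
  note l = Dlt_lin[OF uv(1)] Dlt_lin[OF uv(3)]
  have e: "rcoset_mult Dr (Dlt (i + j)) C D = (\<Union>a\<in>C. \<Union>b\<in>D. cos (i + j) (ocomp a b))"
    unfolding rcoset_mult_def coset_Dr by simp
  have uvD: "ocomp u v \<in> Dlt (Suc (i + j))" using Dlt_ocomp[OF uv(1,3)] by simp
  have "cos (i + j) (ocomp a b) = cos (i + j) (ocomp u v)" if "a \<in> C" "b \<in> D" for a b
    using that unfolding uv mem_cos[OF l(1)] mem_cos[OF l(2)] by (intro cos_eq ocong_comp uv)
  moreover have "u \<in> C" "v \<in> D" unfolding uv using cos_self l by auto
  ultimately have e2: "rcoset_mult Dr (Dlt (i + j)) C D = cos (i + j) (ocomp u v)" unfolding e by blast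
  thus "rcoset_mult Dr (Dlt (i + j)) C D \<in> carrier (gr (i + j))" using gr_carrier uvD by blast
  assume h: "gens L" "\<forall>u\<in>C. inspan L i u" "\<forall>u\<in>D. inspan L j u" "w \<in> rcoset_mult Dr (Dlt (i + j)) C D"
  have "inspan L (i + j) (ocomp u v)" using inspan_comp[OF h(1)] h(2,3) \<open>u \<in> C\<close> \<open>v \<in> D\<close> by blast
  thus "inspan L (i + j) w" using h(4) inspan_cong unfolding e2 mem_cos[OF Dlt_lin[OF uvD]] by blast
qed

text \<open>The generators are replaced by lifts of their homogeneous components. Every symbol is
  then represented by a combination of monomials of weight at most its degree, and the remainder of
  smaller order is treated by induction on the order.\<close>

theorem fg_imp_span:
  assumes fg: "finitely_generated_over R GG (gr_diffop_map K R)"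
  shows "\<exists>L. gens L \<and> (\<forall>n. Dlt (Suc n) = ospan L n)"
proof -
  interpret GA: abelian_group GG by (rule abelian_group_GG)
  obtain S where S: "S \<subseteq> carrier GG" "finite S"
    "generate_ring GG (gr_diffop_map K R ` carrier R \<union> S) = carrier GG"
    using fg[unfolded finitely_generated_over_def] by (elim conjE exE) blast
  let ?gen = "generate_ring GG (gr_diffop_map K R ` carrier R \<union> S)"
  \<comment> \<open>Components in degree 0 are left out: they are multiplications by elements of R
    and are absorbed into the coefficients. The listed operators then have positive weight, as
    finiteness of the count requires.\<close>
  define I where "I = (SIGMA s:S. {n. s n \<noteq> Dlt n \<and> n \<ge> 1})"
  have fI: "finite I" unfolding I_def
  proof (rule finite_SigmaI[OF S(2)])
    fix s assume "s \<in> S"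
    hence "finite {n. s n \<noteq> Dlt n}" using S(1) unfolding subset_iff GG_carrier by blast
    thus "finite {n. s n \<noteq> Dlt n \<and> n \<ge> 1}" by (rule rev_finite_subset) blast
  qed
  define \<rho> where "\<rho> s n = (SOME u. u \<in> Dlt (Suc n) \<and> s n = cos n u)" for s n
  have \<rho>: "\<rho> s n \<in> Dlt (Suc n) \<and> s n = cos n (\<rho> s n)" if "s \<in> carrier GG" for s n
  proof -
    have "\<exists>u. u \<in> Dlt (Suc n) \<and> s n = cos n u" by (rule GG_rep[OF that, of n]) blast
    thus ?thesis unfolding \<rho>_def by (rule someI_ex)
  qed
  obtain L where L: "set L = (\<lambda>(s, n). (\<rho> s n, n)) ` I" using finite_list[OF finite_imageI[OF fI]] by metis
  have G: "gens L" unfolding gens_def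
  proof (clarify)
    fix f d assume "(f, d) \<in> set L"
    then obtain s where s: "s \<in> S" "d \<ge> 1" "f = \<rho> s d" unfolding L I_def by auto
    have "s \<in> carrier GG" using s(1) S(1) by blast
    from \<rho>[OF this, of d] show "1 \<le> d \<and> f \<in> Dlt (Suc d)" unfolding s(3) using s(2) by blast
  qed
  \<comment> \<open>All representatives in all degrees are followed at once, since the product in
    the graded ring mixes the components of its factors.\<close>
  have claim: "\<forall>n. \<forall>u\<in>g n. inspan L n u" if "g \<in> ?gen" for g
    using that
  proof induction
    case one
    show ?case unfolding GG_one
    proof (intro allI ballI)
      fix n u assume u: "u \<in> (if n = 0 then cos 0 oid else Dlt n)"
      show "inspan L n u"
      proof (cases "n = 0")
        case True
        hence "ocong 0 u oid" using u mem_cos[OF lin_basic(2)] by simp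
        thus ?thesis using inspan_cong order_zero_span[OF G oid_Dlt] True by blast
      qed (use u inspan_lower in auto)
    qed
  next
    case (incl h)
    show ?case
    proof (cases "h \<in> S")
      case True
      hence hc: "h \<in> carrier GG" using S(1) by blast
      show ?thesis
      proof (intro allI ballI)
        fix n u assume u: "u \<in> h n"
        note r = \<rho>[OF hc, of n]
        have rl: "\<rho> h n \<in> Lin" using r Dlt_lin by blast
        have cu: "ocong n u (\<rho> h n)" using u r mem_cos[OF rl] by blast
        consider "h n = Dlt n" | "n = 0" | "h n \<noteq> Dlt n" "n \<ge> 1" by linarith
        thus "inspan L n u"
        proof cases
          case 1 thus ?thesis using u inspan_lower by blast
        next
          case 2
          hence "inspan L n (\<rho> h n)" using order_zero_span[OF G] r by blast
          thus ?thesis using inspan_cong cu by blast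
        next
          case 3
          hence "(\<rho> h n, n) \<in> set L" unfolding L I_def using True by force
          from omon_single[OF G this] have "inspan L n (\<rho> h n)" using inspan_omon[OF G, of _ n] by force
          thus ?thesis using inspan_cong cu by blast
        qed
      qed
    next
      case False
      then obtain r where r: "r \<in> carrier R" "h = gr_diffop_map K R r" using incl by blast
      show ?thesis
      proof (intro allI ballI)
        fix n u assume u: "u \<in> h n"
        have hn: "h n = cos n (if n = 0 then (\<lambda>x\<in>carrier R. r \<otimes> x) else ozero)"
          unfolding r(2) gr_diffop_map_def Dlt_def[symmetric] coset_Dr by simp
        show "inspan L n u"
        proof (cases "n = 0")
          case True
          have e: "(\<lambda>x\<in>carrier R. r \<otimes> x) = osc r oid" unfolding osc_def oid_def by auto
          have d: "osc r oid \<in> Dlt (Suc 0)" using Dlt_osc[OF oid_Dlt r(1)] .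
          have "ocong 0 u (osc r oid)" using u hn True e mem_cos[OF Dlt_lin[OF d]] by simp
          thus ?thesis using inspan_cong order_zero_span[OF G d] True by blast
        next
          case False
          hence "ocong n u ozero" using u hn mem_cos[OF lin_basic(1)] by simp
          thus ?thesis using inspan_cong inspan_lower[OF ozero_Dlt] by blast
        qed
      qed
    qed
  next
    case (a_inv h)
    have hc: "h \<in> carrier GG" using a_inv(1) S(3) by simp
    show ?case
    proof (intro allI ballI)
      fix n u assume u: "u \<in> (\<ominus>\<^bsub>GG\<^esub> h) n"
      have "(h \<oplus>\<^bsub>GG\<^esub> \<ominus>\<^bsub>GG\<^esub> h) n = Dlt n" using GA.r_neg[OF hc] GG_zero by simp
      hence "{oadd c d | c d. c \<in> h n \<and> d \<in> (\<ominus>\<^bsub>GG\<^esub> h) n} = Dlt n" unfolding GG_add gr_mult by simp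
      hence cu: "oadd c u \<in> Dlt n" if "c \<in> h n" for c using that u by blast
      obtain w where w: "w \<in> Dlt (Suc n)" "h n = cos n w" using GG_rep[OF hc] by blast
      hence wh: "w \<in> h n" using cos_self Dlt_lin by blast
      have wl: "w \<in> Lin" using w Dlt_lin by blast
      obtain v where v: "v \<in> Dlt (Suc n)" "(\<ominus>\<^bsub>GG\<^esub> h) n = cos n v" using GG_rep[OF GA.a_inv_closed[OF hc]] by blast
      have ul: "u \<in> Lin" using u v cos_lin Dlt_lin by blast
      \<comment> \<open>A representative u of the negative is -w plus the operator w + u, which has
        order below n because the two classes add up to zero.\<close>
      have "u = oadd (osc (\<ominus> \<one>) w) (oadd w u)"
      proof (rule op_eqI)
        fix x assume x: "x \<in> carrier R"
        have c: "w x \<in> carrier R" "u x \<in> carrier R" using linD(1)[OF wl] linD(1)[OF ul] x by auto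
        have "u x = \<ominus> \<one> \<otimes> w x \<oplus> (w x \<oplus> u x)" using c by algebra
        thus "u x = oadd (osc (\<ominus> \<one>) w) (oadd w u) x" using x by simp
      qed (use linD(4)[OF ul] in auto)
      moreover have "inspan L n (osc (\<ominus> \<one>) w)" using inspan_osc[OF G] a_inv(2) wh by blast
      moreover have "inspan L n (oadd w u)" using inspan_lower cu[OF wh] by blast
      ultimately show "inspan L n u" using inspan_oadd[OF G] by metis
    qed
  next
    case (eng_add g h)
    show ?case unfolding GG_add gr_mult using eng_add inspan_oadd[OF G] by blast
  next
    case (eng_mult g h)
    have c: "g \<in> carrier GG" "h \<in> carrier GG" using eng_mult S(3) by auto
    show ?case unfolding GG_mult
    proof (intro allI)
      fix n
      interpret g: comm_group "gr n" by (rule comm_group_gr)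
      let ?p = "\<lambda>i. rcoset_mult Dr (Dlt n) (g i) (h (n - i))"
      have p: "?p i \<in> carrier (gr n)" "\<forall>w\<in>?p i. inspan L n w" if "i \<le> n" for i
      proof -
        have "i + (n - i) = n" using that by simp
        moreover have "g i \<in> carrier (gr i)" "h (n - i) \<in> carrier (gr (n - i))" using c GG_carrier by blast+
        ultimately show "?p i \<in> carrier (gr n)" "\<forall>w\<in>?p i. inspan L n w"
          using inspan_rcoset_mult[of "g i" i "h (n - i)" "n - i"] eng_mult.IH G by auto
      qed
      have "\<forall>u\<in>finprod (gr n) ?p A. inspan L n u" if "finite A" "A \<subseteq> {..n}" for A
        using that
      proof (induction A rule: finite_induct)
        case empty thus ?case using gr_one inspan_lower by simp
      next
        case (insert i A)
        have "finprod (gr n) ?p (insert i A) = ?p i \<otimes>\<^bsub>gr n\<^esub> finprod (gr n) ?p A"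
          using insert p by (intro g.finprod_insert) auto
        thus ?case using insert p inspan_oadd[OF G] unfolding gr_mult by auto
      qed
      from this[of "{..n}"] show "\<forall>u\<in>finprod (gr n) ?p {..n}. inspan L n u" by simp
    qed
  qed
  have "Dlt (Suc n) \<subseteq> ospan L n" for n
  proof (induction n rule: less_induct)
    case (less n)
    show ?case
    proof
      fix \<delta> assume d: "\<delta> \<in> Dlt (Suc n)"
      \<comment> \<open>The symbol of \<delta>, concentrated in degree n; it lies in the generated
        ring, so the claim applies to it.\<close>
      define g where "g k = (if k = n then cos n \<delta> else Dlt k)" for k
      have "g k \<in> carrier (gr k)" for k
        unfolding g_def using d gr_carrier GA.zero_closed unfolding GG_zero GG_carrier by auto
      moreover have "{k. g k \<noteq> Dlt k} \<subseteq> {n}" unfolding g_def by auto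
      ultimately have "g \<in> ?gen" unfolding S(3) GG_carrier by (auto intro: finite_subset)
      from claim[OF this] have "inspan L n \<delta>" unfolding g_def using cos_self[OF Dlt_lin[OF d]] by auto
      then obtain t e where t: "t \<in> ospan L n" "e \<in> Dlt n" "\<delta> = oadd t e" unfolding inspan_def ocong_def by blast
      have "e \<in> ospan L n"
      proof (cases n)
        case 0 thus ?thesis using t(2) by (simp add: Dlt_0 ospan.Szero)
      next
        case (Suc k) thus ?thesis using t(2) less[of k] ospan_mono[of k n L] by auto
      qed
      thus "\<delta> \<in> ospan L n" using t ospan.Sadd by simp
    qed
  qed
  thus ?thesis using G ospan_Dlt[OF G] by blast
qed

end

section \<open>Counting standard monomials\<close>

text \<open>Translation invariance makes weight followed by the lexicographic order a monomial
  order.\<close>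

lemma lex_map2_add:
  fixes a b c :: "nat list"
  assumes "length a = length b" "length c = length b" "a < b"
  shows "map2 (+) a c < map2 (+) b c"
  using assms
proof (induction a arbitrary: b c)
  case (Cons x a)
  then obtain y b' z c' where "b = y # b'" "c = z # c'" by (metis length_Suc_conv)
  thus ?case using Cons by auto
qed simp

lemma map2_sub_add:
  fixes a b :: "nat list"
  shows "list_all2 (\<le>) b a \<Longrightarrow> map2 (+) b (map2 (-) a b) = a"
  by (induction rule: list_all2_induct) auto

text \<open>R = K + \<mm> with a field K inside R. The residue field is expressed by congruences
  between elements, so that the completion can be shown to satisfy the same axioms directly.\<close>

locale coeff = kalg K R
  for K :: "('k, 'p) ring_scheme" and R :: "('k, 'b, 'q) module_scheme" (structure) +
  fixes \<mm> :: "'b set"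
  assumes maxi: "maximalideal \<mm> R" and KKsub: "subring KK R"
    and KKinv: "a \<in> KK \<Longrightarrow> a \<noteq> \<zero> \<Longrightarrow> \<exists>b\<in>KK. b \<otimes> a = \<one>"
    and resid: "r \<in> carrier R \<Longrightarrow> \<exists>a\<in>KK. r \<ominus> a \<in> \<mm>"
begin

lemma mid: "ideal \<mm> R" using maxi maximalideal.axioms(1) by blast

section \<open>Differential powers and lengths over the coefficient field\<close>

definition dpow :: "nat \<Rightarrow> 'b set" where
  "dpow n = {f \<in> carrier R. \<forall>\<delta>\<in>Dlt n. \<delta> f \<in> \<mm>}"

lemma diff_power_dpow: "diff_power K R \<mm> n = dpow n"
  unfolding diff_power_def dpow_def Dlt_def ..

text \<open>\<delta>(u r) = [\<delta>, r](u) + r \<delta>(u), and the order of the commutator does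
  not exceed that of \<delta>.\<close>

lemma dpow_ideal: "ideal (dpow n) R"
proof -
  show ?thesis
  proof (rule ideal_intro)
    show "dpow n \<subseteq> carrier R" unfolding dpow_def by blast
    have "\<delta> \<zero> \<in> \<mm>" if "\<delta> \<in> Dlt n" for \<delta>
      using lin_zero[OF Dlt_lin[OF that]] idealD(4)[OF mid] by simp
    thus "\<zero> \<in> dpow n" unfolding dpow_def by simp
    fix u assume u: "u \<in> dpow n"
    hence uc: "u \<in> carrier R" unfolding dpow_def by blast
    show "u \<oplus> v \<in> dpow n" if v: "v \<in> dpow n" for v
    proof -
      have vc: "v \<in> carrier R" using v unfolding dpow_def by blast
      have "\<delta> (u \<oplus> v) \<in> \<mm>" if "\<delta> \<in> Dlt n" for \<delta>
        using linD(2)[OF Dlt_lin[OF that] uc vc] idealD(5)[OF mid, of "\<delta> u" "\<delta> v"] u v that unfolding dpow_def by auto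
      thus ?thesis using uc vc unfolding dpow_def by simp
    qed
    fix r assume r: "r \<in> carrier R"
    have "\<delta> (u \<otimes> r) \<in> \<mm>" if d: "\<delta> \<in> Dlt n" for \<delta>
    proof -
      have "commutator R \<delta> r \<in> Dlt n"
        using Dlt_comm[of \<delta> n r] d r Dlt_up[of n] by blast
      hence "commutator R \<delta> r u \<in> \<mm>" using u unfolding dpow_def by blast
      moreover have "r \<otimes> \<delta> u \<in> \<mm>" using u d idealD(7)[OF mid r] unfolding dpow_def by blast
      ultimately show ?thesis unfolding lin_split[OF Dlt_lin[OF d] uc r] by (rule idealD(5)[OF mid])
    qed
    thus "r \<otimes> u \<in> dpow n" unfolding dpow_def using r uc by (simp add: m_comm)
  qed
qed

lemma ipow_dpow: "ipow \<mm> n \<subseteq> dpow n"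
proof
  fix x assume x: "x \<in> ipow \<mm> n"
  have "\<delta> x \<in> \<mm>" if "\<delta> \<in> Dlt n" for \<delta>
    using Dlt_ipow[OF mid that, of x 0] x unfolding ipow_1[OF mid] by simp
  thus "x \<in> dpow n" unfolding dpow_def using idealD(3)[OF ipow_ideal[OF mid] x] by blast
qed

lemma KK_sub_asub: "asub R (carrier R) U \<Longrightarrow> asub R KK U"
  using asub_mono KK_carrier by blast

text \<open>Between I + \<mm>^(j + 1) and I + \<mm>^j every K-subspace is an ideal, because \<mm>
  carries the larger into the smaller and R = K + \<mm>. Lengths over K and over R thus agree step
  by step, until I + \<mm>^n = I.\<close>

lemma len_KK_eq:
  assumes I: "ideal I R" "ipow \<mm> n \<subseteq> I"
  shows "klen I (carrier R) = colen I"
proof -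
  note mn = ipow_ideal[OF mid]
  have "klen (I <+> ipow \<mm> j) (carrier R) = colen (I <+> ipow \<mm> j)" for j
  proof (induction j)
    case 0
    have "I <+> ipow \<mm> 0 = carrier R" unfolding ipow_0
      using ideal_subset_add(2)[OF I(1) oneideal] idealD(2)[OF ideal_add[OF I(1) oneideal]] by blast
    thus ?case by (simp only: len_self)
  next
    case (Suc j)
    let ?U = "I <+> ipow \<mm> (Suc j)" and ?V = "I <+> ipow \<mm> j"
    have UV: "?U \<subseteq> ?V" by (rule set_add_mono[OF subset_refl ipow_Suc_subset[OF mid]])
    have Ui: "ideal ?U R" and Vi: "ideal ?V R" by (rule ideal_add[OF I(1) mn])+
    have mV: "\<mu> \<otimes> v \<in> ?U" if h: "\<mu> \<in> \<mm>" "v \<in> ?V" for \<mu> v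
    proof -
      obtain i w where w: "i \<in> I" "w \<in> ipow \<mm> j" "v = i \<oplus> w" using h unfolding mem_set_add by blast
      have c: "\<mu> \<in> carrier R" "i \<in> carrier R" "w \<in> carrier R" using h w idealD(3)[OF mid] idealD(3)[OF I(1)] idealD(3)[OF mn] by auto
      have "\<mu> \<otimes> v = \<mu> \<otimes> i \<oplus> w \<otimes> \<mu>" unfolding w(3) using c by (simp add: r_distr m_comm)
      moreover have "\<mu> \<otimes> i \<in> I" using idealD(7)[OF I(1)] w c by blast
      moreover have "w \<otimes> \<mu> \<in> ipow \<mm> (Suc j)" unfolding ipow_Suc using w(2) h(1) by (rule ideal_prod.prod)
      ultimately show ?thesis unfolding mem_set_add by blast
    qed
    have sub: "asub R (carrier R) N" if N: "asub R KK N" "?U \<subseteq> N" "N \<subseteq> ?V" for N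
      unfolding asub_def
    proof (intro conjI ballI)
      fix r v assume r: "r \<in> carrier R" and v: "v \<in> N"
      obtain a where a: "a \<in> KK" "r \<ominus> a \<in> \<mm>" using resid[OF r] by blast
      have c: "a \<in> carrier R" "v \<in> carrier R" using a KKc v asubD(2)[OF N(1)] by auto
      have "r \<otimes> v = a \<otimes> v \<oplus> (r \<ominus> a) \<otimes> v" using c r by algebra
      moreover have "a \<otimes> v \<in> N" using asubD(6)[OF N(1) a(1) v] .
      moreover have "(r \<ominus> a) \<otimes> v \<in> N" using mV[OF a(2)] v N by blast
      ultimately show "r \<otimes> v \<in> N" using asubD(4)[OF N(1)] by simp
    qed (use asubD[OF N(1)] in auto)
    have "klen ?U ?V = len idlat ?U ?V"
    proof (rule antisym)
      show "klen ?U ?V \<le> len idlat ?U ?V"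
        by (rule len_transfer[where \<Phi> = "\<lambda>N. N"]) (use sub in auto)
      show "len idlat ?U ?V \<le> klen ?U ?V"
        by (rule len_mono) (use KK_sub_asub in auto)
    qed
    moreover have "klen ?U (carrier R) = klen ?U ?V + klen ?V (carrier R)"
      by (rule len_add) (use KK_sub_asub idealD(1,2)[OF Vi] asub_carrier KK_carrier UV in auto)
    ultimately show ?case unfolding len_ideal_add[OF Vi UV] using Suc by simp
  qed
  from this[of n] show ?thesis using add_absorb[OF idealD(1)[OF I(1)] idealD(1)[OF mn] I(2)] by simp
qed

section \<open>Standard monomials\<close>

definition Uset :: "(('b \<Rightarrow> 'b) \<times> nat) list \<Rightarrow> nat list set \<Rightarrow> 'b set" where
  "Uset L B = {f \<in> carrier R. \<forall>b\<in>B. omon L b f \<in> \<mm>}"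

text \<open>Putting the weight in front of the exponents makes the lexicographic order on lists
  compare weights before exponents.\<close>

definition std :: "(('b \<Rightarrow> 'b) \<times> nat) list \<Rightarrow> nat list set" where
  "std L = {a. length a = length L \<and>
     (\<exists>f \<in> Uset L {b. length b = length L \<and> owt L b # b < owt L a # a}. omon L a f \<notin> \<mm>)}"

lemma Uset_asub: "gens L \<Longrightarrow> asub R KK (Uset L B)"
proof -
  assume G: "gens L"
  note l = Dlt_lin[OF omon_Dlt[OF G]]
  show ?thesis unfolding asub_def Uset_def
    using linD(1-3)[OF l] lin_zero[OF l] lin_neg[OF l] idealD(4-7)[OF mid] KKc by auto
qed

text \<open>u \<mapsto> \<delta> u modulo \<mm> is a nonzero K-linear map from U to the residue
  field, which is K.\<close>

lemma codim_one:
  assumes d: "\<delta> \<in> Lin" and U: "asub R KK U" and f: "f \<in> U" "\<delta> f \<notin> \<mm>"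
  shows "klen {u \<in> U. \<delta> u \<in> \<mm>} U = 1"
proof (rule antisym)
  note Uc = asubD(2)[OF U]
  have V: "asub R KK {u \<in> U. \<delta> u \<in> \<mm>}" unfolding asub_def
    using asubD[OF U] linD(1-3)[OF d] lin_zero[OF d] lin_neg[OF d] idealD(4-7)[OF mid] KKc by auto
  show "1 \<le> klen {u \<in> U. \<delta> u \<in> \<mm>} U"
    by (rule len_pos) (use V U f in auto)
  show "klen {u \<in> U. \<delta> u \<in> \<mm>} U \<le> 1"
  proof (rule len_le_one)
    fix N assume N: "N \<in> sublat R KK" "{u \<in> U. \<delta> u \<in> \<mm>} \<subset> N" "N \<subseteq> U"
    then obtain v where v: "v \<in> N" "\<delta> v \<notin> \<mm>" by blast
    have Na: "asub R KK N" using N by simp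
    have vc: "v \<in> carrier R" using v N Uc by blast
    obtain c1 where c1: "c1 \<in> KK" "\<delta> v \<ominus> c1 \<in> \<mm>" using resid linD(1)[OF d vc] by blast
    have "c1 \<noteq> \<zero>" using c1 v linD(1)[OF d vc] by (auto simp: a_minus_def)
    then obtain b where b: "b \<in> KK" "b \<otimes> c1 = \<one>" using KKinv c1 by blast
    have "U \<subseteq> N"
    proof
      fix u assume u: "u \<in> U"
      have uc: "u \<in> carrier R" using u Uc by blast
      obtain c2 where c2: "c2 \<in> KK" "\<delta> u \<ominus> c2 \<in> \<mm>" using resid linD(1)[OF d uc] by blast
      define c where "c = c2 \<otimes> b"
      have c: "c \<in> KK" unfolding c_def using subringE(6)[OF KKsub c2(1) b(1)] .
      have cc: "c \<in> carrier R" "c1 \<in> carrier R" "c2 \<in> carrier R" "b \<in> carrier R" using c c1 c2 b KKc by auto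
      have cv: "c \<otimes> v \<in> N" using asubD(6)[OF Na c v(1)] .
      have cvc: "c \<otimes> v \<in> carrier R" using cc vc by simp
      have "\<delta> (u \<ominus> c \<otimes> v) = \<delta> u \<ominus> c \<otimes> \<delta> v" using lin_minus[OF d uc cvc] linD(3)[OF d c vc] by simp
      also have "\<dots> = (\<delta> u \<ominus> c2) \<ominus> c \<otimes> (\<delta> v \<ominus> c1)"
      proof -
        have "c \<otimes> c1 = c2" unfolding c_def using b cc by (simp add: m_assoc)
        moreover have "\<delta> u \<ominus> c \<otimes> \<delta> v = (\<delta> u \<ominus> c \<otimes> c1) \<ominus> c \<otimes> (\<delta> v \<ominus> c1)"
          using linD(1)[OF d uc] linD(1)[OF d vc] cc by algebra
        ultimately show ?thesis by simp
      qed
      also have "\<dots> \<in> \<mm>" using c2(2) idealD(7)[OF mid cc(1) c1(2)] by (rule idealD(9)[OF mid])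
      finally have "u \<ominus> c \<otimes> v \<in> {u \<in> U. \<delta> u \<in> \<mm>}" using u cv N asubD(7)[OF U] by auto
      hence "u \<ominus> c \<otimes> v \<in> N" using N by blast
      hence "(u \<ominus> c \<otimes> v) \<oplus> c \<otimes> v \<in> N" using cv by (rule asubD(4)[OF Na])
      moreover have "(u \<ominus> c \<otimes> v) \<oplus> c \<otimes> v = u" using uc cvc by algebra
      ultimately show "u \<in> N" by simp
    qed
    thus "N = U" using N by blast
  qed
qed

context
  fixes L
  assumes G: "gens L" and span: "\<And>n. Dlt (Suc n) = ospan L n"
begin

lemma ospan_Uset:
  assumes "t \<in> ospan L n" "f \<in> carrier R" "\<And>b. length b = length L \<Longrightarrow> owt L b \<le> n \<Longrightarrow> omon L b f \<in> \<mm>"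
  shows "t f \<in> \<mm>"
  using assms(1)
proof induction
  case Szero thus ?case using assms(2) idealD(4)[OF mid] by simp
next
  case (Sadd s t) thus ?case using assms(2) idealD(5)[OF mid] by simp
next
  case (Smon r a) thus ?case using assms idealD(7)[OF mid] by simp
qed

lemma dpow_Uset: "dpow (Suc n) = Uset L {b. length b = length L \<and> owt L b \<le> n}"
proof -
  have "omon L b \<in> Dlt (Suc n)" if "owt L b \<le> n" for b
    using omon_Dlt[OF G, of b] Dlt_mono[of "Suc (owt L b)" "Suc n"] that by auto
  thus ?thesis unfolding dpow_def Uset_def span using ospan_Uset span by auto
qed

text \<open>Let c = a - b and let f witness that a is standard. Then g = \<open>omon L c f\<close>
  witnesses b: up to weight a, the monomial of exponent x applied to g is the monomial of exponent x
  + c applied to f, plus an operator of order below the weight of a, and such operators take f into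
  \<mm>.\<close>

lemma down_closed_std: "down_closed (std L)"
  unfolding down_closed_def
proof (intro ballI allI impI)
  fix a b assume a: "a \<in> std L" and ba: "list_all2 (\<le>) b a"
  define c where "c = map2 (-) a b"
  have lab: "length a = length b" using list_all2_lengthD[OF ba] by simp
  have la: "length a = length L" using a unfolding std_def by blast
  have lc: "length c = length L" "length b = length L" unfolding c_def using la lab by auto
  have abc: "map2 (+) b c = a" unfolding c_def by (rule map2_sub_add[OF ba])
  note mult = omon_mult[OF G _ lc(1)]
  obtain f where f: "f \<in> carrier R" "\<And>b. length b = length L \<Longrightarrow> owt L b # b < owt L a # a \<Longrightarrow> omon L b f \<in> \<mm>"
    "omon L a f \<notin> \<mm>" using a unfolding std_def Uset_def by blast
  define g where "g = omon L c f"
  note lin = Dlt_lin[OF omon_Dlt[OF G]]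
  have g: "g \<in> carrier R" unfolding g_def using linD(1)[OF lin f(1)] .
  \<comment> \<open>Operators of order below the weight of a are spanned by monomials of smaller
    weight, all of which take f into \<mm>.\<close>
  have low: "e f \<in> \<mm>" if "e \<in> Dlt k" "k \<le> owt L a" for e k
  proof (cases k)
    case 0 thus ?thesis using that f(1) idealD(4)[OF mid] by (simp add: Dlt_0)
  next
    case (Suc j)
    hence "e \<in> ospan L j" using that span by simp
    thus ?thesis using ospan_Uset f(1,2) that(2) Suc by force
  qed
  have key: "omon L x g \<in> \<mm> \<longleftrightarrow> omon L (map2 (+) x c) f \<in> \<mm>"
    if x: "length x = length L" "owt L x + owt L c \<le> owt L a" for x
  proof -
    obtain e where e: "e \<in> Dlt (owt L x + owt L c)" "ocomp (omon L x) (omon L c) = oadd (omon L (map2 (+) x c)) e"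
      using mult[OF x(1)] unfolding ocong_def by blast
    have ef: "e f \<in> \<mm>" using low[OF e(1) x(2)] .
    have "omon L x g = ocomp (omon L x) (omon L c) f" unfolding g_def using f(1) by simp
    also have "\<dots> = omon L (map2 (+) x c) f \<oplus> e f" unfolding e(2) using f(1) by simp
    finally have E: "omon L x g = omon L (map2 (+) x c) f \<oplus> e f" .
    have cc: "omon L (map2 (+) x c) f \<in> carrier R" "e f \<in> carrier R" using linD(1)[OF lin f(1)] idealD(3)[OF mid ef] by auto
    have "omon L (map2 (+) x c) f = omon L x g \<ominus> e f" unfolding E using cc by algebra
    thus ?thesis using E idealD(5)[OF mid _ ef] idealD(9)[OF mid _ ef] by metis
  qed
  have wa: "owt L b + owt L c = owt L a" using mult[OF lc(2)] abc by simp
  have "omon L b g \<notin> \<mm>" using key[OF lc(2)] wa abc f(3) by simp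
  moreover have "omon L x g \<in> \<mm>" if x: "length x = length L" "owt L x # x < owt L b # b" for x
  proof -
    have w: "owt L x \<le> owt L b" using x by auto
    have wx: "owt L (map2 (+) x c) = owt L x + owt L c" using mult[OF x(1)] by simp
    have "owt L (map2 (+) x c) # map2 (+) x c < owt L a # a"
    proof (cases "owt L x < owt L b")
      case True thus ?thesis unfolding wx wa[symmetric] by simp
    next
      case False
      hence "x < b" "owt L x = owt L b" using x w by auto
      thus ?thesis unfolding wx wa[symmetric] using lex_map2_add[of x b c] x(1) lc abc by simp
    qed
    moreover have "length (map2 (+) x c) = length L" using x lc by simp
    ultimately have "omon L (map2 (+) x c) f \<in> \<mm>" using f(2) by blast
    thus ?thesis using key[OF x(1)] w wa by simp
  qed
  ultimately show "b \<in> std L" unfolding std_def Uset_def using lc(2) g by blast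
qed

text \<open>From an initial segment B of the monomial order the largest exponent a is removed. The
  condition it imposes cuts out a subspace of codimension one if a is standard, and is implied by
  the others otherwise.\<close>

lemma len_Uset:
  assumes "finite B" "\<And>b. b \<in> B \<Longrightarrow> length b = length L"
    "\<And>a b. b \<in> B \<Longrightarrow> length a = length L \<Longrightarrow> owt L a # a < owt L b # b \<Longrightarrow> a \<in> B"
  shows "klen (Uset L B) (carrier R) = enat (card (B \<inter> std L))"
  using assms
proof (induction "card B" arbitrary: B)
  case 0
  hence "B = {}" by simp
  thus ?case unfolding Uset_def by (simp add: len_self zero_enat_def)
next
  case (Suc k)
  let ?key = "\<lambda>a. owt L a # a"
  have ne: "B \<noteq> {}" using Suc(2) by auto
  have "Max (?key ` B) \<in> ?key ` B" using ne Suc(3) by (intro Max_in) auto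
  then obtain a where a: "a \<in> B" "?key a = Max (?key ` B)" by auto
  have le: "?key b \<le> ?key a" if "b \<in> B" for b unfolding a(2) using that Suc(3) by (intro Max_ge) auto
  define B' where "B' = B - {a}"
  \<comment> \<open>As B is an initial segment, removing its maximum a leaves all exponents below a;
    these are the ones in the definition of standardness of a.\<close>
  have B': "B' = {b. length b = length L \<and> ?key b < ?key a}"
  proof (intro equalityI subsetI)
    fix b assume b: "b \<in> B'"
    hence "?key b \<le> ?key a" "?key b \<noteq> ?key a" using le unfolding B'_def by auto
    thus "b \<in> {b. length b = length L \<and> ?key b < ?key a}" using b Suc(4) unfolding B'_def by auto
  next
    fix b assume "b \<in> {b. length b = length L \<and> ?key b < ?key a}"
    thus "b \<in> B'" using Suc(5)[OF a(1), of b] unfolding B'_def by auto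
  qed
  have IH: "klen (Uset L B') (carrier R) = enat (card (B' \<inter> std L))"
  proof (rule Suc(1))
    show "k = card B'" unfolding B'_def using Suc(2,3) a(1) by simp
    show "finite B'" unfolding B'_def using Suc(3) by simp
    show "length b = length L" if "b \<in> B'" for b using that unfolding B' by blast
    show "x \<in> B'" if "b \<in> B'" "length x = length L" "?key x < ?key b" for x b
      using that unfolding B' by (auto intro: less_trans)
  qed
  have UB: "Uset L B = {u \<in> Uset L B'. omon L a u \<in> \<mm>}" unfolding Uset_def B'_def using a(1) by auto
  have sub: "Uset L B \<subseteq> Uset L B'" unfolding UB by blast
  have la: "length a = length L" using a Suc(4) by blast
  have add: "klen (Uset L B) (carrier R) =
      klen (Uset L B) (Uset L B') + klen (Uset L B') (carrier R)"
    by (rule len_add[OF Uset_asub[OF G] asub_carrier[OF KK_carrier] KK_carrier sub]) (auto simp: Uset_def)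
  show ?case
  proof (cases "a \<in> std L")
    case True
    then obtain f where f: "f \<in> Uset L B'" "omon L a f \<notin> \<mm>" unfolding std_def B' by blast
    have "klen (Uset L B) (Uset L B') = 1"
      unfolding UB by (rule codim_one[OF Dlt_lin[OF omon_Dlt[OF G]] Uset_asub[OF G] f])
    moreover have "B \<inter> std L = insert a (B' \<inter> std L)" unfolding B'_def using True a(1) by auto
    moreover have "card (insert a (B' \<inter> std L)) = Suc (card (B' \<inter> std L))"
      by (rule card_insert_disjoint) (use Suc(3) in \<open>auto simp: B'_def\<close>)
    ultimately show ?thesis unfolding add IH by (simp add: one_enat_def)
  next
    case False
    hence "Uset L B = Uset L B'" unfolding UB using la unfolding std_def B' by blast
    moreover have "B \<inter> std L = B' \<inter> std L" unfolding B'_def using False by auto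
    ultimately show ?thesis using IH by simp
  qed
qed

lemma len_dpow: "klen (dpow (Suc n)) (carrier R) = enat (cnt (map snd L) (std L) n)"
proof -
  let ?B = "{b. length b = length L \<and> owt L b \<le> n}"
  have "\<forall>d\<in>set (map snd L). 1 \<le> d" using G unfolding gens_def by auto
  from finite_wt[OF this, of n] have f: "finite ?B" by simp
  have "klen (Uset L ?B) (carrier R) = enat (card (?B \<inter> std L))"
    by (rule len_Uset[OF f]) auto
  moreover have "?B \<inter> std L = {a \<in> std L. owt L a \<le> n}" unfolding std_def by auto
  ultimately show ?thesis unfolding dpow_Uset cnt_def by simp
qed

end

lemma diff_length_eq: "diff_length K R \<mm> n = colen (dpow n)"
  unfolding diff_length_def diff_power_dpow by (rule module_length_quotient[OF dpow_ideal])

theorem diff_length_rational_growth: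
  assumes "finitely_generated_over R (gr_diffop K R) (gr_diffop_map K R)"
  shows "\<exists>f. rational_growth f \<and> (\<forall>n. diff_length K R \<mm> (Suc n) = enat (f n))"
proof -
  obtain L where L: "gens L" "\<And>n. Dlt (Suc n) = ospan L n" using fg_imp_span[OF assms] by blast
  have 1: "diff_length K R \<mm> (Suc n) = enat (cnt (map snd L) (std L) n)" for n
    unfolding diff_length_eq len_KK_eq[OF dpow_ideal ipow_dpow, symmetric] by (rule len_dpow[OF L])
  have "rational_growth (cnt (map snd L) (std L))"
  proof (rule rational_growth_cnt)
    show "\<forall>d\<in>set (map snd L). 1 \<le> d" using L(1) unfolding gens_def by auto
    show "down_closed (std L)" by (rule down_closed_std[OF L])
    show "length a = length (map snd L)" if "a \<in> std L" for a using that unfolding std_def by simp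
  qed
  thus ?thesis using 1 by blast
qed

end

section \<open>The completion\<close>

locale compl = coeff K R \<mm>
  for K :: "('k, 'p) ring_scheme" and R :: "('k, 'b, 'q) module_scheme" (structure) and \<mm> +
  assumes noeth: "noeth_over (carrier R)"
begin

abbreviation mn where "mn n \<equiv> ipow \<mm> n"
abbreviation Q where "Q n \<equiv> R Quot (mn n)"
abbreviation C :: "('k, nat \<Rightarrow> 'b set) module" where "C \<equiv> completion R \<mm>"
abbreviation C_mult (infixl "\<otimes>\<^sub>C" 70) where "f \<otimes>\<^sub>C g \<equiv> f \<otimes>\<^bsub>C\<^esub> g"
abbreviation C_add (infixl "\<oplus>\<^sub>C" 65) where "f \<oplus>\<^sub>C g \<equiv> f \<oplus>\<^bsub>C\<^esub> g"
abbreviation C_minus (infixl "\<ominus>\<^sub>C" 65) where "f \<ominus>\<^sub>C g \<equiv> f \<ominus>\<^bsub>C\<^esub> g"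
abbreviation C_uminus ("\<ominus>\<^sub>C _" [81] 80) where "\<ominus>\<^sub>C f \<equiv> \<ominus>\<^bsub>C\<^esub> f"
abbreviation C_zero ("\<zero>\<^sub>C") where "\<zero>\<^sub>C \<equiv> \<zero>\<^bsub>C\<^esub>"
abbreviation C_one ("\<one>\<^sub>C") where "\<one>\<^sub>C \<equiv> \<one>\<^bsub>C\<^esub>"

lemmas mni = ipow_ideal[OF mid]

lemma quot_one_zero: "\<one>\<^bsub>Q n\<^esub> = mn n +> \<one>" "\<zero>\<^bsub>Q n\<^esub> = mn n +> \<zero>"
  using quot_ops(4,5)[OF mni zero_closed zero_closed] by blast+

definition iota :: "'b \<Rightarrow> nat \<Rightarrow> 'b set" where "iota r = (\<lambda>n. mn n +> r)"

lemma C_carrier: "f \<in> carrier C \<longleftrightarrow> (\<forall>n. \<exists>r\<in>carrier R. f n = mn n +> r) \<and> (\<forall>n. f (Suc n) \<subseteq> f n)"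
  unfolding completion_def Let_def by (simp add: quot_mem)

lemma C_ops: "f \<otimes>\<^sub>C g = (\<lambda>n. f n \<otimes>\<^bsub>Q n\<^esub> g n)" "f \<oplus>\<^sub>C g = (\<lambda>n. f n \<oplus>\<^bsub>Q n\<^esub> g n)"
  "\<one>\<^sub>C = iota \<one>" "\<zero>\<^sub>C = iota \<zero>"
  "k \<odot>\<^bsub>C\<^esub> f = (\<lambda>n. (mn n +> structure_map R k) \<otimes>\<^bsub>Q n\<^esub> f n)"
  unfolding completion_def Let_def iota_def using quot_one_zero by simp_all

lemma coset_mono: "k \<le> n \<Longrightarrow> mn n +> r \<subseteq> mn k +> r"
  using ipow_antimono[OF mid, of k n] unfolding a_r_coset_def' by blast

lemma iota_C: "r \<in> carrier R \<Longrightarrow> iota r \<in> carrier C"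
  unfolding C_carrier iota_def using coset_mono[of n "Suc n" for n] by auto

lemma C_anti: assumes "f \<in> carrier C" "k \<le> n" shows "f n \<subseteq> f k"
  using assms(2)
proof (induction n rule: dec_induct)
  case (step n)
  have "f (Suc n) \<subseteq> f n" using assms(1) unfolding C_carrier by blast
  thus ?case using step by blast
qed simp

lemma C_level:
  assumes "f \<in> carrier C" "r \<in> carrier R" "f n = mn n +> r" "k \<le> n"
  shows "f k = mn k +> r"
proof -
  obtain s where s: "s \<in> carrier R" "f k = mn k +> s" using assms(1) unfolding C_carrier by blast
  have "r \<in> f k" using C_anti[OF assms(1,4)] coset_self[OF mni assms(2), of n] assms(3) by blast
  hence "r \<ominus> s \<in> mn k" using coset_mem_iff[OF mni s(1) assms(2)] s(2) by simp
  hence "mn k +> r = mn k +> s" using coset_eq_iff[OF mni assms(2) s(1)] by blast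
  thus ?thesis using s(2) by simp
qed

lemma C_rep':
  assumes "f \<in> carrier C"
  obtains r where "r \<in> carrier R" "f n = mn n +> r" "\<And>k. k \<le> n \<Longrightarrow> f k = mn k +> r"
proof -
  obtain r where "r \<in> carrier R" "f n = mn n +> r" using assms unfolding C_carrier by blast
  thus ?thesis using that C_level[OF assms] by blast
qed

lemma C_rep:
  assumes "f \<in> carrier C"
  obtains r where "r \<in> carrier R" "\<And>k. k \<le> n \<Longrightarrow> f k = mn k +> r"
  using C_rep'[OF assms, of n] by metis

lemma iota_ops:
  assumes "r \<in> carrier R" "s \<in> carrier R"
  shows "iota (r \<otimes> s) = iota r \<otimes>\<^sub>C iota s" "iota (r \<oplus> s) = iota r \<oplus>\<^sub>C iota s"
  unfolding C_ops iota_def using quot_ops(1,2)[OF mni assms] by auto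

lemma C_op_level:
  assumes "r \<in> carrier R" "s \<in> carrier R" "f n = mn n +> r" "g n = mn n +> s"
  shows "(f \<otimes>\<^sub>C g) n = mn n +> (r \<otimes> s)" "(f \<oplus>\<^sub>C g) n = mn n +> (r \<oplus> s)"
  unfolding C_ops using assms quot_ops(1,2)[OF mni assms(1,2)] by auto

lemma C_memI:
  assumes "\<And>n. \<exists>r\<in>carrier R. \<forall>k\<in>{n, Suc n}. f k = mn k +> r"
  shows "f \<in> carrier C"
  unfolding C_carrier
proof (intro conjI allI)
  fix n
  obtain r where r: "r \<in> carrier R" "\<forall>k\<in>{n, Suc n}. f k = mn k +> r" using assms by blast
  thus "\<exists>r\<in>carrier R. f n = mn n +> r" by blast
  show "f (Suc n) \<subseteq> f n" using r(2) coset_mono[of n "Suc n" r] by simp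
qed

lemma C_closed:
  assumes "f \<in> carrier C" "g \<in> carrier C"
  shows "f \<otimes>\<^sub>C g \<in> carrier C" "f \<oplus>\<^sub>C g \<in> carrier C"
proof -
  have "\<exists>r\<in>carrier R. \<forall>k\<in>{n, Suc n}. (f \<otimes>\<^sub>C g) k = mn k +> r"
    "\<exists>r\<in>carrier R. \<forall>k\<in>{n, Suc n}. (f \<oplus>\<^sub>C g) k = mn k +> r" for n
  proof -
    obtain r where r: "r \<in> carrier R" "\<And>k. k \<le> Suc n \<Longrightarrow> f k = mn k +> r" by (rule C_rep[OF assms(1), of "Suc n"]) blast
    obtain s where s: "s \<in> carrier R" "\<And>k. k \<le> Suc n \<Longrightarrow> g k = mn k +> s" by (rule C_rep[OF assms(2), of "Suc n"]) blast
    have "\<forall>k\<in>{n, Suc n}. (f \<otimes>\<^sub>C g) k = mn k +> (r \<otimes> s)" "\<forall>k\<in>{n, Suc n}. (f \<oplus>\<^sub>C g) k = mn k +> (r \<oplus> s)"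
      using C_op_level[OF r(1) s(1)] r(2) s(2) by auto
    thus "\<exists>r\<in>carrier R. \<forall>k\<in>{n, Suc n}. (f \<otimes>\<^sub>C g) k = mn k +> r"
      "\<exists>r\<in>carrier R. \<forall>k\<in>{n, Suc n}. (f \<oplus>\<^sub>C g) k = mn k +> r" using r(1) s(1) m_closed a_closed by blast+
  qed
  thus "f \<otimes>\<^sub>C g \<in> carrier C" "f \<oplus>\<^sub>C g \<in> carrier C" by (auto intro!: C_memI)
qed

lemma Qcring: "cring (Q n)" by (rule ideal.quotient_is_cring[OF mni cring_axioms])

lemma C_comp: "f \<in> carrier C \<Longrightarrow> f n \<in> carrier (Q n)" unfolding C_carrier quot_mem by blast

lemma C_cring: "cring C"
proof (rule cringI)
  interpret q: cring "Q n" for n by (rule Qcring)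
  note c = C_comp
  have z: "\<zero>\<^sub>C = (\<lambda>n. \<zero>\<^bsub>Q n\<^esub>)" "\<one>\<^sub>C = (\<lambda>n. \<one>\<^bsub>Q n\<^esub>)" unfolding C_ops iota_def using quot_one_zero by auto
  show "abelian_group C"
  proof (rule abelian_groupI)
    show "\<zero>\<^sub>C \<in> carrier C" unfolding C_ops using iota_C by simp
    fix f assume f: "f \<in> carrier C"
    show "\<zero>\<^sub>C \<oplus>\<^sub>C f = f" unfolding z C_ops(2) using q.l_zero[OF c[OF f]] by simp
    have "(\<lambda>n. \<ominus>\<^bsub>Q n\<^esub> f n) \<in> carrier C"
    proof (rule C_memI)
      fix n
      obtain r where r: "r \<in> carrier R" "\<And>k. k \<le> Suc n \<Longrightarrow> f k = mn k +> r" by (rule C_rep[OF f, of "Suc n"]) blast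
      have "\<ominus>\<^bsub>Q k\<^esub> f k = mn k +> (\<ominus> r)" if "k \<le> Suc n" for k
        using quot_ops(3)[OF mni r(1) r(1), of k] r(2)[OF that] by simp
      hence "\<forall>k\<in>{n, Suc n}. \<ominus>\<^bsub>Q k\<^esub> f k = mn k +> (\<ominus> r)" by (metis insertE le_Suc_eq order_refl singletonD)
      thus "\<exists>r\<in>carrier R. \<forall>k\<in>{n, Suc n}. \<ominus>\<^bsub>Q k\<^esub> f k = mn k +> r" using r(1) by blast
    qed
    moreover have "(\<lambda>n. \<ominus>\<^bsub>Q n\<^esub> f n) \<oplus>\<^sub>C f = \<zero>\<^sub>C" unfolding z C_ops(2) using q.l_neg[OF c[OF f]] by simp
    ultimately show "\<exists>g\<in>carrier C. g \<oplus>\<^sub>C f = \<zero>\<^sub>C" by blast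
    fix g assume g: "g \<in> carrier C"
    show "f \<oplus>\<^sub>C g \<in> carrier C" using C_closed f g by blast
    show "f \<oplus>\<^sub>C g = g \<oplus>\<^sub>C f" unfolding C_ops(2) using q.a_comm[OF c[OF f] c[OF g]] by simp
    fix h assume h: "h \<in> carrier C"
    show "f \<oplus>\<^sub>C g \<oplus>\<^sub>C h = f \<oplus>\<^sub>C (g \<oplus>\<^sub>C h)"
      unfolding C_ops(2) using q.a_assoc[OF c[OF f] c[OF g] c[OF h]] by simp
  qed
  show "Group.comm_monoid C"
  proof (rule comm_monoidI)
    show "\<one>\<^sub>C \<in> carrier C" unfolding C_ops using iota_C by simp
    fix f assume f: "f \<in> carrier C"
    show "\<one>\<^sub>C \<otimes>\<^sub>C f = f" unfolding z C_ops(1) using q.l_one[OF c[OF f]] by simp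
    fix g assume g: "g \<in> carrier C"
    show "f \<otimes>\<^sub>C g \<in> carrier C" using C_closed f g by blast
    show "f \<otimes>\<^sub>C g = g \<otimes>\<^sub>C f" unfolding C_ops(1) using q.m_comm[OF c[OF f] c[OF g]] by simp
    fix h assume h: "h \<in> carrier C"
    show "f \<otimes>\<^sub>C g \<otimes>\<^sub>C h = f \<otimes>\<^sub>C (g \<otimes>\<^sub>C h)"
      unfolding C_ops(1) using q.m_assoc[OF c[OF f] c[OF g] c[OF h]] by simp
  qed
  fix f g h assume "f \<in> carrier C" "g \<in> carrier C" "h \<in> carrier C"
  note k = c[OF this(1)] c[OF this(2)] c[OF this(3)]
  show "(f \<oplus>\<^sub>C g) \<otimes>\<^sub>C h = f \<otimes>\<^sub>C h \<oplus>\<^sub>C g \<otimes>\<^sub>C h"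
    unfolding C_ops(1,2) using q.l_distr[OF k] by simp
qed

lemma C_structure_map: "k \<in> carrier K \<Longrightarrow> structure_map C k = iota (structure_map R k)"
  unfolding structure_map_def[of C] C_ops iota_def
  using quot_ops(1)[OF mni sm_closed one_closed, of k] sm_closed[of k] by auto

sublocale C: kalg K C
proof (intro kalg.intro kalg_axioms.intro C_cring)
  fix k f assume k: "k \<in> carrier K"
  show "structure_map C k \<in> carrier C" using C_structure_map[OF k] iota_C sm_closed[OF k] by simp
  show "k \<odot>\<^bsub>C\<^esub> f = structure_map C k \<otimes>\<^sub>C f" unfolding C_structure_map[OF k] C_ops iota_def ..
qed

lemma iota_hom: "ring_hom_ring R C iota"
  by (rule ring_hom_ringI2[OF ring_axioms C.ring_axioms], rule ring_hom_memI)
    (use iota_C iota_ops C_ops(3) in auto)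

lemma iota_neg: assumes "a \<in> carrier R" shows "iota (\<ominus> a) = \<ominus>\<^sub>C iota a"
proof -
  interpret h: ring_hom_ring R C iota by (rule iota_hom)
  show ?thesis using assms by simp
qed

lemma pre_ideal: assumes J: "ideal J C" shows "ideal {r \<in> carrier R. iota r \<in> J} R"
  unfolding asub_ideal_iff[symmetric] asub_def
  using C.idealD(4)[OF J, unfolded C_ops] iota_ops iota_neg C.idealD(5-7)[OF J] iota_C by auto

lemma C_KK: "structure_map C ` carrier K = iota ` KK"
  using C_structure_map by (force simp: image_iff)

lemma C_neg_level: assumes "f \<in> carrier C" "r \<in> carrier R" "f n = mn n +> r"
  shows "(\<ominus>\<^sub>C f) n = mn n +> (\<ominus> r)"
proof -
  obtain s where s: "s \<in> carrier R" "(\<ominus>\<^sub>C f) n = mn n +> s" using C.a_inv_closed[OF assms(1)] unfolding C_carrier by blast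
  have "(f \<oplus>\<^sub>C \<ominus>\<^sub>C f) n = mn n +> (r \<oplus> s)" using C_op_level(2)[of r s f n "\<ominus>\<^sub>C f", OF assms(2) s(1) assms(3) s(2)] .
  moreover have "(f \<oplus>\<^sub>C \<ominus>\<^sub>C f) n = mn n +> \<zero>" using C.r_neg[OF assms(1)] unfolding C_ops iota_def by metis
  ultimately have "r \<oplus> s \<in> mn n" using coset_eq_iff[OF mni, of "r \<oplus> s" \<zero> n] assms s by (simp add: a_minus_def)
  moreover have "s \<ominus> (\<ominus> r) = r \<oplus> s" using assms(2) s(1) by algebra
  ultimately show ?thesis using s coset_eq_iff[OF mni s(1), of "\<ominus> r" n] assms(2) by simp
qed

lemma C_minus_level: assumes "f \<in> carrier C" "g \<in> carrier C" "r \<in> carrier R" "s \<in> carrier R" "f n = mn n +> r" "g n = mn n +> s"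
  shows "(f \<ominus>\<^sub>C g) n = mn n +> (r \<ominus> s)"
  unfolding a_minus_def[of C] a_minus_def[of R]
  using C_op_level(2)[of r "\<ominus> s" f n "\<ominus>\<^sub>C g", OF assms(3) a_inv_closed[OF assms(4)] assms(5) C_neg_level[OF assms(2,4,6)]] .

section \<open>Ideals of the completion and its maximal ideal\<close>

definition lift :: "nat \<Rightarrow> 'b set \<Rightarrow> (nat \<Rightarrow> 'b set) set" where
  "lift k I = {f \<in> carrier C. f k \<subseteq> I}"

text \<open>Since I contains \<mm>^k, the coset \<open>f k\<close> lies in I as soon as one of its
  elements does. For such I, \<open>lift k I\<close> is the preimage of I / \<mm>^k under the
  projection to R / \<mm>^k.\<close>

lemma lift_level:
  assumes I: "ideal I R" "mn k \<subseteq> I" and f: "f \<in> carrier C" "r \<in> carrier R" "f k = mn k +> r"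
  shows "f \<in> lift k I \<longleftrightarrow> r \<in> I"
proof
  assume "f \<in> lift k I"
  thus "r \<in> I" unfolding lift_def f(3)[symmetric] using coset_self[OF mni f(2), of k] f(3) by auto
next
  assume r: "r \<in> I"
  have "mn k +> r \<subseteq> I" unfolding a_r_coset_def' using idealD(5)[OF I(1) _ r] I(2) by blast
  thus "f \<in> lift k I" unfolding lift_def using f by simp
qed

lemma lift_ideal: assumes I: "ideal I R" "mn k \<subseteq> I" shows "ideal (lift k I) C"
proof -
  show ?thesis
  proof (rule C.ideal_intro)
    show "lift k I \<subseteq> carrier C" unfolding lift_def by blast
    show "\<zero>\<^sub>C \<in> lift k I" unfolding C_ops
      using lift_level[OF I iota_C[OF zero_closed] zero_closed] idealD(4)[OF I(1)] by (simp add: iota_def)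
    fix f assume f: "f \<in> lift k I"
    hence fc: "f \<in> carrier C" unfolding lift_def by blast
    obtain r where r: "r \<in> carrier R" "f k = mn k +> r" using fc unfolding C_carrier by blast
    have rm: "r \<in> I" using lift_level[OF I fc r] f by blast
    show "g \<otimes>\<^sub>C f \<in> lift k I" if gc: "g \<in> carrier C" for g
    proof -
      obtain s where s: "s \<in> carrier R" "g k = mn k +> s" using gc unfolding C_carrier by blast
      show ?thesis using lift_level[OF I C.m_closed[OF gc fc] m_closed[OF s(1) r(1)] C_op_level(1)[of s r g k f, OF s(1) r(1) s(2) r(2)]]
          idealD(7)[OF I(1) s(1) rm] by blast
    qed
    fix g assume g: "g \<in> lift k I"
    hence gc: "g \<in> carrier C" unfolding lift_def by blast
    obtain s where s: "s \<in> carrier R" "g k = mn k +> s" using gc unfolding C_carrier by blast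
    have sm: "s \<in> I" using lift_level[OF I gc s] g by blast
    show "f \<oplus>\<^sub>C g \<in> lift k I"
      using lift_level[OF I C.a_closed[OF fc gc] a_closed[OF r(1) s(1)] C_op_level(2)[of r s f k g, OF r(1) s(1) r(2) s(2)]] idealD(5)[OF I(1) rm sm] by blast
  qed
qed

text \<open>The kernel of the projection to R / \<mm>^k; \<open>nn_ipow\<close> identifies it with
  the k-th power of the maximal ideal \<open>nn 1\<close>.\<close>

definition nn :: "nat \<Rightarrow> (nat \<Rightarrow> 'b set) set" where "nn k = {f \<in> carrier C. f k = mn k}"

lemma mn_coset: "r \<in> carrier R \<Longrightarrow> mn k +> r = mn k \<longleftrightarrow> r \<in> mn k"
proof -
  assume r: "r \<in> carrier R"
  have "mn k +> \<zero> = mn k" using a_coset_add_zero[OF idealD(2)[OF mni]] .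
  thus ?thesis using coset_eq_iff[OF mni r zero_closed, of k] r by (simp add: a_minus_def)
qed

lemma nn_level: "f \<in> carrier C \<Longrightarrow> r \<in> carrier R \<Longrightarrow> f k = mn k +> r \<Longrightarrow> f \<in> nn k \<longleftrightarrow> r \<in> mn k"
  unfolding nn_def using mn_coset by auto

lemma iota_nn: "r \<in> carrier R \<Longrightarrow> iota r \<in> nn k \<longleftrightarrow> r \<in> mn k"
  by (rule nn_level[OF iota_C]) (auto simp: iota_def)

lemma minus_nn: assumes "f \<in> carrier C" "g \<in> carrier C" shows "f \<ominus>\<^sub>C g \<in> nn k \<longleftrightarrow> f k = g k"
proof -
  obtain r where r: "r \<in> carrier R" "f k = mn k +> r" using assms(1) unfolding C_carrier by blast
  obtain s where s: "s \<in> carrier R" "g k = mn k +> s" using assms(2) unfolding C_carrier by blast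
  have "f \<ominus>\<^sub>C g \<in> nn k \<longleftrightarrow> r \<ominus> s \<in> mn k"
    by (rule nn_level[OF C.minus_closed[OF assms] minus_closed[OF r(1) s(1)] C_minus_level[OF assms r(1) s(1) r(2) s(2)]])
  thus ?thesis using coset_eq_iff[OF mni r(1) s(1)] r(2) s(2) by simp
qed

lemma C_eqI: assumes "f \<in> carrier C" "g \<in> carrier C" "\<And>k. f \<ominus>\<^sub>C g \<in> nn k" shows "f = g"
  using assms(3) minus_nn[OF assms(1,2)] by auto

lemma nn_0: "nn 0 = carrier C"
proof -
  have "f 0 = mn 0" if f: "f \<in> carrier C" for f
  proof -
    obtain r where r: "r \<in> carrier R" "f 0 = mn 0 +> r" using f unfolding C_carrier by blast
    thus ?thesis using mn_coset[OF r(1), of 0] unfolding ipow_0 by simp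
  qed
  thus ?thesis unfolding nn_def by blast
qed

lemma nn_anti: assumes "k \<le> n" shows "nn n \<subseteq> nn k"
proof
  fix f assume f: "f \<in> nn n"
  hence fc: "f \<in> carrier C" unfolding nn_def by blast
  obtain r where r: "r \<in> carrier R" "f n = mn n +> r" "\<And>k. k \<le> n \<Longrightarrow> f k = mn k +> r" by (rule C_rep'[OF fc, of n]) blast
  have "r \<in> mn n" using nn_level[OF fc r(1,2)] f by blast
  hence "r \<in> mn k" using ipow_antimono[OF mid assms] by blast
  thus "f \<in> nn k" using nn_level[OF fc r(1) r(3)[OF assms]] by blast
qed

lemma nn_mult: assumes "f \<in> nn i" "g \<in> nn j" shows "f \<otimes>\<^sub>C g \<in> nn (i + j)"
proof -
  have fc: "f \<in> carrier C" "g \<in> carrier C" using assms unfolding nn_def by auto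
  obtain r where r: "r \<in> carrier R" "f (i + j) = mn (i + j) +> r" "\<And>k. k \<le> i + j \<Longrightarrow> f k = mn k +> r" by (rule C_rep'[OF fc(1), of "i + j"]) blast
  obtain s where s: "s \<in> carrier R" "g (i + j) = mn (i + j) +> s" "\<And>k. k \<le> i + j \<Longrightarrow> g k = mn k +> s" by (rule C_rep'[OF fc(2), of "i + j"]) blast
  have "r \<in> mn i" using nn_level[OF fc(1) r(1) r(3)[of i]] assms by simp
  moreover have "s \<in> mn j" using nn_level[OF fc(2) s(1) s(3)[of j]] assms by simp
  ultimately have "r \<otimes> s \<in> mn (i + j)" by (rule ipow_mult[OF mid])
  thus ?thesis
    using nn_level[OF C.m_closed[OF fc] m_closed[OF r(1) s(1)] C_op_level(1)[of r s f "i + j" g, OF r(1) s(1) r(2) s(2)]] by blast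
qed

lemma nn_lift: "nn k = lift k (mn k)"
proof -
  have "f \<in> nn k \<longleftrightarrow> f \<in> lift k (mn k)" if f: "f \<in> carrier C" for f
  proof -
    obtain r where r: "r \<in> carrier R" "f k = mn k +> r" using f unfolding C_carrier by blast
    show ?thesis using nn_level[OF f r] lift_level[OF mni subset_refl f r] by simp
  qed
  thus ?thesis unfolding nn_def lift_def by blast
qed

lemma nn_ideal: "ideal (nn k) C"
  unfolding nn_lift by (rule lift_ideal[OF mni subset_refl])

lemma inv_mod: assumes "r \<in> carrier R" "r \<notin> \<mm>" shows "\<exists>s\<in>carrier R. r \<otimes> s \<ominus> \<one> \<in> mn n"
proof -
  have "\<not> pid r \<subseteq> \<mm>" using self_ximg[OF assms(1)] assms(2) by blast
  from add_ipow_full[OF ideal_ximg[OF assms(1)] maxi this, of n]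
  have "\<one> \<in> pid r <+> mn n" by simp
  then obtain w t where w: "w \<in> pid r" "t \<in> mn n" "\<one> = w \<oplus> t" unfolding mem_set_add by blast
  obtain s where s: "s \<in> carrier R" "w = r \<otimes> s" using w(1) unfolding mem_ximg by blast
  have tc: "t \<in> carrier R" using idealD(3)[OF mni w(2)] .
  have "r \<otimes> s \<ominus> \<one> = \<ominus> t" unfolding w(3) s(2) using assms(1) s(1) tc by algebra
  hence "r \<otimes> s \<ominus> \<one> \<in> mn n" using idealD(6)[OF mni w(2)] by simp
  thus ?thesis using s(1) by blast
qed

text \<open>An element whose image in R / \<mm> is nonzero is invertible modulo every \<mm>^n.
  Inverses modulo \<mm>^n are unique, so they are compatible and form an element of the
  completion.\<close>

lemma C_units: assumes f: "f \<in> carrier C" "f \<notin> nn 1" shows "\<exists>g\<in>carrier C. f \<otimes>\<^sub>C g = \<one>\<^sub>C"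
proof -
  have ex: "\<exists>s\<in>carrier R. \<exists>r\<in>carrier R. f n = mn n +> r \<and> r \<otimes> s \<ominus> \<one> \<in> mn n" for n
  proof -
    obtain r where r: "r \<in> carrier R" "\<And>k. k \<le> max 1 n \<Longrightarrow> f k = mn k +> r" by (rule C_rep[OF f(1), of "max 1 n"]) blast
    have "r \<notin> \<mm>" using nn_level[OF f(1) r(1) r(2)[of 1]] f(2) ipow_1[OF mid] by simp
    from inv_mod[OF r(1) this, of n] show ?thesis using r by force
  qed
  define s where "s n = (SOME s. s \<in> carrier R \<and> (\<exists>r\<in>carrier R. f n = mn n +> r \<and> r \<otimes> s \<ominus> \<one> \<in> mn n))" for n
  have s: "s n \<in> carrier R" "\<exists>r\<in>carrier R. f n = mn n +> r \<and> r \<otimes> s n \<ominus> \<one> \<in> mn n" for n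
  proof -
    have "\<exists>t. t \<in> carrier R \<and> (\<exists>r\<in>carrier R. f n = mn n +> r \<and> r \<otimes> t \<ominus> \<one> \<in> mn n)" using ex by blast
    hence "s n \<in> carrier R \<and> (\<exists>r\<in>carrier R. f n = mn n +> r \<and> r \<otimes> s n \<ominus> \<one> \<in> mn n)" unfolding s_def by (rule someI_ex)
    thus "s n \<in> carrier R" "\<exists>r\<in>carrier R. f n = mn n +> r \<and> r \<otimes> s n \<ominus> \<one> \<in> mn n" by auto
  qed
  define g where "g n = mn n +> s n" for n
  have uniq: "mn n +> s n = mn n +> t" if t: "t \<in> carrier R" "r \<in> carrier R" "f n = mn n +> r" "r \<otimes> t \<ominus> \<one> \<in> mn n" for n t r
  proof -
    obtain r' where r': "r' \<in> carrier R" "f n = mn n +> r'" "r' \<otimes> s n \<ominus> \<one> \<in> mn n" using s(2) by blast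
    have d: "r \<ominus> r' \<in> mn n" using coset_eq_iff[OF mni t(2) r'(1), of n] t(3) r'(2) by metis
    have "s n \<ominus> t = (t \<otimes> (r' \<otimes> s n \<ominus> \<one>) \<ominus> s n \<otimes> (r \<otimes> t \<ominus> \<one>)) \<oplus> (s n \<otimes> t) \<otimes> (r \<ominus> r')"
      using t(1,2) r'(1) s(1)[of n] by algebra
    also have "\<dots> \<in> mn n"
      by (rule idealD(5)[OF mni idealD(9)[OF mni idealD(7)[OF mni t(1) r'(3)] idealD(7)[OF mni s(1) t(4)]] idealD(7)[OF mni m_closed[OF s(1) t(1)] d]])
    finally show ?thesis using coset_eq_iff[OF mni s(1) t(1)] by simp
  qed
  have gC: "g \<in> carrier C"
  proof (rule C_memI)
    fix n
    obtain r where r: "r \<in> carrier R" "f (Suc n) = mn (Suc n) +> r" "r \<otimes> s (Suc n) \<ominus> \<one> \<in> mn (Suc n)" using s(2) by blast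
    have "f n = mn n +> r" using C_level[OF f(1) r(1,2)] by simp
    moreover have "r \<otimes> s (Suc n) \<ominus> \<one> \<in> mn n" using r(3) ipow_Suc_subset[OF mid] by blast
    ultimately have "g n = mn n +> s (Suc n)" unfolding g_def using uniq[OF s(1) r(1)] by blast
    thus "\<exists>r\<in>carrier R. \<forall>k\<in>{n, Suc n}. g k = mn k +> r" using s(1)[of "Suc n"] unfolding g_def by blast
  qed
  have "(f \<otimes>\<^sub>C g) n = \<one>\<^sub>C n" for n
  proof -
    obtain r where r: "r \<in> carrier R" "f n = mn n +> r" "r \<otimes> s n \<ominus> \<one> \<in> mn n" using s(2) by blast
    have "(f \<otimes>\<^sub>C g) n = mn n +> (r \<otimes> s n)" using C_op_level(1)[where f = f and g = g, OF r(1) s(1) r(2)] unfolding g_def by blast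
    also have "\<dots> = mn n +> \<one>" using coset_eq_iff[OF mni m_closed[OF r(1) s(1)] one_closed] r(3) by blast
    finally show ?thesis unfolding C_ops iota_def .
  qed
  thus ?thesis using gC by blast
qed

lemma one_notin_nn: "\<one>\<^sub>C \<notin> nn 1"
proof
  assume "\<one>\<^sub>C \<in> nn 1"
  hence "\<one> \<in> mn 1" using iota_nn[OF one_closed] unfolding C_ops by blast
  hence "\<one> \<in> \<mm>" using ipow_1[OF mid] by simp
  thus False using maximalideal.I_notcarr[OF maxi] ideal.one_imp_carrier[OF mid] by blast
qed

lemma proper_ideal_C: assumes "ideal J C" "J \<noteq> carrier C" shows "J \<subseteq> nn 1"
proof (rule ccontr)
  assume "\<not> J \<subseteq> nn 1"
  then obtain f where f: "f \<in> J" "f \<notin> nn 1" by blast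
  then obtain g where g: "g \<in> carrier C" "f \<otimes>\<^sub>C g = \<one>\<^sub>C" using C_units C.idealD(3)[OF assms(1)] by blast
  have "f \<otimes>\<^sub>C g \<in> J" using C.idealD(8)[OF assms(1) g(1) f(1)] .
  thus False using g(2) ideal.one_imp_carrier[OF assms(1)] assms(2) by simp
qed

lemma nn_maximal: "maximalideal (nn 1) C"
proof (rule maximalidealI[OF nn_ideal])
  show "carrier C \<noteq> nn 1" using one_notin_nn by auto
  fix J assume J: "ideal J C" "nn 1 \<subseteq> J" "J \<subseteq> carrier C"
  thus "J = nn 1 \<or> J = carrier C" using proper_ideal_C by blast
qed

lemma maximal_C: "maximalideal M C \<longleftrightarrow> M = nn 1"
proof
  assume M: "maximalideal M C"
  hence "M \<subseteq> nn 1" using proper_ideal_C maximalideal.axioms(1) maximalideal.I_notcarr by metis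
  thus "M = nn 1" using maximalideal.I_maximal[OF M nn_ideal] C.idealD(2)[OF nn_ideal]
      maximalideal.I_notcarr[OF nn_maximal] by metis
qed (use nn_maximal in simp)

lemma max_ideal_C: "max_ideal C = nn 1"
  unfolding max_ideal_def maximal_C by simp

sublocale C: coeff K C "nn 1"
proof (intro coeff.intro coeff_axioms.intro C.kalg_axioms nn_maximal)
  show "subring (structure_map C ` carrier K) C"
    unfolding C_KK by (rule ring_hom_ring.img_is_subring[OF iota_hom KKsub])
  fix a assume a: "a \<in> structure_map C ` carrier K" "a \<noteq> \<zero>\<^sub>C"
  then obtain k where k: "k \<in> KK" "a = iota k" unfolding C_KK by blast
  have "k \<noteq> \<zero>" using a(2) k(2) unfolding C_ops by blast
  then obtain b where b: "b \<in> KK" "b \<otimes> k = \<one>" using KKinv[OF k(1)] by blast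
  have "iota b \<otimes>\<^sub>C a = \<one>\<^sub>C" unfolding k(2) C_ops(3) using iota_ops(1)[of b k] b k KKc by simp
  thus "\<exists>b\<in>structure_map C ` carrier K. b \<otimes>\<^sub>C a = \<one>\<^sub>C" unfolding C_KK using b(1) by blast
next
  fix f assume f: "f \<in> carrier C"
  obtain r where r: "r \<in> carrier R" "f 1 = mn 1 +> r" using f unfolding C_carrier by blast
  obtain a where a: "a \<in> KK" "r \<ominus> a \<in> \<mm>" using resid[OF r(1)] by blast
  have ac: "a \<in> carrier R" using a KKc by blast
  have "r \<ominus> a \<in> mn 1" using a(2) ipow_1[OF mid] by simp
  hence "f 1 = iota a 1" unfolding iota_def r(2) using coset_eq_iff[OF mni r(1) ac] by blast
  hence "f \<ominus>\<^sub>C iota a \<in> nn 1" using minus_nn[OF f iota_C[OF ac]] by blast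
  thus "\<exists>a\<in>structure_map C ` carrier K. f \<ominus>\<^sub>C a \<in> nn 1" unfolding C_KK using a(1) by blast
qed

text \<open>Both sides count ideals of R / \<mm>^k above I / \<mm>^k, since every element of the
  completion agrees with one from R modulo \<open>nn k\<close>.\<close>

lemma len_lift:
  assumes I: "ideal I R" "mn k \<subseteq> I"
  shows "C.colen (lift k I) = colen I"
proof (rule antisym)
  have kl: "nn k \<subseteq> lift k I" unfolding nn_lift lift_def using I(2) by blast
  define pre where "pre J = {r \<in> carrier R. iota r \<in> J}" for J
  show "C.colen (lift k I) \<le> colen I"
  proof (rule len_transfer[where \<Phi> = pre])
    fix J assume "J \<in> C.idlat" and J2: "lift k I \<subseteq> J"
    hence J: "ideal J C" using C.asub_ideal_iff by blast
    have "ideal (pre J) R" unfolding pre_def by (rule pre_ideal[OF J])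
    moreover have "I \<subseteq> pre J"
    proof
      fix r assume r: "r \<in> I"
      have rc: "r \<in> carrier R" using idealD(3)[OF I(1) r] .
      have "iota r \<in> lift k I" using lift_level[OF I iota_C[OF rc] rc] r by (simp add: iota_def)
      thus "r \<in> pre J" unfolding pre_def using J2 rc by blast
    qed
    ultimately show "pre J \<in> idlat \<and> I \<subseteq> pre J \<and> pre J \<subseteq> carrier R" using idealD(1,2) by blast
  next
    fix J J' assume h: "J \<in> C.idlat" "J' \<in> C.idlat" "lift k I \<subseteq> J" "J \<subset> J'"
    then obtain f where f: "f \<in> J'" "f \<notin> J" by blast
    have J: "asub C (carrier C) J" "asub C (carrier C) J'" using h by auto
    have fc: "f \<in> carrier C" using asubD(2)[OF J(2) f(1)] .
    obtain r where r: "r \<in> carrier R" "f k = mn k +> r" using fc unfolding C_carrier by blast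
    have ic: "iota r \<in> carrier C" using iota_C[OF r(1)] .
    have d: "f \<ominus>\<^sub>C iota r \<in> nn k" using minus_nn[OF fc ic] r(2) unfolding iota_def by blast
    hence dJ: "f \<ominus>\<^sub>C iota r \<in> J" "f \<ominus>\<^sub>C iota r \<in> J'" using kl h by blast+
    have "iota r = f \<ominus>\<^sub>C (f \<ominus>\<^sub>C iota r)" using fc ic by algebra
    hence 1: "iota r \<in> J'" using asubD(7)[OF J(2) f(1) dJ(2)] by simp
    have "f = iota r \<oplus>\<^sub>C (f \<ominus>\<^sub>C iota r)" using fc ic by algebra
    hence 2: "iota r \<notin> J" using asubD(4)[OF J(1) _ dJ(1), of "iota r"] f(2) by auto
    show "pre J \<subset> pre J'" using 1 2 r(1) h(4) unfolding pre_def by blast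
  qed
  show "colen I \<le> C.colen (lift k I)"
  proof (rule len_transfer[where \<Phi> = "lift k"])
    fix N assume h: "N \<in> idlat" "I \<subseteq> N"
    have N: "ideal N R" "mn k \<subseteq> N" using h I(2) asub_ideal_iff by auto
    show "lift k N \<in> C.idlat \<and> lift k I \<subseteq> lift k N \<and> lift k N \<subseteq> carrier C"
      using C.idealD(1)[OF lift_ideal[OF N]] h(2) unfolding lift_def by auto
  next
    fix N M assume h: "N \<in> idlat" "M \<in> idlat" "I \<subseteq> N" "N \<subset> M"
    have N: "ideal N R" "mn k \<subseteq> N" "ideal M R" "mn k \<subseteq> M" using h I(2) asub_ideal_iff by auto
    obtain r where r: "r \<in> M" "r \<notin> N" using h(4) by blast
    have rc: "r \<in> carrier R" using idealD(3)[OF N(3) r(1)] .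
    have "iota r \<in> lift k M" "iota r \<notin> lift k N"
      using lift_level[OF N(1,2) iota_C[OF rc] rc] lift_level[OF N(3,4) iota_C[OF rc] rc] r by (auto simp: iota_def)
    thus "lift k N \<subset> lift k M" using h(4) unfolding lift_def by blast
  qed
qed

end

section \<open>Noetherianity of the completion\<close>

context cring begin

section \<open>Finite linear combinations\<close>

definition lc :: "'c set \<Rightarrow> ('c \<Rightarrow> 'a) \<Rightarrow> ('c \<Rightarrow> 'a) \<Rightarrow> 'a" where
  "lc F g a = finsum R (\<lambda>j. a j \<otimes> g j) F"

lemma lc_closed: "(\<And>j. j \<in> F \<Longrightarrow> a j \<in> carrier R) \<Longrightarrow> (\<And>j. j \<in> F \<Longrightarrow> g j \<in> carrier R) \<Longrightarrow> lc F g a \<in> carrier R"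
  unfolding lc_def by (rule finsum_closed) auto

lemma lc_empty: "lc {} g a = \<zero>" unfolding lc_def by simp

lemma lc_insert:
  assumes "finite F" "x \<notin> F" "\<And>j. j \<in> insert x F \<Longrightarrow> a j \<in> carrier R" "\<And>j. j \<in> insert x F \<Longrightarrow> g j \<in> carrier R"
  shows "lc (insert x F) g a = a x \<otimes> g x \<oplus> lc F g a"
  unfolding lc_def using assms by (intro finsum_insert) auto

lemma lc_cong:
  assumes "\<And>j. j \<in> F \<Longrightarrow> a j = b j" "\<And>j. j \<in> F \<Longrightarrow> b j \<in> carrier R" "\<And>j. j \<in> F \<Longrightarrow> g j \<in> carrier R"
  shows "lc F g a = lc F g b"
  unfolding lc_def using assms by (intro finsum_cong') auto

lemma lc_add:
  assumes "\<And>j. j \<in> F \<Longrightarrow> a j \<in> carrier R" "\<And>j. j \<in> F \<Longrightarrow> b j \<in> carrier R" "\<And>j. j \<in> F \<Longrightarrow> g j \<in> carrier R"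
  shows "lc F g (\<lambda>j. a j \<oplus> b j) = lc F g a \<oplus> lc F g b"
proof -
  have "finsum R (\<lambda>j. (a j \<oplus> b j) \<otimes> g j) F = finsum R (\<lambda>j. a j \<otimes> g j \<oplus> b j \<otimes> g j) F"
    by (rule finsum_cong') (use assms l_distr in auto)
  also have "\<dots> = lc F g a \<oplus> lc F g b" unfolding lc_def using assms by (intro finsum_addf) auto
  finally show ?thesis unfolding lc_def .
qed

lemma lc_mult:
  assumes "finite F" "\<And>j. j \<in> F \<Longrightarrow> a j \<in> carrier R" "\<And>j. j \<in> F \<Longrightarrow> g j \<in> carrier R" "r \<in> carrier R"
  shows "lc F g (\<lambda>j. r \<otimes> a j) = r \<otimes> lc F g a"
proof -
  have "finsum R (\<lambda>j. (r \<otimes> a j) \<otimes> g j) F = finsum R (\<lambda>j. r \<otimes> (a j \<otimes> g j)) F"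
    by (rule finsum_cong') (use assms m_assoc in auto)
  also have "\<dots> = r \<otimes> lc F g a" unfolding lc_def using assms by (intro finsum_rdistr[symmetric]) auto
  finally show ?thesis unfolding lc_def .
qed

lemma lc_minus:
  assumes "finite F" "\<And>j. j \<in> F \<Longrightarrow> a j \<in> carrier R" "\<And>j. j \<in> F \<Longrightarrow> b j \<in> carrier R" "\<And>j. j \<in> F \<Longrightarrow> g j \<in> carrier R"
  shows "lc F g (\<lambda>j. a j \<ominus> b j) = lc F g a \<ominus> lc F g b"
proof -
  have c: "lc F g a \<in> carrier R" "lc F g b \<in> carrier R" using lc_closed assms by auto
  have "lc F g (\<lambda>j. a j \<ominus> b j) = lc F g (\<lambda>j. a j \<oplus> (\<ominus> \<one>) \<otimes> b j)"
    by (rule lc_cong) (use assms in \<open>auto simp: l_minus a_minus_def\<close>)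
  also have "\<dots> = lc F g a \<oplus> lc F g (\<lambda>j. (\<ominus> \<one>) \<otimes> b j)" by (rule lc_add) (use assms in auto)
  also have "lc F g (\<lambda>j. (\<ominus> \<one>) \<otimes> b j) = (\<ominus> \<one>) \<otimes> lc F g b" by (rule lc_mult) (use assms in auto)
  finally show ?thesis using c by (simp add: l_minus a_minus_def)
qed

lemma lc_ideal:
  assumes "ideal I R" "finite F" "\<And>j. j \<in> F \<Longrightarrow> a j \<in> carrier R" "\<And>j. j \<in> F \<Longrightarrow> g j \<in> carrier R"
    "\<And>j. j \<in> F \<Longrightarrow> a j \<otimes> g j \<in> I"
  shows "lc F g a \<in> I"
  using assms(2-5)
proof (induction F rule: finite_induct)
  case empty show ?case using idealD(4)[OF assms(1)] by (simp add: lc_empty)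
next
  case (insert x F)
  have "a x \<otimes> g x \<oplus> lc F g a \<in> I" using insert by (intro idealD(5)[OF assms(1)]) auto
  moreover have "lc (insert x F) g a = a x \<otimes> g x \<oplus> lc F g a" by (rule lc_insert) (use insert in auto)
  ultimately show ?case by simp
qed

lemma lc_single:
  assumes "finite F" "i \<in> F" "\<And>j. j \<in> F \<Longrightarrow> g j \<in> carrier R" "r \<in> carrier R"
  shows "lc F g (\<lambda>j. if j = i then r else \<zero>) = r \<otimes> g i"
proof -
  have F: "F = insert i (F - {i})" using assms(2) by blast
  have "lc (F - {i}) g (\<lambda>j. if j = i then r else \<zero>) \<in> {\<zero>}"
    by (rule lc_ideal[OF zeroideal]) (use assms in auto)
  moreover have "lc (insert i (F - {i})) g (\<lambda>j. if j = i then r else \<zero>)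
     = (if i = i then r else \<zero>) \<otimes> g i \<oplus> lc (F - {i}) g (\<lambda>j. if j = i then r else \<zero>)"
    by (rule lc_insert) (use assms in auto)
  ultimately show ?thesis using F assms by simp
qed

text \<open>The combinations of \<open>S\<close> with coefficients in I form an ideal Z, and for i
  in I the colon of Z by i contains \<open>S\<close>, hence M.\<close>

lemma ideal_prod_lc:
  assumes M: "ideal M R" and S: "S \<subseteq> M" "finite S" "\<And>J. ideal J R \<Longrightarrow> S \<subseteq> J \<Longrightarrow> M \<subseteq> J"
    and I: "ideal I R" and x: "x \<in> ideal_prod R I M"
  shows "\<exists>a. (\<forall>s\<in>S. a s \<in> I) \<and> x = lc S (\<lambda>s. s) a"
proof -
  have Sc: "s \<in> carrier R" if "s \<in> S" for s using S(1) idealD(3)[OF M] that by blast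
  note Ic = idealD(3)[OF I]
  define Z where "Z = {lc S (\<lambda>s. s) a | a. \<forall>s\<in>S. a s \<in> I}"
  have ZD: "\<exists>a. u = lc S (\<lambda>s. s) a \<and> (\<forall>s\<in>S. a s \<in> I)" if "u \<in> Z" for u
    using that unfolding Z_def by (rule CollectD)
  have ZI: "lc S (\<lambda>s. s) a \<in> Z" if "\<forall>s\<in>S. a s \<in> I" for a
    unfolding Z_def using that by (intro CollectI exI conjI) (rule refl)
  have Zadd: "u \<oplus> v \<in> Z" if uv: "u \<in> Z" "v \<in> Z" for u v
  proof -
    obtain a where a: "u = lc S (\<lambda>s. s) a \<and> (\<forall>s\<in>S. a s \<in> I)" using ZD[OF uv(1)] by (rule exE)
    obtain b where b: "v = lc S (\<lambda>s. s) b \<and> (\<forall>s\<in>S. b s \<in> I)" using ZD[OF uv(2)] by (rule exE)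
    have ab: "\<forall>s\<in>S. a s \<in> I" "u = lc S (\<lambda>s. s) a" "\<forall>s\<in>S. b s \<in> I" "v = lc S (\<lambda>s. s) b" using a b by auto
    have "lc S (\<lambda>s. s) (\<lambda>j. a j \<oplus> b j) = u \<oplus> v" unfolding ab by (rule lc_add) (use ab Ic Sc in auto)
    moreover have "\<forall>s\<in>S. a s \<oplus> b s \<in> I" using ab idealD(5)[OF I] by blast
    ultimately show ?thesis using ZI[of "\<lambda>j. a j \<oplus> b j"] by simp
  qed
  have Zmult: "r \<otimes> u \<in> Z" if ur: "u \<in> Z" "r \<in> carrier R" for r u
  proof -
    obtain a where a: "u = lc S (\<lambda>s. s) a \<and> (\<forall>s\<in>S. a s \<in> I)" using ZD[OF ur(1)] by (rule exE)
    have ab: "\<forall>s\<in>S. a s \<in> I" "u = lc S (\<lambda>s. s) a" using a by auto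
    have "lc S (\<lambda>s. s) (\<lambda>j. r \<otimes> a j) = r \<otimes> u" unfolding ab by (rule lc_mult) (use ab Ic Sc ur S(2) in auto)
    moreover have "\<forall>s\<in>S. r \<otimes> a s \<in> I" using ab idealD(7)[OF I ur(2)] by blast
    ultimately show ?thesis using ZI[of "\<lambda>j. r \<otimes> a j"] by simp
  qed
  have Zc: "u \<in> carrier R" if uZ: "u \<in> Z" for u
  proof -
    obtain a where a: "u = lc S (\<lambda>s. s) a \<and> (\<forall>s\<in>S. a s \<in> I)" using ZD[OF uZ] by (rule exE)
    thus ?thesis using lc_closed[of S a "\<lambda>s. s"] Ic Sc by auto
  qed
  have Z0: "\<zero> \<in> Z"
  proof -
    have "lc S (\<lambda>s. s) (\<lambda>j. \<zero>) \<in> {\<zero>}" by (rule lc_ideal[OF zeroideal S(2)]) (use Sc in auto)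
    thus ?thesis using ZI[of "\<lambda>j. \<zero>"] idealD(4)[OF I] by simp
  qed
  have Zid: "ideal Z R" by (rule ideal_intro) (use Zc Z0 Zadd Zmult in auto)
  have iM: "i \<otimes> v \<in> Z" if i: "i \<in> I" "v \<in> M" for i v
  proof -
    have ic: "i \<in> carrier R" using Ic i by blast
    have "M \<subseteq> xpre i Z"
    proof (rule S(3)[OF ideal_xpre[OF ic Zid]])
      show "S \<subseteq> xpre i Z"
      proof
        fix s assume s: "s \<in> S"
        have "lc S (\<lambda>s. s) (\<lambda>j. if j = s then i else \<zero>) = i \<otimes> s" by (rule lc_single) (use s S Sc ic in auto)
        moreover have "\<forall>j\<in>S. (if j = s then i else \<zero>) \<in> I" using i idealD(4)[OF I] by simp
        ultimately have "i \<otimes> s \<in> Z" using ZI[of "\<lambda>j. if j = s then i else \<zero>"] by metis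
        thus "s \<in> xpre i Z" unfolding xpre_def using Sc s by simp
      qed
    qed
    thus ?thesis using i unfolding xpre_def by blast
  qed
  have "x \<in> Z" using x by (induction) (use iM Zadd in auto)
  from ZD[OF this] show ?thesis by blast
qed

end

context coeff begin

text \<open>The associated graded ring of \<mm> is generated over K by the classes of
  \<open>T\<close>: modulo \<mm>^(n + 1), coefficients in R may be replaced by their residues in
  K.\<close>

lemma ipow_hom_part:
  assumes T: "T \<subseteq> \<mm>" "\<And>J. ideal J R \<Longrightarrow> T \<subseteq> J \<Longrightarrow> \<mm> \<subseteq> J"
  shows "ipow \<mm> n \<subseteq> hom_part KK T n <+> ipow \<mm> (Suc n)"
proof (induction n)
  case 0
  show ?case
  proof
    fix r assume "r \<in> ipow \<mm> 0"
    hence r: "r \<in> carrier R" unfolding ipow_0 .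
    obtain a where a: "a \<in> KK" "r \<ominus> a \<in> \<mm>" using resid[OF r] by blast
    have ac: "a \<in> carrier R" using a KKc by blast
    have "Gen KK T {(0, \<one>)} 0 (a \<otimes> \<one>)" using a by (intro Gen.Gsmult Gen.Gbase) auto
    hence 1: "a \<in> hom_part KK T 0" using ac by simp
    have "r = a \<oplus> (r \<ominus> a)" using r ac by algebra
    moreover have "r \<ominus> a \<in> ipow \<mm> (Suc 0)" using a(2) ipow_1[OF mid] by simp
    ultimately show "r \<in> hom_part KK T 0 <+> ipow \<mm> (Suc 0)" unfolding mem_set_add using 1 by blast
  qed
next
  case (Suc n)
  note mi = ipow_ideal[OF mid]
  have Tc: "T \<subseteq> carrier R" using T(1) idealD(2)[OF mid] by blast
  note hp = gfamD(1)[OF gfam_hom_part[OF KK_carrier Tc]]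
  define W where "W = hom_part KK T (Suc n) <+> ipow \<mm> (Suc (Suc n))"
  have W: "asub R KK W" unfolding W_def by (rule asub_add[OF hp KK_sub_asub[OF idealD(1)[OF mi]] KK_carrier])
  define G where "G = {v \<in> carrier R. \<forall>u\<in>ipow \<mm> n. u \<otimes> v \<in> W}"
  have "ideal G R"
  proof (rule ideal_intro)
    note uc = idealD(3)[OF mi]
    show "G \<subseteq> carrier R" unfolding G_def by blast
    show "\<zero> \<in> G" unfolding G_def using asubD(3)[OF W] uc by auto
    fix v assume v: "v \<in> G"
    hence vc: "v \<in> carrier R" unfolding G_def by blast
    show "v \<oplus> w \<in> G" if w: "w \<in> G" for w
    proof -
      have wc: "w \<in> carrier R" using w unfolding G_def by blast
      have "u \<otimes> (v \<oplus> w) = u \<otimes> v \<oplus> u \<otimes> w" if "u \<in> ipow \<mm> n" for u using uc[OF that] vc wc by (simp add: r_distr)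
      thus ?thesis using v w asubD(4)[OF W] vc wc unfolding G_def by simp
    qed
    fix r assume r: "r \<in> carrier R"
    have "u \<otimes> (r \<otimes> v) \<in> W" if u: "u \<in> ipow \<mm> n" for u
    proof -
      have "u \<otimes> (r \<otimes> v) = (r \<otimes> u) \<otimes> v" using uc[OF u] vc r by (simp add: m_ac)
      moreover have "r \<otimes> u \<in> ipow \<mm> n" using idealD(7)[OF mi r u] .
      ultimately show ?thesis using v unfolding G_def by simp
    qed
    thus "r \<otimes> v \<in> G" unfolding G_def using r vc by simp
  qed
  moreover have "T \<subseteq> G"
  proof
    fix x assume x: "x \<in> T"
    have xc: "x \<in> carrier R" using x Tc by blast
    have "u \<otimes> x \<in> W" if "u \<in> ipow \<mm> n" for u
    proof -
      have "u \<in> hom_part KK T n <+> ipow \<mm> (Suc n)" using Suc that by (rule subsetD)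
      then obtain v w where vw: "v \<in> hom_part KK T n" "w \<in> ipow \<mm> (Suc n)" "u = v \<oplus> w"
        unfolding mem_set_add by blast
      have c: "v \<in> carrier R" "w \<in> carrier R" using asubD(2)[OF hp vw(1)] idealD(3)[OF mi vw(2)] by auto
      have "u \<otimes> x = x \<otimes> v \<oplus> w \<otimes> x" unfolding vw(3) using c xc by algebra
      moreover have "x \<otimes> v \<in> hom_part KK T (Suc n)" using vw(1) x by (auto intro: Gen.Gmult)
      moreover have "w \<otimes> x \<in> ipow \<mm> (Suc (Suc n))" unfolding ipow_Suc[of \<mm> "Suc n"] using vw(2) x T(1) by (intro ideal_prod.prod) auto
      ultimately show ?thesis unfolding W_def mem_set_add by blast
    qed
    thus "x \<in> G" unfolding G_def using xc by blast
  qed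
  ultimately have "\<mm> \<subseteq> G" by (rule T(2))
  hence *: "u \<otimes> v \<in> W" if "u \<in> ipow \<mm> n" "v \<in> \<mm>" for u v using that unfolding G_def by blast
  have "ideal_prod R (ipow \<mm> n) \<mm> \<subseteq> W"
  proof
    fix x assume "x \<in> ideal_prod R (ipow \<mm> n) \<mm>"
    thus "x \<in> W" by induction (use * asubD(4)[OF W] in auto)
  qed
  thus ?case unfolding W_def by (simp only: ipow_Suc)
qed

end

context compl begin

lemma iota_lc:
  assumes "finite S" "\<And>s. s \<in> S \<Longrightarrow> a s \<in> carrier R" "\<And>s. s \<in> S \<Longrightarrow> g s \<in> carrier R"
  shows "iota (lc S g a) = C.lc S (\<lambda>s. iota (g s)) (\<lambda>s. iota (a s))"
  using assms
proof (induction S rule: finite_induct)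
  case empty show ?case unfolding lc_empty C.lc_empty C_ops ..
next
  case (insert x S)
  have c: "a x \<in> carrier R" "g x \<in> carrier R" "lc S g a \<in> carrier R" using insert lc_closed[of S a g] by auto
  have "lc (insert x S) g a = a x \<otimes> g x \<oplus> lc S g a" by (rule lc_insert) (use insert in auto)
  hence "iota (lc (insert x S) g a) = iota (a x) \<otimes>\<^sub>C iota (g x) \<oplus>\<^sub>C iota (lc S g a)"
    using iota_ops c m_closed by simp
  moreover have "C.lc (insert x S) (\<lambda>s. iota (g s)) (\<lambda>s. iota (a s)) = iota (a x) \<otimes>\<^sub>C iota (g x) \<oplus>\<^sub>C C.lc S (\<lambda>s. iota (g s)) (\<lambda>s. iota (a s))"
    by (rule C.lc_insert) (use insert iota_C in auto)
  ultimately show ?case using insert by simp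
qed

lemma nn_carrier: "f \<in> nn k \<Longrightarrow> f \<in> carrier C" unfolding nn_def by blast

text \<open>Successive approximation: y is corrected by combinations of the \<open>g j\<close>, one
  depth at a time from depth \<open>N\<close> on. The coefficients lose only the constant depth
  \<open>d\<close>, so the corrections tend to zero and their sums converge to coefficients for
  y.\<close>

lemma complete_lc:
  assumes J: "ideal J C" and F: "finite F" and g: "\<And>j. j \<in> F \<Longrightarrow> g j \<in> J"
    and step: "\<And>n y. N \<le> n \<Longrightarrow> y \<in> J \<Longrightarrow> y \<in> nn n \<Longrightarrow>
       \<exists>a. (\<forall>j\<in>F. a j \<in> nn (n - d)) \<and> y \<ominus>\<^sub>C C.lc F g a \<in> nn (Suc n)"
    and y: "y \<in> J" "y \<in> nn N"
  shows "\<exists>b. (\<forall>j\<in>F. b j \<in> carrier C) \<and> y = C.lc F g b"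
proof -
  note Jc = C.idealD(3)[OF J]
  have gc: "g j \<in> carrier C" if "j \<in> F" for j using g that Jc by blast
  define A where "A n y = (SOME a. (\<forall>j\<in>F. a j \<in> nn (n - d)) \<and> y \<ominus>\<^sub>C C.lc F g a \<in> nn (Suc n))" for n y
  have A: "(\<forall>j\<in>F. A n y j \<in> nn (n - d)) \<and> y \<ominus>\<^sub>C C.lc F g (A n y) \<in> nn (Suc n)" if "N \<le> n" "y \<in> J" "y \<in> nn n" for n y
    unfolding A_def by (rule someI_ex[OF step[OF that]])
  \<comment> \<open>\<open>Y i\<close> is the remainder after i corrections; it stays in J and has
    depth N + i.\<close>
  define Y where "Y = rec_nat y (\<lambda>i z. z \<ominus>\<^sub>C C.lc F g (A (N + i) z))"
  have Y0: "Y 0 = y" and YS: "Y (Suc i) = Y i \<ominus>\<^sub>C C.lc F g (A (N + i) (Y i))" for i unfolding Y_def by simp_all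
  have lcJ: "C.lc F g a \<in> J" if "\<And>j. j \<in> F \<Longrightarrow> a j \<in> carrier C" for a
    by (rule C.lc_ideal[OF J F]) (use that gc C.idealD(7)[OF J] g in auto)
  have Y: "Y i \<in> J \<and> Y i \<in> nn (N + i)" for i
  proof (induction i)
    case 0 thus ?case using y Y0 by simp
  next
    case (Suc i)
    have a: "\<forall>j\<in>F. A (N + i) (Y i) j \<in> nn (N + i - d)" "Y i \<ominus>\<^sub>C C.lc F g (A (N + i) (Y i)) \<in> nn (Suc (N + i))"
      using A[of "N + i" "Y i"] Suc by auto
    have "C.lc F g (A (N + i) (Y i)) \<in> J" using lcJ a(1) nn_carrier by blast
    hence "Y (Suc i) \<in> J" unfolding YS using Suc C.idealD(9)[OF J] by blast
    thus ?case using a(2) unfolding YS by simp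
  qed
  have Ai: "A (N + i) (Y i) j \<in> nn (N + i - d)" if "j \<in> F" for i j using A[of "N + i" "Y i"] Y that by auto
  have Ac: "A (N + i) (Y i) j \<in> carrier C" if "j \<in> F" for i j using nn_carrier[OF Ai[OF that]] .
  \<comment> \<open>Partial sums of the coefficients.\<close>
  define B where "B = rec_nat (\<lambda>j. \<zero>\<^sub>C) (\<lambda>i b j. b j \<oplus>\<^sub>C A (N + i) (Y i) j)"
  have B0: "B 0 j = \<zero>\<^sub>C" and BS: "B (Suc i) = (\<lambda>j. B i j \<oplus>\<^sub>C A (N + i) (Y i) j)" for i j unfolding B_def by simp_all
  have Bc: "B i j \<in> carrier C" if "j \<in> F" for i j
    by (induction i) (simp_all add: B0 BS C.a_closed nn_carrier[OF Ai[OF that]])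
  have yB: "y = Y i \<oplus>\<^sub>C C.lc F g (B i)" for i
  proof (induction i)
    case 0
    have "C.lc F g (B 0) \<in> {\<zero>\<^sub>C}" by (rule C.lc_ideal[OF C.zeroideal F]) (use B0 gc in auto)
    thus ?case using Y0 Jc[OF y(1)] by simp
  next
    case (Suc i)
    have "C.lc F g (B (Suc i)) = C.lc F g (B i) \<oplus>\<^sub>C C.lc F g (A (N + i) (Y i))"
      unfolding BS by (rule C.lc_add) (use Bc gc Ac in auto)
    moreover have c: "Y i \<in> carrier C" "C.lc F g (B i) \<in> carrier C" "C.lc F g (A (N + i) (Y i)) \<in> carrier C"
      using Y Jc C.lc_closed[OF Bc gc] C.lc_closed[of F "A (N + i) (Y i)" g] Ac gc by auto
    have "p \<oplus>\<^sub>C q = (p \<ominus>\<^sub>C r) \<oplus>\<^sub>C (q \<oplus>\<^sub>C r)" if "p \<in> carrier C" "q \<in> carrier C" "r \<in> carrier C" for p q r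
      using that by algebra
    note this[OF c]
    ultimately have "Y i \<oplus>\<^sub>C C.lc F g (B i) = Y (Suc i) \<oplus>\<^sub>C C.lc F g (B (Suc i))" unfolding YS by (simp only:)
    thus ?case using Suc by (rule trans[rotated])
  qed
  have Bst: "B (Suc i) j k = B i j k" if j: "j \<in> F" and "k + d \<le> i" for i j k
  proof -
    have "k \<le> N + i - d" using that(2) by linarith
    hence "A (N + i) (Y i) j \<in> nn k" using subsetD[OF nn_anti Ai[OF j, of i]] by blast
    moreover have "B (Suc i) j \<ominus>\<^sub>C B i j = A (N + i) (Y i) j"
    proof -
      have "B i j \<in> carrier C" "A (N + i) (Y i) j \<in> carrier C" using Bc[OF j] Ai[OF j] nn_carrier by auto
      thus ?thesis unfolding BS by algebra
    qed
    ultimately show ?thesis using minus_nn[OF Bc[OF j, of "Suc i"] Bc[OF j, of i], of k] by metis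
  qed
  \<comment> \<open>The component of index k no longer changes after k + d corrections, so the limit
    is read off there.\<close>
  define b where "b j k = B (k + d) j k" for j k
  have bc: "b j \<in> carrier C" if j: "j \<in> F" for j
  proof (rule C_memI)
    fix n
    obtain r where r: "r \<in> carrier R" "\<And>k. k \<le> Suc n \<Longrightarrow> B (Suc n + d) j k = mn k +> r"
      by (rule C_rep[OF Bc[OF j], of "Suc n"]) blast
    have "b j n = B (Suc n + d) j n" unfolding b_def using Bst[OF j, of n "n + d"] by simp
    thus "\<exists>r\<in>carrier R. \<forall>k\<in>{n, Suc n}. b j k = mn k +> r" using r(1) r(2)[of n] r(2)[of "Suc n"] unfolding b_def
      by (intro bexI[of _ r] ballI) (auto simp del: nat_pow_Suc)
  qed
  have "y \<ominus>\<^sub>C C.lc F g b \<in> nn k" for k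
  proof -
    let ?B = "B (k + d)" and ?Y = "Y (k + d)"
    have "C.lc F g (\<lambda>j. ?B j \<ominus>\<^sub>C b j) \<in> nn k"
    proof (rule C.lc_ideal[OF nn_ideal F])
      fix j assume j: "j \<in> F"
      have "?B j \<ominus>\<^sub>C b j \<in> nn k" using minus_nn[OF Bc[OF j] bc[OF j]] unfolding b_def by simp
      thus "(?B j \<ominus>\<^sub>C b j) \<otimes>\<^sub>C g j \<in> nn k" using C.idealD(8)[OF nn_ideal gc[OF j]] by blast
    qed (use Bc bc gc in auto)
    moreover have "C.lc F g (\<lambda>j. ?B j \<ominus>\<^sub>C b j) = C.lc F g ?B \<ominus>\<^sub>C C.lc F g b"
      by (rule C.lc_minus) (use F Bc bc gc in auto)
    moreover have "?Y \<in> nn k" using Y[of "k + d"] nn_anti[of k "N + (k + d)"] by auto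
    ultimately have "?Y \<oplus>\<^sub>C (C.lc F g ?B \<ominus>\<^sub>C C.lc F g b) \<in> nn k" using C.idealD(5)[OF nn_ideal] by simp
    moreover have "y \<ominus>\<^sub>C C.lc F g b = ?Y \<oplus>\<^sub>C (C.lc F g ?B \<ominus>\<^sub>C C.lc F g b)"
    proof -
      have c: "?Y \<in> carrier C" "C.lc F g ?B \<in> carrier C" "C.lc F g b \<in> carrier C"
        using Y Jc C.lc_closed[OF Bc gc] C.lc_closed[OF bc gc] by auto
      have "(p \<oplus>\<^sub>C q) \<ominus>\<^sub>C r = p \<oplus>\<^sub>C (q \<ominus>\<^sub>C r)" if "p \<in> carrier C" "q \<in> carrier C" "r \<in> carrier C" for p q r
        using that by algebra
      thus ?thesis using yB[of "k + d"] c by metis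
    qed
    ultimately show ?thesis by simp
  qed
  hence "\<And>k. y \<ominus>\<^sub>C C.lc F g b \<in> nn k" by blast
  note yk' = this
  have "C.lc F g b \<in> carrier C" by (rule C.lc_closed) (use bc gc in auto)
  from C_eqI[OF Jc[OF y(1)] this yk'] have "y = C.lc F g b" .
  thus ?thesis using bc by blast
qed

text \<open>An element of depth n agrees, modulo \<open>nn (Suc n)\<close>, with an element of
  \<mm>^n = \<mm>^(n - k) \<mm>^k, which is a combination of \<open>S\<close> with coefficients of
  depth n - k. So \<open>complete_lc\<close> applies with d = k.\<close>

lemma nn_generators:
  assumes S: "S \<subseteq> mn k" "finite S" "\<And>J. ideal J R \<Longrightarrow> S \<subseteq> J \<Longrightarrow> mn k \<subseteq> J" and f: "f \<in> nn k"
  shows "\<exists>b. (\<forall>s\<in>S. b s \<in> carrier C) \<and> f = C.lc S iota b"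
proof (rule complete_lc[OF C.oneideal S(2), where N = k and d = k])
  have Sc: "s \<in> carrier R" if "s \<in> S" for s using that S(1) idealD(3)[OF mni] by blast
  show "iota s \<in> carrier C" if "s \<in> S" for s using iota_C Sc that by blast
  show "f \<in> carrier C" "f \<in> nn k" using f nn_carrier by auto
  fix n y assume n: "k \<le> n" and y: "y \<in> nn n"
  have yc: "y \<in> carrier C" using nn_carrier y by blast
  obtain r where r: "r \<in> carrier R" "\<And>k. k \<le> Suc n \<Longrightarrow> y k = mn k +> r"
    by (rule C_rep[OF yc, of "Suc n"]) blast
  have "r \<in> mn n" using nn_level[OF yc r(1) r(2)[of n]] y by simp
  hence "r \<in> mn ((n - k) + k)" using n by simp
  hence "r \<in> ideal_prod R (mn (n - k)) (mn k)" unfolding ipow_add[OF mid] .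
  from ideal_prod_lc[OF mni S mni this] obtain a where a: "\<forall>s\<in>S. a s \<in> mn (n - k)" "r = lc S (\<lambda>s. s) a" by blast
  have ac: "a s \<in> carrier R" if "s \<in> S" for s using a(1) that idealD(3)[OF mni] by blast
  have "iota r = C.lc S iota (\<lambda>s. iota (a s))" unfolding a(2) by (rule iota_lc[OF S(2)]) (use ac Sc in auto)
  moreover have "y \<ominus>\<^sub>C iota r \<in> nn (Suc n)" using minus_nn[OF yc iota_C[OF r(1)], of "Suc n"] r(2)[of "Suc n"] unfolding iota_def by blast
  moreover have "\<forall>s\<in>S. iota (a s) \<in> nn (n - k)" using a(1) iota_nn ac by blast
  ultimately show "\<exists>a. (\<forall>s\<in>S. a s \<in> nn (n - k)) \<and> y \<ominus>\<^sub>C C.lc S iota a \<in> nn (Suc n)" by metis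
qed

text \<open>\<mm>^k is finitely generated, so its generators also generate the kernel
  \<open>nn k\<close> over the completion. The topology of the completion is thus the adic topology
  of its own maximal ideal.\<close>

lemma nn_ipow: "C.ipow (nn 1) k = nn k"
proof
  show "C.ipow (nn 1) k \<subseteq> nn k"
  proof (induction k)
    case 0 thus ?case unfolding C.ipow_0 nn_0 by simp
  next
    case (Suc k)
    have "ideal_prod C (C.ipow (nn 1) k) (nn 1) \<subseteq> nn (k + 1)"
      by (rule C.ideal_prod_least[OF nn_ideal]) (use Suc nn_mult in blast)
    thus ?case unfolding C.ipow_Suc by simp
  qed
  have im: "mn k \<subseteq> {r \<in> carrier R. iota r \<in> C.ipow (nn 1) k}"
  proof (induction k)
    case 0 thus ?case unfolding ipow_0 C.ipow_0 using iota_C by blast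
  next
    case (Suc k)
    have "ideal_prod R (mn k) \<mm> \<subseteq> {r \<in> carrier R. iota r \<in> C.ipow (nn 1) (Suc k)}"
    proof (rule ideal_prod_least[OF pre_ideal[OF C.ipow_ideal[OF nn_ideal]]])
      fix u v assume u: "u \<in> mn k" and v: "v \<in> \<mm>"
      have c: "u \<in> carrier R" "v \<in> carrier R" using idealD(3)[OF mni u] idealD(3)[OF mid v] by auto
      have "iota v \<in> nn 1" using iota_nn[OF c(2), of 1] v ipow_1[OF mid] by simp
      moreover have "iota u \<in> C.ipow (nn 1) k" using Suc u by blast
      ultimately have "iota u \<otimes>\<^sub>C iota v \<in> C.ipow (nn 1) (Suc k)" unfolding C.ipow_Suc by (intro ideal_prod.prod)
      thus "u \<otimes> v \<in> {r \<in> carrier R. iota r \<in> C.ipow (nn 1) (Suc k)}" using iota_ops(1)[OF c] c by simp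
    qed
    thus ?case by (simp only: ipow_Suc)
  qed
  obtain S where S: "S \<subseteq> mn k" "finite S" "\<And>J. ideal J R \<Longrightarrow> S \<subseteq> J \<Longrightarrow> mn k \<subseteq> J" using noeth_fg[OF noeth mni] by blast
  show "nn k \<subseteq> C.ipow (nn 1) k"
  proof
    fix f assume "f \<in> nn k"
    then obtain b where b: "\<forall>s\<in>S. b s \<in> carrier C" "f = C.lc S iota b" using nn_generators[OF S] by blast
    have sc: "iota s \<in> carrier C" if "s \<in> S" for s using iota_C idealD(3)[OF mni] S(1) that by blast
    have sI: "iota s \<in> C.ipow (nn 1) k" if "s \<in> S" for s using im S(1) that by blast
    show "f \<in> C.ipow (nn 1) k" unfolding b(2)
      by (rule C.lc_ideal[OF C.ipow_ideal[OF nn_ideal] S(2)])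
        (use b(1) sI sc C.idealD(7)[OF C.ipow_ideal[OF nn_ideal]] in auto)
  qed
qed

text \<open>Initial forms: in each degree n, the forms over K in generators of the maximal ideal
  that agree with an element of the given ideal up to depth n + 1. These are finitely generated by
  \<open>graded_noetherian\<close>, and lifts of the generators generate the ideal by successive
  approximation.\<close>

theorem noeth_C: "C.noeth_over (carrier C)"
proof (rule C.noeth_overI)
  fix I assume I: "ideal I C"
  note Ic = C.idealD(3)[OF I]
  obtain S where S: "S \<subseteq> \<mm>" "finite S" "\<And>J. ideal J R \<Longrightarrow> S \<subseteq> J \<Longrightarrow> \<mm> \<subseteq> J" using noeth_fg[OF noeth mid] by blast
  have Sc: "s \<in> carrier R" if "s \<in> S" for s using that S(1) idealD(3)[OF mid] by blast
  define T where "T = iota ` S"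
  have Tn: "T \<subseteq> nn 1" unfolding T_def using iota_nn[of _ 1] Sc S(1) ipow_1[OF mid] by auto
  have Tc: "T \<subseteq> carrier C" using Tn nn_carrier by blast
  have Tg: "nn 1 \<subseteq> J" if J: "ideal J C" "T \<subseteq> J" for J
  proof
    fix f assume "f \<in> nn 1"
    then obtain b where b: "\<forall>s\<in>S. b s \<in> carrier C" "f = C.lc S iota b"
      using nn_generators[of S 1 f] S ipow_1[OF mid] by auto
    show "f \<in> J" unfolding b(2)
      by (rule C.lc_ideal[OF J(1) S(2)]) (use b(1) J(2) iota_C Sc C.idealD(7)[OF J(1)] in \<open>auto simp: T_def\<close>)
  qed
  let ?A = "structure_map C ` carrier K"
  note hp = C.gfamD(1)[OF C.gfam_hom_part[OF C.KK_carrier Tc]]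
  define NN where "NN n = C.hom_part ?A T n \<inter> (I <+>\<^bsub>C\<^esub> nn (Suc n))" for n
  have g: "C.gfam ?A T NN" unfolding C.gfam_def
  proof (intro conjI allI ballI)
    fix n
    show "asub C ?A (NN n)" unfolding NN_def
      by (rule C.asub_inter[OF hp C.KK_sub_asub[OF C.idealD(1)[OF C.ideal_add[OF I nn_ideal]]]])
    fix x u assume x: "x \<in> T" and "u \<in> NN n"
    then obtain v w where v: "v \<in> I" "w \<in> nn (Suc n)" "u = v \<oplus>\<^sub>C w" and u: "u \<in> C.hom_part ?A T n"
      unfolding NN_def Int_iff mem_set_add by blast
    have c: "v \<in> carrier C" "w \<in> carrier C" "x \<in> carrier C" using nn_carrier Ic v x Tc by auto
    have e: "x \<otimes>\<^sub>C u = x \<otimes>\<^sub>C v \<oplus>\<^sub>C x \<otimes>\<^sub>C w" unfolding v(3) using c by algebra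
    have "x \<otimes>\<^sub>C w \<in> nn (1 + Suc n)" using nn_mult[of x 1 w "Suc n"] x Tn v(2) by blast
    hence "x \<otimes>\<^sub>C w \<in> nn (Suc (Suc n))" by simp
    moreover have "x \<otimes>\<^sub>C v \<in> I" using C.idealD(7)[OF I] c v by blast
    ultimately have "x \<otimes>\<^sub>C u \<in> I <+>\<^bsub>C\<^esub> nn (Suc (Suc n))" unfolding e mem_set_add by blast
    moreover have "x \<otimes>\<^sub>C u \<in> C.hom_part ?A T (Suc n)" using u x by (auto intro: C.Gen.Gmult)
    ultimately show "x \<otimes>\<^sub>C u \<in> NN (Suc n)" unfolding NN_def by blast
  qed
  have nA: "C.noeth_over ?A" by (rule C.noeth_over_field[OF C.KK_carrier]) (use C.KKinv in auto)
  have NNhp: "NN n \<subseteq> C.hom_part ?A T n" for n unfolding NN_def by blast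
  have fT: "finite T" unfolding T_def using S(2) by simp
  obtain F where F: "finite F" "\<forall>(d, u)\<in>F. u \<in> NN d" "\<forall>n. NN n \<subseteq> {u. C.Gen ?A T F n u}"
    using C.graded_noetherian[OF C.KKsub nA fT Tc g NNhp] by blast
  define h where "h j = (SOME v. v \<in> I \<and> snd j \<ominus>\<^sub>C v \<in> nn (Suc (fst j)))" for j
  have h: "h j \<in> I \<and> snd j \<ominus>\<^sub>C h j \<in> nn (Suc (fst j))" if "j \<in> F" for j
  proof -
    have "snd j \<in> NN (fst j)" using F(2) that by (cases j) auto
    then obtain v w where v: "v \<in> I" "w \<in> nn (Suc (fst j))" "snd j = v \<oplus>\<^sub>C w" unfolding NN_def Int_iff mem_set_add by blast
    have "v \<in> carrier C" "w \<in> carrier C" using Ic v nn_carrier by auto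
    hence "snd j \<ominus>\<^sub>C v = w" unfolding v(3) by algebra
    hence "\<exists>v. v \<in> I \<and> snd j \<ominus>\<^sub>C v \<in> nn (Suc (fst j))" using v by blast
    thus ?thesis unfolding h_def by (rule someI_ex)
  qed
  have hI: "h j \<in> I" if "j \<in> F" for j using h[OF that] by blast
  have hc: "h j \<in> carrier C" if "j \<in> F" for j using h[OF that] Ic by blast
  \<comment> \<open>The largest degree of a generator; it is the loss of depth in the
    approximation.\<close>
  define d where "d = Max (insert 0 (fst ` F))"
  have d: "fst j \<le> d" if "j \<in> F" for j unfolding d_def using F(1) that by (intro Max_ge) auto
  have zn: "\<zero>\<^sub>C \<in> nn k" for k using C.idealD(4)[OF nn_ideal] .
  \<comment> \<open>Elements that are matched up to depth n + 1 by combinations of the lifts with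
    coefficients of the expected depth. As a graded family containing \<open>F\<close> it contains
    every form generated by \<open>F\<close>.\<close>
  define M where "M n = {u \<in> carrier C. \<exists>a. (\<forall>j\<in>F. a j \<in> nn (n - fst j)) \<and> u \<ominus>\<^sub>C C.lc F h a \<in> nn (Suc n)}" for n
  have lcc: "C.lc F h a \<in> carrier C" if "\<forall>j\<in>F. a j \<in> nn (n j)" for a n
    by (rule C.lc_closed) (use that nn_carrier hc in blast)+
  have Mmul: "r \<otimes>\<^sub>C u \<in> M k" if r: "r \<in> nn i" and um: "u \<in> M n" and k: "i + n = k" for r u i n k
  proof -
    obtain a where a: "\<forall>j\<in>F. a j \<in> nn (n - fst j)" "u \<ominus>\<^sub>C C.lc F h a \<in> nn (Suc n)" and uc: "u \<in> carrier C"
      using um unfolding M_def by blast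
    have l: "C.lc F h a \<in> carrier C" by (rule lcc[OF a(1)])
    have rc: "r \<in> carrier C" using nn_carrier[OF r] .
    have e: "C.lc F h (\<lambda>j. r \<otimes>\<^sub>C a j) = r \<otimes>\<^sub>C C.lc F h a" by (rule C.lc_mult) (use F(1) a(1) nn_carrier hc rc in auto)
    have "r \<otimes>\<^sub>C u \<ominus>\<^sub>C r \<otimes>\<^sub>C C.lc F h a = r \<otimes>\<^sub>C (u \<ominus>\<^sub>C C.lc F h a)" using rc uc l by algebra
    also have "\<dots> \<in> nn (i + Suc n)" by (rule nn_mult[OF r a(2)])
    finally have 1: "r \<otimes>\<^sub>C u \<ominus>\<^sub>C C.lc F h (\<lambda>j. r \<otimes>\<^sub>C a j) \<in> nn (Suc k)" unfolding e using k by simp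
    have 2: "r \<otimes>\<^sub>C a j \<in> nn (k - fst j)" if j: "j \<in> F" for j
      by (rule subsetD[OF nn_anti nn_mult[OF r bspec[OF a(1) j]]]) (use k in simp)
    show ?thesis unfolding M_def by (intro CollectI conjI C.m_closed[OF rc uc] exI[of _ "\<lambda>j. r \<otimes>\<^sub>C a j"] ballI 1 2)
  qed
  have M: "ideal (M n) C" for n
  proof (rule C.ideal_intro)
    show "M n \<subseteq> carrier C" unfolding M_def by blast
    have "C.lc F h (\<lambda>j. \<zero>\<^sub>C) \<in> {\<zero>\<^sub>C}" by (rule C.lc_ideal[OF C.zeroideal F(1)]) (use hc in auto)
    hence "\<zero>\<^sub>C \<ominus>\<^sub>C C.lc F h (\<lambda>j. \<zero>\<^sub>C) \<in> nn (Suc n)" using zn by (simp add: a_minus_def)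
    thus "\<zero>\<^sub>C \<in> M n" unfolding M_def using zn by (intro CollectI conjI C.zero_closed exI[of _ "\<lambda>j. \<zero>\<^sub>C"]) auto
    show "r \<otimes>\<^sub>C u \<in> M n" if "r \<in> carrier C" "u \<in> M n" for r u by (rule Mmul[of r 0 u n]) (use that nn_0 in auto)
    fix u v assume "u \<in> M n" and "v \<in> M n"
    then obtain a b where a: "\<forall>j\<in>F. a j \<in> nn (n - fst j)" "u \<ominus>\<^sub>C C.lc F h a \<in> nn (Suc n)" and uc: "u \<in> carrier C"
      and b: "\<forall>j\<in>F. b j \<in> nn (n - fst j)" "v \<ominus>\<^sub>C C.lc F h b \<in> nn (Suc n)" and vc: "v \<in> carrier C"
      unfolding M_def by blast
    note l = lcc[OF a(1)] lcc[OF b(1)]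
    have e: "C.lc F h (\<lambda>j. a j \<oplus>\<^sub>C b j) = C.lc F h a \<oplus>\<^sub>C C.lc F h b"
      by (rule C.lc_add) (use a(1) b(1) nn_carrier hc in auto)
    have "(u \<oplus>\<^sub>C v) \<ominus>\<^sub>C (C.lc F h a \<oplus>\<^sub>C C.lc F h b) = (u \<ominus>\<^sub>C C.lc F h a) \<oplus>\<^sub>C (v \<ominus>\<^sub>C C.lc F h b)"
      using uc vc l by algebra
    also have "\<dots> \<in> nn (Suc n)" using C.idealD(5)[OF nn_ideal a(2) b(2)] .
    finally have 1: "(u \<oplus>\<^sub>C v) \<ominus>\<^sub>C C.lc F h (\<lambda>j. a j \<oplus>\<^sub>C b j) \<in> nn (Suc n)" unfolding e .
    have 2: "a j \<oplus>\<^sub>C b j \<in> nn (n - fst j)" if "j \<in> F" for j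
      using C.idealD(5)[OF nn_ideal bspec[OF a(1) that] bspec[OF b(1) that]] .
    show "u \<oplus>\<^sub>C v \<in> M n" unfolding M_def
      by (intro CollectI conjI C.a_closed[OF uc vc] exI[of _ "\<lambda>j. a j \<oplus>\<^sub>C b j"] ballI 1 2)
  qed
  have Mg: "C.gfam ?A T M" unfolding C.gfam_def
  proof (intro conjI allI ballI)
    show "asub C ?A (M n)" for n by (rule C.KK_sub_asub[OF C.idealD(1)[OF M]])
    show "x \<otimes>\<^sub>C u \<in> M (Suc n)" if "x \<in> T" "u \<in> M n" for n x u
      by (rule Mmul[of x 1 u n]) (use that Tn in auto)
  qed
  have Mb: "u \<in> M e" if j: "(e, u) \<in> F" for e u
  proof -
    let ?a = "\<lambda>j. if j = (e, u) then \<one>\<^sub>C else \<zero>\<^sub>C"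
    have "C.lc F h ?a = \<one>\<^sub>C \<otimes>\<^sub>C h (e, u)" by (rule C.lc_single) (use F(1) j hc in auto)
    hence "u \<ominus>\<^sub>C C.lc F h ?a \<in> nn (Suc e)" using h[OF j] hc[OF j] by simp
    moreover have "u \<in> carrier C" using F(2) j asubD(2)[OF hp] NNhp by blast
    moreover have "\<forall>j\<in>F. ?a j \<in> nn (e - fst j)" using zn nn_0 by auto
    ultimately show ?thesis unfolding M_def by (intro CollectI conjI exI[of _ ?a])
  qed
  have "I \<subseteq> J" if J: "ideal J C" "h ` F \<subseteq> J" for J
  proof
    fix y assume y: "y \<in> I"
    have "\<exists>b. (\<forall>j\<in>F. b j \<in> carrier C) \<and> y = C.lc F h b"
    proof (rule complete_lc[OF I F(1) hI, where N = 0 and d = d])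
      show "y \<in> I" "y \<in> nn 0" using y Ic nn_0 by auto
      fix n z assume z: "z \<in> I" "z \<in> nn n"
      have zc: "z \<in> carrier C" using Ic z by blast
      have "z \<in> C.hom_part ?A T n <+>\<^bsub>C\<^esub> nn (Suc n)" using C.ipow_hom_part[OF Tn Tg, of n] z(2) unfolding nn_ipow by blast
      then obtain u w where uw: "u \<in> C.hom_part ?A T n" "w \<in> nn (Suc n)" "z = u \<oplus>\<^sub>C w" unfolding mem_set_add by blast
      have c: "u \<in> carrier C" "w \<in> carrier C" using asubD(2)[OF hp uw(1)] nn_carrier[OF uw(2)] by auto
      have u: "u = z \<oplus>\<^sub>C (\<ominus>\<^sub>C w)" unfolding uw(3) using c by algebra
      have "u \<in> I <+>\<^bsub>C\<^esub> nn (Suc n)"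
        unfolding mem_set_add by (intro bexI[OF _ z(1)] bexI[OF _ C.idealD(6)[OF nn_ideal uw(2)]] u)
      hence "u \<in> NN n" unfolding NN_def using uw(1) by blast
      hence "C.Gen ?A T F n u" using F(3) by blast
      hence "u \<in> M n" using C.Gen_least[OF Mg Mb] by blast
      then obtain a where a: "\<forall>j\<in>F. a j \<in> nn (n - fst j)" "u \<ominus>\<^sub>C C.lc F h a \<in> nn (Suc n)" unfolding M_def by blast
      note l = lcc[OF a(1)]
      have "z \<ominus>\<^sub>C C.lc F h a = (u \<ominus>\<^sub>C C.lc F h a) \<oplus>\<^sub>C w" unfolding uw(3) using c l by algebra
      also have "\<dots> \<in> nn (Suc n)" using C.idealD(5)[OF nn_ideal a(2) uw(2)] .
      finally have "z \<ominus>\<^sub>C C.lc F h a \<in> nn (Suc n)" .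
      moreover have "\<forall>j\<in>F. a j \<in> nn (n - d)"
      proof
        fix j assume j: "j \<in> F"
        have "n - d \<le> n - fst j" using d[OF j] by simp
        thus "a j \<in> nn (n - d)" using nn_anti a(1) j by blast
      qed
      ultimately show "\<exists>a. (\<forall>j\<in>F. a j \<in> nn (n - d)) \<and> z \<ominus>\<^sub>C C.lc F h a \<in> nn (Suc n)" by blast
    qed
    then obtain b where b: "\<forall>j\<in>F. b j \<in> carrier C" "y = C.lc F h b" by blast
    show "y \<in> J" unfolding b(2)
      by (rule C.lc_ideal[OF J(1) F(1)]) (use b(1) hc J(2) C.idealD(7)[OF J(1)] in auto)
  qed
  thus "\<exists>S\<subseteq>I. finite S \<and> (\<forall>J. ideal J C \<longrightarrow> S \<subseteq> J \<longrightarrow> I \<subseteq> J)"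
    using F(1) hI by (intro exI[of _ "h ` F"]) auto
qed

end

section \<open>Systems of linear equations over a Noetherian ring\<close>

context cring begin

definition vecs :: "'c set \<Rightarrow> ('c \<Rightarrow> 'a) set" where "vecs E = {z. \<forall>e\<in>E. z e \<in> carrier R}"

definition vsub :: "'c set \<Rightarrow> ('c \<Rightarrow> 'a) set \<Rightarrow> bool" where
  "vsub E Z \<longleftrightarrow> Z \<subseteq> vecs E \<and> (\<lambda>e. \<zero>) \<in> Z \<and> (\<forall>y\<in>Z. \<forall>z\<in>Z. (\<lambda>e. y e \<oplus> z e) \<in> Z) \<and>
     (\<forall>r\<in>carrier R. \<forall>z\<in>Z. (\<lambda>e. r \<otimes> z e) \<in> Z)"

lemma vsubD:
  assumes "vsub E Z"
  shows "z \<in> Z \<Longrightarrow> e \<in> E \<Longrightarrow> z e \<in> carrier R" "(\<lambda>e. \<zero>) \<in> Z" "y \<in> Z \<Longrightarrow> z \<in> Z \<Longrightarrow> (\<lambda>e. y e \<oplus> z e) \<in> Z"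
    "r \<in> carrier R \<Longrightarrow> z \<in> Z \<Longrightarrow> (\<lambda>e. r \<otimes> z e) \<in> Z"
  using assms unfolding vsub_def vecs_def by auto

lemma vecsD: "z \<in> vecs E \<Longrightarrow> e \<in> E \<Longrightarrow> z e \<in> carrier R" unfolding vecs_def by blast

lemma lc_commute:
  assumes "a \<in> vecs E" "g \<in> vecs E" shows "lc E g a = lc E a g"
  unfolding lc_def by (rule finsum_cong') (use assms vecsD m_comm in \<open>auto simp: vecs_def\<close>)

lemma lc_vadd: "y \<in> vecs E \<Longrightarrow> z \<in> vecs E \<Longrightarrow> l \<in> vecs E \<Longrightarrow> lc E l (\<lambda>e. y e \<oplus> z e) = lc E l y \<oplus> lc E l z"
  by (rule lc_add) (auto simp: vecs_def)

lemma lc_vmult: "finite E \<Longrightarrow> z \<in> vecs E \<Longrightarrow> l \<in> vecs E \<Longrightarrow> r \<in> carrier R \<Longrightarrow> lc E l (\<lambda>e. r \<otimes> z e) = r \<otimes> lc E l z"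
  by (rule lc_mult) (auto simp: vecs_def)

lemma lc_vclosed: "z \<in> vecs E \<Longrightarrow> l \<in> vecs E \<Longrightarrow> lc E l z \<in> carrier R"
  by (rule lc_closed) (auto simp: vecs_def)

lemma lc_vzero: "finite E \<Longrightarrow> l \<in> vecs E \<Longrightarrow> lc E l (\<lambda>e. \<zero>) = \<zero>"
  using lc_ideal[OF zeroideal, of E "\<lambda>e. \<zero>" l] by (auto simp: vecs_def)

lemma vsub_vecs: "vsub E Z \<Longrightarrow> z \<in> Z \<Longrightarrow> z \<in> vecs E" unfolding vsub_def by blast

lemma vsub_kernel:
  assumes "vsub E Z" "finite E" "l \<in> vecs E" shows "vsub E {z \<in> Z. lc E l z = \<zero>}"
proof -
  note z = vsub_vecs[OF assms(1)]
  show ?thesis unfolding vsub_def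
    using vsubD(2-4)[OF assms(1)] z lc_vzero[OF assms(2,3)] lc_vadd[OF z z assms(3)] lc_vmult[OF assms(2) z assms(3)]
    by auto
qed

lemma vsub_image_ideal:
  assumes "vsub E Z" "finite E" "l \<in> vecs E" shows "ideal (lc E l ` Z) R"
proof -
  note z = vsub_vecs[OF assms(1)]
  have m: "r \<otimes> x \<in> lc E l ` Z" if rx: "r \<in> carrier R" "x \<in> lc E l ` Z" for r x
  proof -
    obtain y where y: "y \<in> Z" "x = lc E l y" using rx(2) by blast
    have "r \<otimes> x = lc E l (\<lambda>e. r \<otimes> y e)" unfolding y(2) using lc_vmult[OF assms(2) z[OF y(1)] assms(3) rx(1)] by simp
    thus ?thesis using vsubD(4)[OF assms(1) rx(1) y(1)] by blast
  qed
  have c: "x \<in> carrier R" if "x \<in> lc E l ` Z" for x using that lc_vclosed[OF z assms(3)] by blast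
  show ?thesis
  proof (rule ideal_intro)
    show "lc E l ` Z \<subseteq> carrier R" using c by blast
    show "\<zero> \<in> lc E l ` Z" using vsubD(2)[OF assms(1)] lc_vzero[OF assms(2,3)] by (metis image_eqI)
    fix x assume x: "x \<in> lc E l ` Z"
    show "r \<otimes> x \<in> lc E l ` Z" if "r \<in> carrier R" for r using m[OF that x] .
    fix w assume w: "w \<in> lc E l ` Z"
    obtain y where y: "y \<in> Z" "x = lc E l y" using x by blast
    obtain y' where y': "y' \<in> Z" "w = lc E l y'" using w by blast
    have "x \<oplus> w = lc E l (\<lambda>e. y e \<oplus> y' e)" unfolding y(2) y'(2) using lc_vadd[OF z[OF y(1)] z[OF y'(1)] assms(3)] by simp
    thus "x \<oplus> w \<in> lc E l ` Z" using vsubD(3)[OF assms(1) y(1) y'(1)] by blast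
  qed
qed

text \<open>Induction on the set of linear forms. Artin-Rees for the ideal of values of
  \<open>l0\<close> on Z gives z1 in Z with entries deep in m and the same value of
  \<open>l0\<close> as c; then c - z1 lies in the kernel of \<open>l0\<close>, where the remaining
  forms are treated. Passing to this kernel is the reason for an arbitrary submodule Z.\<close>

lemma artin_rees_system:
  assumes N: "noeth_over (carrier R)" and m: "ideal m R" and E: "finite E"
    and L: "finite L" "L \<subseteq> vecs E" and Z: "vsub E Z"
  shows "\<exists>k. \<forall>c\<in>Z. (\<forall>l\<in>L. lc E l c \<in> ipow m k) \<longrightarrow>
     (\<exists>c'\<in>Z. (\<forall>e\<in>E. c' e \<in> ipow m j) \<and> (\<forall>l\<in>L. lc E l c' = lc E l c))"
  using L Z
proof (induction L arbitrary: Z j rule: finite_induct)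
  case empty
  have "(\<lambda>e. \<zero>) \<in> Z \<and> (\<forall>e\<in>E. \<zero> \<in> ipow m j)" using vsubD(2)[OF empty(2)] idealD(4)[OF ipow_ideal[OF m]] by blast
  thus ?case by (intro exI[of _ 0]) auto
next
  case (insert l0 L)
  note mi = ipow_ideal[OF m]
  have l0: "l0 \<in> vecs E" and Lv: "L \<subseteq> vecs E" using insert by auto
  note Zv = vsub_vecs[OF insert.prems(2)]
  let ?Z' = "{z \<in> Z. lc E l0 z = \<zero>}"
  have Z': "vsub E ?Z'" by (rule vsub_kernel[OF insert.prems(2) E l0])
  obtain k' where k': "\<And>c. c \<in> ?Z' \<Longrightarrow> (\<forall>l\<in>L. lc E l c \<in> ipow m k') \<Longrightarrow>
     \<exists>c'\<in>?Z'. (\<forall>e\<in>E. c' e \<in> ipow m j) \<and> (\<forall>l\<in>L. lc E l c' = lc E l c)"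
    using insert.IH[OF Lv Z', of j] by blast
  let ?I = "lc E l0 ` Z"
  have I: "ideal ?I R" by (rule vsub_image_ideal[OF insert.prems(2) E l0])
  obtain c0 where c0: "\<And>n. ?I \<inter> ipow m (n + c0) \<subseteq> ideal_prod R (ipow m n) ?I" using artin_rees[OF N m I] by blast
  \<comment> \<open>The entries of z1 must be deep enough for the conclusion, and also for c - z1 to
    meet the bound \<open>k'\<close> of the remaining forms.\<close>
  define j1 where "j1 = max j k'"
  have prodI: "\<exists>z\<in>Z. (\<forall>e\<in>E. z e \<in> ipow m j1) \<and> x = lc E l0 z" if "x \<in> ideal_prod R (ipow m j1) ?I" for x
    using that
  proof induction
    case (prod i y)
    then obtain z where z: "z \<in> Z" "y = lc E l0 z" by blast
    have ic: "i \<in> carrier R" using idealD(3)[OF mi prod(1)] .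
    have "i \<otimes> y = lc E l0 (\<lambda>e. i \<otimes> z e)" unfolding z(2) using lc_vmult[OF E Zv[OF z(1)] l0 ic] by simp
    moreover have "\<forall>e\<in>E. i \<otimes> z e \<in> ipow m j1" using idealD(8)[OF mi _ prod(1)] vecsD[OF Zv[OF z(1)]] by blast
    ultimately show ?case by (intro bexI[OF _ vsubD(4)[OF insert.prems(2) ic z(1)]] conjI)
  next
    case (sum x y)
    obtain z where z: "z \<in> Z" "\<forall>e\<in>E. z e \<in> ipow m j1" "x = lc E l0 z" using sum.IH(1) by blast
    obtain z' where z': "z' \<in> Z" "\<forall>e\<in>E. z' e \<in> ipow m j1" "y = lc E l0 z'" using sum.IH(2) by blast
    have "x \<oplus> y = lc E l0 (\<lambda>e. z e \<oplus> z' e)" unfolding z(3) z'(3) using lc_vadd[OF Zv[OF z(1)] Zv[OF z'(1)] l0] by simp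
    moreover have "\<forall>e\<in>E. z e \<oplus> z' e \<in> ipow m j1" using z(2) z'(2) idealD(5)[OF mi] by blast
    ultimately show ?case by (intro bexI[OF _ vsubD(3)[OF insert.prems(2) z(1) z'(1)]] conjI)
  qed
  have "\<exists>c'\<in>Z. (\<forall>e\<in>E. c' e \<in> ipow m j) \<and> (\<forall>l\<in>insert l0 L. lc E l c' = lc E l c)"
    if c: "c \<in> Z" "\<forall>l\<in>insert l0 L. lc E l c \<in> ipow m (j1 + c0)" for c
  proof -
    have "lc E l0 c \<in> ideal_prod R (ipow m j1) ?I" using c0[of j1] c by blast
    from prodI[OF this] obtain z1 where z1: "z1 \<in> Z" "\<forall>e\<in>E. z1 e \<in> ipow m j1" "lc E l0 c = lc E l0 z1" by blast
    define z1n where "z1n = (\<lambda>e. (\<ominus> \<one>) \<otimes> z1 e)"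
    have z1n: "z1n \<in> Z" unfolding z1n_def using vsubD(4)[OF insert.prems(2) _ z1(1), of "\<ominus> \<one>"] by simp
    define y where "y = (\<lambda>e. c e \<oplus> z1n e)"
    have y: "y \<in> Z" unfolding y_def using vsubD(3)[OF insert.prems(2) c(1) z1n] .
    have ly: "lc E l y = lc E l c \<ominus> lc E l z1" if l: "l \<in> vecs E" for l
    proof -
      have "lc E l y = lc E l c \<oplus> lc E l z1n" unfolding y_def using lc_vadd[OF Zv[OF c(1)] Zv[OF z1n] l] .
      also have "lc E l z1n = (\<ominus> \<one>) \<otimes> lc E l z1" unfolding z1n_def using lc_vmult[OF E Zv[OF z1(1)] l, of "\<ominus> \<one>"] by simp
      finally show ?thesis using lc_vclosed[OF Zv[OF z1(1)] l] by (simp add: l_minus a_minus_def)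
    qed
    have "lc E l0 y = \<zero>" unfolding ly[OF l0] z1(3)[symmetric] using lc_vclosed[OF Zv[OF c(1)] l0] by (simp add: r_neg a_minus_def)
    hence yZ: "y \<in> ?Z'" using y by blast
    have "lc E l y \<in> ipow m k'" if l: "l \<in> L" for l
    proof -
      have lv: "l \<in> vecs E" using l Lv by blast
      have "k' \<le> j1 + c0" unfolding j1_def by simp
      from ipow_antimono[OF m this] have 1: "lc E l c \<in> ipow m k'" using c(2) l by blast
      have "lc E l z1 \<in> ipow m j1"
        by (rule lc_ideal[OF mi E]) (use vecsD[OF Zv[OF z1(1)]] vecsD[OF lv] z1(2) idealD(8)[OF mi] in auto)
      hence 2: "lc E l z1 \<in> ipow m k'" using ipow_antimono[OF m, of k' j1] unfolding j1_def by auto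
      show ?thesis unfolding ly[OF lv] using idealD(9)[OF mi 1 2] .
    qed
    then obtain z2 where z2: "z2 \<in> ?Z'" "\<forall>e\<in>E. z2 e \<in> ipow m j" "\<forall>l\<in>L. lc E l z2 = lc E l y" using k'[OF yZ] by blast
    have z2Z: "z2 \<in> Z" "lc E l0 z2 = \<zero>" using z2(1) by auto
    define c' where "c' = (\<lambda>e. z1 e \<oplus> z2 e)"
    have lc': "lc E l c' = lc E l z1 \<oplus> lc E l z2" if "l \<in> vecs E" for l
      unfolding c'_def using lc_vadd[OF Zv[OF z1(1)] Zv[OF z2Z(1)] that] .
    have "c' \<in> Z" unfolding c'_def using vsubD(3)[OF insert.prems(2) z1(1) z2Z(1)] .
    moreover have "c' e \<in> ipow m j" if e: "e \<in> E" for e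
    proof -
      have "z1 e \<in> ipow m j" using z1(2) e ipow_antimono[OF m, of j j1] unfolding j1_def by auto
      thus ?thesis unfolding c'_def using idealD(5)[OF mi] z2(2) e by blast
    qed
    moreover have "lc E l c' = lc E l c" if l: "l \<in> insert l0 L" for l
    proof -
      have lv: "l \<in> vecs E" using l l0 Lv by blast
      have cc: "lc E l z1 \<in> carrier R" "lc E l c \<in> carrier R" using lc_vclosed[OF Zv[OF z1(1)] lv] lc_vclosed[OF Zv[OF c(1)] lv] by auto
      show ?thesis
      proof (cases "l = l0")
        case True thus ?thesis using lc'[OF lv] z1(3) z2Z(2) cc by simp
      next
        case False
        hence "lc E l z2 = lc E l c \<ominus> lc E l z1" using z2(3) l ly[OF lv] by simp
        thus ?thesis unfolding lc'[OF lv] using cc by (simp, algebra)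
      qed
    qed
    ultimately show ?thesis by blast
  qed
  thus ?case by blast
qed

text \<open>The Noetherian property of R^E, by induction on E: finitely many equations generate the
  ideal of coefficients at the new index e, and finitely many more imply all those with coefficient
  0 there.\<close>

lemma finite_equations:
  assumes N: "noeth_over (carrier R)" and E: "finite E" and L: "vsub E L"
  shows "\<exists>L0\<subseteq>L. finite L0 \<and> (\<forall>c\<in>vecs E. (\<forall>l\<in>L0. lc E l c = \<zero>) \<longrightarrow> (\<forall>l\<in>L. lc E l c = \<zero>))"
  using E L
proof (induction E arbitrary: L rule: finite_induct)
  case empty
  thus ?case by (intro exI[of _ "{}"]) (auto simp: lc_empty)
next
  case (insert e E)
  let ?E = "insert e E"
  note Lv = vsub_vecs[OF insert.prems]
  have fE: "finite ?E" using insert by simp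
  \<comment> \<open>The unit vector at e, so that \<open>lc ?E u l\<close> reads off the coefficient
    \<open>l e\<close>.\<close>
  define u where "u = (\<lambda>x. if x = e then \<one> else \<zero>)"
  have uv: "u \<in> vecs ?E" unfolding u_def vecs_def by auto
  have lu: "lc ?E u l = l e" if l: "l \<in> L" for l
  proof -
    have "lc ?E u l = lc ?E l u" by (rule lc_commute[OF Lv[OF l] uv])
    also have "\<dots> = \<one> \<otimes> l e" unfolding u_def by (rule lc_single) (use fE vecsD[OF Lv[OF l]] in auto)
    finally show ?thesis using vecsD[OF Lv[OF l], of e] by simp
  qed
  have I: "ideal (lc ?E u ` L) R" by (rule vsub_image_ideal[OF insert.prems fE uv])
  let ?L' = "{l \<in> L. lc ?E u l = \<zero>}"
  have "vsub ?E ?L'" by (rule vsub_kernel[OF insert.prems fE uv])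
  hence "vsub E ?L'" unfolding vsub_def vecs_def by blast
  from insert.IH[OF this] obtain L1 where L1: "L1 \<subseteq> ?L'" "finite L1"
    "\<And>c. c \<in> vecs E \<Longrightarrow> (\<forall>l\<in>L1. lc E l c = \<zero>) \<Longrightarrow> (\<forall>l\<in>?L'. lc E l c = \<zero>)" by blast
  obtain S where S: "S \<subseteq> lc ?E u ` L" "finite S" "\<And>J. ideal J R \<Longrightarrow> S \<subseteq> J \<Longrightarrow> lc ?E u ` L \<subseteq> J"
    using noeth_fg[OF N I] by blast
  obtain L2 where L2: "L2 \<subseteq> L" "finite L2" "S = lc ?E u ` L2" using S(1,2) finite_subset_image by metis
  have insc: "lc ?E l c = c e \<otimes> l e \<oplus> lc E l c" if "l \<in> L" "c \<in> vecs ?E" for l c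
    by (rule lc_insert) (use insert that Lv[OF that(1)] in \<open>auto simp: vecs_def\<close>)
  have "\<forall>l\<in>L. lc ?E l c = \<zero>" if c: "c \<in> vecs ?E" "\<forall>l\<in>L1 \<union> L2. lc ?E l c = \<zero>" for c
  proof
    fix l assume l: "l \<in> L"
    have cE: "c \<in> vecs E" "c e \<in> carrier R" using c(1) unfolding vecs_def by auto
    have e0: "lc ?E l c = lc E l c" if "l \<in> ?L'" for l
    proof -
      have "l \<in> L" "l e = \<zero>" using that lu by auto
      moreover have "l \<in> vecs E" using Lv[OF \<open>l \<in> L\<close>] unfolding vecs_def by blast
      ultimately show ?thesis using insc[OF \<open>l \<in> L\<close> c(1)] cE(2) lc_vclosed[OF cE(1)] by simp
    qed
    have "\<forall>l\<in>L1. lc E l c = \<zero>"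
    proof
      fix l assume l1: "l \<in> L1"
      hence "lc ?E l c = lc E l c" using e0 L1(1) by blast
      thus "lc E l c = \<zero>" using c(2) l1 by simp
    qed
    hence k: "lc E l c = \<zero>" if "l \<in> ?L'" for l using L1(3)[OF cE(1)] that by blast
    \<comment> \<open>The coefficients at e of the equations satisfied by c form an ideal containing
      \<open>S\<close>. So each equation has a partner that c satisfies and that has the same
      coefficient at e; their difference has coefficient 0 there.\<close>
    have "vsub ?E {l \<in> L. lc ?E c l = \<zero>}" by (rule vsub_kernel[OF insert.prems fE c(1)])
    hence "ideal (lc ?E u ` {l \<in> L. lc ?E c l = \<zero>}) R" by (rule vsub_image_ideal[OF _ fE uv])
    moreover have "S \<subseteq> lc ?E u ` {l \<in> L. lc ?E c l = \<zero>}"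
    proof -
      have "lc ?E c l = \<zero>" if "l \<in> L2" for l using c(2) that L2(1) lc_commute[OF Lv c(1), of l] by auto
      thus ?thesis using L2 by auto
    qed
    ultimately have "lc ?E u ` L \<subseteq> lc ?E u ` {l \<in> L. lc ?E c l = \<zero>}" by (rule S(3))
    then obtain m where m: "m \<in> L" "lc ?E c m = \<zero>" "lc ?E u l = lc ?E u m" using l by blast
    define n where "n = (\<lambda>x. (\<ominus> \<one>) \<otimes> m x)"
    have n: "n \<in> L" unfolding n_def using vsubD(4)[OF insert.prems _ m(1), of "\<ominus> \<one>"] by simp
    define d where "d = (\<lambda>x. l x \<oplus> n x)"
    have d: "d \<in> L" unfolding d_def using vsubD(3)[OF insert.prems l n] .
    have ld: "lc ?E g d = lc ?E g l \<ominus> lc ?E g m" if g: "g \<in> vecs ?E" for g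
    proof -
      have "lc ?E g d = lc ?E g l \<oplus> lc ?E g n" unfolding d_def using lc_vadd[OF Lv[OF l] Lv[OF n] g] .
      also have "lc ?E g n = (\<ominus> \<one>) \<otimes> lc ?E g m" unfolding n_def using lc_vmult[OF fE Lv[OF m(1)] g, of "\<ominus> \<one>"] by simp
      finally show ?thesis using lc_vclosed[OF Lv[OF m(1)] g] by (simp add: l_minus a_minus_def)
    qed
    have "lc ?E u d = \<zero>" unfolding ld[OF uv] m(3) using lc_vclosed[OF Lv[OF m(1)] uv] by (simp add: r_neg a_minus_def)
    hence dL: "d \<in> ?L'" using d by blast
    have "lc ?E c d = \<zero>" using k[OF dL] e0[OF dL] lc_commute[OF Lv[OF d] c(1)] by simp
    hence "lc ?E c l = \<zero>" using ld[OF c(1)] m(2) lc_vclosed[OF Lv[OF l] c(1)] by (simp add: a_minus_def)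
    thus "lc ?E l c = \<zero>" using lc_commute[OF Lv[OF l] c(1)] by simp
  qed
  thus ?case using L1(1,2) L2(1,2) by (intro exI[of _ "L1 \<union> L2"]) auto
qed

end

section \<open>Differential operators on the completion\<close>

context compl begin

text \<open>Order is tested at finite depth: if modulo every \<mm>^k an operator is induced by
  operators of order below n on R, its commutators are induced by their commutators. The loss of
  depth \<open>N\<close> stays fixed in the induction.\<close>

lemma approx_Dlt:
  assumes "\<epsilon> \<in> C.Lin"
    "\<And>k. \<exists>\<delta>\<in>Dlt n. \<forall>f\<in>carrier C. \<forall>r\<in>carrier R. f (N + k) = mn (N + k) +> r \<longrightarrow> \<epsilon> f k = mn k +> \<delta> r"
  shows "\<epsilon> \<in> C.Dlt n"
  using assms
proof (induction n arbitrary: \<epsilon>)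
  case 0
  note l = C.linD[OF 0(1)]
  have "\<epsilon> = C.ozero"
  proof (rule C.op_eqI[OF l(4) C.op_ext(3)])
    fix f assume f: "f \<in> carrier C"
    have "\<epsilon> f k = iota \<zero> k" for k
    proof -
      obtain r where r: "r \<in> carrier R" "f (N + k) = mn (N + k) +> r" using f unfolding C_carrier by blast
      have "\<epsilon> f k = mn k +> ozero r" using 0(2)[of k] f r unfolding Dlt_0 by blast
      thus ?thesis using r(1) unfolding iota_def by simp
    qed
    thus "\<epsilon> f = C.ozero f" using f unfolding C.op_apply(3)[OF f] C_ops by blast
  qed
  thus ?case by (simp add: C.Dlt_0)
next
  case (Suc n)
  note l = C.linD[OF Suc.prems(1)]
  have "commutator C \<epsilon> g \<in> C.Dlt n" if g: "g \<in> carrier C" for g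
  proof (rule Suc.IH[OF C.lin_ops(4)[OF Suc.prems(1) Suc.prems(1) g]])
    fix k
    obtain \<delta> where d: "\<delta> \<in> Dlt (Suc n)"
      "\<And>f r. f \<in> carrier C \<Longrightarrow> r \<in> carrier R \<Longrightarrow> f (N + k) = mn (N + k) +> r \<Longrightarrow> \<epsilon> f k = mn k +> \<delta> r"
      using Suc.prems(2)[of k] by blast
    note dl = Dlt_lin[OF d(1)]
    obtain s where s: "s \<in> carrier R" "g (N + k) = mn (N + k) +> s" "g k = mn k +> s"
      using C_rep'[OF g, of "N + k"] by (metis le_add2)
    have "commutator C \<epsilon> g f k = mn k +> commutator R \<delta> s r"
      if f: "f \<in> carrier C" and r: "r \<in> carrier R" "f (N + k) = mn (N + k) +> r" for f r
    proof -
      have gf: "g \<otimes>\<^sub>C f \<in> carrier C" using C.m_closed[OF g f] .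
      have 1: "\<epsilon> (g \<otimes>\<^sub>C f) k = mn k +> \<delta> (s \<otimes> r)"
        by (rule d(2)[OF gf m_closed[OF s(1) r(1)]]) (rule C_op_level(1)[of s r g "N + k" f, OF s(1) r(1) s(2) r(2)])
      have 2: "(g \<otimes>\<^sub>C \<epsilon> f) k = mn k +> (s \<otimes> \<delta> r)"
        by (rule C_op_level(1)[of s "\<delta> r" g k "\<epsilon> f", OF s(1) linD(1)[OF dl r(1)] s(3) d(2)[OF f r]])
      have "(\<epsilon> (g \<otimes>\<^sub>C f) \<ominus>\<^sub>C g \<otimes>\<^sub>C \<epsilon> f) k = mn k +> (\<delta> (s \<otimes> r) \<ominus> s \<otimes> \<delta> r)"
        by (rule C_minus_level[of "\<epsilon> (g \<otimes>\<^sub>C f)" "g \<otimes>\<^sub>C \<epsilon> f" "\<delta> (s \<otimes> r)" "s \<otimes> \<delta> r" k, OF l(1)[OF gf] C.m_closed[OF g l(1)[OF f]] _ _ 1 2])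
          (use linD(1)[OF dl] s r in auto)
      thus ?thesis using f r(1) by simp
    qed
    thus "\<exists>\<delta>\<in>Dlt n. \<forall>f\<in>carrier C. \<forall>r\<in>carrier R. f (N + k) = mn (N + k) +> r \<longrightarrow> commutator C \<epsilon> g f k = mn k +> \<delta> r"
      using Dlt_comm[OF d(1) s(1)] by blast
  qed
  thus ?case using Suc.prems(1) by (simp add: C.Dlt_Suc)
qed

text \<open>Extension by continuity. The component k of a value is computed from a representative at
  depth n + k; for \<delta> of order below n the choice does not matter, by
  \<open>Dlt_ipow\<close>.\<close>

definition ext :: "nat \<Rightarrow> ('b \<Rightarrow> 'b) \<Rightarrow> (nat \<Rightarrow> 'b set) \<Rightarrow> (nat \<Rightarrow> 'b set)" where
  "ext n \<delta> = (\<lambda>f\<in>carrier C. \<lambda>k. mn k +> \<delta> (SOME r. r \<in> carrier R \<and> f (n + k) = mn (n + k) +> r))"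

lemma ext_level:
  assumes d: "\<delta> \<in> Dlt n" and f: "f \<in> carrier C" "r \<in> carrier R" "f (n + k) = mn (n + k) +> r"
  shows "ext n \<delta> f k = mn k +> \<delta> r"
proof -
  note dl = Dlt_lin[OF d]
  define s where "s = (SOME r. r \<in> carrier R \<and> f (n + k) = mn (n + k) +> r)"
  have s: "s \<in> carrier R \<and> f (n + k) = mn (n + k) +> s" unfolding s_def by (rule someI[of _ r]) (use f in blast)
  hence "mn (n + k) +> s = mn (n + k) +> r" using f(3) by simp
  hence "s \<ominus> r \<in> mn (n + k)" using coset_eq_iff[OF mni conjunct1[OF s] f(2)] by blast
  hence "\<delta> (s \<ominus> r) \<in> mn (Suc k)" by (rule Dlt_ipow[OF mid d])
  hence "\<delta> s \<ominus> \<delta> r \<in> mn k" using lin_minus[OF dl conjunct1[OF s] f(2)] ipow_Suc_subset[OF mid, of k] by (metis subsetD)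
  hence "mn k +> \<delta> s = mn k +> \<delta> r" using coset_eq_iff[OF mni linD(1)[OF dl conjunct1[OF s]] linD(1)[OF dl f(2)]] by blast
  thus ?thesis unfolding ext_def s_def using f(1) by simp
qed

lemma ext_Dlt: assumes d: "\<delta> \<in> Dlt n" shows "ext n \<delta> \<in> C.Dlt n"
proof (rule approx_Dlt[where N = n])
  note dl = Dlt_lin[OF d]
  have ec: "ext n \<delta> f \<in> carrier C" if f: "f \<in> carrier C" for f
  proof (rule C_memI)
    fix k
    obtain r where r: "r \<in> carrier R" "\<And>i. i \<le> n + Suc k \<Longrightarrow> f i = mn i +> r"
      by (rule C_rep[OF f, of "n + Suc k"]) blast
    have "ext n \<delta> f i = mn i +> \<delta> r" if "i \<in> {k, Suc k}" for i
      by (rule ext_level[OF d f r(1)]) (use that r(2)[of "n + i"] in auto)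
    thus "\<exists>r\<in>carrier R. \<forall>i\<in>{k, Suc k}. ext n \<delta> f i = mn i +> r" using linD(1)[OF dl r(1)] by blast
  qed
  show "ext n \<delta> \<in> C.Lin"
  proof (rule C.linI)
    show "ext n \<delta> \<in> extensional (carrier C)" unfolding ext_def by simp
    show "ext n \<delta> f \<in> carrier C" if "f \<in> carrier C" for f using ec[OF that] .
    fix f assume f: "f \<in> carrier C"
    show "ext n \<delta> (f \<oplus>\<^sub>C g) = ext n \<delta> f \<oplus>\<^sub>C ext n \<delta> g" if g: "g \<in> carrier C" for g
    proof
      fix k
      obtain r where r: "r \<in> carrier R" "f (n + k) = mn (n + k) +> r" using f unfolding C_carrier by blast
      obtain s where s: "s \<in> carrier R" "g (n + k) = mn (n + k) +> s" using g unfolding C_carrier by blast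
      have "ext n \<delta> (f \<oplus>\<^sub>C g) k = mn k +> \<delta> (r \<oplus> s)"
        by (rule ext_level[OF d C.a_closed[OF f g] a_closed[OF r(1) s(1)]]) (rule C_op_level(2)[of r s f "n + k" g, OF r(1) s(1) r(2) s(2)])
      also have "\<dots> = mn k +> (\<delta> r \<oplus> \<delta> s)" using linD(2)[OF dl r(1) s(1)] by simp
      also have "\<dots> = (ext n \<delta> f \<oplus>\<^sub>C ext n \<delta> g) k"
        by (rule C_op_level(2)[of "\<delta> r" "\<delta> s" "ext n \<delta> f" k "ext n \<delta> g", OF linD(1)[OF dl r(1)] linD(1)[OF dl s(1)] ext_level[OF d f r] ext_level[OF d g s], symmetric])
      finally show "ext n \<delta> (f \<oplus>\<^sub>C g) k = (ext n \<delta> f \<oplus>\<^sub>C ext n \<delta> g) k" .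
    qed
    fix a assume "a \<in> structure_map C ` carrier K"
    then obtain c where c: "c \<in> KK" "a = iota c" unfolding C_KK by blast
    have cc: "c \<in> carrier R" using c KKc by blast
    show "ext n \<delta> (a \<otimes>\<^sub>C f) = a \<otimes>\<^sub>C ext n \<delta> f"
    proof
      fix k
      obtain r where r: "r \<in> carrier R" "f (n + k) = mn (n + k) +> r" using f unfolding C_carrier by blast
      have a: "a i = mn i +> c" for i unfolding c(2) iota_def ..
      have "ext n \<delta> (a \<otimes>\<^sub>C f) k = mn k +> \<delta> (c \<otimes> r)"
        by (rule ext_level[OF d C.m_closed[OF _ f] m_closed[OF cc r(1)]])
          (use c iota_C[OF cc] C_op_level(1)[of c r a "n + k" f, OF cc r(1) a r(2)] in auto)
      also have "\<dots> = mn k +> (c \<otimes> \<delta> r)" using linD(3)[OF dl c(1) r(1)] by simp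
      also have "\<dots> = (a \<otimes>\<^sub>C ext n \<delta> f) k"
        by (rule C_op_level(1)[of c "\<delta> r" a k "ext n \<delta> f", OF cc linD(1)[OF dl r(1)] a ext_level[OF d f r], symmetric])
      finally show "ext n \<delta> (a \<otimes>\<^sub>C f) k = (a \<otimes>\<^sub>C ext n \<delta> f) k" .
    qed
  qed
  show "\<exists>\<delta>'\<in>Dlt n. \<forall>f\<in>carrier C. \<forall>r\<in>carrier R. f (n + k) = mn (n + k) +> r \<longrightarrow> ext n \<delta> f k = mn k +> \<delta>' r" for k
    using d ext_level[OF d] by blast
qed

end

text \<open>\<open>T\<close> generates R over K up to units. The unit w is taken in K[T] together
  with w r, so that w e stays in K[T] when e is there. Finitely generated algebras use w = 1,
  localizations their denominators.\<close>

locale ess = compl K R \<mm>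
  for K :: "('k, 'p) ring_scheme" and R :: "('k, 'b, 'q) module_scheme" (structure) and \<mm> +
  fixes T :: "'b set"
  assumes T: "finite T" "T \<subseteq> carrier R"
    and frac: "r \<in> carrier R \<Longrightarrow> \<exists>w\<in>Units R. w \<in> homalg KK T \<and> w \<otimes> r \<in> homalg KK T"
begin

abbreviation val :: "'b set \<Rightarrow> ((nat \<Rightarrow> 'b set) \<Rightarrow> nat \<Rightarrow> 'b set) \<Rightarrow> ('b \<Rightarrow> 'b) \<Rightarrow> nat \<Rightarrow> 'b set" where
  "val E \<delta> l \<equiv> C.lc E (\<lambda>e. \<delta> (iota e)) (\<lambda>e. iota (l e))"

text \<open>The coefficients \<rho> lie in R and are the same for all operators \<delta>; this is
  what lets relations between values be studied over R.\<close>

definition represented :: "nat \<Rightarrow> 'b set \<Rightarrow> (((nat \<Rightarrow> 'b set) \<Rightarrow> nat \<Rightarrow> 'b set) \<Rightarrow> nat \<Rightarrow> 'b set) \<Rightarrow> bool" where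
  "represented n E \<Phi> \<longleftrightarrow> (\<exists>\<rho>\<in>vecs E. \<forall>\<delta>\<in>C.Dlt n. \<Phi> \<delta> = val E \<delta> \<rho>)"

lemma iota_vecs: "\<rho> \<in> vecs E \<Longrightarrow> (\<lambda>e. iota (\<rho> e)) \<in> C.vecs E"
  unfolding vecs_def C.vecs_def using iota_C by blast

lemma eval_vecs: "\<delta> \<in> C.Dlt n \<Longrightarrow> E \<subseteq> carrier R \<Longrightarrow> (\<lambda>e. \<delta> (iota e)) \<in> C.vecs E"
  unfolding C.vecs_def using iota_C C.linD(1)[OF C.Dlt_lin] by blast

context
  fixes E and n :: nat assumes E: "finite E" "E \<subseteq> carrier R"
begin

lemma val_add:
  assumes a: "a \<in> vecs E" and b: "b \<in> vecs E" and d: "\<delta> \<in> C.Dlt n"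
  shows "val E \<delta> (\<lambda>e. a e \<oplus> b e) = val E \<delta> a \<oplus>\<^sub>C val E \<delta> b"
proof -
  have "val E \<delta> (\<lambda>e. a e \<oplus> b e) = C.lc E (\<lambda>e. \<delta> (iota e)) (\<lambda>e. iota (a e) \<oplus>\<^sub>C iota (b e))"
  proof (rule C.lc_cong)
    fix e assume e: "e \<in> E"
    note ab = vecsD[OF a e] vecsD[OF b e]
    show "iota (a e \<oplus> b e) = iota (a e) \<oplus>\<^sub>C iota (b e)" using iota_ops(2)[OF ab] by simp
    show "iota (a e) \<oplus>\<^sub>C iota (b e) \<in> carrier C" using C.a_closed[OF iota_C[OF ab(1)] iota_C[OF ab(2)]] .
    show "\<delta> (iota e) \<in> carrier C" using C.vecsD[OF eval_vecs[OF d E(2)] e] .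
  qed
  also have "\<dots> = val E \<delta> a \<oplus>\<^sub>C val E \<delta> b"
    by (rule C.lc_vadd[OF iota_vecs[OF a] iota_vecs[OF b] eval_vecs[OF d E(2)]])
  finally show ?thesis .
qed

lemma val_mult:
  assumes a: "a \<in> vecs E" and r: "r \<in> carrier R" and d: "\<delta> \<in> C.Dlt n"
  shows "val E \<delta> (\<lambda>e. r \<otimes> a e) = iota r \<otimes>\<^sub>C val E \<delta> a"
proof -
  have "val E \<delta> (\<lambda>e. r \<otimes> a e) = C.lc E (\<lambda>e. \<delta> (iota e)) (\<lambda>e. iota r \<otimes>\<^sub>C iota (a e))"
  proof (rule C.lc_cong)
    fix e assume e: "e \<in> E"
    note ab = vecsD[OF a e]
    show "iota (r \<otimes> a e) = iota r \<otimes>\<^sub>C iota (a e)" using iota_ops(1)[OF r ab] by simp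
    show "iota r \<otimes>\<^sub>C iota (a e) \<in> carrier C" using C.m_closed[OF iota_C[OF r] iota_C[OF ab]] .
    show "\<delta> (iota e) \<in> carrier C" using C.vecsD[OF eval_vecs[OF d E(2)] e] .
  qed
  also have "\<dots> = iota r \<otimes>\<^sub>C val E \<delta> a"
    by (rule C.lc_vmult[OF E(1) iota_vecs[OF a] eval_vecs[OF d E(2)] iota_C[OF r]])
  finally show ?thesis .
qed

lemma rep_add: assumes "represented n E \<Phi>" "represented n E \<Psi>" shows "represented n E (\<lambda>\<delta>. \<Phi> \<delta> \<oplus>\<^sub>C \<Psi> \<delta>)"
proof -
  obtain a b where a: "a \<in> vecs E" "\<forall>\<delta>\<in>C.Dlt n. \<Phi> \<delta> = val E \<delta> a"
    and b: "b \<in> vecs E" "\<forall>\<delta>\<in>C.Dlt n. \<Psi> \<delta> = val E \<delta> b"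
    using assms unfolding represented_def by (elim bexE)
  have v: "(\<lambda>e. a e \<oplus> b e) \<in> vecs E" using a(1) b(1) unfolding vecs_def by auto
  have "\<Phi> \<delta> \<oplus>\<^sub>C \<Psi> \<delta> = val E \<delta> (\<lambda>e. a e \<oplus> b e)" if d: "\<delta> \<in> C.Dlt n" for \<delta>
    unfolding bspec[OF a(2) d] bspec[OF b(2) d] by (rule val_add[OF a(1) b(1) d, symmetric])
  note eq = this
  show ?thesis unfolding represented_def by (intro bexI[OF _ v] ballI) (rule eq)
qed

lemma rep_mult: assumes "represented n E \<Phi>" "r \<in> carrier R" shows "represented n E (\<lambda>\<delta>. iota r \<otimes>\<^sub>C \<Phi> \<delta>)"
proof -
  obtain a where a: "a \<in> vecs E" "\<forall>\<delta>\<in>C.Dlt n. \<Phi> \<delta> = val E \<delta> a"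
    using assms(1) unfolding represented_def by (elim bexE)
  have v: "(\<lambda>e. r \<otimes> a e) \<in> vecs E" using a(1) assms(2) unfolding vecs_def by auto
  have "iota r \<otimes>\<^sub>C \<Phi> \<delta> = val E \<delta> (\<lambda>e. r \<otimes> a e)" if d: "\<delta> \<in> C.Dlt n" for \<delta>
    unfolding bspec[OF a(2) d] by (rule val_mult[OF a(1) assms(2) d, symmetric])
  note eq = this
  show ?thesis unfolding represented_def by (intro bexI[OF _ v] ballI) (rule eq)
qed

lemma rep_point: assumes "e \<in> E" shows "represented n E (\<lambda>\<delta>. \<delta> (iota e))"
proof -
  let ?a = "\<lambda>x. if x = e then \<one> else \<zero>"
  have "\<delta> (iota e) = C.lc E (\<lambda>e. \<delta> (iota e)) (\<lambda>x. iota (?a x))" if d: "\<delta> \<in> C.Dlt n" for \<delta>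
  proof -
    have "(\<lambda>x. iota (?a x)) = (\<lambda>x. if x = e then \<one>\<^sub>C else \<zero>\<^sub>C)" unfolding C_ops by auto
    moreover have "C.lc E (\<lambda>e. \<delta> (iota e)) (\<lambda>x. if x = e then \<one>\<^sub>C else \<zero>\<^sub>C) = \<one>\<^sub>C \<otimes>\<^sub>C \<delta> (iota e)"
      by (rule C.lc_single) (use E(1) assms C.vecsD[OF eval_vecs[OF d E(2)]] in auto)
    ultimately show ?thesis using C.vecsD[OF eval_vecs[OF d E(2)] assms] by simp
  qed
  thus ?thesis unfolding represented_def by (intro bexI[of _ ?a]) (auto simp: vecs_def)
qed

lemma rep_zero: "represented n E (\<lambda>\<delta>. \<zero>\<^sub>C)"
proof -
  have "C.lc E (\<lambda>e. \<delta> (iota e)) (\<lambda>e. iota \<zero>) = \<zero>\<^sub>C" if d: "\<delta> \<in> C.Dlt n" for \<delta>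
    using C.lc_vzero[OF E(1) eval_vecs[OF d E(2)]] unfolding C_ops .
  thus ?thesis unfolding represented_def by (intro bexI[of _ "\<lambda>e. \<zero>"]) (auto simp: vecs_def)
qed

lemma rep_neg: assumes "represented n E \<Phi>" "\<And>\<delta>. \<delta> \<in> C.Dlt n \<Longrightarrow> \<Phi> \<delta> \<in> carrier C"
  shows "represented n E (\<lambda>\<delta>. \<ominus>\<^sub>C \<Phi> \<delta>)"
proof -
  have "iota (\<ominus> \<one>) = \<ominus>\<^sub>C \<one>\<^sub>C" unfolding C_ops by (rule iota_neg[OF one_closed])
  hence "iota (\<ominus> \<one>) \<otimes>\<^sub>C \<Phi> \<delta> = \<ominus>\<^sub>C \<Phi> \<delta>" if "\<delta> \<in> C.Dlt n" for \<delta>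
    using assms(2)[OF that] by (simp add: C.l_minus)
  thus ?thesis using rep_mult[OF assms(1), of "\<ominus> \<one>"] unfolding represented_def by auto
qed

lemma rep_cong: "represented n E \<Phi> \<Longrightarrow> (\<And>\<delta>. \<delta> \<in> C.Dlt n \<Longrightarrow> \<Psi> \<delta> = \<Phi> \<delta>) \<Longrightarrow> represented n E \<Psi>"
  unfolding represented_def by auto

lemma rep_lc:
  assumes "finite A" "\<rho> \<in> vecs A" "\<And>e. e \<in> A \<Longrightarrow> represented n E (\<lambda>\<delta>. g \<delta> e)"
    "\<And>e \<delta>. e \<in> A \<Longrightarrow> \<delta> \<in> C.Dlt n \<Longrightarrow> g \<delta> e \<in> carrier C"
  shows "represented n E (\<lambda>\<delta>. C.lc A (g \<delta>) (\<lambda>e. iota (\<rho> e)))"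
  using assms
proof (induction A rule: finite_induct)
  case empty thus ?case using rep_cong[OF rep_zero] C.lc_empty by metis
next
  case (insert x A)
  have v: "\<rho> \<in> vecs A" "\<rho> x \<in> carrier R" using insert.prems(1) unfolding vecs_def by auto
  have "represented n E (\<lambda>\<delta>. iota (\<rho> x) \<otimes>\<^sub>C g \<delta> x \<oplus>\<^sub>C C.lc A (g \<delta>) (\<lambda>e. iota (\<rho> e)))"
    by (rule rep_add[OF rep_mult[OF _ v(2)] insert.IH[OF v(1)]]) (use insert.prems in auto)
  thus ?case
  proof (rule rep_cong)
    fix \<delta> assume d: "\<delta> \<in> C.Dlt n"
    show "C.lc (insert x A) (g \<delta>) (\<lambda>e. iota (\<rho> e)) = iota (\<rho> x) \<otimes>\<^sub>C g \<delta> x \<oplus>\<^sub>C C.lc A (g \<delta>) (\<lambda>e. iota (\<rho> e))"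
      by (rule C.lc_insert) (use insert d iota_C vecsD[OF insert.prems(1)] in auto)
  qed
qed

end

lemma homalg_facts: "homalg KK T \<subseteq> carrier R" "subring (homalg KK T) R" "T \<subseteq> homalg KK T" "KK \<subseteq> homalg KK T"
  using homalg_subring[OF KKsub T(2)] homalg_incl[OF KKsub T(2)] subringE(1) by blast+

text \<open>An operator is determined by its values at finitely many points, independent of the operator,
  because its commutators with the generators have smaller order.\<close>

theorem universal_formula:
  "\<exists>E. finite E \<and> E \<subseteq> homalg KK T \<and> (\<forall>f\<in>carrier R. represented n E (\<lambda>\<delta>. \<delta> (iota f)))"
proof (induction n)
  case 0
  have "represented 0 {} (\<lambda>\<delta>. \<delta> (iota f))" if f: "f \<in> carrier R" for f
    unfolding represented_def C.Dlt_0 C.lc_empty using iota_C[OF f] by (auto simp: vecs_def)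
  thus ?case by blast
next
  case (Suc n)
  then obtain E where E: "finite E" "E \<subseteq> homalg KK T" "\<And>f. f \<in> carrier R \<Longrightarrow> represented n E (\<lambda>\<delta>. \<delta> (iota f))" by blast
  note hs = subringE[OF homalg_facts(2)]
  have Ec: "E \<subseteq> carrier R" using E(2) homalg_facts(1) by blast
  \<comment> \<open>The element 1 starts the generation of K[T]; the points e and t e express
    [\<delta>, t](e) = \<delta>(t e) - t \<delta>(e), to which the formula for smaller order
    applies.\<close>
  define E' where "E' = E \<union> {\<one>} \<union> (\<lambda>(t, e). t \<otimes> e) ` (T \<times> E)"
  have E'h: "E' \<subseteq> homalg KK T" unfolding E'_def using E(2) hs(3) hs(6) homalg_facts(3) by auto
  have E': "finite E'" "E' \<subseteq> carrier R" using E(1) T(1) E'h homalg_facts(1) unfolding E'_def by auto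
  let ?rep = "represented (Suc n) E'"
  note add = rep_add[OF E', of "Suc n"] and mult = rep_mult[OF E', of "Suc n"] and point = rep_point[OF E', of _ "Suc n"]
    and neg = rep_neg[OF E', of "Suc n"] and cong = rep_cong[OF E', of "Suc n"] and rlc = rep_lc[OF E', of _ _ "Suc n"]
  have dc: "\<delta> (iota f) \<in> carrier C" if "\<delta> \<in> C.Dlt k" "f \<in> carrier R" for \<delta> f k
    using C.linD(1)[OF C.Dlt_lin[OF that(1)] iota_C[OF that(2)]] .
  \<comment> \<open>The formula for order below n is applied to [\<delta>, w], and its values at the
    points of E are expressed by values of \<delta>.\<close>
  have comm: "?rep (\<lambda>\<delta>. commutator C \<delta> (iota w) (iota f))"
    if w: "w \<in> carrier R" and f: "f \<in> carrier R" and we: "\<And>e. e \<in> E \<Longrightarrow> ?rep (\<lambda>\<delta>. \<delta> (iota (w \<otimes> e)))" for w f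
  proof -
    obtain \<rho> where r: "\<rho> \<in> vecs E" "\<And>\<delta>. \<delta> \<in> C.Dlt n \<Longrightarrow> \<delta> (iota f) = val E \<delta> \<rho>"
      using E(3)[OF f] unfolding represented_def by blast
    let ?g = "\<lambda>\<delta> e. \<delta> (iota (w \<otimes> e)) \<oplus>\<^sub>C \<ominus>\<^sub>C (iota w \<otimes>\<^sub>C \<delta> (iota e))"
    have "?rep (\<lambda>\<delta>. C.lc E (?g \<delta>) (\<lambda>e. iota (\<rho> e)))"
    proof (rule rlc[OF E(1) r(1)])
      fix e assume e: "e \<in> E"
      have ec: "e \<in> carrier R" using e Ec by blast
      show "?rep (\<lambda>\<delta>. ?g \<delta> e)"
      proof (rule add[OF we[OF e]], rule neg)
        show "?rep (\<lambda>\<delta>. iota w \<otimes>\<^sub>C \<delta> (iota e))" by (rule mult[OF point w]) (use e E'_def in auto)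
        show "iota w \<otimes>\<^sub>C \<delta> (iota e) \<in> carrier C" if "\<delta> \<in> C.Dlt (Suc n)" for \<delta>
          using C.m_closed[OF iota_C[OF w] dc[OF that ec]] .
      qed
      show "?g \<delta> e \<in> carrier C" if d: "\<delta> \<in> C.Dlt (Suc n)" for \<delta>
        using dc[OF d ec] dc[OF d m_closed[OF w ec]] iota_C[OF w] by simp
    qed
    thus ?thesis
    proof (rule cong)
      fix \<delta> assume d: "\<delta> \<in> C.Dlt (Suc n)"
      have cd: "commutator C \<delta> (iota w) \<in> C.Dlt n" by (rule C.Dlt_comm[OF d iota_C[OF w]])
      have "commutator C \<delta> (iota w) (iota f) = C.lc E (\<lambda>e. commutator C \<delta> (iota w) (iota e)) (\<lambda>e. iota (\<rho> e))"
        by (rule r(2)[OF cd])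
      also have "\<dots> = C.lc E (?g \<delta>) (\<lambda>e. iota (\<rho> e))"
        unfolding C.lc_def
      proof (rule C.finsum_cong')
        fix e assume e: "e \<in> E"
        have ec: "e \<in> carrier R" using e Ec by blast
        show "iota (\<rho> e) \<otimes>\<^sub>C commutator C \<delta> (iota w) (iota e) = iota (\<rho> e) \<otimes>\<^sub>C ?g \<delta> e"
          using iota_C[OF ec] iota_ops(1)[OF w ec] by (simp add: a_minus_def)
      next
        show "(\<lambda>e. iota (\<rho> e) \<otimes>\<^sub>C ?g \<delta> e) \<in> E \<rightarrow> carrier C"
        proof
          fix e assume e: "e \<in> E"
          have ec: "e \<in> carrier R" using e Ec by blast
          show "iota (\<rho> e) \<otimes>\<^sub>C ?g \<delta> e \<in> carrier C"
            using dc[OF d ec] dc[OF d m_closed[OF w ec]] iota_C[OF w] iota_C[OF vecsD[OF r(1) e]] by simp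
        qed
      qed simp
      finally show "commutator C \<delta> (iota w) (iota f) = C.lc E (?g \<delta>) (\<lambda>e. iota (\<rho> e))" .
    qed
  qed
  define V where "V = {f \<in> carrier R. ?rep (\<lambda>\<delta>. \<delta> (iota f))}"
  have split: "\<delta> (iota (w \<otimes> f)) = iota w \<otimes>\<^sub>C \<delta> (iota f) \<oplus>\<^sub>C commutator C \<delta> (iota w) (iota f)"
    if "\<delta> \<in> C.Dlt (Suc n)" "w \<in> carrier R" "f \<in> carrier R" for \<delta> w f
  proof -
    have c: "iota w \<otimes>\<^sub>C \<delta> (iota f) \<in> carrier C" "\<delta> (iota (w \<otimes> f)) \<in> carrier C"
      using that dc[OF that(1)] iota_C by auto
    have "commutator C \<delta> (iota w) (iota f) = \<delta> (iota (w \<otimes> f)) \<ominus>\<^sub>C iota w \<otimes>\<^sub>C \<delta> (iota f)"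
      using iota_C[OF that(3)] iota_ops(1)[OF that(2,3)] by simp
    thus ?thesis using c by (simp add: a_minus_def C.a_comm C.a_lcomm C.r_neg)
  qed
  have Vmul: "w \<otimes> f \<in> V" if w: "w \<in> carrier R" and f: "f \<in> V" and we: "\<And>e. e \<in> E \<Longrightarrow> ?rep (\<lambda>\<delta>. \<delta> (iota (w \<otimes> e)))" for w f
  proof -
    have fc: "f \<in> carrier R" "?rep (\<lambda>\<delta>. \<delta> (iota f))" using f unfolding V_def by auto
    have "?rep (\<lambda>\<delta>. iota w \<otimes>\<^sub>C \<delta> (iota f) \<oplus>\<^sub>C commutator C \<delta> (iota w) (iota f))"
      by (rule add[OF mult[OF fc(2) w] comm[OF w fc(1) we]])
    hence "?rep (\<lambda>\<delta>. \<delta> (iota (w \<otimes> f)))" by (rule cong) (rule split[OF _ w fc(1)])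
    thus ?thesis unfolding V_def using w fc by simp
  qed
  have Vg: "gfam KK (insert \<one> T) (\<lambda>_. V)" unfolding gfam_def
  proof (intro conjI allI ballI)
    have VKK: "a \<otimes> f \<in> V" if a: "a \<in> KK" and f: "f \<in> V" for a f
    proof -
      have fc: "f \<in> carrier R" "?rep (\<lambda>\<delta>. \<delta> (iota f))" using f unfolding V_def by auto
      have ac: "a \<in> carrier R" using a KKc by blast
      have "?rep (\<lambda>\<delta>. \<delta> (iota (a \<otimes> f)))"
      proof (rule cong[OF mult[OF fc(2) ac]])
        fix \<delta> assume d: "\<delta> \<in> C.Dlt (Suc n)"
        have "iota a \<in> structure_map C ` carrier K" unfolding C_KK using a by blast
        thus "\<delta> (iota (a \<otimes> f)) = iota a \<otimes>\<^sub>C \<delta> (iota f)"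
          using C.linD(3)[OF C.Dlt_lin[OF d] _ iota_C[OF fc(1)]] iota_ops(1)[OF ac fc(1)] by simp
      qed
      thus ?thesis unfolding V_def using ac fc by simp
    qed
    show "asub R KK V"
    proof (rule asubI[OF KKsub])
      show "V \<subseteq> carrier R" unfolding V_def by blast
      have "?rep (\<lambda>\<delta>. \<delta> (iota \<zero>))"
        by (rule cong[OF rep_zero[OF E']]) (use C.lin_zero[OF C.Dlt_lin] in \<open>auto simp: C_ops\<close>)
      thus "\<zero> \<in> V" unfolding V_def by simp
      fix f assume f: "f \<in> V"
      have fc: "f \<in> carrier R" "?rep (\<lambda>\<delta>. \<delta> (iota f))" using f unfolding V_def by auto
      show "a \<otimes> f \<in> V" if "a \<in> KK" for a using VKK[OF that f] .
      fix h assume h: "h \<in> V"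
      have hc: "h \<in> carrier R" "?rep (\<lambda>\<delta>. \<delta> (iota h))" using h unfolding V_def by auto
      have "?rep (\<lambda>\<delta>. \<delta> (iota (f \<oplus> h)))"
      proof (rule cong[OF add[OF fc(2) hc(2)]])
        fix \<delta> assume d: "\<delta> \<in> C.Dlt (Suc n)"
        show "\<delta> (iota (f \<oplus> h)) = \<delta> (iota f) \<oplus>\<^sub>C \<delta> (iota h)"
          using C.linD(2)[OF C.Dlt_lin[OF d] iota_C[OF fc(1)] iota_C[OF hc(1)]] iota_ops(2)[OF fc(1) hc(1)] by simp
      qed
      thus "f \<oplus> h \<in> V" unfolding V_def using fc hc by simp
    qed
  next
    fix x f assume x: "x \<in> insert \<one> T" and f: "f \<in> V"
    show "x \<otimes> f \<in> V"
    proof (cases "x = \<one>")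
      case True thus ?thesis using f unfolding V_def by simp
    next
      case False
      hence xT: "x \<in> T" using x by blast
      show ?thesis
      proof (rule Vmul[OF _ f])
        show "x \<in> carrier R" using xT T(2) by blast
        show "?rep (\<lambda>\<delta>. \<delta> (iota (x \<otimes> e)))" if "e \<in> E" for e
          by (rule point) (use xT that in \<open>auto simp: E'_def\<close>)
      qed
    qed
  qed
  \<comment> \<open>V contains 1 and is stable under K and T, hence contains K[T].\<close>
  have "\<one> \<in> V" unfolding V_def using point[of \<one>] unfolding E'_def by simp
  hence homV: "homalg KK T \<subseteq> V" unfolding homalg_def using Gen_least[OF Vg, of "{(0, \<one>)}"] by auto
  have "represented (Suc n) E' (\<lambda>\<delta>. \<delta> (iota f))" if f: "f \<in> carrier R" for f
  proof -
    \<comment> \<open>For fractions, w \<delta>(f) = \<delta>(w f) - [\<delta>, w](f) with w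
      invertible. The points w e must lie in K[T] here, which is why E is kept inside K[T].\<close>
    obtain w where w: "w \<in> Units R" "w \<in> homalg KK T" "w \<otimes> f \<in> homalg KK T" using frac[OF f] by blast
    have wc: "w \<in> carrier R" "inv w \<in> carrier R" "inv w \<otimes> w = \<one>" using w(1) by auto
    have we: "?rep (\<lambda>\<delta>. \<delta> (iota (w \<otimes> e)))" if "e \<in> E" for e
      using homV hs(6)[OF w(2)] E(2) that unfolding V_def by blast
    have wf: "?rep (\<lambda>\<delta>. \<delta> (iota (w \<otimes> f)))" using homV w(3) unfolding V_def by blast
    have cc: "commutator C \<delta> (iota w) (iota f) \<in> carrier C" if "\<delta> \<in> C.Dlt (Suc n)" for \<delta>
      using C.linD(1)[OF C.Dlt_lin[OF C.Dlt_comm[OF that iota_C[OF wc(1)]]] iota_C[OF f]] .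
    have "?rep (\<lambda>\<delta>. iota (inv w) \<otimes>\<^sub>C (\<delta> (iota (w \<otimes> f)) \<oplus>\<^sub>C \<ominus>\<^sub>C commutator C \<delta> (iota w) (iota f)))"
      by (rule mult[OF add[OF wf neg[OF comm[OF wc(1) f we] cc]] wc(2)])
    thus ?thesis
    proof (rule cong)
      fix \<delta> assume d: "\<delta> \<in> C.Dlt (Suc n)"
      note c = dc[OF d f] cc[OF d] iota_C[OF wc(1)] iota_C[OF wc(2)]
      have "\<delta> (iota (w \<otimes> f)) \<oplus>\<^sub>C \<ominus>\<^sub>C commutator C \<delta> (iota w) (iota f) = iota w \<otimes>\<^sub>C \<delta> (iota f)"
        unfolding split[OF d wc(1) f] using c by (simp add: C.a_assoc C.r_neg)
      moreover have "iota (inv w) \<otimes>\<^sub>C (iota w \<otimes>\<^sub>C \<delta> (iota f)) = \<delta> (iota f)"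
        using c iota_ops(1)[OF wc(2,1)] unfolding wc(3) C_ops(3)[symmetric]
        by (metis C.m_assoc C.l_one)
      ultimately show "\<delta> (iota f) = iota (inv w) \<otimes>\<^sub>C (\<delta> (iota (w \<otimes> f)) \<oplus>\<^sub>C \<ominus>\<^sub>C commutator C \<delta> (iota w) (iota f))"
        by simp
    qed
  qed
  thus ?case using E'(1) E'h by blast
qed

end

section \<open>Descending differential operators from the completion\<close>

context ess begin

lemma val_closed: "l \<in> vecs E \<Longrightarrow> \<delta> \<in> C.Dlt n \<Longrightarrow> E \<subseteq> carrier R \<Longrightarrow> val E \<delta> l \<in> carrier C"
  by (rule C.lc_vclosed[OF iota_vecs eval_vecs])

lemma val_zero: "finite E \<Longrightarrow> \<delta> \<in> C.Dlt n \<Longrightarrow> E \<subseteq> carrier R \<Longrightarrow> val E \<delta> (\<lambda>e. \<zero>) = \<zero>\<^sub>C"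
  unfolding C_ops(4)[symmetric] by (rule C.lc_vzero[OF _ eval_vecs])

text \<open>Relations that hold for all operators of order below n at once. Vectors over R
  satisfying them are the candidates for the values at E of an operator of R.\<close>

definition relations :: "nat \<Rightarrow> 'b set \<Rightarrow> ('b \<Rightarrow> 'b) set" where
  "relations n E = {l \<in> vecs E. \<forall>\<delta>\<in>C.Dlt n. val E \<delta> l = \<zero>\<^sub>C}"

context
  fixes E and n :: nat assumes E: "finite E" "E \<subseteq> carrier R"
begin

lemma vsub_relations: "vsub E (relations n E)"
  unfolding vsub_def
proof (intro conjI ballI)
  show "relations n E \<subseteq> vecs E" unfolding relations_def by blast
  show "(\<lambda>e. \<zero>) \<in> relations n E"
    unfolding relations_def using val_zero[OF E(1) _ E(2)] by (auto simp: vecs_def)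
  fix z assume z: "z \<in> relations n E"
  hence zv: "z \<in> vecs E" and z0: "\<And>\<delta>. \<delta> \<in> C.Dlt n \<Longrightarrow> val E \<delta> z = \<zero>\<^sub>C" unfolding relations_def by auto
  show "(\<lambda>e. r \<otimes> z e) \<in> relations n E" if r: "r \<in> carrier R" for r
  proof -
    have "(\<lambda>e. r \<otimes> z e) \<in> vecs E" using zv r unfolding vecs_def by auto
    moreover have "val E \<delta> (\<lambda>e. r \<otimes> z e) = \<zero>\<^sub>C" if d: "\<delta> \<in> C.Dlt n" for \<delta>
      unfolding val_mult[OF E zv r d] z0[OF d] using iota_C[OF r] by simp
    ultimately show ?thesis unfolding relations_def by blast
  qed
  fix y assume y: "y \<in> relations n E"
  hence yv: "y \<in> vecs E" and y0: "\<And>\<delta>. \<delta> \<in> C.Dlt n \<Longrightarrow> val E \<delta> y = \<zero>\<^sub>C" unfolding relations_def by auto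
  have "(\<lambda>e. y e \<oplus> z e) \<in> vecs E" using zv yv unfolding vecs_def by auto
  moreover have "val E \<delta> (\<lambda>e. y e \<oplus> z e) = \<zero>\<^sub>C" if d: "\<delta> \<in> C.Dlt n" for \<delta>
    unfolding val_add[OF E yv zv d] z0[OF d] y0[OF d] by simp
  ultimately show "(\<lambda>e. y e \<oplus> z e) \<in> relations n E" unfolding relations_def by blast
qed

context
  fixes c assumes c: "c \<in> vecs E" "\<And>l. l \<in> relations n E \<Longrightarrow> lc E c l = \<zero>"
begin

text \<open>The difference of y and z is a relation, which c satisfies. So pairing with c is well
  defined on functionals of operators, whatever coefficients represent them.\<close>

lemma relation_eq:
  assumes y: "y \<in> vecs E" and z: "z \<in> vecs E" and eq: "\<And>\<delta>. \<delta> \<in> C.Dlt n \<Longrightarrow> val E \<delta> y = val E \<delta> z"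
  shows "lc E c y = lc E c z"
proof -
  define w where "w = (\<lambda>e. (\<ominus> \<one>) \<otimes> z e)"
  have w: "w \<in> vecs E" using z unfolding w_def vecs_def by auto
  have "(\<lambda>e. y e \<oplus> w e) \<in> relations n E"
  proof -
    have "(\<lambda>e. y e \<oplus> w e) \<in> vecs E" using y w unfolding vecs_def by auto
    moreover have "val E \<delta> (\<lambda>e. y e \<oplus> w e) = \<zero>\<^sub>C" if d: "\<delta> \<in> C.Dlt n" for \<delta>
    proof -
      have "val E \<delta> w = \<ominus>\<^sub>C val E \<delta> z"
        unfolding w_def val_mult[OF E z a_inv_closed[OF one_closed] d] iota_neg[OF one_closed] C_ops(3)[symmetric]
        using val_closed[OF z d E(2)] by (simp add: C.l_minus)
      thus ?thesis unfolding val_add[OF E y w d] eq[OF d] using val_closed[OF z d E(2)] by (simp add: C.r_neg)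
    qed
    ultimately show ?thesis unfolding relations_def by blast
  qed
  from c(2)[OF this] have "lc E c y \<oplus> lc E c w = \<zero>" using lc_vadd[OF y w c(1)] by simp
  moreover have "lc E c w = (\<ominus> \<one>) \<otimes> lc E c z" unfolding w_def by (rule lc_vmult[OF E(1) z c(1)]) simp
  ultimately show ?thesis
    using lc_vclosed[OF y c(1)] lc_vclosed[OF z c(1)] by (simp add: l_minus minus_equality[symmetric] minus_minus) (metis minus_equality minus_minus a_inv_closed)
qed

text \<open>Replacing the values at \<open>E\<close> by any solution of the relations between them again gives an operator.\<close>

lemma shadow_Dlt:
  assumes "\<And>\<delta>. \<delta> \<in> C.Dlt n \<Longrightarrow> \<Theta> \<delta> \<in> C.Dlt j" "\<And>f. f \<in> carrier R \<Longrightarrow> \<tau> f \<in> vecs E"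
    "\<And>f \<delta>. f \<in> carrier R \<Longrightarrow> \<delta> \<in> C.Dlt n \<Longrightarrow> \<Theta> \<delta> (iota f) = val E \<delta> (\<tau> f)"
  shows "(\<lambda>f\<in>carrier R. lc E c (\<tau> f)) \<in> Dlt j"
  using assms
proof (induction j arbitrary: \<Theta> \<tau>)
  case 0
  have "lc E c (\<tau> f) = \<zero>" if f: "f \<in> carrier R" for f
  proof -
    have "lc E c (\<tau> f) = lc E c (\<lambda>e. \<zero>)"
    proof (rule relation_eq[OF 0(2)[OF f]])
      show "(\<lambda>e. \<zero>) \<in> vecs E" unfolding vecs_def by simp
      fix \<delta> assume d: "\<delta> \<in> C.Dlt n"
      have "\<Theta> \<delta> (iota f) = \<zero>\<^sub>C" using 0(1)[OF d] iota_C[OF f] unfolding C.Dlt_0 by simp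
      thus "val E \<delta> (\<tau> f) = val E \<delta> (\<lambda>e. \<zero>)" unfolding val_zero[OF E(1) d E(2)] using 0(3)[OF f d] by simp
    qed
    thus ?thesis using lc_vzero[OF E(1) c(1)] by simp
  qed
  hence "(\<lambda>f\<in>carrier R. lc E c (\<tau> f)) = ozero" by (intro op_eqI) auto
  thus ?case by (simp add: Dlt_0)
next
  case (Suc j)
  note \<tau> = Suc.prems(2) and eq = Suc.prems(3)
  note lin = C.linD[OF C.Dlt_lin[OF Suc.prems(1)]]
  let ?op = "\<lambda>f\<in>carrier R. lc E c (\<tau> f)"
  have l: "?op \<in> Lin"
  proof (rule linI)
    show "?op \<in> extensional (carrier R)" by simp
    fix f assume f: "f \<in> carrier R"
    show "?op f \<in> carrier R" using lc_vclosed[OF \<tau>[OF f] c(1)] f by simp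
    show "?op (f \<oplus> g) = ?op f \<oplus> ?op g" if g: "g \<in> carrier R" for g
    proof -
      have v: "(\<lambda>e. \<tau> f e \<oplus> \<tau> g e) \<in> vecs E" using \<tau>[OF f] \<tau>[OF g] unfolding vecs_def by auto
      have "lc E c (\<tau> (f \<oplus> g)) = lc E c (\<lambda>e. \<tau> f e \<oplus> \<tau> g e)"
      proof (rule relation_eq[OF \<tau>[OF a_closed[OF f g]] v])
        fix \<delta> assume d: "\<delta> \<in> C.Dlt n"
        show "val E \<delta> (\<tau> (f \<oplus> g)) = val E \<delta> (\<lambda>e. \<tau> f e \<oplus> \<tau> g e)"
          unfolding val_add[OF E \<tau>[OF f] \<tau>[OF g] d] eq[OF _ d, symmetric, OF f] eq[OF _ d, symmetric, OF g]
            eq[OF _ d, symmetric, OF a_closed[OF f g]] iota_ops(2)[OF f g]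
          by (rule lin(2)[OF d iota_C[OF f] iota_C[OF g]])
      qed
      thus ?thesis using lc_vadd[OF \<tau>[OF f] \<tau>[OF g] c(1)] f g by simp
    qed
    fix a assume a: "a \<in> KK"
    have ac: "a \<in> carrier R" using a KKc by blast
    have v: "(\<lambda>e. a \<otimes> \<tau> f e) \<in> vecs E" using \<tau>[OF f] ac unfolding vecs_def by auto
    have "lc E c (\<tau> (a \<otimes> f)) = lc E c (\<lambda>e. a \<otimes> \<tau> f e)"
    proof (rule relation_eq[OF \<tau>[OF m_closed[OF ac f]] v])
      fix \<delta> assume d: "\<delta> \<in> C.Dlt n"
      have "iota a \<in> structure_map C ` carrier K" unfolding C_KK using a by blast
      thus "val E \<delta> (\<tau> (a \<otimes> f)) = val E \<delta> (\<lambda>e. a \<otimes> \<tau> f e)"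
        unfolding val_mult[OF E \<tau>[OF f] ac d] eq[OF _ d, symmetric, OF f]
          eq[OF _ d, symmetric, OF m_closed[OF ac f]] iota_ops(1)[OF ac f]
        by (rule lin(3)[OF d _ iota_C[OF f]])
    qed
    thus "?op (a \<otimes> f) = a \<otimes> ?op f" using lc_vmult[OF E(1) \<tau>[OF f] c(1) ac] f ac by simp
  qed
  have "commutator R ?op r \<in> Dlt j" if r: "r \<in> carrier R" for r
  proof -
    \<comment> \<open>Coefficients for [\<Theta> \<delta>, r](f) = \<Theta> \<delta> (r f) - r
      \<Theta> \<delta> (f). The statement allows any \<Theta> so that the induction hypothesis
      covers these commutators.\<close>
    define \<tau>' where "\<tau>' f = (\<lambda>e. \<tau> (r \<otimes> f) e \<oplus> (\<ominus> r) \<otimes> \<tau> f e)" for f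
    have rc: "(\<lambda>e. (\<ominus> r) \<otimes> \<tau> f e) \<in> vecs E" if "f \<in> carrier R" for f using \<tau>[OF that] r unfolding vecs_def by auto
    have "(\<lambda>f\<in>carrier R. lc E c (\<tau>' f)) \<in> Dlt j"
    proof (rule Suc.IH)
      show "commutator C (\<Theta> \<delta>) (iota r) \<in> C.Dlt j" if "\<delta> \<in> C.Dlt n" for \<delta>
        by (rule C.Dlt_comm[OF Suc.prems(1)[OF that] iota_C[OF r]])
      fix f assume f: "f \<in> carrier R"
      show "\<tau>' f \<in> vecs E" using rc[OF f] \<tau>[OF m_closed[OF r f]] unfolding \<tau>'_def vecs_def by auto
      fix \<delta> assume d: "\<delta> \<in> C.Dlt n"
      have "val E \<delta> (\<tau>' f) = \<Theta> \<delta> (iota (r \<otimes> f)) \<oplus>\<^sub>C iota (\<ominus> r) \<otimes>\<^sub>C \<Theta> \<delta> (iota f)"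
        unfolding \<tau>'_def val_add[OF E \<tau>[OF m_closed[OF r f]] rc[OF f] d] val_mult[OF E \<tau>[OF f] a_inv_closed[OF r] d]
          eq[OF f d] eq[OF m_closed[OF r f] d] ..
      also have "\<dots> = commutator C (\<Theta> \<delta>) (iota r) (iota f)"
        using iota_C[OF f] iota_C[OF r] lin(1)[OF d iota_C[OF f]] unfolding iota_neg[OF r] iota_ops(1)[OF r f]
        by (simp add: C.l_minus a_minus_def)
      finally show "commutator C (\<Theta> \<delta>) (iota r) (iota f) = val E \<delta> (\<tau>' f)" by (rule sym)
    qed
    moreover have "commutator R ?op r = (\<lambda>f\<in>carrier R. lc E c (\<tau>' f))"
    proof (rule op_eqI)
      fix f assume f: "f \<in> carrier R"
      have "lc E c (\<tau>' f) = lc E c (\<tau> (r \<otimes> f)) \<oplus> (\<ominus> r) \<otimes> lc E c (\<tau> f)"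
        unfolding \<tau>'_def lc_vadd[OF \<tau>[OF m_closed[OF r f]] rc[OF f] c(1)] lc_vmult[OF E(1) \<tau>[OF f] c(1) a_inv_closed[OF r]] ..
      thus "commutator R ?op r f = (\<lambda>f\<in>carrier R. lc E c (\<tau>' f)) f"
        using f r lc_vclosed[OF \<tau>[OF f] c(1)] by (simp add: a_minus_def l_minus)
    qed auto
    ultimately show ?thesis by simp
  qed
  thus ?case using l unfolding Dlt_Suc by blast
qed

end

lemma val_approx:
  assumes d: "\<delta> \<in> C.Dlt n" and c: "c \<in> vecs E" "\<And>e. e \<in> E \<Longrightarrow> \<delta> (iota e) \<ominus>\<^sub>C iota (c e) \<in> nn k" and l: "l \<in> vecs E"
  shows "val E \<delta> l \<ominus>\<^sub>C iota (lc E c l) \<in> nn k"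
proof -
  have dv: "(\<lambda>e. \<delta> (iota e)) \<in> C.vecs E" by (rule eval_vecs[OF d E(2)])
  note cv = iota_vecs[OF c(1)] and lv = iota_vecs[OF l]
  have "iota (lc E c l) = C.lc E (\<lambda>e. iota (c e)) (\<lambda>e. iota (l e))"
    by (rule iota_lc[OF E(1)]) (use vecsD[OF c(1)] vecsD[OF l] in auto)
  also have "\<dots> = C.lc E (\<lambda>e. iota (l e)) (\<lambda>e. iota (c e))" by (rule C.lc_commute[OF lv cv])
  finally have "val E \<delta> l \<ominus>\<^sub>C iota (lc E c l)
     = C.lc E (\<lambda>e. iota (l e)) (\<lambda>e. \<delta> (iota e)) \<ominus>\<^sub>C C.lc E (\<lambda>e. iota (l e)) (\<lambda>e. iota (c e))"
    using C.lc_commute[OF lv dv] by simp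
  also have "\<dots> = C.lc E (\<lambda>e. iota (l e)) (\<lambda>e. \<delta> (iota e) \<ominus>\<^sub>C iota (c e))"
    by (rule C.lc_minus[symmetric, OF E(1)]) (use C.vecsD[OF dv] C.vecsD[OF cv] C.vecsD[OF lv] in auto)
  also have "\<dots> \<in> nn k"
  proof (rule C.lc_ideal[OF nn_ideal E(1)])
    fix e assume e: "e \<in> E"
    show "\<delta> (iota e) \<ominus>\<^sub>C iota (c e) \<in> carrier C" using nn_carrier[OF c(2)[OF e]] .
    show "iota (l e) \<in> carrier C" using C.vecsD[OF lv e] .
    thus "(\<delta> (iota e) \<ominus>\<^sub>C iota (c e)) \<otimes>\<^sub>C iota (l e) \<in> nn k"
      by (rule C.idealD(8)[OF nn_ideal _ c(2)[OF e]])
  qed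
  finally show ?thesis .
qed

end

lemma vsub_all: "vsub E (vecs E)" unfolding vsub_def vecs_def by auto

text \<open>The values of \<delta> at E satisfy all relations but lie in the completion.
  Approximations c in R satisfy the relations only modulo \<mm>^k; for k large enough there is a
  correction c' with entries in \<mm> and the same defects, and c - c' satisfies the relations
  exactly while it still agrees with the values of \<delta> modulo the maximal ideal.\<close>

theorem descend_Dlt:
  assumes d: "\<delta> \<in> C.Dlt n"
  shows "\<exists>\<epsilon>\<in>Dlt n. \<forall>f\<in>carrier R. \<delta> (iota f) \<ominus>\<^sub>C iota (\<epsilon> f) \<in> nn 1"
proof -
  obtain E where E0: "finite E" "E \<subseteq> homalg KK T" "\<forall>f\<in>carrier R. represented n E (\<lambda>\<delta>. \<delta> (iota f))"
    using universal_formula[of n] by blast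
  have E: "finite E" "E \<subseteq> carrier R" using E0(1,2) homalg_facts(1) by auto
  have "\<forall>f\<in>carrier R. \<exists>r. r \<in> vecs E \<and> (\<forall>\<delta>\<in>C.Dlt n. \<delta> (iota f) = val E \<delta> r)"
    using E0(3) unfolding represented_def by (simp only: Bex_def)
  from bchoice[OF this] obtain \<rho> where "\<forall>f\<in>carrier R. \<rho> f \<in> vecs E \<and> (\<forall>\<delta>\<in>C.Dlt n. \<delta> (iota f) = val E \<delta> (\<rho> f))"
    by (rule exE)
  hence \<rho>: "\<And>f. f \<in> carrier R \<Longrightarrow> \<rho> f \<in> vecs E"
    "\<And>f \<delta>. f \<in> carrier R \<Longrightarrow> \<delta> \<in> C.Dlt n \<Longrightarrow> \<delta> (iota f) = val E \<delta> (\<rho> f)" by (simp_all only:)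
  \<comment> \<open>Finitely many relations imply all of them, as \<open>artin_rees_system\<close>
    requires.\<close>
  obtain L0 where L0: "L0 \<subseteq> relations n E" "finite L0"
    "\<And>c. c \<in> vecs E \<Longrightarrow> (\<forall>l\<in>L0. lc E l c = \<zero>) \<Longrightarrow> (\<forall>l\<in>relations n E. lc E l c = \<zero>)"
    using finite_equations[OF noeth E(1) vsub_relations[OF E, of n]] by blast
  have rv: "l \<in> vecs E" if "l \<in> relations n E" for l using that unfolding relations_def by blast
  have L0v: "L0 \<subseteq> vecs E" using L0(1) rv by blast
  obtain k where k: "\<And>c. c \<in> vecs E \<Longrightarrow> (\<forall>l\<in>L0. lc E l c \<in> mn k) \<Longrightarrow>
     (\<exists>c'\<in>vecs E. (\<forall>e\<in>E. c' e \<in> mn 1) \<and> (\<forall>l\<in>L0. lc E l c' = lc E l c))"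
    using artin_rees_system[OF noeth mid E(1) L0(2) L0v vsub_all, of 1] by blast
  \<comment> \<open>Level k is used for the relations and level 1 for the final congruence;
    \<open>Suc k\<close> bounds both.\<close>
  have "\<forall>e\<in>E. \<exists>c. c \<in> carrier R \<and> (\<forall>i\<le>Suc k. \<delta> (iota e) i = mn i +> c)"
  proof
    fix e assume "e \<in> E"
    hence "\<delta> (iota e) \<in> carrier C" using C.vecsD[OF eval_vecs[OF d E(2)]] by blast
    then obtain c where "c \<in> carrier R" "\<And>i. i \<le> Suc k \<Longrightarrow> \<delta> (iota e) i = mn i +> c" by (rule C_rep[of _ "Suc k"]) blast
    thus "\<exists>c. c \<in> carrier R \<and> (\<forall>i\<le>Suc k. \<delta> (iota e) i = mn i +> c)" by blast
  qed
  from bchoice[OF this] obtain c where c: "\<forall>e\<in>E. c e \<in> carrier R \<and> (\<forall>i\<le>Suc k. \<delta> (iota e) i = mn i +> c e)" by (rule exE)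
  have cv: "c \<in> vecs E" using c unfolding vecs_def by blast
  have near: "\<delta> (iota e) \<ominus>\<^sub>C iota a \<in> nn i" if e: "e \<in> E" and a: "a \<in> carrier R" "c e \<ominus> a \<in> mn i" and i: "i \<le> Suc k" for e a i
  proof -
    have "c e \<in> carrier R" "\<delta> (iota e) i = mn i +> c e" using c e i by blast+
    hence "\<delta> (iota e) i = iota a i" using coset_eq_iff[OF mni _ a(1), of "c e" i] a(2) unfolding iota_def by simp
    thus ?thesis using minus_nn[OF C.vecsD[OF eval_vecs[OF d E(2)] e] iota_C[OF a(1)]] by blast
  qed
  have "lc E l c \<in> mn k" if l: "l \<in> L0" for l
  proof -
    have lv: "l \<in> vecs E" and l0: "val E \<delta> l = \<zero>\<^sub>C" using l L0(1) d unfolding relations_def by blast+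
    have "val E \<delta> l \<ominus>\<^sub>C iota (lc E c l) \<in> nn k"
    proof (rule val_approx[OF E d cv _ lv])
      fix e assume e: "e \<in> E"
      have ce: "c e \<in> carrier R" using vecsD[OF cv e] .
      hence "c e \<ominus> c e \<in> mn k" using idealD(4)[OF mni] by (simp add: r_neg a_minus_def)
      thus "\<delta> (iota e) \<ominus>\<^sub>C iota (c e) \<in> nn k" by (rule near[OF e ce]) simp
    qed
    hence "val E \<delta> l k = iota (lc E c l) k"
      using minus_nn[OF val_closed[OF lv d E(2)] iota_C[OF lc_vclosed[OF lv cv]]] by blast
    hence "iota (lc E c l) k = mn k +> \<zero>" unfolding l0 C_ops iota_def[of \<zero>] by (rule sym)
    hence "lc E c l \<in> mn k" using coset_eq_iff[OF mni lc_vclosed[OF lv cv] zero_closed, of k] lc_vclosed[OF lv cv]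
      unfolding iota_def by (simp add: a_minus_def)
    thus ?thesis using lc_commute[OF lv cv] by simp
  qed
  then obtain c' where c': "c' \<in> vecs E" "\<And>e. e \<in> E \<Longrightarrow> c' e \<in> mn 1" "\<And>l. l \<in> L0 \<Longrightarrow> lc E l c' = lc E l c"
    using k[OF cv] by blast
  define b where "b = (\<lambda>e. c e \<ominus> c' e)"
  have bv: "b \<in> vecs E" unfolding b_def vecs_def using vecsD[OF cv] vecsD[OF c'(1)] by auto
  have "lc E l b = \<zero>" if l: "l \<in> L0" for l
  proof -
    have lv: "l \<in> vecs E" using l L0v by blast
    have "lc E l b = lc E l c \<ominus> lc E l c'" unfolding b_def
      by (rule lc_minus[OF E(1)]) (use vecsD[OF cv] vecsD[OF c'(1)] vecsD[OF lv] in auto)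
    thus ?thesis unfolding c'(3)[OF l] using lc_vclosed[OF cv lv] by (simp add: r_neg a_minus_def)
  qed
  hence b0: "lc E b l = \<zero>" if "l \<in> relations n E" for l
    using L0(3)[OF bv] lc_commute[OF bv rv[OF that]] that by simp
  let ?op = "\<lambda>f\<in>carrier R. lc E b (\<rho> f)"
  have "?op \<in> Dlt n"
    by (rule shadow_Dlt[where \<Theta> = "\<lambda>\<delta>. \<delta>" and n = n, OF E bv b0]) (use \<rho> in auto)
  moreover have "\<delta> (iota f) \<ominus>\<^sub>C iota (?op f) \<in> nn 1" if f: "f \<in> carrier R" for f
  proof -
    have "val E \<delta> (\<rho> f) \<ominus>\<^sub>C iota (lc E b (\<rho> f)) \<in> nn 1"
    proof (rule val_approx[OF E d bv _ \<rho>(1)[OF f]])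
      fix e assume e: "e \<in> E"
      have "c e \<ominus> b e = c' e" unfolding b_def using vecsD[OF cv e] vecsD[OF c'(1) e] by algebra
      thus "\<delta> (iota e) \<ominus>\<^sub>C iota (b e) \<in> nn 1" using near[OF e vecsD[OF bv e], of 1] c'(2)[OF e] by simp
    qed
    thus ?thesis using \<rho>(2)[OF f d] f by simp
  qed
  ultimately show ?thesis by blast
qed

text \<open>An element of the completion may be replaced by an element r of R, since
  \<open>nn n\<close> lies in the n-th differential power. Operators of R are then tested on r
  through their extensions, and operators of the completion through
  \<open>descend_Dlt\<close>.\<close>

lemma C_dpow: "C.dpow n = lift n (dpow n)"
proof -
  have "f \<in> C.dpow n \<longleftrightarrow> f \<in> lift n (dpow n)" if f: "f \<in> carrier C" for f
  proof -
    obtain r where r: "r \<in> carrier R" "f n = mn n +> r" using f unfolding C_carrier by blast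
    have ir: "iota r \<in> carrier C" using iota_C[OF r(1)] .
    have "f \<ominus>\<^sub>C iota r \<in> nn n" using minus_nn[OF f ir] r(2) unfolding iota_def by blast
    hence fd: "f \<ominus>\<^sub>C iota r \<in> C.dpow n" using C.ipow_dpow[of n] unfolding nn_ipow by blast
    have "f = (f \<ominus>\<^sub>C iota r) \<oplus>\<^sub>C iota r" using f ir by algebra
    moreover have "iota r = f \<ominus>\<^sub>C (f \<ominus>\<^sub>C iota r)" using f ir by algebra
    ultimately have 1: "f \<in> C.dpow n \<longleftrightarrow> iota r \<in> C.dpow n"
      using C.idealD(5)[OF C.dpow_ideal fd] C.idealD(9)[OF C.dpow_ideal _ fd] by metis
    have "r \<in> dpow n" if i: "iota r \<in> C.dpow n"
    proof -
      have "\<delta> r \<in> \<mm>" if d: "\<delta> \<in> Dlt n" for \<delta>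
      proof -
        have dr: "\<delta> r \<in> carrier R" using linD(1)[OF Dlt_lin[OF d] r(1)] .
        have "ext n \<delta> (iota r) \<in> nn 1" using i ext_Dlt[OF d] unfolding C.dpow_def by blast
        moreover have "ext n \<delta> (iota r) 1 = mn 1 +> \<delta> r" by (rule ext_level[OF d ir r(1)]) (simp add: iota_def)
        ultimately have "\<delta> r \<in> mn 1" using nn_level[OF nn_carrier dr] by blast
        thus ?thesis using ipow_1[OF mid] by simp
      qed
      thus ?thesis unfolding dpow_def using r(1) by blast
    qed
    moreover have "iota r \<in> C.dpow n" if i: "r \<in> dpow n"
    proof -
      have "\<delta> (iota r) \<in> nn 1" if d: "\<delta> \<in> C.Dlt n" for \<delta>
      proof -
        obtain \<epsilon> where e: "\<epsilon> \<in> Dlt n" "\<delta> (iota r) \<ominus>\<^sub>C iota (\<epsilon> r) \<in> nn 1" using descend_Dlt[OF d] r(1) by blast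
        have er: "\<epsilon> r \<in> carrier R" using linD(1)[OF Dlt_lin[OF e(1)] r(1)] .
        have "\<epsilon> r \<in> \<mm>" using i e(1) unfolding dpow_def by blast
        hence "\<epsilon> r \<in> mn 1" using ipow_1[OF mid] by simp
        hence "iota (\<epsilon> r) \<in> nn 1" using iota_nn[OF er] by blast
        from C.idealD(5)[OF nn_ideal e(2) this] have "(\<delta> (iota r) \<ominus>\<^sub>C iota (\<epsilon> r)) \<oplus>\<^sub>C iota (\<epsilon> r) \<in> nn 1" .
        moreover have "(\<delta> (iota r) \<ominus>\<^sub>C iota (\<epsilon> r)) \<oplus>\<^sub>C iota (\<epsilon> r) = \<delta> (iota r)"
          using C.linD(1)[OF C.Dlt_lin[OF d] ir] iota_C[OF er] by algebra
        ultimately show ?thesis by simp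
      qed
      thus ?thesis unfolding C.dpow_def using ir by blast
    qed
    ultimately show ?thesis unfolding 1 lift_level[OF dpow_ideal ipow_dpow f r] by blast
  qed
  moreover have "C.dpow n \<subseteq> carrier C" "lift n (dpow n) \<subseteq> carrier C" unfolding C.dpow_def lift_def by auto
  ultimately show ?thesis by blast
qed

theorem diff_length_C: "diff_length K C (nn 1) n = diff_length K R \<mm> n"
  unfolding C.diff_length_eq diff_length_eq C_dpow by (rule len_lift[OF dpow_ideal ipow_dpow])

end

section \<open>Krull dimension\<close>

lemma krull_dim_eqI:
  assumes "\<forall>i\<le>h. primeideal (P i) R" "\<forall>i<h. P i \<subset> P (Suc i)"
    and "\<And>k P. \<forall>i\<le>k. primeideal (P i) R \<Longrightarrow> \<forall>i<k. P i \<subset> P (Suc i) \<Longrightarrow> k \<le> h"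
  shows "krull_dim R = enat h"
  unfolding krull_dim_def
proof (rule antisym)
  show "Sup {enat n |n. \<exists>P. (\<forall>i\<le>n. primeideal (P i) R) \<and> (\<forall>i<n. P i \<subset> P (Suc i))} \<le> enat h"
    using assms(3) by (intro Sup_least) auto
  show "enat h \<le> Sup {enat n |n. \<exists>P. (\<forall>i\<le>n. primeideal (P i) R) \<and> (\<forall>i<n. P i \<subset> P (Suc i))}"
    using assms(1,2) by (intro Sup_upper) blast
qed

context cring begin

lemma pchainI:
  assumes "\<forall>i\<le>k. primeideal (P i) R" "\<forall>i<k. P i \<subset> P (Suc i)" "\<And>I. primeideal I R \<Longrightarrow> I \<subseteq> m"
  shows "pchain {\<zero>} m k P"
proof -
  have "{\<zero>} \<subseteq> P i" if "i \<le> k" for i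
  proof -
    have "ideal (P i) R" using assms(1) that primeideal.axioms(1) by blast
    thus ?thesis using idealD(4) by simp
  qed
  moreover have "P i \<subseteq> m" if "i \<le> k" for i by (rule assms(3)) (use assms(1) that in blast)
  ultimately show ?thesis unfolding pchain_def
    by (intro conjI allI impI assms(1)[rule_format] assms(2)[rule_format])
qed

lemma local_contains:
  assumes N: "noeth_over (carrier R)" and m: "\<And>M. maximalideal M R \<Longrightarrow> M = m" and I: "primeideal I R"
  shows "I \<subseteq> m"
proof -
  let ?A = "{J. ideal J R \<and> I \<subseteq> J \<and> J \<noteq> carrier R}"
  have Ii: "ideal I R" "I \<noteq> carrier R" using I primeideal.axioms(1) primeideal.I_notcarr by blast+
  hence "?A \<noteq> {}" by blast
  hence "\<exists>M\<in>?A. \<forall>J\<in>?A. M \<subseteq> J \<longrightarrow> J = M" by (rule noeth_maximal[OF N]) simp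
  then obtain M where M: "M \<in> ?A" "\<forall>J\<in>?A. M \<subseteq> J \<longrightarrow> J = M" by (rule bexE)
  have "maximalideal M R"
  proof (rule maximalidealI)
    show "ideal M R" "carrier R \<noteq> M" using M(1) by auto
    show "J = M \<or> J = carrier R" if "ideal J R" "M \<subseteq> J" "J \<subseteq> carrier R" for J using that M by blast
  qed
  thus ?thesis using m M(1) by blast
qed

section \<open>Sums of homogeneous elements with degrees in a given set\<close>

inductive hspan :: "(nat \<Rightarrow> 'a set) \<Rightarrow> nat set \<Rightarrow> 'a \<Rightarrow> bool" for G I where
  zero: "hspan G I \<zero>"
| add: "i \<in> I \<Longrightarrow> g \<in> G i \<Longrightarrow> hspan G I x \<Longrightarrow> hspan G I (g \<oplus> x)"

context
  fixes G assumes G: "is_grading R G"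
begin

lemma gr_sub: "additive_subgroup (G i) R" and gr_mult: "x \<in> G i \<Longrightarrow> y \<in> G j \<Longrightarrow> x \<otimes> y \<in> G (i + j)"
  using G unfolding is_grading_def by blast+

lemma gr_closed: "x \<in> G i \<Longrightarrow> x \<in> carrier R" "\<zero> \<in> G i" "x \<in> G i \<Longrightarrow> y \<in> G i \<Longrightarrow> x \<oplus> y \<in> G i"
  using additive_subgroup.a_Hcarr[OF gr_sub] additive_subgroup.zero_closed[OF gr_sub]
    additive_subgroup.a_closed[OF gr_sub] by blast+

lemma hspan_closed: "hspan G I x \<Longrightarrow> x \<in> carrier R"
  by (induction rule: hspan.induct) (auto simp: gr_closed(1))

lemma hspan_mono: "hspan G I x \<Longrightarrow> I \<subseteq> J \<Longrightarrow> hspan G J x"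
  by (induction rule: hspan.induct) (auto intro: hspan.intros)

lemma hspan_hom: "g \<in> G i \<Longrightarrow> i \<in> I \<Longrightarrow> hspan G I g"
  using hspan.add[where g = g and i = i and I = I and G = G and x = \<zero>] hspan.zero gr_closed(1)[of g i] by simp

lemma hspan_add: "hspan G I x \<Longrightarrow> hspan G I y \<Longrightarrow> hspan G I (x \<oplus> y)"
proof (induction rule: hspan.induct)
  case (add i g x)
  thus ?case using hspan.add[where G = G and I = I, OF add(1,2), of "x \<oplus> y"] gr_closed(1)[of g i] hspan_closed by (simp add: a_assoc)
qed (simp add: hspan_closed)

lemma hspan_mult:
  assumes "hspan G I x" "hspan G J y" "\<And>i j. i \<in> I \<Longrightarrow> j \<in> J \<Longrightarrow> i + j \<in> L"
  shows "hspan G L (x \<otimes> y)"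
  using assms(1)
proof (induction rule: hspan.induct)
  case zero thus ?case using hspan_closed[OF assms(2)] by (simp add: hspan.zero)
next
  case (add i g x)
  have gc: "g \<in> carrier R" using gr_closed(1)[OF add(2)] .
  have "hspan G L (g \<otimes> y)" using assms(2)
  proof (induction rule: hspan.induct)
    case zero thus ?case using gc by (simp add: hspan.zero)
  next
    case (add j h z)
    have "g \<otimes> (h \<oplus> z) = g \<otimes> h \<oplus> g \<otimes> z" using gc gr_closed(1)[OF add(2)] hspan_closed[OF add(3)] by (simp add: r_distr)
    thus ?case using hspan.add[where G = G and I = L, OF assms(3)[OF \<open>i \<in> I\<close> add(1)] gr_mult[OF \<open>g \<in> G i\<close> add(2)] add(4)] by simp
  qed
  thus ?case using hspan_add[OF _ add(4)] gc hspan_closed[OF add(3)] hspan_closed[OF assms(2)] by (simp add: l_distr)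
qed

lemma hspan_UNIV: assumes "x \<in> carrier R" shows "\<exists>N. hspan G {..N} x"
proof -
  obtain c where c: "\<forall>i. c i \<in> G i" "finite {i. c i \<noteq> \<zero>}" "x = finsum R c {i. c i \<noteq> \<zero>}"
    using G assms unfolding is_grading_def by blast
  obtain N where N: "{i. c i \<noteq> \<zero>} \<subseteq> {..N}" using c(2) finite_nat_iff_bounded_le by blast
  have "hspan G {..N} (finsum R c F)" if "finite F" "F \<subseteq> {..N}" for F
    using that
  proof (induction F rule: finite_induct)
    case (insert i F)
    have "c \<in> F \<rightarrow> carrier R" "c i \<in> carrier R" using c(1) gr_closed(1) by blast+
    thus ?case using insert hspan.add[of i "{..N}" "c i" G] c(1) by (simp add: finsum_insert)
  qed (simp add: hspan.zero)
  thus ?thesis using c N by blast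
qed

lemma hspan_decomp:
  assumes "hspan G I x"
  shows "\<exists>c. (\<forall>i. c i \<in> G i) \<and> finite {i. c i \<noteq> \<zero>} \<and> {i. c i \<noteq> \<zero>} \<subseteq> I \<and> x = finsum R c {i. c i \<noteq> \<zero>}"
proof -
  have "\<exists>c F. finite F \<and> F \<subseteq> I \<and> (\<forall>i. c i \<in> G i) \<and> (\<forall>i. i \<notin> F \<longrightarrow> c i = \<zero>) \<and> x = finsum R c F"
    using assms
  proof (induction rule: hspan.induct)
    case zero
    show ?case by (intro exI[of _ "\<lambda>_. \<zero>"] exI[of _ "{}"]) (auto simp: gr_closed)
  next
    case (add i g x)
    then obtain c F where c: "finite F" "F \<subseteq> I" "\<forall>i. c i \<in> G i" "\<forall>i. i \<notin> F \<longrightarrow> c i = \<zero>" "x = finsum R c F" by blast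
    have cc: "c j \<in> carrier R" for j using c(3) gr_closed(1) by blast
    have gc: "g \<in> carrier R" using gr_closed(1)[OF add(2)] .
    define u where "u j = (if i = j then g else \<zero>)" for j
    have u: "u j \<in> G j" for j using add(2) gr_closed(2) unfolding u_def by auto
    have "finsum R (\<lambda>j. u j \<oplus> c j) (insert i F) = finsum R u (insert i F) \<oplus> finsum R c (insert i F)"
      by (rule finsum_addf) (use u cc gr_closed(1) in auto)
    also have "finsum R u (insert i F) = g" unfolding u_def by (rule add.finprod_singleton) (use c(1) gc in auto)
    also have "finsum R c (insert i F) = finsum R c F"
      by (rule add.finprod_mono_neutral_cong_right) (use c cc in auto)
    finally have "g \<oplus> x = finsum R (\<lambda>j. u j \<oplus> c j) (insert i F)" using c(5) by simp
    moreover have "\<forall>j. u j \<oplus> c j \<in> G j" using u c(3) gr_closed(3) by blast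
    moreover have "\<forall>j. j \<notin> insert i F \<longrightarrow> u j \<oplus> c j = \<zero>" using c(4) unfolding u_def by auto
    ultimately show ?case using c(1,2) add(1) by (intro exI[of _ "\<lambda>j. u j \<oplus> c j"] exI[of _ "insert i F"]) auto
  qed
  then obtain c F where c: "finite F" "F \<subseteq> I" "\<forall>i. c i \<in> G i" "\<forall>i. i \<notin> F \<longrightarrow> c i = \<zero>" "x = finsum R c F" by blast
  have s: "{i. c i \<noteq> \<zero>} \<subseteq> F" using c(4) by blast
  have cc: "c i \<in> carrier R" for i using c(3) gr_closed(1) by blast
  have "finsum R c F = finsum R c {i. c i \<noteq> \<zero>}"
    by (rule add.finprod_mono_neutral_cong_right) (use c s cc in auto)
  thus ?thesis using c s finite_subset by (intro exI[of _ c]) auto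
qed

text \<open>Uniqueness of the homogeneous components; \<open>hspan_decomp\<close> brings the
  recursive sums into the normal form in which the grading states it.\<close>

lemma hspan_disjoint: assumes "hspan G I x" "hspan G J x" "I \<inter> J = {}" shows "x = \<zero>"
proof -
  obtain c where c: "(\<forall>i. c i \<in> G i) \<and> finite {i. c i \<noteq> \<zero>} \<and> x = finsum R c {i. c i \<noteq> \<zero>}" "{i. c i \<noteq> \<zero>} \<subseteq> I"
    using hspan_decomp[OF assms(1)] by blast
  obtain c' where c': "(\<forall>i. c' i \<in> G i) \<and> finite {i. c' i \<noteq> \<zero>} \<and> x = finsum R c' {i. c' i \<noteq> \<zero>}" "{i. c' i \<noteq> \<zero>} \<subseteq> J"
    using hspan_decomp[OF assms(2)] by blast
  have "\<exists>!c. (\<forall>i. c i \<in> G i) \<and> finite {i. c i \<noteq> \<zero>} \<and> x = finsum R c {i. c i \<noteq> \<zero>}"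
    using G hspan_closed[OF assms(1)] unfolding is_grading_def by blast
  hence "c = c'" using c(1) c'(1) by blast
  hence "{i. c i \<noteq> \<zero>} = {}" using c(2) c'(2) assms(3) by blast
  thus ?thesis using c(1) by simp
qed

end

end

section \<open>Dimension of graded algebras\<close>

context coeff begin

context
  fixes G assumes G: "is_grading R G" and G0: "G 0 = KK" and hom: "homogeneous_ideal R G \<mm>"
begin

lemma hspan_asub: "asub R KK {x. hspan G I x}"
proof (rule asubI[OF KKsub])
  fix a x assume a: "a \<in> KK" and x: "x \<in> {x. hspan G I x}"
  have "hspan G {0} a" by (rule hspan_hom[OF G]) (use a G0 in auto)
  thus "a \<otimes> x \<in> {x. hspan G I x}" using hspan_mult[OF G, of "{0}" a I x I] x by simp
qed (use hspan_closed[OF G] hspan.zero hspan_add[OF G] in auto)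

text \<open>\<mm> is generated by homogeneous elements, and a nonzero one cannot have degree 0,
  where all nonzero elements are units. So \<mm> starts in degree 1 and \<mm>^n in degree n.\<close>

lemma ipow_hspan: "ipow \<mm> n \<subseteq> {x. hspan G {n..} x}"
proof -
  have id: "ideal {x. hspan G {n..} x} R" for n
  proof (rule ideal_intro)
    fix a x assume a: "a \<in> carrier R" and x: "x \<in> {x. hspan G {n..} x}"
    obtain N where "hspan G {..N} a" using hspan_UNIV[OF G a] by blast
    thus "a \<otimes> x \<in> {x. hspan G {n..} x}" using hspan_mult[OF G, of "{..N}" a "{n..}" x "{n..}"] x by simp
  qed (use hspan_closed[OF G] hspan.zero hspan_add[OF G] in auto)
  have "\<mm> \<inter> (\<Union>i. G i) \<subseteq> {x. hspan G {1..} x}"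
  proof
    fix x assume "x \<in> \<mm> \<inter> (\<Union>i. G i)"
    then obtain i where x: "x \<in> \<mm>" "x \<in> G i" by blast
    show "x \<in> {x. hspan G {1..} x}"
    proof (cases i)
      case 0
      have "x = \<zero>"
      proof (rule ccontr)
        assume "x \<noteq> \<zero>"
        moreover have "x \<in> KK" using x(2) G0 0 by simp
        ultimately obtain b where b: "b \<in> KK" "b \<otimes> x = \<one>" using KKinv[of x] by blast
        have "b \<otimes> x \<in> \<mm>" using idealD(7)[OF mid _ x(1)] KKc[OF b(1)] by blast
        thus False using b(2) maximalideal.I_notcarr[OF maxi] ideal.one_imp_carrier[OF mid] by simp
      qed
      thus ?thesis by (simp add: hspan.zero)
    next
      case (Suc j) thus ?thesis using hspan_hom[OF G x(2)] by simp
    qed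
  qed
  hence m: "\<mm> \<subseteq> {x. hspan G {1..} x}"
    using genideal_minimal[OF id] hom unfolding homogeneous_ideal_def by blast
  show ?thesis
  proof (induction n)
    case 0
    have "hspan G {0..} x" if x: "x \<in> carrier R" for x using hspan_UNIV[OF G x] hspan_mono[OF G] by fastforce
    thus ?case unfolding ipow_0 by blast
  next
    case (Suc n)
    show ?case unfolding ipow_Suc
    proof (rule ideal_prod_least[OF id])
      fix i j assume "i \<in> ipow \<mm> n" "j \<in> \<mm>"
      hence "hspan G {n..} i" "hspan G {1..} j" using Suc m by auto
      thus "i \<otimes> j \<in> {x. hspan G {Suc n..} x}" using hspan_mult[OF G, of "{n..}" i "{1..}" j "{Suc n..}"] by simp
    qed
  qed
qed

abbreviation "low N \<equiv> {x. hspan G {..N} x}"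

lemma low_mono: "N \<le> M \<Longrightarrow> low N \<subseteq> low M" using hspan_mono[OF G] by fastforce

text \<open>Sums of components of degree at most N meet \<mm>^(N + 1) only in 0, so they embed into
  R / \<mm>^(N + 1).\<close>

lemma len_low: "klen {\<zero>} (low N) \<le> colen (ipow \<mm> (Suc N))"
proof -
  note i = ipow_ideal[OF mid, of "Suc N"]
  have "low N \<inter> ipow \<mm> (Suc N) = {\<zero>}"
  proof
    show "low N \<inter> ipow \<mm> (Suc N) \<subseteq> {\<zero>}"
    proof
      fix x assume x: "x \<in> low N \<inter> ipow \<mm> (Suc N)"
      hence "hspan G {..N} x" "hspan G {Suc N..} x" using ipow_hspan by blast+
      hence "x = \<zero>" by (rule hspan_disjoint[OF G]) auto
      thus "x \<in> {\<zero>}" by simp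
    qed
    show "{\<zero>} \<subseteq> low N \<inter> ipow \<mm> (Suc N)" using idealD(4)[OF i] hspan.zero by simp
  qed
  hence "klen {\<zero>} (low N) = klen (ipow \<mm> (Suc N)) (ipow \<mm> (Suc N) <+> low N)"
    using len_second_iso[OF KK_sub_asub[OF idealD(1)[OF i]] hspan_asub[of "{..N}"] KK_carrier] by simp
  also have "\<dots> \<le> klen (ipow \<mm> (Suc N)) (carrier R)"
    by (rule len_mono) (use asubD(2)[OF asub_add[OF KK_sub_asub[OF idealD(1)[OF i]] hspan_asub[of "{..N}"] KK_carrier]] in auto)
  also have "\<dots> = colen (ipow \<mm> (Suc N))" by (rule len_KK_eq[OF i subset_refl])
  finally show ?thesis .
qed

text \<open>Compared with the local case, the filtration by powers of \<open>\<mm>\<close> is replaced by the filtration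
  by degree, so that prime chains need not end in \<open>\<mm>\<close>.\<close>

lemma graded_growth:
  assumes "\<forall>i\<le>k. primeideal (P i) R" "\<forall>i<k. P i \<subset> P (Suc i)"
  shows "growth_ge k (\<lambda>N. klen (P 0) (P 0 <+> low N))"
  using assms
proof (induction k arbitrary: P)
  case 0
  have P: "ideal (P 0) R" "P 0 \<noteq> carrier R" using 0(1) primeideal.axioms(1) primeideal.I_notcarr by blast+
  have "1 \<le> klen (P 0) (P 0 <+> low N)" for N
  proof (rule len_pos)
    show "P 0 \<in> sublat R KK" using KK_sub_asub[OF idealD(1)[OF P(1)]] by simp
    show "P 0 <+> low N \<in> sublat R KK" using asub_add[OF KK_sub_asub[OF idealD(1)[OF P(1)]] hspan_asub KK_carrier] by simp
    note s = add_subset[OF KK_sub_asub[OF idealD(1)[OF P(1)]] hspan_asub[of "{..N}"]]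
    have "\<one> \<in> G 0" using subringE(3)[OF KKsub] G0 by simp
    hence "\<one> \<in> low N" using hspan_hom[OF G, of \<one> 0] by simp
    moreover have "\<one> \<notin> P 0" using P ideal.one_imp_carrier by blast
    ultimately show "P 0 \<subset> P 0 <+> low N" using s by blast
  qed
  thus ?case unfolding growth_ge_def by (intro exI[of _ 1]) (auto simp: one_enat_def)
next
  case (Suc k)
  have P: "primeideal (P 0) R" "primeideal (P 1) R" "P 0 \<subset> P 1" using Suc.prems by auto
  have Pi: "ideal (P 0) R" "ideal (P 1) R" using P primeideal.axioms(1) by blast+
  note Pa = KK_sub_asub[OF idealD(1)[OF Pi(1)]] KK_sub_asub[OF idealD(1)[OF Pi(2)]]
  have IH: "growth_ge k (\<lambda>N. klen (P 1) (P 1 <+> low N))"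
    using Suc.IH[of "\<lambda>i. P (Suc i)"] Suc.prems by simp
  obtain f where f: "f \<in> P 1" "f \<notin> P 0" using P(3) by blast
  have fc: "f \<in> carrier R" using f idealD(3)[OF Pi(2)] by blast
  \<comment> \<open>A bound on the degrees in f: multiplication by f maps \<open>low N\<close> into
    \<open>low (N + c)\<close>. It takes the place of the constant from Artin-Rees in the local
    argument.\<close>
  obtain c where c: "hspan G {..c} f" using hspan_UNIV[OF G fc] by blast
  have mono: "mono (\<lambda>N. klen J (J <+> low N))" for J
    by (intro monoI len_mono set_add_mono subset_refl low_mono)
  show ?case
  proof (rule growth_ge_Suc[OF _ mono mono IH])
    fix N
    note a = hspan_asub[of "{..N}"] and a' = hspan_asub[of "{..N + c}"]
    let ?D = "P 0 <+> ximg f (low N)" and ?V = "P 0 <+> low (N + c)"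
    have xa: "asub R KK (ximg f (low N))" by (rule asub_ximg[OF a fc KK_carrier])
    have D: "asub R KK ?D" by (rule asub_add[OF Pa(1) xa KK_carrier])
    have V: "asub R KK ?V" by (rule asub_add[OF Pa(1) a' KK_carrier])
    have x: "ximg f (low N) \<subseteq> low (N + c)"
    proof
      fix y assume "y \<in> ximg f (low N)"
      then obtain v where v: "hspan G {..N} v" "y = f \<otimes> v" unfolding mem_ximg by blast
      show "y \<in> low (N + c)" unfolding v(2) using hspan_mult[OF G c v(1), of "{..N + c}"] by simp
    qed
    have DV: "?D \<subseteq> ?V" by (rule set_add_mono[OF subset_refl x])
    have xf: "ximg f (low N) \<subseteq> P 1"
      using idealD(8)[OF Pi(2) _ f(1)] hspan_closed[OF G] unfolding ximg_def by blast
    have DP: "?D \<subseteq> P 1" by (rule add_least[OF Pa(2)]) (use P(3) xf in auto)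
    \<comment> \<open>f cancels modulo the prime \<open>P 0\<close>, so multiplication by f is
      injective there.\<close>
    have "low N \<inter> xpre f (P 0) = low N \<inter> P 0"
    proof -
      have "f \<otimes> r \<in> P 0 \<longleftrightarrow> r \<in> P 0" if r: "r \<in> carrier R" for r
        using primeideal.I_prime[OF P(1) fc r] f(2) idealD(7)[OF Pi(1) fc] by blast
      thus ?thesis using hspan_closed[OF G] unfolding xpre_def by blast
    qed
    hence 1: "klen (P 0) ?D = klen (P 0) (P 0 <+> low N)"
      unfolding len_ximg[OF Pa(1) a fc KK_carrier] len_second_iso[OF Pa(1) a KK_carrier] by simp
    have sub: "P 0 \<subseteq> ?V" "low (N + c) \<subseteq> ?V" using add_subset[OF Pa(1) a'] by auto
    have sub1: "P 1 \<subseteq> P 1 <+> low (N + c)" "low (N + c) \<subseteq> P 1 <+> low (N + c)" using add_subset[OF Pa(2) a'] by auto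
    have sub2: "P 1 \<subseteq> P 1 <+> ?V" "?V \<subseteq> P 1 <+> ?V" using add_subset[OF Pa(2) V] by auto
    have "P 1 <+> ?V \<subseteq> P 1 <+> low (N + c)"
    proof (rule add_least[OF asub_add[OF Pa(2) a' KK_carrier] sub1(1)])
      show "?V \<subseteq> P 1 <+> low (N + c)"
        by (rule add_least[OF asub_add[OF Pa(2) a' KK_carrier] _ sub1(2)]) (use P(3) sub1(1) in blast)
    qed
    moreover have "P 1 <+> low (N + c) \<subseteq> P 1 <+> ?V"
      by (rule add_least[OF asub_add[OF Pa(2) V KK_carrier] sub2(1)]) (use sub(2) sub2(2) in blast)
    ultimately have eq: "P 1 <+> low (N + c) = P 1 <+> ?V" by blast
    \<comment> \<open>\<open>?D\<close> lies in \<open>P 1\<close> and in \<open>?V\<close>, so what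
      \<open>?V\<close> contributes modulo \<open>P 1\<close> is counted inside the interval from
      \<open>?D\<close> to \<open>?V\<close>.\<close>
    have "klen (P 1) (P 1 <+> low (N + c)) = klen (?V \<inter> P 1) ?V"
      unfolding eq by (rule len_second_iso[OF Pa(2) V KK_carrier])
    also have "\<dots> \<le> klen ?D ?V" by (rule len_mono) (use DV DP in auto)
    finally have 2: "klen (P 1) (P 1 <+> low (N + c)) \<le> klen ?D ?V" .
    have "klen (P 0) ?D + klen ?D ?V \<le> klen (P 0) ?V"
      using len_superadd[OF _ DV, of "P 0" "sublat R KK"] add_subset(1)[OF Pa(1) xa] by simp
    thus "klen (P 0) (P 0 <+> low N) + klen (P 1) (P 1 <+> low (N + c))
       \<le> klen (P 0) ?V"
      unfolding 1[symmetric] using 2 add_left_mono order_trans by blast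
  qed
qed

text \<open>The degree filtration modulo \<open>P 0\<close> is dominated by the lengths of R /
  \<mm>^n. So a chain of primes, even one not contained in \<mm>, cannot be longer than an exponent
  bounding these lengths.\<close>

lemma graded_chain_bound:
  assumes "\<forall>i\<le>k. primeideal (P i) R" "\<forall>i<k. P i \<subset> P (Suc i)"
    and "\<And>n. colen (ipow \<mm> n) \<le> enat (C * n ^ h)"
  shows "k \<le> h"
proof (rule growth_ge_bound[OF graded_growth[OF assms(1,2)]])
  fix N
  have P: "ideal (P 0) R" using assms(1) primeideal.axioms(1) by blast
  have "klen (P 0) (P 0 <+> low N) = klen (low N \<inter> P 0) (low N)"
    by (rule len_second_iso[OF KK_sub_asub[OF idealD(1)[OF P]] hspan_asub KK_carrier])
  also have "\<dots> \<le> klen {\<zero>} (low N)"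
    by (rule len_mono) (use idealD(4)[OF P] hspan.zero in auto)
  also have "\<dots> \<le> colen (ipow \<mm> (Suc N))" by (rule len_low)
  also have "\<dots> \<le> enat (C * (N + 1) ^ h)" using assms(3)[of "Suc N"] by simp
  finally show "klen (P 0) (P 0 <+> low N) \<le> enat (C * (N + 1) ^ h)" .
qed

end

end

section \<open>The differential signature\<close>

context ess begin

text \<open>The quotients of R and of the completion by the n-th powers of their maximal ideals have
  equal length, so the exponents of growth, and with them the heights, agree. The completion is
  local, so its dimension is this height.\<close>

lemma krull_dim_C:
  assumes top: "\<And>k P. pchain {\<zero>} \<mm> k P \<Longrightarrow> k \<le> h"
    and ub: "\<And>n. colen (mn n) \<le> enat (c * n ^ h)"
    and lb: "growth_ge h (\<lambda>n. colen (mn n))"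
  shows "krull_dim C = enat h"
proof -
  obtain h' c' P' where h': "C.pchain {\<zero>\<^sub>C} (nn 1) h' P'" "\<forall>k P. C.pchain {\<zero>\<^sub>C} (nn 1) k P \<longrightarrow> k \<le> h'"
    "\<forall>n. C.colen (C.ipow (nn 1) n) \<le> enat (c' * n ^ h')"
    "growth_ge h' (\<lambda>n. C.colen (C.ipow (nn 1) n))"
    using C.height_growth[OF noeth_C nn_maximal] by blast
  have l: "C.colen (C.ipow (nn 1) n) = colen (mn n)" for n
    unfolding nn_ipow nn_lift[of n] by (rule len_lift[OF mni subset_refl])
  have "h' \<le> h" by (rule growth_ge_bound[OF h'(4)[unfolded l], of c 0]) (use ub in simp)
  moreover have "h \<le> h'" by (rule growth_ge_bound[OF lb, of c' 0]) (use h'(3) l in simp)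
  ultimately have hh: "h' = h" by simp
  show ?thesis
  proof (rule krull_dim_eqI)
    show "\<forall>i\<le>h. primeideal (P' i) C" "\<forall>i<h. P' i \<subset> P' (Suc i)" using h'(1) unfolding C.pchain_def hh by auto
    fix k P assume P: "\<forall>i\<le>k. primeideal (P i) C" "\<forall>i<k. P i \<subset> P (Suc i)"
    have "C.pchain {\<zero>\<^sub>C} (nn 1) k P"
    proof (rule C.pchainI[OF P])
      fix I assume I: "primeideal I C"
      have "I \<noteq> carrier C" using primeideal.I_notcarr[OF I] by blast
      thus "I \<subseteq> nn 1" by (rule proper_ideal_C[OF primeideal.axioms(1)[OF I]])
    qed
    thus "k \<le> h" using h'(2) hh by blast
  qed
qed

text \<open>The assumption \<open>chains\<close> isolates the one point where the graded and the
  local case differ: why an arbitrary chain of primes is no longer than the height of \<mm>.\<close>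

lemma signature_main:
  assumes fg: "finitely_generated_over R (gr_diffop K R) (gr_diffop_map K R)"
    and chains: "\<And>k P c h. \<forall>i\<le>k. primeideal (P i) R \<Longrightarrow> \<forall>i<k. P i \<subset> P (Suc i) \<Longrightarrow>
      (\<And>k P. pchain {\<zero>} \<mm> k P \<Longrightarrow> k \<le> h) \<Longrightarrow> (\<And>n. colen (mn n) \<le> enat (c * n ^ h)) \<Longrightarrow> k \<le> h"
    and d: "d = the_enat (krull_dim R)"
  shows "(\<lambda>n. ereal_of_enat (diff_length K R \<mm> n) / ereal (real n ^ d / fact d)) \<longlonglongrightarrow> diff_signature K R \<mm>
     \<and> diff_signature K R \<mm> = diff_signature K C (max_ideal C)
     \<and> (\<exists>q\<in>\<rat>. diff_signature K R \<mm> = ereal q)"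
proof -
  obtain h c P where h: "pchain {\<zero>} \<mm> h P" "\<And>k P. pchain {\<zero>} \<mm> k P \<Longrightarrow> k \<le> h"
    "\<And>n. colen (mn n) \<le> enat (c * n ^ h)"
    "growth_ge h (\<lambda>n. colen (mn n))"
    using height_growth[OF noeth maxi] by blast
  have kR: "krull_dim R = enat h"
  proof (rule krull_dim_eqI)
    show "\<forall>i\<le>h. primeideal (P i) R" "\<forall>i<h. P i \<subset> P (Suc i)" using h(1) unfolding pchain_def by auto
    show "k \<le> h" if P: "\<forall>i\<le>k. primeideal (P i) R" "\<forall>i<k. P i \<subset> P (Suc i)" for k P
      by (rule chains[OF P h(2,3)])
  qed
  have dh: "d = h" using d kR by simp
  have kC: "krull_dim C = enat h" by (rule krull_dim_C[OF h(2-4)])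
  obtain f where f: "rational_growth f" "\<And>n. diff_length K R \<mm> (Suc n) = enat (f n)"
    using diff_length_rational_growth[OF fg] by blast
  have "f n \<le> c * Suc n ^ h" for n
  proof -
    have "enat (f n) \<le> colen (mn (Suc n))"
      unfolding f(2)[symmetric] diff_length_eq by (rule len_antimono[OF ipow_dpow])
    also have "\<dots> \<le> enat (c * Suc n ^ h)" by (rule h(3))
    finally show ?thesis by simp
  qed
  from rational_growth_limit[OF f(1) this] obtain q where
    q: "q \<in> \<rat>" "(\<lambda>n. real (f (n - 1)) / (real n ^ h / fact h)) \<longlonglongrightarrow> q" by blast
  let ?F = "\<lambda>n. ereal_of_enat (diff_length K R \<mm> n) / ereal (real n ^ h / fact h)"
  \<comment> \<open>At n = 0 the denominator may vanish and \<open>f (n - 1)\<close> is not the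
    length, so equality is claimed from 1 on.\<close>
  have "?F n = ereal (real (f (n - 1)) / (real n ^ h / fact h))" if n: "1 \<le> n" for n
  proof -
    have "real n ^ h / fact h \<noteq> 0" using n by simp
    moreover have "diff_length K R \<mm> n = enat (f (n - 1))" using f(2)[of "n - 1"] n by simp
    ultimately show ?thesis by simp
  qed
  hence "\<forall>\<^sub>F n in sequentially. ereal (real (f (n - 1)) / (real n ^ h / fact h)) = ?F n"
    unfolding eventually_sequentially by (intro exI[of _ 1]) simp
  moreover have "(\<lambda>n. ereal (real (f (n - 1)) / (real n ^ h / fact h))) \<longlonglongrightarrow> ereal q" using q(2) by simp
  ultimately have lim: "?F \<longlonglongrightarrow> ereal q" by (rule Lim_transform_eventually[rotated])
  have s: "diff_signature K R \<mm> = limsup ?F" unfolding diff_signature_def kR by simp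
  have "limsup ?F = ereal q" by (rule lim_imp_Limsup[OF _ lim]) simp
  moreover have "diff_signature K C (max_ideal C) = limsup ?F"
    unfolding diff_signature_def kC max_ideal_C diff_length_C by simp
  ultimately show ?thesis using lim q(1) unfolding dh s by auto
qed

end

section \<open>The graded and the local case as instances\<close>

lemma (in cring) maximal_of_local:
  assumes "local_ring R" shows "maximalideal (max_ideal R) R" "maximalideal M R \<Longrightarrow> M = max_ideal R"
proof -
  have ex: "\<exists>!M. maximalideal M R" using assms unfolding local_ring_def by blast
  show "maximalideal (max_ideal R) R" unfolding max_ideal_def by (rule theI'[OF ex])
  thus "maximalideal M R \<Longrightarrow> M = max_ideal R" using ex by blast
qed

text \<open>Surjectivity of K \<rightarrow> R / \<mm> gives R = K + \<mm>; inverses in the image of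
  K are images of inverses in K.\<close>

lemma coeff_of_coefficient_field:
  assumes K: "field K" and alg: "algebra K R" and m: "maximalideal \<mm> R"
    and iso: "(\<lambda>k. \<mm> +>\<^bsub>R\<^esub> structure_map R k) \<in> ring_iso K (R Quot \<mm>)"
  shows "coeff K R \<mm>"
proof -
  interpret K: field K by fact
  interpret R: cring R using alg by (rule algebra.axioms(2))
  interpret A: algebra K R by fact
  have sc: "structure_map R k \<in> carrier R" if "k \<in> carrier K" for k
    using that A.smult_closed unfolding structure_map_def by simp
  have sm: "k \<odot>\<^bsub>R\<^esub> x = structure_map R k \<otimes>\<^bsub>R\<^esub> x" if "k \<in> carrier K" "x \<in> carrier R" for k x
    using A.smult_assoc2[OF that(1) R.one_closed that(2)] that unfolding structure_map_def by simp
  have sadd: "structure_map R (k \<oplus>\<^bsub>K\<^esub> l) = structure_map R k \<oplus>\<^bsub>R\<^esub> structure_map R l"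
    if "k \<in> carrier K" "l \<in> carrier K" for k l
    unfolding structure_map_def using A.smult_l_distr that by simp
  have smul: "structure_map R (k \<otimes>\<^bsub>K\<^esub> l) = structure_map R k \<otimes>\<^bsub>R\<^esub> structure_map R l"
    if "k \<in> carrier K" "l \<in> carrier K" for k l
    using A.smult_assoc1[OF that R.one_closed] sm[OF that(1) sc[OF that(2)]] unfolding structure_map_def by simp
  have sone: "structure_map R \<one>\<^bsub>K\<^esub> = \<one>\<^bsub>R\<^esub>" unfolding structure_map_def by (rule A.smult_one[OF R.one_closed])
  have szero: "structure_map R \<zero>\<^bsub>K\<^esub> = \<zero>\<^bsub>R\<^esub>" unfolding structure_map_def by (rule A.smult_l_null[OF R.one_closed])
  show ?thesis
  proof (intro coeff.intro kalg.intro kalg_axioms.intro coeff_axioms.intro R.cring_axioms m)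
    show "k \<odot>\<^bsub>R\<^esub> x = structure_map R k \<otimes>\<^bsub>R\<^esub> x" if "k \<in> carrier K" "x \<in> carrier R" for k x using sm[OF that] .
    show "structure_map R k \<in> carrier R" if "k \<in> carrier K" for k using sc[OF that] .
    have "ring_hom_ring K R (structure_map R)"
      by (rule ring_hom_ringI2[OF K.ring_axioms R.ring_axioms], rule ring_hom_memI) (use sc smul sadd sone in auto)
    from ring_hom_ring.img_is_subring[OF this K.carrier_is_subring]
    show "subring (structure_map R ` carrier K) R" .
    show "\<exists>b\<in>structure_map R ` carrier K. b \<otimes>\<^bsub>R\<^esub> a = \<one>\<^bsub>R\<^esub>"
      if a: "a \<in> structure_map R ` carrier K" "a \<noteq> \<zero>\<^bsub>R\<^esub>" for a
    proof -
      obtain k where k: "k \<in> carrier K" "a = structure_map R k" using a(1) by blast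
      have "k \<noteq> \<zero>\<^bsub>K\<^esub>" using a(2) k(2) szero by blast
      hence u: "k \<in> Units K" using K.field_Units k(1) by blast
      have "structure_map R (inv\<^bsub>K\<^esub> k) \<otimes>\<^bsub>R\<^esub> a = \<one>\<^bsub>R\<^esub>"
        unfolding k(2) using smul[OF K.Units_inv_closed[OF u] k(1)] K.Units_l_inv[OF u] sone by simp
      thus ?thesis using K.Units_inv_closed[OF u] by blast
    qed
    show "\<exists>a\<in>structure_map R ` carrier K. r \<ominus>\<^bsub>R\<^esub> a \<in> \<mm>" if r: "r \<in> carrier R" for r
    proof -
      have mi: "ideal \<mm> R" using m maximalideal.axioms(1) by blast
      have "\<mm> +>\<^bsub>R\<^esub> r \<in> carrier (R Quot \<mm>)" using r unfolding FactRing_def A_RCOSETS_def' by auto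
      hence "\<mm> +>\<^bsub>R\<^esub> r \<in> (\<lambda>k. \<mm> +>\<^bsub>R\<^esub> structure_map R k) ` carrier K"
        using iso unfolding ring_iso_def bij_betw_def by blast
      then obtain k where k: "k \<in> carrier K" "\<mm> +>\<^bsub>R\<^esub> r = \<mm> +>\<^bsub>R\<^esub> structure_map R k" by blast
      thus ?thesis using R.coset_eq_iff[OF mi r sc[OF k(1)]] by blast
    qed
  qed
qed

lemma localization_in_homalg:
  assumes "cring A" "cring R" "ring_hom_ring A R \<phi>" "subring H R"
    "generate_ring A (Y \<union> S) = carrier A" "\<phi> ` (Y \<union> S) \<subseteq> H"
  shows "\<phi> ` carrier A \<subseteq> H"
proof -
  interpret h: ring_hom_ring A R \<phi> by fact
  note s = subringE[OF assms(4)]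
  have "\<phi> a \<in> H" if a: "a \<in> generate_ring A (Y \<union> S)" for a
    using a
  proof induction
    case (incl a) thus ?case using assms(6) by blast
  next
    case (a_inv a)
    hence "a \<in> carrier A" using assms(5) by blast
    thus ?case using s(5)[OF a_inv.IH] by simp
  next
    case (eng_add a b)
    hence "a \<in> carrier A" "b \<in> carrier A" using assms(5) by blast+
    thus ?case using s(7)[OF eng_add.IH] by simp
  next
    case (eng_mult a b)
    hence "a \<in> carrier A" "b \<in> carrier A" using assms(5) by blast+
    thus ?case using s(6)[OF eng_mult.IH] by simp
  qed (use s(3) in simp)
  thus ?thesis unfolding assms(5)[symmetric] by blast
qed

context coeff begin

lemma essI:
  assumes "finite T" "T \<subseteq> carrier R"
    "\<And>r. r \<in> carrier R \<Longrightarrow> \<exists>w\<in>Units R. w \<in> homalg KK T \<and> w \<otimes> r \<in> homalg KK T"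
  shows "ess K R \<mm> T"
proof (intro ess.intro compl.intro coeff_axioms compl_axioms.intro ess_axioms.intro assms)
  show "noeth_over (carrier R)"
    by (rule noeth_ess_finite[OF KKsub assms(2) noeth_over_field[OF KK_carrier KKinv] assms(1)]) (use assms(3) in blast)+
qed

lemma ess_of_finitely_generated:
  assumes "finitely_generated_over K R (structure_map R)"
  shows "\<exists>T. ess K R \<mm> T"
proof -
  obtain T where T: "T \<subseteq> carrier R" "finite T" "generate_ring R (KK \<union> T) = carrier R"
    using assms unfolding finitely_generated_over_def by blast
  have h: "carrier R \<subseteq> homalg KK T" using generate_ring_homalg[OF KKsub T(1)] T(3) by simp
  have "ess K R \<mm> T" by (rule essI[OF T(2,1)]) (use h in \<open>auto intro!: bexI[of _ \<one>]\<close>)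
  thus ?thesis by blast
qed

text \<open>\<open>T\<close> is the image of algebra generators of A. The image of A then lies in
  K[T] and contains the denominators, which are units of R.\<close>

lemma ess_of_localization:
  assumes "essentially_of_finite_type K R"
  shows "\<exists>T. ess K R \<mm> T"
proof -
  obtain A :: "('k, 'b) module" and W \<phi> where A: "algebra K A" "finitely_generated_over K A (structure_map A)"
    "is_localization A W R \<phi>" "\<forall>k\<in>carrier K. \<phi> (structure_map A k) = structure_map R k"
    using assms unfolding essentially_of_finite_type_def by blast
  interpret A: algebra K A by fact
  have Ac: "cring A" by unfold_locales
  obtain S where S: "S \<subseteq> carrier A" "finite S" "generate_ring A (structure_map A ` carrier K \<union> S) = carrier A"
    using A(2) unfolding finitely_generated_over_def by blast
  have W: "W \<subseteq> carrier A" "\<phi> \<in> ring_hom A R" "\<phi> ` W \<subseteq> Units R"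
    "\<And>b. b \<in> carrier R \<Longrightarrow> \<exists>a\<in>carrier A. \<exists>w\<in>W. b = \<phi> a \<otimes> inv (\<phi> w)"
    using A(3) unfolding is_localization_def by blast+
  have hh: "ring_hom_ring A R \<phi>" by (rule ring_hom_ringI2[OF cring.axioms(1)[OF Ac] ring_axioms W(2)])
  have T: "finite (\<phi> ` S)" "\<phi> ` S \<subseteq> carrier R" using S(1,2) ring_hom_closed[OF W(2)] by auto
  note hs = homalg_subring[OF KKsub T(2)] and hi = homalg_incl[OF KKsub T(2)]
  have h: "\<phi> ` carrier A \<subseteq> homalg KK (\<phi> ` S)"
    by (rule localization_in_homalg[OF Ac is_cring hh hs S(3)]) (use hi A(4) in auto)
  have "\<exists>w\<in>Units R. w \<in> homalg KK (\<phi> ` S) \<and> w \<otimes> r \<in> homalg KK (\<phi> ` S)" if r: "r \<in> carrier R" for r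
  proof -
    obtain a w where a: "a \<in> carrier A" "w \<in> W" "r = \<phi> a \<otimes> inv (\<phi> w)" using W(4)[OF r] by blast
    have u: "\<phi> w \<in> Units R" using W(3) a(2) by blast
    have ac: "\<phi> a \<in> carrier R" using ring_hom_closed[OF W(2) a(1)] .
    have "\<phi> w \<otimes> r = \<phi> a" unfolding a(3) using u ac Units_closed[OF u] by (simp add: m_lcomm[of "\<phi> w" "\<phi> a"])
    moreover have "\<phi> w \<in> homalg KK (\<phi> ` S)" "\<phi> a \<in> homalg KK (\<phi> ` S)" using h a W(1) by blast+
    ultimately show ?thesis using u by auto
  qed
  from essI[OF T this] show ?thesis by blast
qed

end

theorem theorem9p8:
  fixes K :: "('k, 'p) ring_scheme"
    and R :: "('k, 'a, 'q) module_scheme"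
    and \<mm> :: "'a set"
    and d :: nat
  assumes "algebra_with_coefficient_field K R \<mm>"
    and "d = the_enat (krull_dim R)"
    and "finitely_generated_over R (gr_diffop K R) (gr_diffop_map K R)"
  shows "(\<lambda>n. ereal_of_enat (diff_length K R \<mm> n) / ereal (real n ^ d / fact d))
           \<longlonglongrightarrow> diff_signature K R \<mm>
       \<and> diff_signature K R \<mm> =
           diff_signature K (completion R \<mm>) (max_ideal (completion R \<mm>))
       \<and> (\<exists>q \<in> \<rat>. diff_signature K R \<mm> = ereal q)"
proof -
  have F: "field K" "algebra K R" "(\<lambda>k. \<mm> +>\<^bsub>R\<^esub> structure_map R k) \<in> ring_iso K (R Quot \<mm>)"
    and cases: "graded_algebra_with_ideal K R \<mm> \<or> local_ring R \<and> \<mm> = max_ideal R \<and> essentially_of_finite_type K R"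
    using assms(1) unfolding algebra_with_coefficient_field_def by blast+
  have Rc: "cring R" using F(2) algebra.axioms(2) by blast
  show ?thesis
    using cases
  proof
    assume g: "graded_algebra_with_ideal K R \<mm>"
    then obtain G where G: "is_grading R G" "G 0 = structure_map R ` carrier K" "maximalideal \<mm> R" "homogeneous_ideal R G \<mm>"
      and fg: "finitely_generated_over K R (structure_map R)"
      unfolding graded_algebra_with_ideal_def by blast
    interpret coeff K R \<mm> by (rule coeff_of_coefficient_field[OF F(1,2) G(3) F(3)])
    obtain T where "ess K R \<mm> T" using ess_of_finitely_generated[OF fg] by blast
    then interpret ess K R \<mm> T .
    show ?thesis
    proof (rule signature_main[OF assms(3) _ assms(2)])
      fix k P c h
      assume "\<forall>i\<le>k. primeideal (P i) R" "\<forall>i<k. P i \<subset> P (Suc i)" "\<And>n. colen (mn n) \<le> enat (c * n ^ h)"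
      thus "k \<le> h" by (rule graded_chain_bound[OF G(1,2,4)])
    qed
  next
    assume l: "local_ring R \<and> \<mm> = max_ideal R \<and> essentially_of_finite_type K R"
    hence lr: "local_ring R" and me: "\<mm> = max_ideal R" by auto
    have m: "maximalideal \<mm> R" unfolding me by (rule cring.maximal_of_local(1)[OF Rc lr])
    have mu: "M = \<mm>" if "maximalideal M R" for M unfolding me using cring.maximal_of_local(2)[OF Rc lr that] .
    interpret coeff K R \<mm> by (rule coeff_of_coefficient_field[OF F(1,2) m F(3)])
    obtain T where "ess K R \<mm> T" using ess_of_localization l by blast
    then interpret ess K R \<mm> T .
    show ?thesis
    proof (rule signature_main[OF assms(3) _ assms(2)])
      fix k P h
      assume P: "\<forall>i\<le>k. primeideal (P i) R" "\<forall>i<k. P i \<subset> P (Suc i)" and top: "\<And>k P. pchain {\<zero>\<^bsub>R\<^esub>} \<mm> k P \<Longrightarrow> k \<le> h"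
      have "pchain {\<zero>\<^bsub>R\<^esub>} \<mm> k P" by (rule pchainI[OF P local_contains[OF noeth mu]])
      thus "k \<le> h" by (rule top)
    qed
  qed
qed

end
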